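(* The set $\{\operatorname{ch}^\bullet\mathsf L(\lambda)\mid\lambda\in\Lambda\}$ is a $\mathbb Z[t,t^{-1}]$-basis of $R^\bullet$ (where $R^\bullet$ is viewed inside $K[t,t^{-1}]$ through $\operatorname{ch}^\bullet$, which is injective). More explicitly, if $\mathsf N=\bigoplus_{i\in\mathbb Z}\mathsf N(i)$ is a $\mathbb Z$-graded $\mathcal D$-module, then the Laurent polynomials $p_{\mathsf N,\mathsf L(\lambda)}$, $\lambda\in\Lambda$, are the unique elements of $\mathbb Z[t,t^{-1}]$ such that $$\operatorname{ch}^\bullet\mathsf N=\sum_{\lambda\in\Lambda}p_{\mathsf N,\mathsf L(\lambda)}\,\operatorname{ch}^\bullet\mathsf L(\lambda).$$ Therefore $[\mathsf N:\mathsf L(\lambda)]=p_{\mathsf N,\mathsf L(\lambda)}(1)$ for all $\lambda\in\Lambda$.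
   Context: Setting. $\Bbbk$ is an algebraically closed field of characteristic zero, $G$ a finite group, $V$ a Yetter–Drinfeld module over $\Bbbk G$ whose Nichols algebra $\mathfrak B(V)$ is finite-dimensional, and $\overline V$ the Yetter–Drinfeld module over $\Bbbk^G$ with $\mathfrak B(\overline V)\#\Bbbk^G\simeq(\mathfrak B(V)\#\Bbbk G)^{*op}$. $\mathcal D$ is the Drinfeld double of the bosonization $\mathfrak B(V)\#\Bbbk G$ and $\mathcal D(G)$ the Drinfeld double of $\Bbbk G$; $\mathfrak B(V)\#\Bbbk G$, $\mathfrak B(\overline V)\#\Bbbk^G$ and $\mathcal D(G)$ are Hopf subalgebras of $\mathcal D$, and multiplication gives a linear isomorphism $\mathfrak B(V)\otimes\mathcal D(G)\otimes\mathfrak B(\overline V)\to\mathcal D$. $\mathcal D$ is $\mathbb Z$-graded by $\mathcal D^n=\bigoplus_{n=j-i}\mathfrak B^i(V)\otimes\mathcal D(G)\otimes\mathfrak B^j(\overline V)$. $\mathcal D^{\ge0}$ is the Hopf subalgebra generated by $\mathcal D(G)$ and $\mathfrak B(\overline V)$. All modules are finite-dimensional left modules. Weights and modules. $\Lambda$ is a set of representatives of isomorphism classes of simple $\mathcal D(G)$-modules ($\mathcal D(G)$ is semisimple); $\lambda\in\Lambda$ is regarded as a simple $\mathcal D^{\ge0}$-module by letting $\overline V$ act by zero. $\mathsf M(\lambda)=\mathcal D\otimes_{\mathcal D^{\ge0}}\lambda$ is the Verma module, $\mathsf L(\lambda)$ its simple head; $\lambda\mapsto\mathsf L(\lambda)$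 parametrizes the simple $\mathcal D$-modules. $\mathsf P(\lambda)$ is the projective cover of $\mathsf L(\lambda)$. $[\mathsf N:\mathsf L(\lambda)]$ is the composition multiplicity (forgetting gradings). Gradings. A $\mathbb Z$-graded $\mathcal D$-module is $\mathsf N=\bigoplus_i\mathsf N(i)$ with $\mathcal D^n\mathsf N(i)\subseteq\mathsf N(n+i)$; $\mathsf N[\ell](i)=\mathsf N(i-\ell)$; $\operatorname{Hom}^\bullet_{\mathcal D}(\mathsf N,\mathsf N')_0$ is the space of degree-preserving morphisms. $\mathsf M(\lambda)$ is graded with $1\otimes\lambda$ in degree $0$, $\mathsf L(\lambda)$ inherits the grading. $\mathsf P(\lambda)$ carries the unique grading for which it is generated by a homogeneous $\mathcal D(G)$-submodule isomorphic to $\lambda$ in degree $0$ and $\mathsf P(\lambda)\to\mathsf L(\lambda)$ has degree $0$. The modules $\mathsf L(\lambda)[i]$ form a complete set of non-isomorphic simple graded modules. Characters. $K$ is the Grothendieck ring of $\mathcal D(G)$-modules, a free abelian group on $\Lambda$; $\operatorname{ch}N=\sum_\lambda\dim\operatorname{Hom}_{\mathcal D(G)}(\lambda,N)\,\lambda\in K$ and $\operatorname{ch}^\bullet\mathsf N=\sum_i\operatorname{ch}\mathsf N(i)\,t^i\in K[t,t^{-1}]$. $R^\bullet$ is the Grothendieck ring of the category of $\mathbb Z$-graded $\mathcal D$-modules, with $\mathbb Z[t,t^{-1}]$ acting by $t^\ell[\mathsf N]=[\mathsf N[\ell]]$; $\operatorname{ch}^\bullet$ induces a ring homomorphism $R^\bullet\to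 K[t,t^{-1}]$. Put $p_{\mathsf N,\mathsf L(\lambda)}=\sum_i a_{\mathsf N,\mathsf L(\lambda),i}\,t^i$ where $a_{\mathsf N,\mathsf L(\lambda),i}=\dim\operatorname{Hom}^\bullet_{\mathcal D}(\mathsf P(\lambda)[i],\mathsf N)_0$, the number of graded composition factors of $\mathsf N$ isomorphic to $\mathsf L(\lambda)[i]$. *)

theory Defs
  imports
    "HOL-Analysis.Finite_Cartesian_Product"
    "HOL-Analysis.Cartesian_Space"
    "HOL-Computational_Algebra.Polynomial"
    "HOL-Library.Function_Algebras"
    "HOL-Library.Poly_Mapping"
    "HOL-Algebra.Free_Abelian_Groups"
begin

section \<open>Linear algebra\<close>

text \<open>
  A finite-dimensional algebra or coalgebra is carried by the coordinate space \<open>'k^'b\<close> of a finite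
  basis type \<open>'b\<close>, so that \<open>'k^('b \<times> 'c)\<close> is the tensor product of \<open>'k^'b\<close> and \<open>'k^'c\<close>. Modules
  live in subspaces of arbitrary vector spaces, given by their scalar multiplication.
\<close>

definition lin_on ::
  "('k \<Rightarrow> 'm::ab_group_add \<Rightarrow> 'm) \<Rightarrow> 'm set \<Rightarrow> ('k \<Rightarrow> 'n::ab_group_add \<Rightarrow> 'n) \<Rightarrow> 'n set \<Rightarrow> ('m \<Rightarrow> 'n) \<Rightarrow> bool"
  where "lin_on s1 S s2 T f \<longleftrightarrow>
    (\<forall>x\<in>S. f x \<in> T) \<and> (\<forall>x\<in>S. \<forall>y\<in>S. f (x + y) = f x + f y) \<and> (\<forall>c. \<forall>x\<in>S. f (s1 c x) = s2 c (f x))"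

definition decomposes :: "('i \<Rightarrow> 'm::ab_group_add set) \<Rightarrow> 'm \<Rightarrow> ('i \<Rightarrow> 'm) \<Rightarrow> bool"
  where "decomposes C x f \<longleftrightarrow> (\<forall>i. f i \<in> C i) \<and> finite {i. f i \<noteq> 0} \<and> x = (\<Sum>i | f i \<noteq> 0. f i)"

definition direct_sum ::
  "('k::field \<Rightarrow> 'm::ab_group_add \<Rightarrow> 'm) \<Rightarrow> 'm set \<Rightarrow> ('i \<Rightarrow> 'm set) \<Rightarrow> bool"
  where "direct_sum s S C \<longleftrightarrow>
    (\<forall>i. module.subspace s (C i) \<and> C i \<subseteq> S) \<and> (\<forall>x\<in>S. \<exists>!f. decomposes C x f)"

definition part :: "('i \<Rightarrow> 'm::ab_group_add set) \<Rightarrow> 'i \<Rightarrow> 'm \<Rightarrow> 'm"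
  where "part C i x = (THE f. decomposes C x f) i"

definition tens :: "'k::field ^ 'a \<Rightarrow> 'k ^ 'b \<Rightarrow> 'k ^ ('a::finite \<times> 'b::finite)"
  where "tens x y = (\<chi> p. x $ fst p * y $ snd p)"

text \<open>The linear map on the tensor product induced by a bilinear map.\<close>

definition lift2 ::
  "('k::field ^ 'a \<Rightarrow> 'k ^ 'b \<Rightarrow> 'k ^ 'c) \<Rightarrow> 'k ^ ('a::finite \<times> 'b::finite) \<Rightarrow> 'k ^ 'c::finite"
  where "lift2 m t = (\<Sum>p\<in>UNIV. t $ p *s m (axis (fst p) 1) (axis (snd p) 1))"

definition tmap ::
  "('k::field ^ 'a \<Rightarrow> 'k ^ 'c) \<Rightarrow> ('k ^ 'b \<Rightarrow> 'k ^ 'd) \<Rightarrow> 'k ^ ('a::finite \<times> 'b::finite) \<Rightarrow> 'k ^ ('c::finite \<times> 'd::finite)"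
  where "tmap f g = lift2 (\<lambda>x y. tens (f x) (g y))"

definition reassoc ::
  "'k ^ (('a::finite \<times> 'b::finite) \<times> 'c::finite) \<Rightarrow> 'k ^ ('a \<times> ('b \<times> 'c))"
  where "reassoc t = (\<chi> p. t $ ((fst p, fst (snd p)), snd (snd p)))"

section \<open>Hopf algebras\<close>

record ('k, 'b::finite) bialg =
  mul :: "'k ^ 'b \<Rightarrow> 'k ^ 'b \<Rightarrow> 'k ^ 'b"
  one :: "'k ^ 'b"
  cop :: "'k ^ 'b \<Rightarrow> 'k ^ ('b \<times> 'b)"
  cou :: "'k ^ 'b \<Rightarrow> 'k"

definition assoc_algebra :: "('k::field, 'b::finite) bialg \<Rightarrow> bool"
  where "assoc_algebra A \<longleftrightarrow>
    (\<forall>x. Vector_Spaces.linear (*s) (*s) (\<lambda>y. mul A x y)) \<and>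
    (\<forall>y. Vector_Spaces.linear (*s) (*s) (\<lambda>x. mul A x y)) \<and>
    (\<forall>x y z. mul A (mul A x y) z = mul A x (mul A y z)) \<and>
    (\<forall>x. mul A (one A) x = x \<and> mul A x (one A) = x)"

definition coalgebra :: "('k::field, 'b::finite) bialg \<Rightarrow> bool"
  where "coalgebra A \<longleftrightarrow>
    Vector_Spaces.linear (*s) (*s) (cop A) \<and> Vector_Spaces.linear (*s) (*) (cou A) \<and>
    (\<forall>x. reassoc (tmap (cop A) id (cop A x)) = tmap id (cop A) (cop A x)) \<and>
    (\<forall>x. lift2 (\<lambda>a b. cou A a *s b) (cop A x) = x \<and> lift2 (\<lambda>a b. cou A b *s a) (cop A x) = x)"

definition tmul ::
  "('k::field, 'b::finite) bialg \<Rightarrow> 'k ^ ('b \<times> 'b) \<Rightarrow> 'k ^ ('b \<times> 'b) \<Rightarrow> 'k ^ ('b \<times> 'b)"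
  where "tmul A s t = lift2 (\<lambda>a b. lift2 (\<lambda>c d. tens (mul A a c) (mul A b d)) t) s"

definition bialgebra :: "('k::field, 'b::finite) bialg \<Rightarrow> bool"
  where "bialgebra A \<longleftrightarrow> assoc_algebra A \<and> coalgebra A \<and>
    (\<forall>x y. cop A (mul A x y) = tmul A (cop A x) (cop A y)) \<and> cop A (one A) = tens (one A) (one A) \<and>
    (\<forall>x y. cou A (mul A x y) = cou A x * cou A y) \<and> cou A (one A) = 1"

definition is_antipode :: "('k::field, 'b::finite) bialg \<Rightarrow> ('k ^ 'b \<Rightarrow> 'k ^ 'b) \<Rightarrow> bool"
  where "is_antipode A S \<longleftrightarrow> Vector_Spaces.linear (*s) (*s) S \<and>
    (\<forall>x. lift2 (\<lambda>a b. mul A (S a) b) (cop A x) = cou A x *s one A \<and>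
         lift2 (\<lambda>a b. mul A a (S b)) (cop A x) = cou A x *s one A)"

definition hopf_algebra :: "('k::field, 'b::finite) bialg \<Rightarrow> bool"
  where "hopf_algebra A \<longleftrightarrow> bialgebra A \<and> (\<exists>S. is_antipode A S)"

definition antipode :: "('k::field, 'b::finite) bialg \<Rightarrow> 'k ^ 'b \<Rightarrow> 'k ^ 'b"
  where "antipode A = (THE S. is_antipode A S)"

definition bialgebra_hom ::
  "('k::field, 'b::finite) bialg \<Rightarrow> ('k, 'c::finite) bialg \<Rightarrow> ('k ^ 'b \<Rightarrow> 'k ^ 'c) \<Rightarrow> bool"
  where "bialgebra_hom A B f \<longleftrightarrow> Vector_Spaces.linear (*s) (*s) f \<and>
    (\<forall>x y. f (mul A x y) = mul B (f x) (f y)) \<and> f (one A) = one B \<and>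
    (\<forall>x. cop B (f x) = tmap f f (cop A x)) \<and> (\<forall>x. cou B (f x) = cou A x)"

definition gen_subalgebra :: "('k::field, 'b::finite) bialg \<Rightarrow> ('k ^ 'b) set \<Rightarrow> ('k ^ 'b) set"
  where "gen_subalgebra A X = \<Inter>{U. module.subspace (*s) U \<and> one A \<in> U \<and>
    (\<forall>x\<in>U. \<forall>y\<in>U. mul A x y \<in> U) \<and> X \<subseteq> U}"

definition pairing :: "'k::field ^ 'b \<Rightarrow> 'k ^ 'b::finite \<Rightarrow> 'k"
  where "pairing f x = (\<Sum>i\<in>UNIV. f $ i * x $ i)"

text \<open>
  The Hopf algebra \<open>A\<^sup>*\<^sup>o\<^sup>p\<close>, a functional being identified with its coordinates in the dual basis:
  \<open>(f g)(x) = g(x\<^sub>1) f(x\<^sub>2)\<close>, and the coproduct is transpose to the product of \<open>A\<close>.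
\<close>

definition dual_op :: "('k::field, 'b::finite) bialg \<Rightarrow> ('k, 'b) bialg"
  where "dual_op A = \<lparr>
    mul = (\<lambda>f g. \<chi> i. \<Sum>p\<in>UNIV. cop A (axis i 1) $ p * g $ fst p * f $ snd p),
    one = (\<chi> i. cou A (axis i 1)),
    cop = (\<lambda>f. \<chi> p. pairing f (mul A (axis (fst p) 1) (axis (snd p) 1))),
    cou = (\<lambda>f. pairing f (one A)) \<rparr>"

text \<open>
  A Drinfeld double of \<open>H\<close>: a Hopf algebra \<open>D\<close> containing \<open>H\<close> and \<open>H\<^sup>*\<^sup>o\<^sup>p\<close> as Hopf subalgebras
  (through \<open>\<iota>\<close> and \<open>\<kappa>\<close>), such that the multiplication \<open>H \<otimes> H\<^sup>*\<^sup>o\<^sup>p \<rightarrow> D\<close> is bijective and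
  \<open>f h = f\<^sub>1(h\<^sub>1) f\<^sub>3(S h\<^sub>3) h\<^sub>2 f\<^sub>2\<close>. The functional \<open>f\<^sub>1(a) f\<^sub>3(c) f\<^sub>2\<close> is \<open>y \<mapsto> f(a y c)\<close>.
\<close>

definition drinfeld_double ::
  "('k::field, 'h::finite) bialg \<Rightarrow> ('k, 'd::finite) bialg \<Rightarrow> ('k ^ 'h \<Rightarrow> 'k ^ 'd) \<Rightarrow> ('k ^ 'h \<Rightarrow> 'k ^ 'd) \<Rightarrow> bool"
  where "drinfeld_double H D \<iota> \<kappa> \<longleftrightarrow>
    hopf_algebra H \<and> hopf_algebra D \<and> bialgebra_hom H D \<iota> \<and> bialgebra_hom (dual_op H) D \<kappa> \<and>
    bij (lift2 (\<lambda>h f. mul D (\<iota> h) (\<kappa> f))) \<and>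
    (\<forall>f h. mul D (\<kappa> f) (\<iota> h) =
      lift2 (\<lambda>a r. lift2 (\<lambda>b c. mul D (\<iota> b)
          (\<kappa> (\<chi> y. pairing f (mul H a (mul H (axis y 1) (antipode H c))))))
        (cop H r)) (cop H h))"

section \<open>Yetter-Drinfeld modules and Nichols algebras\<close>

text \<open>
  A coaction of the group algebra is a grading by the group: \<open>v\<close> is mapped to the sum over \<open>g\<close> of
  \<open>g \<otimes> part (gcomp V) g v\<close>. Since index types are needed for \<open>'k^'g\<close>, a finite group is
  a group whose carrier is the whole of a finite type.
\<close>

record ('k, 'g, 'm) yd =
  yscl :: "'k \<Rightarrow> 'm \<Rightarrow> 'm"
  ycar :: "'m set"
  gact :: "'g \<Rightarrow> 'm \<Rightarrow> 'm"
  gcomp :: "'g \<Rightarrow> 'm set"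

definition yd_module :: "'g monoid \<Rightarrow> ('k::field, 'g, 'm::ab_group_add) yd \<Rightarrow> bool"
  where "yd_module G V \<longleftrightarrow>
    vector_space (yscl V) \<and> module.subspace (yscl V) (ycar V) \<and>
    direct_sum (yscl V) (ycar V) (gcomp V) \<and>
    (\<forall>g. lin_on (yscl V) (ycar V) (yscl V) (ycar V) (gact V g)) \<and>
    (\<forall>v\<in>ycar V. gact V \<one>\<^bsub>G\<^esub> v = v) \<and>
    (\<forall>g h. \<forall>v\<in>ycar V. gact V (g \<otimes>\<^bsub>G\<^esub> h) v = gact V g (gact V h v)) \<and>
    (\<forall>g h. gact V h ` gcomp V g \<subseteq> gcomp V (h \<otimes>\<^bsub>G\<^esub> g \<otimes>\<^bsub>G\<^esub> inv\<^bsub>G\<^esub> h))"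

text \<open>
  The product of the braided tensor square, \<open>(a \<otimes> b)(c \<otimes> d) = a (b\<^sub>(\<^sub>-\<^sub>1\<^sub>) \<cdot> c) \<otimes> b\<^sub>(\<^sub>0\<^sub>) d\<close>.
\<close>

definition braided_tmul ::
  "('k::field, 'r::finite) bialg \<Rightarrow> ('k, 'g::finite, 'k ^ 'r) yd \<Rightarrow> 'k ^ ('r \<times> 'r) \<Rightarrow> 'k ^ ('r \<times> 'r) \<Rightarrow> 'k ^ ('r \<times> 'r)"
  where "braided_tmul B Y s t =
    lift2 (\<lambda>a b. lift2 (\<lambda>c d.
      \<Sum>g\<in>UNIV. tens (mul B a (gact Y g c)) (mul B (part (gcomp Y) g b) d)) t) s"

definition braided_hopf_algebra ::
  "'g monoid \<Rightarrow> ('k::field, 'r::finite) bialg \<Rightarrow> ('k, 'g::finite, 'k ^ 'r) yd \<Rightarrow> bool"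
  where "braided_hopf_algebra G B Y \<longleftrightarrow>
    yd_module G Y \<and> yscl Y = (*s) \<and> ycar Y = UNIV \<and> assoc_algebra B \<and> coalgebra B \<and>
    (\<forall>g x y. gact Y g (mul B x y) = mul B (gact Y g x) (gact Y g y)) \<and>
    (\<forall>g. gact Y g (one B) = one B) \<and>
    (\<forall>g h. \<forall>x\<in>gcomp Y g. \<forall>y\<in>gcomp Y h. mul B x y \<in> gcomp Y (g \<otimes>\<^bsub>G\<^esub> h)) \<and>
    one B \<in> gcomp Y \<one>\<^bsub>G\<^esub> \<and>
    (\<forall>g x. cop B (gact Y g x) = tmap (gact Y g) (gact Y g) (cop B x)) \<and>
    (\<forall>g x. cou B (gact Y g x) = cou B x) \<and>
    (\<forall>k. \<forall>x\<in>gcomp Y k. cop B x \<in> module.span (*s)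
      {tens y z | y z g h. y \<in> gcomp Y g \<and> z \<in> gcomp Y h \<and> g \<otimes>\<^bsub>G\<^esub> h = k}) \<and>
    (\<forall>g. \<forall>x\<in>gcomp Y g. g \<noteq> \<one>\<^bsub>G\<^esub> \<longrightarrow> cou B x = 0) \<and>
    (\<forall>x y. cop B (mul B x y) = braided_tmul B Y (cop B x) (cop B y)) \<and>
    cop B (one B) = tens (one B) (one B) \<and>
    (\<forall>x y. cou B (mul B x y) = cou B x * cou B y) \<and> cou B (one B) = 1 \<and>
    (\<exists>S. is_antipode B S \<and> (\<forall>g x. S (gact Y g x) = gact Y g (S x)) \<and> (\<forall>g. S ` gcomp Y g \<subseteq> gcomp Y g))"

text \<open>\<open>gr\<close> makes \<open>B\<close> a graded Hopf algebra in the category of Yetter-Drinfeld modules.\<close>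

definition braided_grading ::
  "('k::field, 'r::finite) bialg \<Rightarrow> ('k, 'g::finite, 'k ^ 'r) yd \<Rightarrow> (nat \<Rightarrow> ('k ^ 'r) set) \<Rightarrow> bool"
  where "braided_grading B Y gr \<longleftrightarrow>
    direct_sum (*s) UNIV gr \<and>
    (\<forall>n g. gact Y g ` gr n \<subseteq> gr n \<and> part (gcomp Y) g ` gr n \<subseteq> gr n) \<and>
    (\<forall>m n. \<forall>x\<in>gr m. \<forall>y\<in>gr n. mul B x y \<in> gr (m + n)) \<and> one B \<in> gr 0 \<and>
    (\<forall>n. \<forall>x\<in>gr n. cop B x \<in> module.span (*s)
      {tens y z | y z i j. y \<in> gr i \<and> z \<in> gr j \<and> i + j = n}) \<and>
    (\<forall>n>0. \<forall>x\<in>gr n. cou B x = 0)"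

text \<open>
  \<open>B\<close> is the (finite-dimensional) Nichols algebra of \<open>V\<close>: a connected graded braided Hopf algebra
  which is generated in degree one, whose primitive elements are those of degree one, and whose
  component of degree one is isomorphic to \<open>V\<close>.
\<close>

definition nichols_algebra ::
  "'g monoid \<Rightarrow> ('k::field, 'g::finite, 'v::ab_group_add) yd \<Rightarrow>
   ('k, 'r::finite) bialg \<Rightarrow> ('k, 'g, 'k ^ 'r) yd \<Rightarrow> (nat \<Rightarrow> ('k ^ 'r) set) \<Rightarrow> bool"
  where "nichols_algebra G V B Y gr \<longleftrightarrow>
    yd_module G V \<and> braided_hopf_algebra G B Y \<and> braided_grading B Y gr \<and>
    gr 0 = range (\<lambda>c. c *s one B) \<and>
    gen_subalgebra B (gr 1) = UNIV \<and>
    {x. cop B x = tens x (one B) + tens (one B) x} = gr 1 \<and>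
    (\<exists>\<phi>. lin_on (yscl V) (ycar V) (*s) (gr 1) \<phi> \<and> bij_betw \<phi> (ycar V) (gr 1) \<and>
      (\<forall>g. \<forall>v\<in>ycar V. \<phi> (gact V g v) = gact Y g (\<phi> v)) \<and>
      (\<forall>g. \<phi> ` gcomp V g \<subseteq> gcomp Y g))"

text \<open>
  The bosonization \<open>B # kG\<close>, where \<open>tens x (axis g 1)\<close> is \<open>x # g\<close>:
  \<open>(x # g)(y # h) = x (g \<cdot> y) # gh\<close> and
  \<open>\<Delta>(x # g) = x\<^sup>1 # (x\<^sup>2)\<^sub>(\<^sub>-\<^sub>1\<^sub>) g \<otimes> (x\<^sup>2)\<^sub>(\<^sub>0\<^sub>) # g\<close>. An arbitrary element \<open>u\<close> is the sum of the
  \<open>slice u g # g\<close>.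
\<close>

definition slice :: "'k ^ ('r::finite \<times> 'g::finite) \<Rightarrow> 'g \<Rightarrow> 'k ^ 'r"
  where "slice u g = (\<chi> a. u $ (a, g))"

definition bosonization ::
  "'g monoid \<Rightarrow> ('k::field, 'r::finite) bialg \<Rightarrow> ('k, 'g::finite, 'k ^ 'r) yd \<Rightarrow> ('k, 'r \<times> 'g) bialg"
  where "bosonization G B Y = \<lparr>
    mul = (\<lambda>u w. \<Sum>g\<in>UNIV. \<Sum>h\<in>UNIV.
      tens (mul B (slice u g) (gact Y g (slice w h))) (axis (g \<otimes>\<^bsub>G\<^esub> h) 1)),
    one = tens (one B) (axis \<one>\<^bsub>G\<^esub> 1),
    cop = (\<lambda>u. \<Sum>g\<in>UNIV. lift2 (\<lambda>a b. \<Sum>k\<in>UNIV.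
      tens (tens a (axis (k \<otimes>\<^bsub>G\<^esub> g) 1)) (tens (part (gcomp Y) k b) (axis g 1))) (cop B (slice u g))),
    cou = (\<lambda>u. \<Sum>g\<in>UNIV. cou B (slice u g)) \<rparr>"

section \<open>The double of the bosonization\<close>

record ('k, 'g::finite, 'r::finite, 'd::finite) double =
  grp :: "'g monoid"
  nic :: "('k, 'r) bialg"
  nyd :: "('k, 'g, 'k ^ 'r) yd"
  ngr :: "nat \<Rightarrow> ('k ^ 'r) set"
  alg :: "('k, 'd) bialg"
  emb :: "'k ^ ('r \<times> 'g) \<Rightarrow> 'k ^ 'd"
  demb :: "'k ^ ('r \<times> 'g) \<Rightarrow> 'k ^ 'd"

abbreviation bos :: "('k::field, 'g::finite, 'r::finite, 'd::finite) double \<Rightarrow> ('k, 'r \<times> 'g) bialg"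
  where "bos T \<equiv> bosonization (grp T) (nic T) (nyd T)"

text \<open>\<open>alg T\<close> is the algebra \<open>\<D>\<close> attached to the Yetter-Drinfeld module \<open>V\<close> over the finite group \<open>grp T\<close>.\<close>

definition double_of ::
  "('k::field, 'g::finite, 'v::ab_group_add) yd \<Rightarrow> ('k, 'g, 'r::finite, 'd::finite) double \<Rightarrow> bool"
  where "double_of V T \<longleftrightarrow>
    group (grp T) \<and> carrier (grp T) = UNIV \<and>
    nichols_algebra (grp T) V (nic T) (nyd T) (ngr T) \<and>
    drinfeld_double (bos T) (alg T) (emb T) (demb T)"

definition nich_part :: "('k::field, 'g::finite, 'r::finite, 'd::finite) double \<Rightarrow> nat \<Rightarrow> ('k ^ 'd) set"
  where "nich_part T n = emb T ` {tens x (axis \<one>\<^bsub>grp T\<^esub> 1) | x. x \<in> ngr T n}"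

text \<open>
  The projection \<open>x # g \<mapsto> \<epsilon>(x) g\<close> of the bosonization \<open>H\<close> onto the group algebra embeds the function
  algebra \<open>k\<^sup>G\<close> into \<open>H\<^sup>*\<^sup>o\<^sup>p\<close>, and restriction to the group algebra is a retraction of this
  embedding. Its right coinvariants, the functionals with \<open>f(h g) = f(h)\<close>, form the Nichols algebra
  of the dual of \<open>V\<close>, whose component of degree \<open>n\<close> consists of the functionals supported in degree \<open>n\<close>.
\<close>

definition dnich_part :: "('k::field, 'g::finite, 'r::finite, 'd::finite) double \<Rightarrow> nat \<Rightarrow> ('k ^ 'd) set"
  where "dnich_part T n = demb T ` {f.
    (\<forall>u g. pairing f (mul (bos T) u (tens (one (nic T)) (axis g 1))) = pairing f u) \<and>
    (\<forall>m x g. m \<noteq> n \<longrightarrow> x \<in> ngr T m \<longrightarrow> pairing f (tens x (axis g 1)) = 0)}"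

definition group_algebra :: "('k::field, 'g::finite, 'r::finite, 'd::finite) double \<Rightarrow> ('k ^ 'd) set"
  where "group_algebra T = emb T ` range (\<lambda>a. tens (one (nic T)) a)"

definition function_algebra :: "('k::field, 'g::finite, 'r::finite, 'd::finite) double \<Rightarrow> ('k ^ 'd) set"
  where "function_algebra T = demb T ` {f. \<forall>x g.
    pairing f (tens x (axis g 1)) = cou (nic T) x * pairing f (tens (one (nic T)) (axis g 1))}"

text \<open>The Drinfeld double of the group algebra, as a subalgebra of \<open>\<D>\<close>.\<close>

definition DG :: "('k::field, 'g::finite, 'r::finite, 'd::finite) double \<Rightarrow> ('k ^ 'd) set"
  where "DG T = module.span (*s)
    {mul (alg T) x y | x y. x \<in> group_algebra T \<and> y \<in> function_algebra T}"

definition Dgr :: "('k::field, 'g::finite, 'r::finite, 'd::finite) double \<Rightarrow> int \<Rightarrow> ('k ^ 'd) set"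
  where "Dgr T n = module.span (*s)
    {mul (alg T) (mul (alg T) x d) y | x d y i j.
      x \<in> nich_part T i \<and> d \<in> DG T \<and> y \<in> dnich_part T j \<and> n = int j - int i}"

definition Dge0 :: "('k::field, 'g::finite, 'r::finite, 'd::finite) double \<Rightarrow> ('k ^ 'd) set"
  where "Dge0 T = gen_subalgebra (alg T) (DG T \<union> (\<Union>j. dnich_part T j))"

section \<open>Modules\<close>

text \<open>A module over a subalgebra \<open>A\<close> of \<open>D\<close>; the values of \<open>act\<close> outside of \<open>A\<close> and \<open>car\<close> are irrelevant.\<close>

record ('k, 'd::finite, 'm) rep =
  scl :: "'k \<Rightarrow> 'm \<Rightarrow> 'm"
  car :: "'m set"
  act :: "'k ^ 'd \<Rightarrow> 'm \<Rightarrow> 'm"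

record ('k, 'd::finite, 'm) grep = "('k, 'd, 'm) rep" +
  piece :: "int \<Rightarrow> 'm set"

text \<open>Every finite-dimensional module is isomorphic to one carried by a subspace of \<open>nat \<Rightarrow> 'k\<close>.\<close>

type_synonym ('k, 'd) urep = "('k, 'd, nat \<Rightarrow> 'k) rep"
type_synonym ('k, 'd) ugrep = "('k, 'd, nat \<Rightarrow> 'k) grep"

definition fd_module ::
  "('k::field, 'd::finite) bialg \<Rightarrow> ('k ^ 'd) set \<Rightarrow> ('k, 'd, 'm::ab_group_add, 'z) rep_scheme \<Rightarrow> bool"
  where "fd_module D A M \<longleftrightarrow>
    vector_space (scl M) \<and> module.subspace (scl M) (car M) \<and>
    (\<exists>B. finite B \<and> module.span (scl M) B = car M) \<and>
    (\<forall>x\<in>A. lin_on (scl M) (car M) (scl M) (car M) (act M x)) \<and>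
    (\<forall>v\<in>car M. lin_on (*s) A (scl M) (car M) (\<lambda>x. act M x v)) \<and>
    (\<forall>v\<in>car M. act M (one D) v = v) \<and>
    (\<forall>x\<in>A. \<forall>y\<in>A. \<forall>v\<in>car M. act M (mul D x y) v = act M x (act M y v))"

definition submodule ::
  "('k::field ^ 'd) set \<Rightarrow> ('k, 'd::finite, 'm::ab_group_add, 'z) rep_scheme \<Rightarrow> 'm set \<Rightarrow> bool"
  where "submodule A M U \<longleftrightarrow>
    module.subspace (scl M) U \<and> U \<subseteq> car M \<and> (\<forall>x\<in>A. \<forall>u\<in>U. act M x u \<in> U)"

definition simple_module ::
  "('k::field, 'd::finite) bialg \<Rightarrow> ('k ^ 'd) set \<Rightarrow> ('k, 'd, 'm::ab_group_add, 'z) rep_scheme \<Rightarrow> bool"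
  where "simple_module D A M \<longleftrightarrow>
    fd_module D A M \<and> car M \<noteq> {0} \<and> (\<forall>U. submodule A M U \<longrightarrow> U = {0} \<or> U = car M)"

text \<open>Homomorphisms vanish outside of the module, so that they are determined by their values on it.\<close>

definition homs ::
  "('k::field ^ 'd) set \<Rightarrow> ('k, 'd::finite, 'm::ab_group_add, 'y) rep_scheme \<Rightarrow>
   ('k, 'd, 'n::ab_group_add, 'z) rep_scheme \<Rightarrow> ('m \<Rightarrow> 'n) set"
  where "homs A M N = {f. lin_on (scl M) (car M) (scl N) (car N) f \<and>
    (\<forall>x\<in>A. \<forall>v\<in>car M. f (act M x v) = act N x (f v)) \<and> (\<forall>v. v \<notin> car M \<longrightarrow> f v = 0)}"

definition iso_modules ::
  "('k::field ^ 'd) set \<Rightarrow> ('k, 'd::finite, 'm::ab_group_add, 'y) rep_scheme \<Rightarrow>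
   ('k, 'd, 'n::ab_group_add, 'z) rep_scheme \<Rightarrow> bool"
  where "iso_modules A M N \<longleftrightarrow> (\<exists>f\<in>homs A M N. bij_betw f (car M) (car N))"

definition hom_dim ::
  "('k::field, 'd::finite, 'n::ab_group_add, 'z) rep_scheme \<Rightarrow> ('m \<Rightarrow> 'n) set \<Rightarrow> nat"
  where "hom_dim N F = vector_space.dim (\<lambda>c f v. scl N c (f v)) F"

definition graded_module ::
  "('k::field, 'g::finite, 'r::finite, 'd::finite) double \<Rightarrow> ('k, 'd, 'm::ab_group_add, 'z) grep_scheme \<Rightarrow> bool"
  where "graded_module T N \<longleftrightarrow>
    fd_module (alg T) UNIV N \<and> direct_sum (scl N) (car N) (piece N) \<and>
    (\<forall>n i. \<forall>x\<in>Dgr T n. \<forall>v\<in>piece N i. act N x v \<in> piece N (n + i))"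

definition shift :: "int \<Rightarrow> ('k, 'd::finite, 'm, 'z) grep_scheme \<Rightarrow> ('k, 'd, 'm, 'z) grep_scheme"
  where "shift l N = N\<lparr>piece := \<lambda>i. piece N (i - l)\<rparr>"

definition ghoms ::
  "('k::field, 'd::finite, 'm::ab_group_add, 'y) grep_scheme \<Rightarrow>
   ('k, 'd, 'n::ab_group_add, 'z) grep_scheme \<Rightarrow> ('m \<Rightarrow> 'n) set"
  where "ghoms M N = {f \<in> homs UNIV M N. \<forall>i. f ` piece M i \<subseteq> piece N i}"

text \<open>
  Composition multiplicities. The subquotient \<open>U' / U\<close> is isomorphic to \<open>L\<close> if there is a surjective
  homomorphism from \<open>U'\<close> to \<open>L\<close> with kernel \<open>U\<close>.
\<close>

definition composition_series ::
  "('k::field, 'd::finite, 'm::ab_group_add, 'z) rep_scheme \<Rightarrow> 'm set list \<Rightarrow> bool"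
  where "composition_series N us \<longleftrightarrow>
    us \<noteq> [] \<and> hd us = {0} \<and> last us = car N \<and> (\<forall>U\<in>set us. submodule UNIV N U) \<and>
    (\<forall>i. Suc i < length us \<longrightarrow> us ! i \<subset> us ! Suc i \<and>
      (\<forall>W. submodule UNIV N W \<longrightarrow> us ! i \<subseteq> W \<longrightarrow> W \<subseteq> us ! Suc i \<longrightarrow> W = us ! i \<or> W = us ! Suc i))"

definition subquotient_iso ::
  "('k::field, 'd::finite, 'm::ab_group_add, 'y) rep_scheme \<Rightarrow> 'm set \<Rightarrow> 'm set \<Rightarrow>
   ('k, 'd, 'n::ab_group_add, 'z) rep_scheme \<Rightarrow> bool"
  where "subquotient_iso N U U' L \<longleftrightarrow>
    (\<exists>f\<in>homs UNIV (N\<lparr>car := U'\<rparr>) L. f ` U' = car L \<and> {v \<in> U'. f v = 0} = U)"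

definition multiplicity_in ::
  "('k::field, 'd::finite, 'm::ab_group_add, 'y) rep_scheme \<Rightarrow>
   ('k, 'd, 'n::ab_group_add, 'z) rep_scheme \<Rightarrow> nat"
  where "multiplicity_in N L = (THE m. \<forall>us. composition_series N us \<longrightarrow>
    m = card {i. Suc i < length us \<and> subquotient_iso N (us ! i) (us ! Suc i) L})"

section \<open>Verma modules, simple modules, projective covers\<close>

definition weights ::
  "('k::field, 'g::finite, 'r::finite, 'd::finite) double \<Rightarrow> ('k, 'd) urep set \<Rightarrow> bool"
  where "weights T \<Lambda> \<longleftrightarrow>
    (\<forall>l\<in>\<Lambda>. simple_module (alg T) (DG T) l) \<and>
    (\<forall>S :: ('k, 'd) urep. simple_module (alg T) (DG T) S \<longrightarrow> (\<exists>!l. l \<in> \<Lambda> \<and> iso_modules (DG T) S l))"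

text \<open>\<open>l'\<close> is \<open>l\<close>, regarded as a module over \<open>Dge0 T\<close> on which the dual of \<open>V\<close> acts by zero.\<close>

definition inflation ::
  "('k::field, 'g::finite, 'r::finite, 'd::finite) double \<Rightarrow>
   ('k, 'd, 'm::ab_group_add) rep \<Rightarrow> ('k, 'd, 'm) rep \<Rightarrow> bool"
  where "inflation T l l' \<longleftrightarrow>
    fd_module (alg T) (Dge0 T) l' \<and> scl l' = scl l \<and> car l' = car l \<and>
    (\<forall>x\<in>DG T. \<forall>v\<in>car l. act l' x v = act l x v) \<and>
    (\<forall>y\<in>dnich_part T 1. \<forall>v\<in>car l. act l' y v = 0)"

text \<open>
  The tensor product over the field of \<open>'k^'d\<close> and the space of \<open>l\<close>, the sum of the \<open>axis i 1 \<otimes> t i\<close>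
  being represented by \<open>t\<close>.
\<close>

definition tspace :: "('k, 'd::finite, 'm) rep \<Rightarrow> ('d \<Rightarrow> 'm) set"
  where "tspace l = {t. \<forall>i. t i \<in> car l}"

definition tscl :: "('k, 'd::finite, 'm) rep \<Rightarrow> 'k \<Rightarrow> ('d \<Rightarrow> 'm) \<Rightarrow> ('d \<Rightarrow> 'm)"
  where "tscl l c t = (\<lambda>i. scl l c (t i))"

definition pure :: "('k, 'd::finite, 'm) rep \<Rightarrow> 'k ^ 'd \<Rightarrow> 'm \<Rightarrow> ('d \<Rightarrow> 'm)"
  where "pure l x v = (\<lambda>i. scl l (x $ i) v)"

text \<open>
  \<open>M\<close> is the quotient \<open>\<D> \<otimes>\<^bsub>Dge0\<^esub> l\<close> of the tensor product over the field by the balancing relations,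
  graded with \<open>1 \<otimes> l\<close> in degree zero; \<open>q\<close> is the quotient map.
\<close>

definition verma_module ::
  "('k::field, 'g::finite, 'r::finite, 'd::finite) double \<Rightarrow>
   ('k, 'd, 'm::ab_group_add) rep \<Rightarrow> ('k, 'd, 'n::ab_group_add) grep \<Rightarrow> bool"
  where "verma_module T l M \<longleftrightarrow> graded_module T M \<and>
    (\<exists>l' q. inflation T l l' \<and>
      lin_on (tscl l) (tspace l) (scl M) (car M) q \<and> q ` tspace l = car M \<and>
      {t \<in> tspace l. q t = 0} = module.span (tscl l)
        {pure l (mul (alg T) x b) v - pure l x (act l' b v) | x b v. b \<in> Dge0 T \<and> v \<in> car l} \<and>
      (\<forall>x y. \<forall>v\<in>car l. act M y (q (pure l x v)) = q (pure l (mul (alg T) y x) v)) \<and>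
      (\<forall>n. piece M n = q ` module.span (tscl l) {pure l x v | x v. x \<in> Dgr T n \<and> v \<in> car l}))"

definition radical :: "('k::field, 'd::finite, 'm::ab_group_add, 'z) rep_scheme \<Rightarrow> 'm set"
  where "radical M = car M \<inter> \<Inter>{U. submodule UNIV M U \<and> U \<noteq> car M \<and>
    (\<forall>W. submodule UNIV M W \<longrightarrow> U \<subseteq> W \<longrightarrow> W = U \<or> W = car M)}"

text \<open>
  The head is the quotient by the radical, with the inherited grading. That the head of a Verma
  module is simple is not part of the definition.
\<close>

definition graded_head ::
  "('k::field, 'g::finite, 'r::finite, 'd::finite) double \<Rightarrow>
   ('k, 'd, 'm::ab_group_add) grep \<Rightarrow> ('k, 'd, 'n::ab_group_add) grep \<Rightarrow> bool"
  where "graded_head T M L \<longleftrightarrow> graded_module T L \<and>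
    (\<exists>f\<in>ghoms M L. f ` car M = car L \<and> {v \<in> car M. f v = 0} = radical M)"

definition projective_module ::
  "('k::field, 'd::finite) bialg \<Rightarrow> ('k, 'd, 'm::ab_group_add, 'z) rep_scheme \<Rightarrow> bool"
  where "projective_module D P \<longleftrightarrow> fd_module D UNIV P \<and>
    (\<forall>(X :: ('k, 'd) urep) (Y :: ('k, 'd) urep). fd_module D UNIV X \<longrightarrow> fd_module D UNIV Y \<longrightarrow>
      (\<forall>g\<in>homs UNIV X Y. g ` car X = car Y \<longrightarrow>
        (\<forall>f\<in>homs UNIV P Y. \<exists>h\<in>homs UNIV P X. \<forall>v\<in>car P. g (h v) = f v)))"

text \<open>
  \<open>P\<close> is the projective cover of \<open>L\<close>, graded such that the covering has degree zero and \<open>P\<close> is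
  generated by a copy of \<open>l\<close> in degree zero.
\<close>

definition graded_projective_cover ::
  "('k::field, 'g::finite, 'r::finite, 'd::finite) double \<Rightarrow> ('k, 'd, 'l::ab_group_add) rep \<Rightarrow>
   ('k, 'd, 'n::ab_group_add) grep \<Rightarrow> ('k, 'd, 'm::ab_group_add) grep \<Rightarrow> bool"
  where "graded_projective_cover T l L P \<longleftrightarrow>
    graded_module T P \<and> projective_module (alg T) P \<and>
    (\<exists>f\<in>ghoms P L. f ` car P = car L \<and> (\<forall>U. submodule UNIV P U \<longrightarrow> f ` U = car L \<longrightarrow> U = car P)) \<and>
    (\<exists>U. U \<subseteq> piece P 0 \<and> submodule (DG T) P U \<and> iso_modules (DG T) l (P\<lparr>car := U\<rparr>) \<and>
      (\<forall>W. submodule UNIV P W \<longrightarrow> U \<subseteq> W \<longrightarrow> W = car P))"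

section \<open>Characters and Grothendieck groups\<close>

text \<open>
  The group ring \<open>int \<Rightarrow>\<^sub>0 int\<close> of the integers is the ring of integral Laurent polynomials, with
  \<open>Poly_Mapping.single i 1\<close> as \<open>t\<^sup>i\<close>. Since \<open>K\<close> is free on \<open>\<Lambda>\<close>, the module \<open>K[t, t\<^sup>-\<^sup>1]\<close> consists of the
  functions from \<open>\<Lambda>\<close> to Laurent polynomials, extended by zero, with \<open>lscale\<close> as scalar multiplication.
\<close>

type_synonym laurent = "int \<Rightarrow>\<^sub>0 int"

definition laurent_poly :: "(int \<Rightarrow> int) \<Rightarrow> laurent"
  where "laurent_poly a = (\<Sum>i | a i \<noteq> 0. Poly_Mapping.single i (a i))"

definition eval1 :: "laurent \<Rightarrow> int"
  where "eval1 p = (\<Sum>i\<in>Poly_Mapping.keys p. Poly_Mapping.lookup p i)"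

definition lscale :: "laurent \<Rightarrow> ('i \<Rightarrow> laurent) \<Rightarrow> ('i \<Rightarrow> laurent)"
  where "lscale p c = (\<lambda>l. p * c l)"

definition ch ::
  "('k::field, 'g::finite, 'r::finite, 'd::finite) double \<Rightarrow> ('k, 'd) urep set \<Rightarrow>
   ('k, 'd, 'm::ab_group_add, 'z) rep_scheme \<Rightarrow> ('k, 'd) urep \<Rightarrow> int"
  where "ch T \<Lambda> N l = (if l \<in> \<Lambda> then int (hom_dim N (homs (DG T) l N)) else 0)"

definition gch ::
  "('k::field, 'g::finite, 'r::finite, 'd::finite) double \<Rightarrow> ('k, 'd) urep set \<Rightarrow>
   ('k, 'd, 'm::ab_group_add, 'z) grep_scheme \<Rightarrow> ('k, 'd) urep \<Rightarrow> laurent"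
  where "gch T \<Lambda> N l = laurent_poly (\<lambda>i. ch T \<Lambda> (N\<lparr>car := piece N i\<rparr>) l)"

text \<open>For \<open>P\<close> the graded projective cover of \<open>L\<close>, this is the Laurent polynomial \<open>p\<^bsub>N,L\<^esub>\<close>.\<close>

definition mult_poly ::
  "('k::field, 'd::finite, 'm::ab_group_add) grep \<Rightarrow> ('k, 'd, 'n::ab_group_add) grep \<Rightarrow> laurent"
  where "mult_poly P N = laurent_poly (\<lambda>i. int (hom_dim N (ghoms (shift i P) N)))"

definition gmodules :: "('k::field, 'g::finite, 'r::finite, 'd::finite) double \<Rightarrow> ('k, 'd) ugrep set"
  where "gmodules T = {N. graded_module T N}"

definition short_exact ::
  "('k::field, 'd::finite) ugrep \<Rightarrow> ('k, 'd) ugrep \<Rightarrow> ('k, 'd) ugrep \<Rightarrow> bool"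
  where "short_exact N' N N'' \<longleftrightarrow> (\<exists>f\<in>ghoms N' N. \<exists>g\<in>ghoms N N''.
    inj_on f (car N') \<and> f ` car N' = {v \<in> car N. g v = 0} \<and> g ` car N = car N'')"

text \<open>
  The free abelian group on all graded modules modulo the subgroup generated by short exact
  sequences. Isomorphic modules are identified by the sequences with a zero module.
\<close>

abbreviation free_gmodules :: "('k::field, 'g::finite, 'r::finite, 'd::finite) double \<Rightarrow> (('k, 'd) ugrep \<Rightarrow>\<^sub>0 int) monoid"
  where "free_gmodules T \<equiv> free_Abelian_group (gmodules T)"

definition exact_relations ::
  "('k::field, 'g::finite, 'r::finite, 'd::finite) double \<Rightarrow> (('k, 'd) ugrep \<Rightarrow>\<^sub>0 int) set"
  where "exact_relations T = generate (free_gmodules T)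
    {Poly_Mapping.single N 1 - Poly_Mapping.single N' 1 - Poly_Mapping.single N'' 1 | N' N N''.
      N' \<in> gmodules T \<and> N \<in> gmodules T \<and> N'' \<in> gmodules T \<and> short_exact N' N N''}"

definition grothendieck ::
  "('k::field, 'g::finite, 'r::finite, 'd::finite) double \<Rightarrow> (('k, 'd) ugrep \<Rightarrow>\<^sub>0 int) set monoid"
  where "grothendieck T = free_gmodules T Mod exact_relations T"

definition gclass ::
  "('k::field, 'g::finite, 'r::finite, 'd::finite) double \<Rightarrow> ('k, 'd) ugrep \<Rightarrow> (('k, 'd) ugrep \<Rightarrow>\<^sub>0 int) set"
  where "gclass T N = exact_relations T #>\<^bsub>free_gmodules T\<^esub> Poly_Mapping.single N 1"

text \<open>
  The action of Laurent polynomials determined by \<open>t\<^sup>l [N] = [N[l]]\<close>, first on the free group and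
  then on cosets of the relations.
\<close>

definition laurent_act_free :: "laurent \<Rightarrow> (('k, 'd::finite) ugrep \<Rightarrow>\<^sub>0 int) \<Rightarrow> (('k, 'd) ugrep \<Rightarrow>\<^sub>0 int)"
  where "laurent_act_free p c = (\<Sum>l\<in>Poly_Mapping.keys p. \<Sum>N\<in>Poly_Mapping.keys c.
    Poly_Mapping.single (shift l N) (Poly_Mapping.lookup p l * Poly_Mapping.lookup c N))"

definition laurent_act ::
  "('k::field, 'g::finite, 'r::finite, 'd::finite) double \<Rightarrow> laurent \<Rightarrow>
   (('k, 'd) ugrep \<Rightarrow>\<^sub>0 int) set \<Rightarrow> (('k, 'd) ugrep \<Rightarrow>\<^sub>0 int) set"
  where "laurent_act T p X = (\<Union>c\<in>X. exact_relations T #>\<^bsub>free_gmodules T\<^esub> laurent_act_free p c)"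

definition gch_free ::
  "('k::field, 'g::finite, 'r::finite, 'd::finite) double \<Rightarrow> ('k, 'd) urep set \<Rightarrow>
   (('k, 'd) ugrep \<Rightarrow>\<^sub>0 int) \<Rightarrow> ('k, 'd) urep \<Rightarrow> laurent"
  where "gch_free T \<Lambda> c = (\<lambda>l. \<Sum>N\<in>Poly_Mapping.keys c. of_int (Poly_Mapping.lookup c N) * gch T \<Lambda> N l)"

definition gch_class ::
  "('k::field, 'g::finite, 'r::finite, 'd::finite) double \<Rightarrow> ('k, 'd) urep set \<Rightarrow>
   (('k, 'd) ugrep \<Rightarrow>\<^sub>0 int) set \<Rightarrow> ('k, 'd) urep \<Rightarrow> laurent"
  where "gch_class T \<Lambda> X = (THE y. \<forall>c\<in>X. gch_free T \<Lambda> c = y)"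

end

theory Submission
  imports Defs
begin

text \<open>
  By Maschke's theorem the double of the group is semisimple, so the graded character is additive on exact
  sequences and factors through the Grothendieck group. Since \<open>M(\<lambda>)\<close> lives in degrees at most zero with degree-zero
  piece \<open>\<lambda>\<close>, so does its head \<open>L(\<lambda>)\<close>; comparing top degrees shows that the characters of the \<open>L(\<lambda>)\<close> are linearly
  independent over the Laurent polynomials. The top piece of any graded module contains some \<open>\<lambda>\<close>, which by the
  universal property of \<open>M(\<lambda>)\<close> yields a map from a shift of \<open>M(\<lambda>)\<close>; hence a minimal graded submodule is
  a shift of some \<open>L(\<lambda>)\<close>, and induction on the dimension reduces every graded module to these. Both
  \<open>ch\<^sup>\<bullet>\<close> and the dimensions of \<open>Hom(P(\<lambda>)[i], -)\<close> are additive, so the formula for \<open>ch\<^sup>\<bullet> N\<close> need only be checked on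
  the \<open>L(\<mu>)[j]\<close>, and evaluation at one follows because \<open>Hom(P(\<lambda>), -)\<close> also counts ungraded factors.
\<close>

section \<open>Finite-dimensional spaces and modules\<close>

text \<open>The definitions leave several facts to be proved: that a Verma module is nonzero, that
  its head is simple, that \<Lambda> is finite. The first comes from the projective cover, which
  contains a copy of \<open>l\<close>, the others from the grading and from Maschke's theorem.
  Extending a map from \<open>l\<close> to \<open>N\<close> over the Verma module requires the dual
  of V to annihilate its image, which is automatic only in the top degree of \<open>N\<close>; hence
  the choice of the top piece. Projectivity is stated without gradings: graded lifts arise as
  homogeneous components of arbitrary lifts, and for these to be equivariant the homogeneous
  elements have to span D. Algebraic closure enters through Schur's lemma, which turns
  multiplicities into dimensions of Hom spaces, characteristic zero through division by the order of
  G. Many definitions speak of modules carried by \<open>nat => 'k\<close>, while the theorem and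
  some auxiliary modules use other types; modules are therefore repeatedly replaced by isomorphic
  copies.\<close>

definition fd_space :: "('k::field \<Rightarrow> 'm::ab_group_add \<Rightarrow> 'm) \<Rightarrow> 'm set \<Rightarrow> bool"
  where "fd_space s S \<longleftrightarrow>
    vector_space s \<and> module.subspace s S \<and> (\<exists>B. finite B \<and> module.span s B = S)"

text \<open>This is the scalar multiplication with respect to which \<open>hom_dim\<close> takes
  dimensions, so the dimension formulas for spaces of functions apply to it directly.\<close>

abbreviation (input) fscale :: "('k \<Rightarrow> 'n \<Rightarrow> 'n) \<Rightarrow> 'k \<Rightarrow> ('m \<Rightarrow> 'n) \<Rightarrow> ('m \<Rightarrow> 'n)"
  where "fscale s \<equiv> (\<lambda>c f v. s c (f v))"

lemma fd_spaceD:
  assumes "fd_space s S"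
  shows "vector_space s" "module s" "module.subspace s S"
  using assms by (auto simp: fd_space_def module_iff_vector_space)

lemma subspaceD:
  assumes "vector_space s" "module.subspace s S"
  shows "0 \<in> S" "\<And>x y. x \<in> S \<Longrightarrow> y \<in> S \<Longrightarrow> x + y \<in> S" "\<And>c x. x \<in> S \<Longrightarrow> s c x \<in> S"
    "\<And>x y. x \<in> S \<Longrightarrow> y \<in> S \<Longrightarrow> x - y \<in> S" "\<And>x. x \<in> S \<Longrightarrow> - x \<in> S"
    "\<And>f I. (\<And>i. i \<in> I \<Longrightarrow> f i \<in> S) \<Longrightarrow> sum f I \<in> S"
proof -
  interpret vector_space s by fact
  show "0 \<in> S" "\<And>x y. x \<in> S \<Longrightarrow> y \<in> S \<Longrightarrow> x + y \<in> S" "\<And>c x. x \<in> S \<Longrightarrow> s c x \<in> S"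
    "\<And>x y. x \<in> S \<Longrightarrow> y \<in> S \<Longrightarrow> x - y \<in> S" "\<And>x. x \<in> S \<Longrightarrow> - x \<in> S"
    "\<And>f I. (\<And>i. i \<in> I \<Longrightarrow> f i \<in> S) \<Longrightarrow> sum f I \<in> S"
    using assms(2) by (simp_all add: subspace_0 subspace_add subspace_scale subspace_diff subspace_neg subspace_sum)
qed

lemma vs_subspaceI:
  assumes "vector_space s" "0 \<in> S" "\<And>x y. x \<in> S \<Longrightarrow> y \<in> S \<Longrightarrow> x + y \<in> S"
    "\<And>c x. x \<in> S \<Longrightarrow> s c x \<in> S"
  shows "module.subspace s S"
  using assms by (simp add: module.subspace_def module_iff_vector_space)

lemma lin_onD:
  assumes "lin_on s1 S s2 T f"
  shows "\<And>x. x \<in> S \<Longrightarrow> f x \<in> T" "\<And>x y. x \<in> S \<Longrightarrow> y \<in> S \<Longrightarrow> f (x + y) = f x + f y"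
    "\<And>c x. x \<in> S \<Longrightarrow> f (s1 c x) = s2 c (f x)"
  using assms by (auto simp: lin_on_def)

lemma lin_on_zero:
  assumes "vector_space s1" "module.subspace s1 S" "lin_on s1 S s2 T f"
  shows "f 0 = 0"
  using lin_onD(2)[OF assms(3), of 0 0] subspaceD(1)[OF assms(1,2)] by simp

lemma lin_on_diff:
  assumes "vector_space s1" "module.subspace s1 S" "lin_on s1 S s2 T f" "x \<in> S" "y \<in> S"
  shows "f (x - y) = f x - f y"
  using lin_onD(2)[OF assms(3), of "x - y" y] subspaceD(4)[OF assms(1,2), of x y] assms(4,5)
  by (simp add: algebra_simps)

lemma lin_on_sum:
  assumes "vector_space s1" "module.subspace s1 S" "lin_on s1 S s2 T f" "\<And>i. i \<in> I \<Longrightarrow> g i \<in> S"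
  shows "f (sum g I) = (\<Sum>i\<in>I. f (g i))"
  using assms(4)
proof (induction I rule: infinite_finite_induct)
  case (insert i I)
  then show ?case
    using lin_onD(2)[OF assms(3), of "g i" "sum g I"] subspaceD(6)[OF assms(1,2), of I g] by simp
qed (use lin_on_zero[OF assms(1-3)] in simp_all)

lemma lin_on_comp:
  assumes "lin_on s1 S s2 T f" "lin_on s2 T' s3 U g" "f ` S \<subseteq> T'"
  shows "lin_on s1 S s3 U (\<lambda>x. g (f x))"
  using assms unfolding lin_on_def by (simp add: image_subset_iff)

lemma lin_on_mono:
  assumes "lin_on s1 S s2 T f" "S' \<subseteq> S" "f ` S' \<subseteq> T'"
  shows "lin_on s1 S' s2 T' f"
  using assms unfolding lin_on_def by (auto simp: subset_iff)

lemma lin_on_kernel_subspace: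
  assumes "vector_space s1" "module.subspace s1 S" "vector_space s2" "lin_on s1 S s2 T f"
  shows "module.subspace s1 {x \<in> S. f x = 0}"
  using subspaceD[OF assms(1,2)] lin_on_zero[OF assms(1,2,4)] lin_onD[OF assms(4)]
  by (intro vs_subspaceI[OF assms(1)]) (auto simp: vector_space.scale_eq_0_iff[OF assms(3)])

lemma lin_on_image_subspace:
  assumes "vector_space s1" "module.subspace s1 S" "vector_space s2" "lin_on s1 S s2 T f"
    "module.subspace s1 U" "U \<subseteq> S"
  shows "module.subspace s2 (f ` U)"
proof (rule vs_subspaceI[OF assms(3)])
  show "0 \<in> f ` U"
    using subspaceD(1)[OF assms(1,5)] lin_on_zero[OF assms(1,2,4)] by force
  show "\<And>x y. x \<in> f ` U \<Longrightarrow> y \<in> f ` U \<Longrightarrow> x + y \<in> f ` U"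
    using subspaceD(2)[OF assms(1,5)] lin_onD(2)[OF assms(4)] assms(6)
    by (smt (verit) image_iff subset_eq)
  show "\<And>c x. x \<in> f ` U \<Longrightarrow> s2 c x \<in> f ` U"
    using subspaceD(3)[OF assms(1,5)] lin_onD(3)[OF assms(4)] assms(6)
    by (smt (verit) image_iff subset_eq)
qed

lemma fd_space_basis:
  assumes "fd_space s S"
  obtains B where "finite B" "B \<subseteq> S" "\<not> module.dependent s B" "module.span s B = S"
    "card B = vector_space.dim s S"
proof -
  interpret vector_space s using assms by (simp add: fd_space_def)
  obtain C where C: "finite C" "span C = S" "subspace S" using assms by (auto simp: fd_space_def)
  obtain B where B: "B \<subseteq> S" "independent B" "S \<subseteq> span B" "card B = dim S"
    using basis_exists by blast
  have "finite B" using independent_span_bound[OF C(1) B(2)] B(1) C(2) by simp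
  moreover have "span B = S" using B C(3) by (simp add: span_subspace)
  ultimately show ?thesis using that B by blast
qed

lemma fd_space_subspace_basis:
  assumes "fd_space s S" "module.subspace s U" "U \<subseteq> S"
  obtains B C where "B \<subseteq> C" "finite C" "\<not> module.dependent s C" "module.span s B = U"
    "module.span s C = S" "card B = vector_space.dim s U" "card C = vector_space.dim s S"
proof -
  interpret vector_space s using assms by (simp add: fd_space_def)
  obtain C where C: "finite C" "span C = S" "subspace S" using assms by (auto simp: fd_space_def)
  obtain B where B: "B \<subseteq> U" "independent B" "U \<subseteq> span B" "card B = dim U"
    using basis_exists by blast
  obtain B' where B': "B \<subseteq> B'" "B' \<subseteq> S" "independent B'" "S \<subseteq> span B'"
    using maximal_independent_subset_extend[of B S] B assms(3) by blast
  have "finite B'" using independent_span_bound[OF C(1) B'(3)] B' C(2) by simp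
  moreover have "span B' = S" using B' C(3) by (simp add: span_subspace)
  moreover have "span B = U" using B assms(2) by (simp add: span_subspace)
  moreover have "card B' = dim S" using basis_card_eq_dim[of B' S] B' by auto
  ultimately show ?thesis using that B B' by blast
qed

lemma fd_space_subspace:
  assumes "fd_space s S" "module.subspace s U" "U \<subseteq> S"
  shows "fd_space s U"
proof -
  obtain B C where "B \<subseteq> C" "finite C" "module.span s B = U"
    using fd_space_subspace_basis[OF assms] by metis
  then show ?thesis using assms by (auto simp: fd_space_def intro: finite_subset)
qed

lemma fd_space_dim_less:
  assumes "fd_space s S" "module.subspace s U" "U \<subset> S"
  shows "vector_space.dim s U < vector_space.dim s S"
proof -
  obtain B C where BC: "B \<subseteq> C" "finite C" "module.span s B = U"
    "module.span s C = S" "card B = vector_space.dim s U" "card C = vector_space.dim s S"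
    using fd_space_subspace_basis[of s S U] assms by (metis psubset_imp_subset)
  then have "B \<noteq> C" using assms(3) by auto
  then show ?thesis using BC psubset_card_mono[of C B] by (metis psubsetI)
qed

lemma vs_dim_0:
  assumes "vector_space s"
  shows "vector_space.dim s {0} = 0"
proof -
  interpret vector_space s by fact
  show ?thesis using dim_le_card[of "{0}" "{}"] by simp
qed

lemma fd_space_dim_eq_0:
  assumes "fd_space s S"
  shows "vector_space.dim s S = 0 \<longleftrightarrow> S = {0}"
proof
  interpret vector_space s using assms by (simp add: fd_space_def)
  assume "dim S = 0"
  moreover have "subspace {0}" by simp
  moreover have "0 \<in> S" using assms by (simp add: fd_space_def subspace_0)
  ultimately show "S = {0}" using fd_space_dim_less[OF assms, of "{0}"] by fastforce
next
  assume "S = {0}"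
  then show "vector_space.dim s S = 0" using vs_dim_0 assms by (auto simp: fd_space_def)
qed

lemma fd_space_singleton:
  assumes "vector_space s"
  shows "fd_space s {0}"
proof -
  interpret vector_space s by fact
  have "span {} = {0}" by simp
  then show ?thesis unfolding fd_space_def using assms by auto
qed

text \<open>Prescribing the values on a basis of \<open>S\<close> gives a map that is linear on the
  whole type, to which the facts about \<open>Vector_Spaces.linear\<close> apply.\<close>

lemma lin_on_extend:
  assumes "fd_space s1 S" "vector_space s2" "lin_on s1 S s2 T f"
  obtains g where "Vector_Spaces.linear s1 s2 g" "\<And>x. x \<in> S \<Longrightarrow> g x = f x"
proof -
  interpret vector_space_pair s1 s2 using assms by (simp add: vector_space_pair_def fd_space_def)
  note S = fd_spaceD(1,3)[OF assms(1)]
  obtain B where B: "finite B" "B \<subseteq> S" "vs1.independent B" "vs1.span B = S"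
    by (rule fd_space_basis[OF assms(1)])
  define g where "g = construct B f"
  have lg: "Vector_Spaces.linear s1 s2 g" unfolding g_def by (rule linear_construct[OF B(3)])
  have "g x = f x" if "x \<in> S" for x
  proof -
    have "x \<in> vs1.span B" using B that by simp
    then obtain u where x: "x = (\<Sum>b\<in>B. s1 (u b) b)"
      using vs1.span_finite[OF B(1)] by auto
    have "f x = (\<Sum>b\<in>B. f (s1 (u b) b))"
      unfolding x using subspaceD(3)[OF S] B(2) by (intro lin_on_sum[OF S assms(3)]) auto
    also have "\<dots> = (\<Sum>b\<in>B. s2 (u b) (f b))"
      using B(2) lin_onD(3)[OF assms(3)] by (intro sum.cong) auto
    also have "\<dots> = (\<Sum>b\<in>B. s2 (u b) (g b))"
      unfolding g_def using construct_basis[OF B(3)] by (intro sum.cong) auto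
    also have "\<dots> = g x"
      unfolding x using lg by (simp add: linear_sum linear_scale)
    finally show ?thesis ..
  qed
  then show ?thesis using that lg by blast
qed

text \<open>A basis of the kernel is extended to a basis of \<open>S\<close>; the added vectors span
  a complement on which the map is injective, so their images form a basis of the image.\<close>

lemma rank_nullity:
  assumes "fd_space s1 S" "vector_space s2" "lin_on s1 S s2 T f"
  shows "fd_space s2 (f ` S)"
    "vector_space.dim s1 S = vector_space.dim s1 {x \<in> S. f x = 0} + vector_space.dim s2 (f ` S)"
proof -
  interpret vector_space_pair s1 s2 using assms by (simp add: vector_space_pair_def fd_space_def)
  note S = fd_spaceD(1,3)[OF assms(1)]
  obtain g where g: "Vector_Spaces.linear s1 s2 g" "\<And>x. x \<in> S \<Longrightarrow> g x = f x"
    using lin_on_extend[OF assms] by blast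
  define K where "K = {x \<in> S. f x = 0}"
  have "vs1.subspace K" "K \<subseteq> S"
    unfolding K_def using lin_on_kernel_subspace[OF S assms(2,3)] by auto
  then obtain B C where BC: "B \<subseteq> C" "finite C" "vs1.independent C" "vs1.span B = K"
    "vs1.span C = S" "card B = vs1.dim K" "card C = vs1.dim S"
    using fd_space_subspace_basis[OF assms(1)] by metis
  define D where "D = C - B"
  have D: "vs1.independent D" "D \<subseteq> C" "finite D" using BC vs1.independent_mono
    unfolding D_def by auto
  \<comment> \<open>An element of \<open>span D\<close> in the kernel also lies in
    \<open>span B\<close>. Its coordinates with respect to \<open>C\<close> are thus supported both
    in \<open>D\<close> and in \<open>B\<close>, which are disjoint.\<close>
  have inter: "x = 0" if "x \<in> vs1.span D" "g x = 0" for x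
  proof -
    have xS: "x \<in> S" using that(1) BC(5) D(2) vs1.span_mono by blast
    then have "x \<in> vs1.span B" using that g(2) BC(4) K_def by simp
    then have r: "vs1.representation C x = vs1.representation B x"
      "vs1.representation C x = vs1.representation D x"
      using vs1.representation_extend[OF BC(3) _ BC(1)] vs1.representation_extend[OF BC(3) that(1) D(2)] by auto
    have "vs1.representation C x b = 0" for b
    proof (cases "b \<in> B")
      case True
      then have "vs1.representation D x b = 0" using vs1.representation_ne_zero[of D x b] unfolding D_def by blast
      then show ?thesis by (simp only: r(2))
    next
      case False
      then have "vs1.representation B x b = 0" using vs1.representation_ne_zero[of B x b] by blast
      then show ?thesis by (simp only: r(1))
    qed
    moreover have "(\<Sum>b | vs1.representation C x b \<noteq> 0. s1 (vs1.representation C x b) b) = x"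
      using vs1.sum_nonzero_representation_eq[OF BC(3)] xS BC(5) by simp
    ultimately show ?thesis by simp
  qed
  have inj: "inj_on g (vs1.span D)"
  proof (rule inj_onI)
    fix x y assume "x \<in> vs1.span D" "y \<in> vs1.span D" "g x = g y"
    then show "x = y" using inter[of "x - y"] g(1) by (simp add: vs1.span_diff linear_diff)
  qed
  have ind: "vs2.independent (g ` D)"
    using linear_independent_injective_image[OF g(1) D(1) inj] .
  have "g ` S = vs2.span (g ` C)" using g(1) BC(5) linear_span_image by blast
  also have "\<dots> = vs2.span (g ` D)"
  proof (rule vs2.span_eq[THEN iffD2], intro conjI)
    have "g b = 0" if "b \<in> B" for b
      using that BC(4) vs1.span_superset[of B] g(2) K_def by auto
    then have "g ` C \<subseteq> insert 0 (g ` D)" unfolding D_def by auto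
    moreover have "insert 0 (g ` D) \<subseteq> vs2.span (g ` D)"
      by (simp add: vs2.span_zero vs2.span_superset)
    ultimately show "g ` C \<subseteq> vs2.span (g ` D)" by (rule subset_trans)
    show "g ` D \<subseteq> vs2.span (g ` C)" using image_mono[OF D(2)] vs2.span_superset[of "g ` C"] by (rule subset_trans)
  qed
  finally have sp: "f ` S = vs2.span (g ` D)" using image_cong[OF refl g(2), of S] by simp
  show "fd_space s2 (f ` S)"
    unfolding fd_space_def sp
  proof (intro conjI exI)
    show "finite (g ` D)" using D(3) by simp
    show "vs2.subspace (vs2.span (g ` D))" by simp
  qed (rule assms(2) refl)+
  have "vs2.dim (f ` S) = card (g ` D)" unfolding sp using ind by (rule vs2.dim_span_eq_card_independent)
  also have "\<dots> = card D" using inj vs1.span_superset[of D] by (metis card_image inj_on_subset)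
  also have "\<dots> = card C - card B" unfolding D_def using BC by (simp add: card_Diff_subset finite_subset)
  finally show "vs1.dim S = vs1.dim {x \<in> S. f x = 0} + vs2.dim (f ` S)"
    using BC(6,7) card_mono[OF BC(2,1)] unfolding K_def[symmetric] by linarith
qed

text \<open>Here \<open>S\<close> is not yet known to be finite-dimensional: generators of the
  kernel together with preimages of a basis of the image generate it.\<close>

lemma fd_space_extension:
  assumes "vector_space s1" "module.subspace s1 S" "fd_space s2 T" "lin_on s1 S s2 T f"
    "fd_space s1 {x \<in> S. f x = 0}"
  shows "fd_space s1 S"
proof -
  interpret vector_space_pair s1 s2 using assms by (simp add: vector_space_pair_def fd_space_def)
  note v2 = fd_spaceD(1)[OF assms(3)]
  have im: "vs2.subspace (f ` S)" using lin_on_image_subspace[OF assms(1,2) v2 assms(4) assms(2)] by simp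
  then have "fd_space s2 (f ` S)"
    using fd_space_subspace[OF assms(3) im] lin_onD(1)[OF assms(4)] by blast
  then obtain B where B: "finite B" "B \<subseteq> f ` S" "vs2.span B = f ` S" by (rule fd_space_basis)
  obtain C where C: "finite C" "vs1.span C = {x \<in> S. f x = 0}" using assms(5) by (auto simp: fd_space_def)
  obtain h where h: "\<And>b. b \<in> B \<Longrightarrow> h b \<in> S \<and> f (h b) = b"
    using B(2) by (metis (full_types) image_iff subset_iff)
  have CS: "C \<subseteq> S" using C(2) vs1.span_superset by blast
  have sub: "C \<union> h ` B \<subseteq> S" using CS h by auto
  have "S \<subseteq> vs1.span (C \<union> h ` B)"
  proof
    fix x assume x: "x \<in> S"
    then obtain u where u: "f x = (\<Sum>b\<in>B. s2 (u b) b)"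
      using vs2.span_finite[OF B(1)] B(3) by blast
    define y where "y = (\<Sum>b\<in>B. s1 (u b) (h b))"
    have yS: "y \<in> S" unfolding y_def using subspaceD(3)[OF assms(1,2)] h by (intro subspaceD(6)[OF assms(1,2)]) blast
    have "f y = (\<Sum>b\<in>B. f (s1 (u b) (h b)))"
      unfolding y_def using h subspaceD(3)[OF assms(1,2)] by (intro lin_on_sum[OF assms(1,2,4)]) auto
    also have "\<dots> = f x"
      unfolding u using h lin_onD(3)[OF assms(4)] by (intro sum.cong) auto
    finally have "x - y \<in> {x \<in> S. f x = 0}"
      using lin_on_diff[OF assms(1,2,4) x yS] subspaceD(4)[OF assms(1,2) x yS] by simp
    then have "x - y \<in> vs1.span (C \<union> h ` B)" using C(2) vs1.span_mono[of C "C \<union> h ` B"] by auto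
    moreover have "y \<in> vs1.span (C \<union> h ` B)"
      unfolding y_def by (intro vs1.span_sum vs1.span_scale vs1.span_base) auto
    ultimately show "x \<in> vs1.span (C \<union> h ` B)" using vs1.span_add by fastforce
  qed
  then have "vs1.span (C \<union> h ` B) = S" using sub assms(2) vs1.span_subspace by metis
  then show ?thesis unfolding fd_space_def using assms(1,2) B(1) C(1) by (metis finite_UnI finite_imageI)
qed

lemma vector_space_fscale: "vector_space s \<Longrightarrow> vector_space (fscale s)"
  unfolding vector_space_def by (simp add: fun_eq_iff)

text \<open>Induction on the set of basis vectors at which a map may be nonzero: evaluation at one
  more vector takes values in the finite-dimensional \<open>T\<close>, and its kernel is covered by
  the induction hypothesis.\<close>

lemma fd_space_lin_maps:
  assumes "fd_space s1 S" "fd_space s2 T"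
  shows "fd_space (fscale s2) {f. lin_on s1 S s2 T f \<and> (\<forall>v. v \<notin> S \<longrightarrow> f v = 0)}" (is "fd_space _ ?F")
proof -
  note S = fd_spaceD(1,3)[OF assms(1)] and T = fd_spaceD(1,3)[OF assms(2)]
  interpret vs2: vector_space s2 by (rule T(1))
  have vf: "vector_space (fscale s2 :: 'a \<Rightarrow> ('b \<Rightarrow> 'c) \<Rightarrow> 'b \<Rightarrow> 'c)" by (rule vector_space_fscale[OF T(1)])
  obtain B where B: "finite B" "B \<subseteq> S" "module.span s1 B = S" using fd_space_basis[OF assms(1)] by metis
  define F where "F C = {f \<in> ?F. \<forall>b\<in>C. f b = 0}" for C
  have sub: "module.subspace (fscale s2) (F C)" if "C \<subseteq> S" for C
    unfolding F_def using subspaceD[OF T]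
    by (intro vs_subspaceI[OF vf]) (auto simp: lin_on_def vs2.scale_right_distrib mult.commute)
  have "fd_space (fscale s2) (F (B - E))" if "finite E" for E
    using that
  proof induction
    case empty
    have "f = (\<lambda>_. 0)" if "f \<in> F B" for f
    proof
      fix v
      from that have f: "lin_on s1 S s2 T f" "\<forall>v. v \<notin> S \<longrightarrow> f v = 0" "\<forall>b\<in>B. f b = 0" by (auto simp: F_def)
      obtain g where g: "Vector_Spaces.linear s1 s2 g" "\<And>x. x \<in> S \<Longrightarrow> g x = f x"
        using lin_on_extend[OF assms(1) T(1) f(1)] by blast
      interpret vector_space_pair s1 s2 using S(1) T(1) by (simp add: vector_space_pair_def)
      have "g v = 0" if "v \<in> S"
      proof -
        have "v \<in> vs1.span B" using that B by simp
        moreover have "g b = 0" if "b \<in> B" for b using that f(3) g(2) B(2) by auto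
        ultimately show ?thesis using linear_eq_0_on_span[OF g(1)] by blast
      qed
      then show "f v = 0" using f(2) g(2) by (cases "v \<in> S") auto
    qed
    then have "F B \<subseteq> {0}" by (auto simp: zero_fun_def)
    then have "F B = {0}" using subspaceD(1)[OF vf sub[OF B(2)]] by blast
    then show ?case using fd_space_singleton[OF vf] by simp
  next
    case (insert b E)
    show ?case
    proof (cases "b \<in> B - E")
      case False
      then have "B - insert b E = B - E" by auto
      then show ?thesis using insert.IH by simp
    next
      case True
      then have b: "b \<in> S" using B by auto
      have eq: "{f \<in> F (B - insert b E). f b = 0} = F (B - E)" using True by (auto simp: F_def)
      have "lin_on (fscale s2) (F (B - insert b E)) s2 T (\<lambda>f. f b)"
        unfolding lin_on_def F_def using b by (auto simp: lin_on_def)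
      then show ?thesis
        using fd_space_extension[OF vf sub assms(2), of "B - insert b E" "\<lambda>f. f b"] insert.IH B(2) eq by auto
    qed
  qed
  from this[OF B(1)] have "fd_space (fscale s2) (F {})" by simp
  moreover have "F {} = ?F" unfolding F_def by auto
  ultimately show ?thesis by simp
qed

definition sstd :: "'k::field \<Rightarrow> (nat \<Rightarrow> 'k) \<Rightarrow> nat \<Rightarrow> 'k"
  where "sstd c f = (\<lambda>i. c * f i)"

lemma vector_space_sstd: "vector_space (sstd :: 'k::field \<Rightarrow> _)"
  by unfold_locales (simp_all add: sstd_def fun_eq_iff algebra_simps)

text \<open>A basis of \<open>U\<close> is sent to zero and the remaining basis vectors of
  \<open>S\<close> to distinct unit vectors. The image is a model of \<open>S / U\<close> inside
  \<open>nat => 'k\<close>, the carrier type of \<open>urep\<close>.\<close>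

lemma exists_linear_with_kernel:
  fixes s :: "'k::field \<Rightarrow> 'm::ab_group_add \<Rightarrow> 'm"
  assumes "fd_space s S" "module.subspace s U" "U \<subseteq> S"
  obtains \<phi> where "lin_on s S sstd UNIV \<phi>" "{v \<in> S. \<phi> v = 0} = U"
proof -
  interpret vector_space_pair s "sstd :: 'k \<Rightarrow> _"
    using assms vector_space_sstd by (auto simp: vector_space_pair_def fd_space_def)
  obtain B C where BC: "B \<subseteq> C" "finite C" "vs1.independent C" "vs1.span B = U" "vs1.span C = S"
    using fd_space_subspace_basis[OF assms] by metis
  obtain e :: "'m \<Rightarrow> nat" where e: "inj_on e (C - B)"
    using finite_imp_inj_to_nat_seg[of "C - B"] BC(2) by auto
  define d where "d b = (if b \<in> B then 0 else (\<lambda>i. if i = e b then 1 else 0 :: 'k))" for b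
  define \<phi> where "\<phi> = construct C d"
  have l: "Vector_Spaces.linear s sstd \<phi>" unfolding \<phi>_def by (rule linear_construct[OF BC(3)])
  have \<phi>b: "\<phi> b = d b" if "b \<in> C" for b unfolding \<phi>_def using construct_basis[OF BC(3) that] .
  have "{v \<in> S. \<phi> v = 0} = U"
  proof (intro subset_antisym subsetI)
    fix v assume v: "v \<in> {v \<in> S. \<phi> v = 0}"
    then have "v \<in> vs1.span C" using BC(5) by simp
    then obtain u where u: "v = (\<Sum>b\<in>C. s (u b) b)" unfolding vs1.span_finite[OF BC(2)] by (rule rangeE)
    have "\<phi> v = (\<Sum>b\<in>C. sstd (u b) (d b))"
      unfolding u linear_sum[OF l] using \<phi>b linear_scale[OF l] by (intro sum.cong) auto
    then have z: "(\<Sum>b\<in>C. sstd (u b) (d b)) = 0" using v by simp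
    \<comment> \<open>Evaluation at the index \<open>e c\<close> isolates the coefficient of
      \<open>c\<close>.\<close>
    have "u c = 0" if "c \<in> C - B" for c
    proof -
      have sum_at: "sum f A i = (\<Sum>a\<in>A. f a i)" for f :: "'m \<Rightarrow> nat \<Rightarrow> 'k" and A i
        by (induction A rule: infinite_finite_induct) auto
      have "0 = (\<Sum>b\<in>C. sstd (u b) (d b)) (e c)" using z by simp
      also have "\<dots> = (\<Sum>b\<in>C. u b * d b (e c))" by (simp add: sum_at sstd_def)
      also have "\<dots> = (\<Sum>b\<in>C. if b = c then u b else 0)"
        using that inj_onD[OF e] by (intro sum.cong) (auto simp: d_def)
      also have "\<dots> = u c" using that BC(2) by simp
      finally show ?thesis by simp
    qed
    then have "v = (\<Sum>b\<in>B. s (u b) b)"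
      unfolding u using BC(1,2) by (intro sum.mono_neutral_right) auto
    also have "\<dots> \<in> vs1.span B" by (intro vs1.span_sum vs1.span_scale vs1.span_base)
    finally show "v \<in> U" using BC(4) by simp
  next
    fix v assume v: "v \<in> U"
    have "\<phi> v = 0"
    proof (rule linear_eq_0_on_span[OF l, of B])
      show "\<And>x. x \<in> B \<Longrightarrow> \<phi> x = 0" using \<phi>b BC(1) by (auto simp: d_def)
    qed (use v BC(4) in simp)
    then show "v \<in> {v \<in> S. \<phi> v = 0}" using v assms(3) by auto
  qed
  moreover have "lin_on s S sstd UNIV \<phi>"
    unfolding lin_on_def by (intro conjI ballI allI linear_add[OF l] linear_scale[OF l] UNIV_I)
  ultimately show ?thesis using that by blast
qed

text \<open>Preimages are chosen on a basis of \<open>T\<close>. This linear section is the starting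
  point of the averaging in \<open>DG_lift\<close>.\<close>

lemma lin_on_section:
  assumes "fd_space s1 S" "vector_space s2" "lin_on s1 S s2 T g" "g ` S = T"
  obtains h where "lin_on s2 T s1 S h" "\<And>y. y \<in> T \<Longrightarrow> g (h y) = y"
proof -
  note S = fd_spaceD(1,3)[OF assms(1)]
  interpret vector_space_pair s2 s1
    using assms S by (auto simp: vector_space_pair_def)
  have T: "fd_space s2 T" using rank_nullity(1)[OF assms(1-3)] assms(4) by simp
  obtain B where B: "finite B" "B \<subseteq> T" "vs1.independent B" "vs1.span B = T"
    by (rule fd_space_basis[OF T])
  obtain p where p: "\<And>b. b \<in> B \<Longrightarrow> p b \<in> S \<and> g (p b) = b"
  proof -
    have "\<forall>b\<in>B. \<exists>x. x \<in> S \<and> g x = b" using B(2) assms(4) by blast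
    then show thesis using that by metis
  qed
  define h where "h = construct B p"
  have l: "Vector_Spaces.linear s2 s1 h" unfolding h_def by (rule linear_construct[OF B(3)])
  have hb: "h b = p b" if "b \<in> B" for b unfolding h_def using construct_basis[OF B(3) that] .
  have "h y \<in> S \<and> g (h y) = y" if "y \<in> T" for y
  proof -
    have "y \<in> vs1.span B" using B(4) that by simp
    then obtain u where u: "y = (\<Sum>b\<in>B. s2 (u b) b)" unfolding vs1.span_finite[OF B(1)] by (rule rangeE)
    have hy: "h y = (\<Sum>b\<in>B. s1 (u b) (p b))"
      unfolding u linear_sum[OF l] using hb linear_scale[OF l] by (intro sum.cong) auto
    have i: "s1 (u b) (p b) \<in> S" if "b \<in> B" for b using p[OF that] subspaceD(3)[OF S] by simp
    have "g (h y) = (\<Sum>b\<in>B. g (s1 (u b) (p b)))"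
      unfolding hy by (rule lin_on_sum[OF S assms(3)]) (rule i)
    also have "\<dots> = y" unfolding u using p lin_onD(3)[OF assms(3)] by (intro sum.cong) auto
    finally show ?thesis unfolding hy using subspaceD(6)[OF S, of B] i by simp
  qed
  then show ?thesis using that[of h] linear_add[OF l] linear_scale[OF l] by (simp add: lin_on_def)
qed

text \<open>The condition on kernels makes the value independent of the chosen preimage. The factor
  map is zero outside of \<open>T\<close>, as \<open>homs\<close> demands of homomorphisms.\<close>

lemma lin_on_factor:
  assumes S: "vector_space s1" "module.subspace s1 S" and g: "lin_on s1 S s2 T g" "g ` S = T"
    and f: "lin_on s1 S s3 R f" and ker: "\<And>x. x \<in> S \<Longrightarrow> g x = 0 \<Longrightarrow> f x = 0"
  obtains h where "lin_on s2 T s3 R h" "\<And>x. x \<in> S \<Longrightarrow> h (g x) = f x" "\<And>y. y \<notin> T \<Longrightarrow> h y = 0"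
proof -
  define h where "h y = (if y \<in> T then f (SOME x. x \<in> S \<and> g x = y) else 0)" for y
  have hg: "h (g x) = f x" if x: "x \<in> S" for x
  proof -
    define x' where "x' = (SOME z. z \<in> S \<and> g z = g x)"
    have x': "x' \<in> S" "g x' = g x" using someI[of "\<lambda>z. z \<in> S \<and> g z = g x" x] x by (auto simp: x'_def)
    have "f (x' - x) = 0"
      using ker[of "x' - x"] lin_on_diff[OF S g(1) x'(1) x] x' subspaceD(4)[OF S x'(1) x] by simp
    then have "f x' = f x" using lin_on_diff[OF S f x'(1) x] by simp
    then show ?thesis unfolding h_def using g(2) x by (auto simp: x'_def)
  qed
  have "lin_on s2 T s3 R h"
    unfolding lin_on_def
  proof (intro conjI ballI allI)
    fix y assume "y \<in> T" then obtain x where x: "x \<in> S" "y = g x" using g(2) by auto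
    show "h y \<in> R" using x hg lin_onD(1)[OF f] by simp
    show "h (s2 c y) = s3 c (h y)" for c
      using x hg[OF subspaceD(3)[OF S x(1), of c]] hg lin_onD(3)[OF f x(1)] lin_onD(3)[OF g(1) x(1)] by simp
    fix y' assume "y' \<in> T" then obtain x' where x': "x' \<in> S" "y' = g x'" using g(2) by auto
    show "h (y + y') = h y + h y'"
      using x x' hg[OF subspaceD(2)[OF S x(1) x'(1)]] hg lin_onD(2)[OF f x(1) x'(1)] lin_onD(2)[OF g(1) x(1) x'(1)]
      by simp
  qed
  then show ?thesis using that hg by (auto simp: h_def)
qed

lemma dim_exact:
  assumes F': "fd_space s1 F'" and F: "fd_space s2 F" and "vector_space s3"
    and \<alpha>: "lin_on s1 F' s2 F \<alpha>" "inj_on \<alpha> F'" and \<beta>: "lin_on s2 F s3 F'' \<beta>" "\<beta> ` F = F''"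
    and ex: "{x \<in> F. \<beta> x = 0} = \<alpha> ` F'"
  shows "vector_space.dim s2 F = vector_space.dim s1 F' + vector_space.dim s3 F''"
proof -
  note S = fd_spaceD(1,3)[OF F']
  have "{x \<in> F'. \<alpha> x = 0} = {0}"
    using inj_onD[OF \<alpha>(2), of _ 0] lin_on_zero[OF S \<alpha>(1)] subspaceD(1)[OF S] by auto
  then have "vector_space.dim s1 F' = vector_space.dim s2 (\<alpha> ` F')"
    using rank_nullity(2)[OF F' fd_spaceD(1)[OF F] \<alpha>(1)] vs_dim_0[OF S(1)] by simp
  then show ?thesis using rank_nullity(2)[OF F assms(3) \<beta>(1)] \<beta>(2) ex by simp
qed

lemma independent_powers:
  assumes "vector_space s" "\<And>n. w n \<notin> module.span s (w ` {..<n})"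
  shows "\<not> module.dependent s (w ` {..<n}) \<and> card (w ` {..<n}) = n"
proof -
  interpret vector_space s by fact
  show ?thesis
  proof (induction n)
    case (Suc n)
    have *: "w n \<notin> w ` {..<n}" using assms(2)[of n] span_base[of "w n" "w ` {..<n}"] by auto
    have eq: "w ` {..<Suc n} = insert (w n) (w ` {..<n})" by (simp add: lessThan_Suc)
    have "card (w ` {..<Suc n}) = Suc n" unfolding eq using * Suc by simp
    moreover have "independent (w ` {..<Suc n})"
      unfolding eq using Suc by (intro independent_insertI[OF assms(2)[of n]]) simp
    ultimately show ?case by simp
  qed (simp add: independent_empty)
qed

text \<open>The iterates of \<theta> on a nonzero \<open>v\<close> become linearly dependent, which
  yields a monic polynomial annihilating \<open>v\<close>. Splitting off linear factors one at a
  time must reach a nonzero vector that the next factor kills.\<close>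

lemma exists_eigenvector:
  fixes s :: "'k::alg_closed_field \<Rightarrow> 'm::ab_group_add \<Rightarrow> 'm"
  assumes Q: "fd_space s Q" "Q \<noteq> {0}" and \<theta>: "lin_on s Q s Q \<theta>"
  obtains c w where "w \<in> Q" "w \<noteq> 0" "\<theta> w = s c w"
proof -
  note S = fd_spaceD(1,3)[OF Q(1)]
  interpret vector_space s by (rule S(1))
  obtain v where v: "v \<in> Q" "v \<noteq> 0" using Q(2) subspaceD(1)[OF S] by auto
  define w where "w n = (\<theta> ^^ n) v" for n
  have w0: "w 0 = v" and wS: "w (Suc n) = \<theta> (w n)" for n by (simp_all add: w_def)
  have wQ: "w n \<in> Q" for n by (induction n) (use v w0 wS lin_onD(1)[OF \<theta>] in auto)
  obtain B where B: "finite B" "span B = Q" using fd_space_basis[OF Q(1)] by metis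
  have "\<exists>n. w n \<in> span (w ` {..<n})"
  proof (rule ccontr)
    assume "\<not> ?thesis"
    then have "independent (w ` {..<Suc (card B)}) \<and> card (w ` {..<Suc (card B)}) = Suc (card B)"
      using independent_powers[OF S(1)] by blast
    then show False using independent_span_bound[OF B(1), of "w ` {..<Suc (card B)}"] B(2) wQ by auto
  qed
  then obtain n where n: "w n \<in> span (w ` {..<n})" ..
  have "\<exists>c. w n = (\<Sum>i<n. s (c i) (w i))"
    using n
  proof (induction rule: span_induct_alt)
    case base
    then show ?case by (intro exI[of _ "\<lambda>_. 0"]) simp
  next
    case (step a x y)
    then obtain i c where i: "i < n" "x = w i" "y = (\<Sum>i<n. s (c i) (w i))" by auto
    have "s a x = (\<Sum>j<n. s (if j = i then a else 0) (w j))"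
      using i by (simp add: if_distrib if_distribR cong: if_cong)
    then have "s a x + y = (\<Sum>j<n. s ((if j = i then a else 0) + c j) (w j))"
      unfolding i(3) by (simp add: sum.distrib scale_left_distrib)
    then show ?case by (intro exI[of _ "\<lambda>j. (if j = i then a else 0) + c j"])
  qed
  then obtain c where c: "w n = (\<Sum>i<n. s (c i) (w i))" ..
  \<comment> \<open>\<open>pe p\<close> is the polynomial \<open>p\<close> in \<theta>, applied to
    \<open>v\<close>.\<close>
  define pe where "pe p = (\<Sum>i\<le>degree p. s (coeff p i) (w i))" for p
  have pe_bound: "pe p = (\<Sum>i\<le>N. s (coeff p i) (w i))" if "degree p \<le> N" for p N
    unfolding pe_def using that by (intro sum.mono_neutral_left) (auto simp: coeff_eq_0)
  have peQ: "pe p \<in> Q" for p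
    unfolding pe_def using wQ subspaceD(3)[OF S] by (intro subspaceD(6)[OF S]) auto
  have pe_lin: "pe ([:- a, 1:] * q) = \<theta> (pe q) - s a (pe q)" for a q
  proof -
    let ?N = "degree q"
    have d: "degree ([:- a, 1:] * q) \<le> Suc ?N"
      using degree_mult_le[of "[:- a, 1:]" q] by simp
    have "\<theta> (pe q) = (\<Sum>i\<le>?N. s (coeff q i) (w (Suc i)))"
      unfolding pe_def using wQ subspaceD(3)[OF S] lin_onD(3)[OF \<theta> wQ]
      by (subst lin_on_sum[OF S \<theta>]) (auto simp: wS)
    also have "\<dots> = (\<Sum>i\<le>Suc ?N. s (if i = 0 then 0 else coeff q (i - 1)) (w i))"
      by (simp only: sum.atMost_Suc_shift) simp
    finally have 1: "\<theta> (pe q) = (\<Sum>i\<le>Suc ?N. s (if i = 0 then 0 else coeff q (i - 1)) (w i))" .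
    have 2: "s a (pe q) = (\<Sum>i\<le>Suc ?N. s (a * coeff q i) (w i))"
      using pe_bound[of q "Suc ?N"] by (simp add: scale_sum_right scale_right_distrib)
    have co: "coeff ([:- a, 1:] * q) i = (if i = 0 then 0 else coeff q (i - 1)) - a * coeff q i" for i
      by (cases i) (simp_all add: coeff_pCons)
    show ?thesis
      unfolding pe_bound[OF d] 1 2 co by (simp only: sum_subtractf[symmetric] scale_left_diff_distrib)
  qed
  \<comment> \<open>The linear relation \<open>c\<close> among the iterates, turned into a monic
    polynomial with \<open>pe p0 = 0\<close>.\<close>
  define p0 where "p0 = monom 1 n - (\<Sum>i<n. monom (c i) i)"
  have co0: "coeff p0 i = (if i = n then 1 else 0) - (if i < n then c i else 0)" for i
    unfolding p0_def by (simp add: coeff_sum if_distrib cong: if_cong)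
  have d0: "degree p0 \<le> n" by (rule degree_le) (simp add: co0)
  have "pe p0 = 0"
    unfolding pe_bound[OF d0] lessThan_Suc_atMost[symmetric]
    by (simp add: co0 c scale_minus_left sum_negf)
  moreover have "p0 \<noteq> 0" using co0[of n] by auto
  moreover have "(\<exists>c w. w \<in> Q \<and> w \<noteq> 0 \<and> \<theta> w = s c w)" if "p \<noteq> 0" "pe p = 0" for p
    using that
  proof (induction "degree p" arbitrary: p rule: less_induct)
    case less
    show ?case
    proof (cases "degree p = 0")
      case True
      then have "pe p = s (coeff p 0) v" unfolding pe_def by (simp add: w0)
      moreover have "coeff p 0 \<noteq> 0" using True less.prems(1) by (metis leading_coeff_0_iff)
      ultimately show ?thesis using v less.prems by simp
    next
      case False
      then obtain a where "poly p a = 0" using alg_closed_imp_poly_has_root[of p] by auto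
      then obtain q where q: "p = [:- a, 1:] * q" by (auto simp: poly_eq_0_iff_dvd elim: dvdE)
      then have q0: "q \<noteq> 0" using less.prems(1) by auto
      then have "degree p = Suc (degree q)" unfolding q by (subst degree_mult_eq) auto
      \<comment> \<open>If \<open>pe q\<close> is nonzero it is an eigenvector for the root
        \<open>a\<close>; otherwise \<open>q\<close> is a polynomial of smaller degree annihilating
        \<open>v\<close>.\<close>
      then show ?thesis
        using less.hyps[of q] q0 pe_lin[of a q] less.prems(2) q peQ[of q] by (cases "pe q = 0") auto
    qed
  qed
  ultimately show ?thesis using that by blast
qed

text \<open>Nonzero members of \<open>F\<close> share image and kernel, so \<open>h2\<close> factors
  through \<open>h1\<close> by an endomorphism \<theta> of \<open>Q\<close>; subtracting an
  eigenvalue times \<open>h1\<close> gives a member of \<open>F\<close> whose kernel is larger than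
  \<open>K\<close>, hence zero. With \<open>K = {0}\<close> this is Schur's lemma for simple
  modules; other kernels serve for maps out of a projective cover.\<close>

lemma schur_proportional:
  fixes s2 :: "'k::alg_closed_field \<Rightarrow> 'n::ab_group_add \<Rightarrow> 'n"
  assumes S: "vector_space s1" "module.subspace s1 S" and Q: "fd_space s2 Q" "Q \<noteq> {0}"
    and F: "module.subspace (fscale s2) F" "\<And>h. h \<in> F \<Longrightarrow> lin_on s1 S s2 Q h"
    and sch: "\<And>h. h \<in> F \<Longrightarrow> h \<noteq> 0 \<Longrightarrow> h ` S = Q \<and> {v \<in> S. h v = 0} = K"
    and h1: "h1 \<in> F" "h1 \<noteq> 0" and h2: "h2 \<in> F"
  shows "\<exists>c. h2 = (\<lambda>v. s2 c (h1 v))"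
proof -
  interpret vs2: vector_space s2 using fd_spaceD(1)[OF Q(1)] .
  have vf: "vector_space (fscale s2 :: 'k \<Rightarrow> ('a \<Rightarrow> 'n) \<Rightarrow> _)" by (rule vector_space_fscale) unfold_locales
  have k: "h2 v = 0" if "v \<in> S" "h1 v = 0" for v
    using that sch[OF h1] sch[OF h2] by (cases "h2 = 0") auto
  obtain \<theta> where \<theta>: "lin_on s2 Q s2 Q \<theta>" "\<And>x. x \<in> S \<Longrightarrow> \<theta> (h1 x) = h2 x"
    using lin_on_factor[OF S F(2)[OF h1(1)] _ F(2)[OF h2] k] sch[OF h1] by metis
  obtain c w where w: "w \<in> Q" "w \<noteq> 0" "\<theta> w = s2 c w" by (rule exists_eigenvector[OF Q \<theta>(1)])
  then obtain u where u: "u \<in> S" "h1 u = w" using sch[OF h1] by auto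
  define h where "h = h2 - (\<lambda>v. s2 c (h1 v))"
  have hF: "h \<in> F" unfolding h_def using subspaceD(3,4)[OF vf F(1)] h1(1) h2 by blast
  have "h u = 0" using u w \<theta>(2)[OF u(1)] by (simp add: h_def)
  then have "h = 0" using sch[OF hF] sch[OF h1] u w(2) by auto
  then show ?thesis unfolding h_def by (auto simp: fun_eq_iff)
qed

lemma dim_eq_1:
  assumes V: "vector_space s" and "module.subspace s F" and h: "h \<in> F" "h \<noteq> 0"
    and pr: "\<And>h'. h' \<in> F \<Longrightarrow> \<exists>c. h' = s c h"
  shows "vector_space.dim s F = 1"
proof -
  interpret vector_space s by (rule V)
  have "F \<subseteq> span {h}" using pr span_base[of h "{h}"] span_scale by blast
  moreover have "span {h} \<subseteq> F" using h assms(2) by (intro span_minimal) auto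
  ultimately have "F = span {h}" by simp
  then show ?thesis using h(2) by (simp add: dim_eq_card_independent)
qed

section \<open>Modules over a subalgebra, their homomorphisms and quotients\<close>

lemma fd_moduleD:
  assumes "fd_module D A M"
  shows "fd_space (scl M) (car M)" "vector_space (scl M)" "module.subspace (scl M) (car M)"
    "\<And>x. x \<in> A \<Longrightarrow> lin_on (scl M) (car M) (scl M) (car M) (act M x)"
    "\<And>v. v \<in> car M \<Longrightarrow> lin_on (*s) A (scl M) (car M) (\<lambda>x. act M x v)"
    "\<And>v. v \<in> car M \<Longrightarrow> act M (one D) v = v"
    "\<And>x y v. x \<in> A \<Longrightarrow> y \<in> A \<Longrightarrow> v \<in> car M \<Longrightarrow> act M (mul D x y) v = act M x (act M y v)"
    "\<And>x v. x \<in> A \<Longrightarrow> v \<in> car M \<Longrightarrow> act M x v \<in> car M"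
  using assms unfolding fd_module_def fd_space_def lin_on_def by blast+

definition subalgebra :: "('k::field, 'd::finite) bialg \<Rightarrow> ('k ^ 'd) set \<Rightarrow> bool"
  where "subalgebra D A \<longleftrightarrow> module.subspace (*s) A \<and> one D \<in> A \<and> (\<forall>x\<in>A. \<forall>y\<in>A. mul D x y \<in> A)"

lemma subalgebraD:
  assumes "subalgebra D A"
  shows "one D \<in> A" "\<And>x y. x \<in> A \<Longrightarrow> y \<in> A \<Longrightarrow> mul D x y \<in> A" "\<And>x y. x \<in> A \<Longrightarrow> y \<in> A \<Longrightarrow> x + y \<in> A"
    "\<And>c x. x \<in> A \<Longrightarrow> c *s x \<in> A"
  using assms by (auto simp: subalgebra_def vec.subspace_add vec.subspace_scale)

lemma fd_module_cong:
  "scl M = scl M' \<Longrightarrow> car M = car M' \<Longrightarrow> act M = act M' \<Longrightarrow> fd_module D A M = fd_module D A M'"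
  by (simp add: fd_module_def)

lemma fd_module_mono:
  assumes "fd_module D A' M" "A \<subseteq> A'"
  shows "fd_module D A M"
  using assms unfolding fd_module_def lin_on_def by (meson subsetD)

lemma submoduleD:
  assumes "submodule A M U"
  shows "module.subspace (scl M) U" "U \<subseteq> car M" "\<And>x u. x \<in> A \<Longrightarrow> u \<in> U \<Longrightarrow> act M x u \<in> U"
  using assms by (auto simp: submodule_def)

lemma submodule_car: "fd_module D A M \<Longrightarrow> submodule A M (car M)"
  using fd_moduleD(3,8)[of D A M] by (auto simp: submodule_def)

lemma submodule_zero:
  assumes "fd_module D A M"
  shows "submodule A M {0}"
proof -
  note M = fd_moduleD[OF assms]
  have "act M x 0 = 0" if "x \<in> A" for x using lin_on_zero[OF M(2,3) M(4)[OF that]] .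
  then show ?thesis unfolding submodule_def
    using subspaceD(1)[OF M(2,3)] fd_spaceD(3)[OF fd_space_singleton[OF M(2)]] by auto
qed

lemma submodule_fd_module:
  assumes "fd_module D A M" "submodule A M U"
  shows "fd_module D A (M\<lparr>car := U\<rparr>)"
proof -
  note M = fd_moduleD[OF assms(1)] and U = submoduleD[OF assms(2)]
  have "fd_space (scl M) U" by (rule fd_space_subspace[OF M(1) U(1,2)])
  then show ?thesis
    using assms(1) U unfolding fd_module_def fd_space_def lin_on_def by (auto simp: subset_iff)
qed

lemma homsD:
  assumes "f \<in> homs A M N"
  shows "lin_on (scl M) (car M) (scl N) (car N) f" "\<And>x v. x \<in> A \<Longrightarrow> v \<in> car M \<Longrightarrow> f (act M x v) = act N x (f v)"
    "\<And>v. v \<notin> car M \<Longrightarrow> f v = 0" "\<And>v. v \<in> car M \<Longrightarrow> f v \<in> car N"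
  using assms by (auto simp: homs_def lin_on_def)

lemma homs_zero: "fd_module D A M \<Longrightarrow> f \<in> homs A M N \<Longrightarrow> f 0 = 0"
  using lin_on_zero fd_moduleD(2,3) homsD(1) by metis

lemma homsI:
  assumes "lin_on (scl M) (car M) (scl N) (car N) f" "\<And>x v. x \<in> A \<Longrightarrow> v \<in> car M \<Longrightarrow> f (act M x v) = act N x (f v)"
    "\<And>v. v \<notin> car M \<Longrightarrow> f v = 0"
  shows "f \<in> homs A M N"
  using assms by (auto simp: homs_def)

text \<open>The cut-off outside of \<open>U\<close> respects the convention that homomorphisms
  vanish off their domain. \<open>A\<close> may be smaller than \<open>A'\<close>, so that
  homomorphisms over D restrict to homomorphisms over \<open>DG\<close> between graded
  pieces.\<close>

lemma homs_restrict:
  assumes M: "fd_module D A M" and f: "f \<in> homs A' M N" "A \<subseteq> A'" and U: "submodule A M U" and "f ` U \<subseteq> W"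
  shows "(\<lambda>v. if v \<in> U then f v else 0) \<in> homs A (M\<lparr>car := U\<rparr>) (N\<lparr>car := W\<rparr>)"
proof (rule homsI)
  note U = submoduleD[OF U] and M = fd_moduleD[OF M] and AA = subsetD[OF f(2)] and f = homsD[OF f(1)]
  show "lin_on (scl (M\<lparr>car := U\<rparr>)) (car (M\<lparr>car := U\<rparr>)) (scl (N\<lparr>car := W\<rparr>)) (car (N\<lparr>car := W\<rparr>))
      (\<lambda>v. if v \<in> U then f v else 0)"
    unfolding lin_on_def using assms(5) subspaceD[OF M(2) U(1)] lin_onD[OF f(1)] U(2)
    by (auto simp: image_subset_iff subset_iff)
  show "(if act (M\<lparr>car := U\<rparr>) x v \<in> U then f (act (M\<lparr>car := U\<rparr>) x v) else 0) =
      act (N\<lparr>car := W\<rparr>) x (if v \<in> U then f v else 0)" if "x \<in> A" "v \<in> car (M\<lparr>car := U\<rparr>)" for x v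
    using that U f(2)[OF AA] by auto
qed auto

lemma homs_comp:
  assumes "fd_module D A N" "f \<in> homs A M N" "g \<in> homs A N K"
  shows "(\<lambda>v. g (f v)) \<in> homs A M K"
proof (rule homsI)
  note f = homsD[OF assms(2)] and g = homsD[OF assms(3)]
  show "lin_on (scl M) (car M) (scl K) (car K) (\<lambda>v. g (f v))"
    using lin_on_comp[OF f(1) g(1)] f(4) by blast
qed (use homsD[OF assms(2)] homsD[OF assms(3)] homs_zero[OF assms(1,3)] in auto)

lemma homs_subspace:
  assumes "fd_module D A M" "fd_module D A N"
  shows "module.subspace (fscale (scl N)) (homs A M N)"
proof -
  note M = fd_moduleD[OF assms(1)] and N = fd_moduleD[OF assms(2)]
  interpret vector_space "scl N" by (rule N(2))
  show ?thesis
  proof (rule vs_subspaceI[OF vector_space_fscale[OF N(2)]])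
    show "0 \<in> homs A M N"
      using subspaceD[OF N(2,3)] lin_on_zero[OF N(2,3) N(4)] by (auto simp: homs_def lin_on_def)
    show "f + g \<in> homs A M N" if "f \<in> homs A M N" "g \<in> homs A M N" for f g
      using homsD[OF that(1)] homsD[OF that(2)] subspaceD(2)[OF N(2,3)] lin_onD(2)[OF N(4)]
      by (auto simp: homs_def lin_on_def scale_right_distrib)
    show "(\<lambda>v. scl N c (f v)) \<in> homs A M N" if "f \<in> homs A M N" for f c
      using homsD[OF that] subspaceD(3)[OF N(2,3)] lin_onD(3)[OF N(4)]
      by (auto simp: homs_def lin_on_def scale_right_distrib mult.commute)
  qed
qed

lemma homs_fd:
  assumes "fd_module D A M" "fd_module D A N"
  shows "fd_space (fscale (scl N)) (homs A M N)"
  by (rule fd_space_subspace[OF fd_space_lin_maps[OF fd_moduleD(1)[OF assms(1)] fd_moduleD(1)[OF assms(2)]]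
        homs_subspace[OF assms]]) (auto simp: homs_def)

lemma hom_kernel_submodule:
  assumes "fd_module D A M" "fd_module D A N" "f \<in> homs A M N"
  shows "submodule A M {v \<in> car M. f v = 0}"
  unfolding submodule_def
  using lin_on_kernel_subspace[OF fd_moduleD(2,3)[OF assms(1)] fd_moduleD(2)[OF assms(2)] homsD(1)[OF assms(3)]]
    homsD[OF assms(3)] fd_moduleD(8)[OF assms(1)] lin_on_zero[OF fd_moduleD(2,3,4)[OF assms(2)]] by auto

lemma hom_image_submodule:
  assumes "fd_module D A M" "fd_module D A N" "f \<in> homs A M N" "submodule A M U"
  shows "submodule A N (f ` U)"
  unfolding submodule_def
proof (intro conjI ballI)
  note U = submoduleD[OF assms(4)] and f = homsD[OF assms(3)]
  show "module.subspace (scl N) (f ` U)"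
    using lin_on_image_subspace[OF fd_moduleD(2,3)[OF assms(1)] fd_moduleD(2)[OF assms(2)] f(1) U(1,2)] .
  show "f ` U \<subseteq> car N" using U(2) f(4) by auto
  show "act N x u \<in> f ` U" if x: "x \<in> A" and u: "u \<in> f ` U" for x u
  proof -
    obtain w where w: "w \<in> U" "u = f w" using u by auto
    then have "act N x u = f (act M x w)" using f(2)[OF x] U(2) by auto
    then show ?thesis using U(3)[OF x w(1)] by auto
  qed
qed

lemma homs_factor:
  assumes M: "fd_module D A M" and g: "g \<in> homs A M N" "g ` car M = car N"
    and f: "f \<in> homs A M K" and ker: "\<And>v. v \<in> car M \<Longrightarrow> g v = 0 \<Longrightarrow> f v = 0"
    and N: "fd_module D A N"
  obtains h where "h \<in> homs A N K" "\<And>v. h (g v) = f v"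
proof -
  note M' = fd_moduleD[OF M] and g' = homsD[OF g(1)] and f' = homsD[OF f]
  obtain h where h: "lin_on (scl N) (car N) (scl K) (car K) h" "\<And>x. x \<in> car M \<Longrightarrow> h (g x) = f x"
    "\<And>y. y \<notin> car N \<Longrightarrow> h y = 0"
    using lin_on_factor[OF M'(2,3) g'(1) g(2) f'(1) ker] by blast
  have "h (act N x w) = act K x (h w)" if xw: "x \<in> A" "w \<in> car N" for x w
  proof -
    obtain v where v: "v \<in> car M" "w = g v" using xw(2) g(2) by auto
    have "h (act N x w) = h (g (act M x v))" using g'(2)[OF xw(1) v(1)] v(2) by simp
    also have "\<dots> = act K x (h w)" using h(2) v M'(8)[OF xw(1) v(1)] f'(2)[OF xw(1) v(1)] by simp
    finally show ?thesis .
  qed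
  then have "h \<in> homs A N K" using h by (intro homsI)
  moreover have "h (g v) = f v" for v
    using h(2) g'(3) f'(3) lin_on_zero[OF fd_moduleD(2,3)[OF N] h(1)] by (cases "v \<in> car M") auto
  ultimately show ?thesis using that by blast
qed

text \<open>A preimage under the injective \<open>f\<close> is unique, so linearity and equivariance
  of the lift are inherited from \<open>h\<close> and \<open>f\<close>.\<close>

lemma homs_lift_inj:
  assumes P: "fd_module D A P" and N': "fd_module D A N'" and f: "f \<in> homs A N' N" "inj_on f (car N')"
    and h: "h \<in> homs A P N" "h ` car P \<subseteq> f ` car N'"
  obtains h' where "h' \<in> homs A P N'" "\<And>v. f (h' v) = h v"
proof -
  note P' = fd_moduleD[OF P] and N = fd_moduleD[OF N'] and f' = homsD[OF f(1)] and h' = homsD[OF h(1)]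
  define k where "k v = (if v \<in> car P then inv_into (car N') f (h v) else 0)" for v
  have k: "k v \<in> car N'" "f (k v) = h v" if "v \<in> car P" for v
  proof -
    have "h v \<in> f ` car N'" using that h(2) by blast
    then show "k v \<in> car N'" "f (k v) = h v"
      unfolding k_def using that by (simp_all add: inv_into_into f_inv_into_f)
  qed
  have uniq: "k v = u" if "v \<in> car P" "u \<in> car N'" "f u = h v" for v u
    using k that inj_onD[OF f(2)] by auto
  have "k \<in> homs A P N'"
  proof (rule homsI)
    show "lin_on (scl P) (car P) (scl N') (car N') k"
      unfolding lin_on_def
    proof (intro conjI ballI allI)
      show "k (x + y) = k x + k y" if "x \<in> car P" "y \<in> car P" for x y
        using that by (intro uniq) (auto simp: k lin_onD(2)[OF f'(1)] lin_onD(2)[OF h'(1)] subspaceD(2)[OF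
            P'(2,3)] subspaceD(2)[OF N(2,3)])
      show "k (scl P c x) = scl N' c (k x)" if "x \<in> car P" for c x
        using that by (intro uniq) (auto simp: k lin_onD(3)[OF f'(1)] lin_onD(3)[OF h'(1)] subspaceD(3)[OF
            P'(2,3)] subspaceD(3)[OF N(2,3)])
    qed (use k in auto)
    show "k (act P x v) = act N' x (k v)" if "x \<in> A" "v \<in> car P" for x v
      using that by (intro uniq) (auto simp: k f'(2) h'(2) P'(8) N(8))
  qed (simp add: k_def)
  moreover have "f (k v) = h v" for v
  proof (cases "v \<in> car P")
    case False
    then have "k v = 0" by (simp add: k_def)
    then show ?thesis using h'(3)[OF False] lin_on_zero[OF N(2,3) f'(1)] by simp
  qed (rule k)
  ultimately show ?thesis using that by blast
qed

lemma homs_id: "(\<lambda>v. if v \<in> car M then v else 0) \<in> homs A M M" if "fd_module D A M"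
  using fd_moduleD[OF that] subspaceD[OF fd_moduleD(2,3)[OF that]] by (auto simp: homs_def lin_on_def)

lemma homs_inverse:
  assumes "fd_module D A M" "fd_module D A N" and f: "f \<in> homs A M N" "bij_betw f (car M) (car N)"
  obtains g where "g \<in> homs A N M" "\<And>v. v \<in> car M \<Longrightarrow> g (f v) = v" "\<And>w. w \<in> car N \<Longrightarrow> f (g w) = w"
    "bij_betw g (car N) (car M)"
proof -
  obtain g where g: "g \<in> homs A N M" "\<And>v. f (g v) = (if v \<in> car N then v else 0)"
    using homs_lift_inj[OF assms(2,1) f(1) _ homs_id[OF assms(2)]] f(2) by (auto simp: bij_betw_def)
  have "g (f v) = v" if "v \<in> car M" for v
    using that g(2)[of "f v"] homsD(4)[OF f(1) that] homsD(4)[OF g(1), of "f v"] f(2)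
    by (auto simp: bij_betw_def inj_on_def)
  moreover from this have "bij_betw g (car N) (car M)"
    using g homsD(4)[OF f(1)] homsD(4)[OF g(1)] by (intro bij_betwI[of _ _ _ f]) auto
  ultimately show ?thesis using that g by auto
qed

lemma iso_modules_sym:
  assumes "fd_module D A M" "fd_module D A N" "iso_modules A M N"
  shows "iso_modules A N M"
  using homs_inverse[OF assms(1,2)] assms(3) unfolding iso_modules_def by metis

lemma iso_modules_trans:
  assumes "fd_module D A N" "iso_modules A M N" "iso_modules A N K"
  shows "iso_modules A M K"
proof -
  obtain f g where "f \<in> homs A M N" "bij_betw f (car M) (car N)" "g \<in> homs A N K" "bij_betw g (car N) (car K)"
    using assms unfolding iso_modules_def by blast
  then show ?thesis unfolding iso_modules_def using homs_comp[OF assms(1)] bij_betw_trans[of f _ _ g]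
    by (metis comp_def bij_betw_cong)
qed

lemma iso_modules_refl: "fd_module D A M \<Longrightarrow> iso_modules A M M"
  unfolding iso_modules_def using homs_id
  by (intro bexI[of _ "\<lambda>v. if v \<in> car M then v else 0"]) (auto simp: bij_betw_def inj_on_def)

text \<open>The quotient is modelled on the image of a linear map with kernel \<open>U\<close>, to
  which the action descends. Besides quotients this gives, for \<open>U = {0}\<close>, a copy of any
  module in the type \<open>urep\<close>.\<close>

lemma exists_quotient:
  fixes M :: "('k::field, 'd::finite, 'm::ab_group_add, 'z) rep_scheme"
  assumes A: "subalgebra D A" and M: "fd_module D A M" and U: "submodule A M U"
  obtains Q :: "('k, 'd) urep" and \<pi> where "fd_module D A Q" "\<pi> \<in> homs A M Q" "\<pi> ` car M = car Q"
    "{v \<in> car M. \<pi> v = 0} = U"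
proof -
  note M' = fd_moduleD[OF M] and U' = submoduleD[OF U] and A = subalgebraD[OF A]
  obtain \<phi> where \<phi>: "lin_on (scl M) (car M) sstd UNIV \<phi>" "{v \<in> car M. \<phi> v = 0} = U"
    using exists_linear_with_kernel[OF M'(1) U'(1,2)] by blast
  have "\<exists>h. \<forall>v\<in>car M. h (\<phi> v) = \<phi> (act M x v)" if x: "x \<in> A" for x
  proof -
    have "\<phi> (act M x v) = 0" if v: "v \<in> car M" "\<phi> v = 0" for v
    proof -
      have "v \<in> U" using v \<phi>(2) by blast
      then have "act M x v \<in> U" using U'(3) x by blast
      then show ?thesis using \<phi>(2) by blast
    qed
    moreover have "lin_on (scl M) (car M) sstd UNIV (\<lambda>v. \<phi> (act M x v))"
      using lin_on_comp[OF M'(4)[OF x] \<phi>(1)] M'(8)[OF x] by blast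
    ultimately obtain h where "\<And>v. v \<in> car M \<Longrightarrow> h (\<phi> v) = \<phi> (act M x v)"
      using lin_on_factor[OF M'(2,3) lin_on_mono[OF \<phi>(1) subset_refl subset_refl] refl] by metis
    then show ?thesis by blast
  qed
  then obtain ac where ac: "\<And>x v. x \<in> A \<Longrightarrow> v \<in> car M \<Longrightarrow> ac x (\<phi> v) = \<phi> (act M x v)" by metis
  define Q :: "('k, 'd) urep" where "Q = \<lparr>scl = sstd, car = \<phi> ` car M, act = ac\<rparr>"
  define \<pi> where "\<pi> v = (if v \<in> car M then \<phi> v else 0)" for v
  have fdQ: "fd_space sstd (\<phi> ` car M)" by (rule rank_nullity(1)[OF M'(1) vector_space_sstd \<phi>(1)])
  have "fd_module D A Q"
    unfolding fd_module_def
  proof (intro conjI ballI)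
    note sub = subspaceD[OF M'(2,3)]
    show "vector_space (scl Q)" "module.subspace (scl Q) (car Q)" "\<exists>B. finite B \<and> module.span (scl Q) B = car Q"
      using fdQ by (auto simp: Q_def fd_space_def)
    show "lin_on (scl Q) (car Q) (scl Q) (car Q) (act Q x)" if x: "x \<in> A" for x
      unfolding lin_on_def Q_def
    proof (intro conjI ballI allI; clarsimp)
      fix v assume v: "v \<in> car M"
      show "ac x (\<phi> v) \<in> \<phi> ` car M" using ac[OF x v] M'(8)[OF x v] by simp
      show "ac x (sstd c (\<phi> v)) = sstd c (ac x (\<phi> v))" for c
        using ac[OF x sub(3)[OF v, of c]] ac[OF x v] lin_onD(3)[OF \<phi>(1) v] lin_onD(3)[OF M'(4)[OF x] v]
          lin_onD(3)[OF \<phi>(1) M'(8)[OF x v]] by simp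
      show "ac x (\<phi> v + \<phi> u) = ac x (\<phi> v) + ac x (\<phi> u)" if u: "u \<in> car M" for u
        using ac[OF x sub(2)[OF v u]] ac[OF x v] ac[OF x u] lin_onD(2)[OF \<phi>(1) v u] lin_onD(2)[OF M'(4)[OF x] v u]
          lin_onD(2)[OF \<phi>(1) M'(8)[OF x v] M'(8)[OF x u]] by simp
    qed
    fix w assume "w \<in> car Q"
    then obtain v where v: "v \<in> car M" "w = \<phi> v" by (auto simp: Q_def)
    have aw: "act Q x w = \<phi> (act M x v)" if "x \<in> A" for x using ac[OF that v(1)] v by (simp add: Q_def)
    note lv = lin_onD[OF M'(5)[OF v(1)]]
    show "lin_on (*s) A (scl Q) (car Q) (\<lambda>x. act Q x w)"
      unfolding lin_on_def
    proof (intro conjI ballI allI)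
      fix x assume x: "x \<in> A"
      show "act Q x w \<in> car Q" using aw[OF x] M'(8)[OF x v(1)] by (simp add: Q_def)
      show "act Q (x + y) w = act Q x w + act Q y w" if y: "y \<in> A" for y
        using aw[OF x] aw[OF y] aw[OF A(3)[OF x y]] lv(2)[OF x y] lin_onD(2)[OF \<phi>(1) lv(1)[OF x] lv(1)[OF y]] by simp
      show "act Q (c *s x) w = scl Q c (act Q x w)" for c
        using aw[OF x] aw[OF A(4)[OF x]] lv(3)[OF x] lin_onD(3)[OF \<phi>(1) lv(1)[OF x]] by (simp add: Q_def)
    qed
    show "act Q (one D) w = w" using aw[OF A(1)] M'(6)[OF v(1)] v(2) by simp
    show "act Q (mul D x y) w = act Q x (act Q y w)" if "x \<in> A" "y \<in> A" for x y
      using aw[OF A(2)[OF that]] aw[OF that(2)] M'(7)[OF that v(1)] ac[OF that(1) M'(8)[OF that(2) v(1)]]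
      by (simp add: Q_def)
  qed
  moreover have "\<pi> \<in> homs A M Q"
    using lin_onD[OF \<phi>(1)] ac M'(8) subspaceD[OF M'(2,3)] by (auto simp: homs_def \<pi>_def Q_def lin_on_def)
  moreover have "\<pi> ` car M = car Q" by (auto simp: \<pi>_def Q_def)
  moreover have "{v \<in> car M. \<pi> v = 0} = U" using \<phi>(2) by (auto simp: \<pi>_def)
  ultimately show ?thesis using that by blast
qed

lemma decomposes_sum:
  assumes "decomposes C x f" "finite I" "{i. f i \<noteq> 0} \<subseteq> I"
  shows "x = sum f I"
  using assms unfolding decomposes_def by (metis (mono_tags, lifting) mem_Collect_eq DiffE sum.mono_neutral_left)

lemma decomposesI:
  assumes "finite I" "\<And>i. f i \<in> C i" "\<And>i. i \<notin> I \<Longrightarrow> f i = 0" "x = sum f I"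
  shows "decomposes C x f"
proof -
  have "{i. f i \<noteq> 0} \<subseteq> I" using assms(3) by auto
  moreover from this have "sum f I = (\<Sum>i | f i \<noteq> 0. f i)"
    using assms(1) by (intro sum.mono_neutral_right) auto
  ultimately show ?thesis unfolding decomposes_def using assms finite_subset by auto
qed

text \<open>The difference of two decompositions is a decomposition of zero, so uniqueness has to be
  checked for zero only.\<close>

lemma direct_sumI:
  assumes "vector_space s" "\<And>i. module.subspace s (C i)" "\<And>i. C i \<subseteq> S"
    and ex: "\<And>x. x \<in> S \<Longrightarrow> \<exists>I f. finite I \<and> (\<forall>i. f i \<in> C i) \<and> x = sum f I"
    and un: "\<And>I f. finite I \<Longrightarrow> (\<And>i. f i \<in> C i) \<Longrightarrow> sum f I = 0 \<Longrightarrow> (\<And>i. i \<in> I \<Longrightarrow> f i = 0)"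
  shows "direct_sum s S C"
  unfolding direct_sum_def
proof (intro conjI allI ballI)
  note sub = subspaceD[OF assms(1,2)]
  fix x assume "x \<in> S"
  then obtain I f where If: "finite I" "\<And>i. f i \<in> C i" "x = sum f I" using ex by blast
  show "\<exists>!f. decomposes C x f"
  proof (rule ex1I)
    show "decomposes C x (\<lambda>i. if i \<in> I then f i else 0)"
      using If sub(1) by (intro decomposesI[of I]) auto
  next
    fix g assume g: "decomposes C x g"
    define J where "J = I \<union> {i. g i \<noteq> 0}"
    define h where "h i = (if i \<in> I then f i else 0) - g i" for i
    have J: "finite J" using If g by (auto simp: J_def decomposes_def)
    have "sum h J = sum (\<lambda>i. if i \<in> I then f i else 0) J - sum g J" by (simp add: h_def sum_subtractf)
    also have "sum (\<lambda>i. if i \<in> I then f i else 0) J = sum f I"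
      using J by (intro sum.mono_neutral_cong_right) (auto simp: J_def)
    also have "sum g J = x" using decomposes_sum[OF g J] by (auto simp: J_def)
    finally have "sum h J = 0" using If(3) by simp
    moreover have "h i \<in> C i" for i
      using If(2)[of i] g sub(4)[of "f i" i "g i"] sub(5)[of "g i" i] by (auto simp: h_def decomposes_def)
    ultimately have "\<And>i. i \<in> J \<Longrightarrow> h i = 0" using un J by blast
    moreover have "h i = 0" if "i \<notin> J" for i using that by (auto simp: h_def J_def)
    ultimately have "h i = 0" for i by blast
    then show "g = (\<lambda>i. if i \<in> I then f i else 0)" by (auto simp: h_def fun_eq_iff)
  qed
qed (use assms in auto)

section \<open>Graded modules\<close>

locale graded_space =
  fixes s :: "'k::field \<Rightarrow> 'm::ab_group_add \<Rightarrow> 'm" and S :: "'m set" and C :: "'i \<Rightarrow> 'm set"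
  assumes fd: "fd_space s S" and ds: "direct_sum s S C"
begin

lemma vs: "vector_space s" and sub: "module.subspace s S"
  using fd_spaceD[OF fd] by auto

lemma C: "module.subspace s (C i)" "C i \<subseteq> S"
  using ds by (auto simp: direct_sum_def)

lemma part_decomposes: "x \<in> S \<Longrightarrow> decomposes C x (\<lambda>i. part C i x)"
  using theI'[of "decomposes C x"] ds unfolding part_def direct_sum_def by auto

lemma part_in: "x \<in> S \<Longrightarrow> part C i x \<in> C i"
  using part_decomposes by (auto simp: decomposes_def)

lemma part_eqI:
  assumes "finite I" "\<And>i. i \<in> I \<Longrightarrow> f i \<in> C i" "x = sum f I"
  shows "part C i x = (if i \<in> I then f i else 0)"
proof -
  have "x \<in> S" unfolding assms(3) using assms(2) C(2) by (intro subspaceD(6)[OF vs sub]) auto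
  moreover have "decomposes C x (\<lambda>i. if i \<in> I then f i else 0)"
    using assms subspaceD(1)[OF vs C(1)] by (intro decomposesI[of I]) auto
  ultimately have "(\<lambda>i. part C i x) = (\<lambda>i. if i \<in> I then f i else 0)"
    using part_decomposes[of x] ds unfolding direct_sum_def by blast
  then show ?thesis by meson
qed

lemma part_homog: "x \<in> C j \<Longrightarrow> part C i x = (if i = j then x else 0)"
  using part_eqI[of "{j}" "\<lambda>_. x"] by simp

text \<open>A finite spanning set has nonzero parts at finitely many indices, collected in
  \<open>I\<close>. An element of any other \<open>C j\<close> is a sum of elements of components
  with index in \<open>I\<close>, so its part at \<open>j\<close>, which is the element itself,
  vanishes.\<close>

lemma fin_supp: "finite {i. C i \<noteq> {0}}"
proof -
  obtain B where B: "finite B" "B \<subseteq> S" "module.span s B = S" using fd_space_basis[OF fd] by metis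
  interpret vector_space s by (rule vs)
  define I where "I = (\<Union>b\<in>B. {i. part C i b \<noteq> 0})"
  have I: "finite I" unfolding I_def using B part_decomposes by (auto simp: decomposes_def)
  have "\<exists>f. (\<forall>i. f i \<in> C i) \<and> x = sum f I" if "x \<in> span B" for x
    using that
  proof (induction rule: span_induct_alt)
    case base
    then show ?case using subspaceD(1)[OF vs C(1)] by (intro exI[of _ "\<lambda>_. 0"]) auto
  next
    case (step c b y)
    then obtain f where f: "\<And>i. f i \<in> C i" "y = sum f I" by blast
    have b: "b \<in> S" using step B by auto
    have "{i. part C i b \<noteq> 0} \<subseteq> I" using step by (auto simp: I_def)
    then have "b = (\<Sum>i\<in>I. part C i b)" using decomposes_sum[OF part_decomposes[OF b] I] by auto
    then have "s c b = (\<Sum>i\<in>I. s c (part C i b))" by (metis scale_sum_right)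
    then have "s c b + y = (\<Sum>i\<in>I. s c (part C i b) + f i)" using f by (simp add: sum.distrib)
    moreover have "s c (part C i b) + f i \<in> C i" for i
      using f(1) part_in[OF b] subspaceD(2,3)[OF vs C(1)] by blast
    ultimately show ?case by (intro exI[of _ "\<lambda>i. s c (part C i b) + f i"]) simp
  qed
  note * = this
  have "C j = {0}" if j: "j \<notin> I" for j
  proof -
    have "x = 0" if x: "x \<in> C j" for x
    proof -
      have "x \<in> span B" using B x C(2) by auto
      then obtain f where f: "\<And>i. f i \<in> C i" "x = sum f I" using * by blast
      have "part C j x = 0" using part_eqI[OF I _ f(2), of j] f(1) j by simp
      then show ?thesis using part_homog[OF x, of j] by simp
    qed
    then show ?thesis using subspaceD(1)[OF vs C(1)] by blast
  qed
  then have "{i. C i \<noteq> {0}} \<subseteq> I" by blast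
  then show ?thesis using I finite_subset by blast
qed

lemma sum_parts:
  assumes "x \<in> S" "finite I" "{i. C i \<noteq> {0}} \<subseteq> I"
  shows "x = (\<Sum>i\<in>I. part C i x)"
proof (rule decomposes_sum[OF part_decomposes[OF assms(1)] assms(2)])
  show "{i. part C i x \<noteq> 0} \<subseteq> I" using part_in[OF assms(1)] assms(3) by auto
qed

lemma part_lin: "lin_on s S s (C i) (part C i)"
proof -
  interpret vector_space s by (rule vs)
  define I where "I = {i. C i \<noteq> {0}}"
  have I: "finite I" unfolding I_def by (rule fin_supp)
  have sp: "x = (\<Sum>i\<in>I. part C i x)" if "x \<in> S" for x using sum_parts[OF that I] by (simp add: I_def)
  have out: "part C i x = 0" if "x \<in> S" "i \<notin> I" for x i using part_in[OF that(1), of i] that(2) by (auto simp: I_def)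
  show ?thesis
    unfolding lin_on_def
  proof (intro conjI ballI allI part_in)
    fix x assume x: "x \<in> S"
    have "s c x = (\<Sum>i\<in>I. s c (part C i x))" for c using sp[OF x] by (metis scale_sum_right)
    from part_eqI[OF I _ this, of _ i]
    show "part C i (s c x) = s c (part C i x)" for c
      using x part_in subspaceD(3)[OF vs C(1)] out by auto
    fix y assume y: "y \<in> S"
    have "x + y = (\<Sum>i\<in>I. part C i x + part C i y)" using sp[OF x] sp[OF y] by (simp add: sum.distrib)
    from part_eqI[OF I _ this, of i]
    show "part C i (x + y) = part C i x + part C i y"
      using x y part_in subspaceD(2)[OF vs C(1)] out by auto
  qed
qed

lemma parts_eq_0: "x \<in> S \<Longrightarrow> (\<And>i. part C i x = 0) \<Longrightarrow> x = 0"
  using sum_parts[OF _ fin_supp subset_refl, of x] by simp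

lemma lin_eqI:
  assumes "lin_on s S t R f" "lin_on s S t R g" "\<And>i x. x \<in> C i \<Longrightarrow> f x = g x" "x \<in> S"
  shows "f x = g x"
proof -
  have "f x = (\<Sum>i | C i \<noteq> {0}. f (part C i x))"
    using part_in[OF assms(4)] C(2) by (subst sum_parts[OF assms(4) fin_supp subset_refl], subst lin_on_sum[OF
        vs sub assms(1)]) auto
  also have "\<dots> = (\<Sum>i | C i \<noteq> {0}. g (part C i x))"
    using part_in[OF assms(4)] assms(3) by (intro sum.cong) auto
  also have "\<dots> = g x"
    using part_in[OF assms(4)] C(2) by (subst (2) sum_parts[OF assms(4) fin_supp subset_refl], subst
        lin_on_sum[OF vs sub assms(2)]) auto
  finally show ?thesis .
qed

end

lemma graded_module_fd: "graded_module T N \<Longrightarrow> fd_module (alg T) UNIV N"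
  by (simp add: graded_module_def)

lemma graded_module_space: "graded_module T N \<Longrightarrow> graded_space (scl N) (car N) (piece N)"
  unfolding graded_module_def graded_space_def using fd_moduleD(1) by blast

lemma graded_module_piece:
  assumes "graded_module T N"
  shows "module.subspace (scl N) (piece N i)" "piece N i \<subseteq> car N"
  using graded_space.C[OF graded_module_space[OF assms]] by auto

lemma graded_module_act: "graded_module T N \<Longrightarrow> x \<in> Dgr T n \<Longrightarrow> v \<in> piece N i \<Longrightarrow> act N x v \<in> piece N (n + i)"
  by (simp add: graded_module_def)

lemma graded_module_act_part:
  assumes N: "graded_module T N" and x: "x \<in> Dgr T n" and v: "v \<in> car N"
  shows "part (piece N) (n + i) (act N x v) = act N x (part (piece N) i v)"
proof -
  interpret graded_space "scl N" "car N" "piece N" by (rule graded_module_space[OF N])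
  note M = fd_moduleD[OF graded_module_fd[OF N]]
  have ax: "lin_on (scl N) (car N) (scl N) (car N) (act N x)" using M(4) by simp
  have pl: "lin_on (scl N) (car N) (scl N) (car N) (part (piece N) j)" for j
    using lin_on_mono[OF part_lin subset_refl, of j] part_in C(2) by blast
  have "lin_on (scl N) (car N) (scl N) (car N) (\<lambda>v. part (piece N) (n + i) (act N x v))"
    using lin_on_comp[OF ax pl] M(8) by blast
  moreover have "lin_on (scl N) (car N) (scl N) (car N) (\<lambda>v. act N x (part (piece N) i v))"
    using lin_on_comp[OF pl ax] part_in C(2) by blast
  ultimately show ?thesis
  proof (rule lin_eqI[OF _ _ _ v])
    fix j u assume u: "u \<in> piece N j"
    have "act N x 0 = 0" using lin_on_zero[OF M(2,3) ax] .
    then show "part (piece N) (n + i) (act N x u) = act N x (part (piece N) i u)"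
      using part_homog[OF u] part_homog[OF graded_module_act[OF N x u]] by simp
  qed
qed

lemma ghomsD:
  assumes "f \<in> ghoms M N"
  shows "f \<in> homs UNIV M N" "\<And>v i. v \<in> piece M i \<Longrightarrow> f v \<in> piece N i"
  using assms by (auto simp: ghoms_def)

lemma ghoms_part:
  assumes M: "graded_module T M" and N: "graded_module T N" and f: "f \<in> ghoms M N" and v: "v \<in> car M"
  shows "part (piece N) i (f v) = f (part (piece M) i v)"
proof -
  interpret M: graded_space "scl M" "car M" "piece M" by (rule graded_module_space[OF M])
  interpret N: graded_space "scl N" "car N" "piece N" by (rule graded_module_space[OF N])
  note f' = homsD[OF ghomsD(1)[OF f]]
  have "f v = (\<Sum>i | piece M i \<noteq> {0}. f (part (piece M) i v))"
    using M.part_in[OF v] M.C(2)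
    by (subst M.sum_parts[OF v M.fin_supp subset_refl], subst lin_on_sum[OF M.vs M.sub f'(1)]) auto
  from N.part_eqI[OF M.fin_supp _ this, of i]
  have "part (piece N) i (f v) = (if piece M i \<noteq> {0} then f (part (piece M) i v) else 0)"
    using M.part_in[OF v] ghomsD(2)[OF f] by auto
  then show ?thesis using M.part_in[OF v, of i] lin_on_zero[OF M.vs M.sub f'(1)] by auto
qed

lemma shift_simps [simp]: "scl (shift l N) = scl N" "car (shift l N) = car N" "act (shift l N) = act N"
  "piece (shift l N) = (\<lambda>i. piece N (i - l))"
  by (simp_all add: shift_def)

lemma homs_shift [simp]: "homs A (shift l M) N = homs A M N" "homs A M (shift l N) = homs A M N"
  by (simp_all add: homs_def)

lemma shift_shift [simp]: "shift k (shift l N) = shift (k + l) N"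
  by (simp add: shift_def algebra_simps)

lemma shift_0 [simp]: "shift 0 N = N"
  by (simp add: shift_def)

lemma graded_module_shift:
  assumes "graded_module T N"
  shows "graded_module T (shift l N)"
  unfolding graded_module_def
proof (intro conjI allI ballI)
  interpret graded_space "scl N" "car N" "piece N" by (rule graded_module_space[OF assms])
  show "fd_module (alg T) UNIV (shift l N)"
    using graded_module_fd[OF assms] fd_module_cong[of "shift l N" N] by simp
  show "direct_sum (scl (shift l N)) (car (shift l N)) (piece (shift l N))"
  proof (simp, rule direct_sumI[OF vs C])
    fix x assume "x \<in> car N"
    then show "\<exists>I f. finite I \<and> (\<forall>i. f i \<in> piece N (i - l)) \<and> x = sum f I"
      using sum_parts[OF _ fin_supp subset_refl] part_in fin_supp
      by (intro exI[of _ "(\<lambda>i. i + l) ` {i. piece N i \<noteq> {0}}"] exI[of _ "\<lambda>i. part (piece N) (i - l) x"])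
        (auto simp: sum.reindex)
  next
    fix I :: "int set" and f i assume If: "finite I" "\<And>i. f i \<in> piece N (i - l)" "sum f I = 0" "i \<in> I"
    have "0 = sum (\<lambda>i. f (i + l)) ((\<lambda>i. i - l) ` I)" using If by (subst sum.reindex) (auto simp: inj_on_def)
    from part_eqI[OF _ _ this, of "i - l"] show "f i = 0"
      using If(1,2,4) If(2)[of "_ + l"] lin_on_zero[OF vs sub part_lin] by (auto simp: image_iff)
  qed
  show "act (shift l N) x v \<in> piece (shift l N) (n + i)" if "x \<in> Dgr T n" "v \<in> piece (shift l N) i" for n i x v
    using graded_module_act[OF assms that(1), of v "i - l"] that(2) by (simp add: add_diff_eq)
qed

lemma ghoms_comp:
  assumes "fd_module D UNIV N" "f \<in> ghoms M N" "g \<in> ghoms N K"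
  shows "(\<lambda>v. g (f v)) \<in> ghoms M K"
  using homs_comp[OF assms(1) ghomsD(1)[OF assms(2)] ghomsD(1)[OF assms(3)]] ghomsD(2)[OF assms(2)]
      ghomsD(2)[OF assms(3)]
  by (auto simp: ghoms_def)

lemma ghoms_shift: "f \<in> ghoms (shift l M) (shift l N) \<longleftrightarrow> f \<in> ghoms M N"
proof -
  have "(\<forall>i. f ` piece M (i - l) \<subseteq> piece N (i - l)) \<longleftrightarrow> (\<forall>i. f ` piece M i \<subseteq> piece N i)"
    by (metis add_diff_cancel_right')
  then show ?thesis by (simp add: ghoms_def)
qed

text \<open>Closure under the projections to the pieces says that \<open>U\<close> is the direct sum
  of its intersections with them; these intersections are the pieces of
  \<open>gsubmod N U\<close>.\<close>

definition gsub :: "('k::field, 'd::finite, 'm::ab_group_add, 'z) grep_scheme \<Rightarrow> 'm set \<Rightarrow> bool"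
  where "gsub N U \<longleftrightarrow> submodule UNIV N U \<and> (\<forall>u\<in>U. \<forall>i. part (piece N) i u \<in> U)"

abbreviation gsubmod :: "('k::field, 'd::finite, 'm::ab_group_add, 'z) grep_scheme \<Rightarrow> 'm set \<Rightarrow> ('k, 'd, 'm, 'z)
    grep_scheme"
  where "gsubmod N U \<equiv> N\<lparr>car := U, piece := \<lambda>i. piece N i \<inter> U\<rparr>"

lemma graded_module_gsubmod:
  assumes N: "graded_module T N" and U: "gsub N U"
  shows "graded_module T (gsubmod N U)"
  unfolding graded_module_def
proof (intro conjI allI ballI)
  interpret graded_space "scl N" "car N" "piece N" by (rule graded_module_space[OF N])
  have U': "submodule UNIV N U" "\<And>u i. u \<in> U \<Longrightarrow> part (piece N) i u \<in> U" using U by (auto simp: gsub_def)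
  note sU = submoduleD[OF U'(1)]
  show "fd_module (alg T) UNIV (gsubmod N U)"
    using submodule_fd_module[OF graded_module_fd[OF N] U'(1)] fd_module_cong[of "gsubmod N U" "N\<lparr>car := U\<rparr>"] by simp
  have "direct_sum (scl N) U (\<lambda>i. piece N i \<inter> U)"
  proof (rule direct_sumI[OF vs])
    show "module.subspace (scl N) (piece N i \<inter> U)" for i
      using C(1) sU(1) vs by (simp add: module.subspace_inter module_iff_vector_space)
    fix x assume "x \<in> U"
    then show "\<exists>I f. finite I \<and> (\<forall>i. f i \<in> piece N i \<inter> U) \<and> x = sum f I"
      using sum_parts[OF _ fin_supp subset_refl, of x] part_in[of x] fin_supp U'(2)[of x] sU(2)
      by (intro exI[of _ "{i. piece N i \<noteq> {0}}"] exI[of _ "\<lambda>i. part (piece N) i x"]) auto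
  next
    fix I f i assume If: "finite I" "\<And>i. f i \<in> piece N i \<inter> U" "sum f I = 0" "i \<in> I"
    show "f i = 0"
      using part_eqI[OF If(1) _ If(3)[symmetric], of i] If lin_on_zero[OF vs sub part_lin] by auto
  qed auto
  then show "direct_sum (scl (gsubmod N U)) (car (gsubmod N U)) (piece (gsubmod N U))" by simp
  show "act (gsubmod N U) x v \<in> piece (gsubmod N U) (n + i)" if "x \<in> Dgr T n" "v \<in> piece (gsubmod N U) i" for n i x v
    using that graded_module_act[OF N] sU(3) by auto
qed

lemma gsub_kernel:
  assumes "graded_module T M" "graded_module T N" "f \<in> ghoms M N"
  shows "gsub M {v \<in> car M. f v = 0}"
proof -
  interpret M: graded_space "scl M" "car M" "piece M" by (rule graded_module_space[OF assms(1)])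
  interpret N: graded_space "scl N" "car N" "piece N" by (rule graded_module_space[OF assms(2)])
  have "f (part (piece M) i u) = 0" if "u \<in> car M" "f u = 0" for u i
    using ghoms_part[OF assms that(1), of i] that(2) lin_on_zero[OF N.vs N.sub N.part_lin] by simp
  then show ?thesis
    unfolding gsub_def using hom_kernel_submodule[OF graded_module_fd[OF assms(1)] graded_module_fd[OF assms(2)]
        ghomsD(1)[OF assms(3)]]
      M.part_in M.C(2) by blast
qed

lemma gsub_image:
  assumes "graded_module T M" "graded_module T N" "f \<in> ghoms M N" "gsub M U"
  shows "gsub N (f ` U)"
proof -
  have U: "submodule UNIV M U" "\<And>u i. u \<in> U \<Longrightarrow> part (piece M) i u \<in> U" using assms(4) by (auto simp: gsub_def)
  have "part (piece N) i (f u) \<in> f ` U" if "u \<in> U" for u i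
    using ghoms_part[OF assms(1-3), of u i] U(2)[OF that, of i] that submoduleD(2)[OF U(1)] by auto
  then show ?thesis
    unfolding gsub_def using hom_image_submodule[OF graded_module_fd[OF assms(1)] graded_module_fd[OF assms(2)]
        ghomsD(1)[OF assms(3)] U(1)]
    by blast
qed

lemma gsub_car: "graded_module T M \<Longrightarrow> gsub M (car M)"
  using graded_space.part_in[OF graded_module_space] graded_module_piece(2) submodule_car[OF graded_module_fd]
  unfolding gsub_def by blast

lemma gsub_zero: "graded_module T M \<Longrightarrow> gsub M {0}"
  using lin_on_zero[OF graded_space.vs graded_space.sub graded_space.part_lin, OF graded_module_space
      graded_module_space graded_module_space]
    submodule_zero[OF graded_module_fd]
  unfolding gsub_def by blast

lemma subalgebra_UNIV: "subalgebra D UNIV"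
  by (simp add: subalgebra_def)

lemma exists_graded_quotient:
  fixes N :: "('k::field, 'd::finite, 'm::ab_group_add, 'z) grep_scheme"
  assumes N: "graded_module T N" and U: "gsub N U"
  obtains Q :: "('k, 'd) ugrep" and \<pi> where "graded_module T Q" "\<pi> \<in> ghoms N Q" "\<pi> ` car N = car Q"
    "{v \<in> car N. \<pi> v = 0} = U"
proof -
  interpret graded_space "scl N" "car N" "piece N" by (rule graded_module_space[OF N])
  have U': "submodule UNIV N U" "\<And>u i. u \<in> U \<Longrightarrow> part (piece N) i u \<in> U" using U by (auto simp: gsub_def)
  obtain R :: "('k, 'd) urep" and \<pi> where R: "fd_module (alg T) UNIV R" "\<pi> \<in> homs UNIV N R" "\<pi> ` car N = car R"
    "{v \<in> car N. \<pi> v = 0} = U"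
    using exists_quotient[OF subalgebra_UNIV graded_module_fd[OF N] U'(1)] by blast
  note \<pi> = homsD[OF R(2)] and R' = fd_moduleD[OF R(1)]
  define Q :: "('k, 'd) ugrep" where "Q = \<lparr>scl = scl R, car = car R, act = act R, piece = \<lambda>i. \<pi> ` piece N i\<rparr>"
  have Q: "scl Q = scl R" "car Q = car R" "act Q = act R" "piece Q = (\<lambda>i. \<pi> ` piece N i)" by (simp_all add: Q_def)
  have "graded_module T Q"
    unfolding graded_module_def
  proof (intro conjI allI ballI)
    show "fd_module (alg T) UNIV Q" using R(1) fd_module_cong[of Q R] Q by simp
    have "direct_sum (scl R) (car R) (\<lambda>i. \<pi> ` piece N i)"
    proof (rule direct_sumI[OF R'(2)])
      show "module.subspace (scl R) (\<pi> ` piece N i)" for i by (rule lin_on_image_subspace[OF vs sub R'(2) \<pi>(1) C])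
      show "\<pi> ` piece N i \<subseteq> car R" for i using \<pi>(4) C(2) by blast
    next
      fix w assume "w \<in> car R"
      then obtain v where v: "v \<in> car N" "w = \<pi> v" using R(3) by auto
      have "\<pi> v = (\<Sum>i | piece N i \<noteq> {0}. \<pi> (part (piece N) i v))"
        using part_in[OF v(1)] C(2)
        by (subst sum_parts[OF v(1) fin_supp subset_refl], subst lin_on_sum[OF vs sub \<pi>(1)]) auto
      then show "\<exists>I f. finite I \<and> (\<forall>i. f i \<in> \<pi> ` piece N i) \<and> w = sum f I"
        using v fin_supp part_in[OF v(1)]
        by (intro exI[of _ "{i. piece N i \<noteq> {0}}"] exI[of _ "\<lambda>i. \<pi> (part (piece N) i v)"]) auto
    next
      fix I f i assume If: "finite I" "\<And>i. f i \<in> \<pi> ` piece N i" "sum f I = 0" "i \<in> I"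
      have "\<forall>i. \<exists>u. u \<in> piece N i \<and> f i = \<pi> u" using If(2) by blast
      then obtain u where u: "\<And>i. u i \<in> piece N i" "\<And>i. f i = \<pi> (u i)" by metis
      have uI: "sum u I \<in> car N" using u(1) C(2) by (intro subspaceD(6)[OF vs sub]) auto
      have "\<pi> (sum u I) = 0" using If(3) u C(2) by (subst lin_on_sum[OF vs sub \<pi>(1)]) auto
      \<comment> \<open>Directness of the sum of the images uses that \<open>U\<close> is graded: if
        a sum of homogeneous elements lies in \<open>U\<close>, so does each summand.\<close>
      then have "sum u I \<in> U" using R(4) uI by blast
      then have "part (piece N) i (sum u I) \<in> U" by (rule U'(2))
      then have "u i \<in> U" using part_eqI[OF If(1) _ refl, of u i] u(1) If(4) by simp
      then show "f i = 0" using R(4) u(2) by auto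
    qed
    then show "direct_sum (scl Q) (car Q) (piece Q)" using Q by simp
    show "act Q x w \<in> piece Q (n + i)" if "x \<in> Dgr T n" "w \<in> piece Q i" for n i x w
    proof -
      have "w \<in> \<pi> ` piece N i" using that(2) Q by simp
      then obtain v where v: "v \<in> piece N i" "w = \<pi> v" by blast
      then have "act Q x w = \<pi> (act N x v)" using \<pi>(2)[OF UNIV_I subsetD[OF C(2) v(1)]] Q by simp
      then show ?thesis using graded_module_act[OF N \<open>x \<in> Dgr T n\<close> v(1)] Q by auto
    qed
  qed
  moreover have "\<pi> \<in> ghoms N Q" using R(2) Q by (auto simp: ghoms_def homs_def)
  ultimately show ?thesis using that R(3,4) Q by auto
qed

section \<open>Homogeneous components of homomorphisms\<close>

definition hcomp :: "int \<Rightarrow> ('k::field, 'd::finite, 'm::ab_group_add, 'y) grep_scheme \<Rightarrow>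
    ('k, 'd, 'n::ab_group_add, 'z) grep_scheme \<Rightarrow> ('m \<Rightarrow> 'n) \<Rightarrow> 'm \<Rightarrow> 'n"
  where "hcomp k M N h v =
    (if v \<in> car M then \<Sum>i | piece M i \<noteq> {0}. part (piece N) (i + k) (h (part (piece M) i v)) else 0)"

lemma hcomp_homog:
  assumes M: "graded_module T M" and N: "graded_module T N" and h: "h \<in> homs UNIV M N" and v: "v \<in> piece M i"
  shows "hcomp k M N h v = part (piece N) (i + k) (h v)"
proof -
  interpret M: graded_space "scl M" "car M" "piece M" by (rule graded_module_space[OF M])
  interpret N: graded_space "scl N" "car N" "piece N" by (rule graded_module_space[OF N])
  have z: "part (piece N) j (h 0) = 0" for j
    using homs_zero[OF graded_module_fd[OF M] h] lin_on_zero[OF N.vs N.sub N.part_lin] by simp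
  have vM: "v \<in> car M" using v M.C(2) by blast
  have "hcomp k M N h v = (\<Sum>j | piece M j \<noteq> {0}. part (piece N) (j + k) (h (if j = i then v else 0)))"
    using vM by (simp add: hcomp_def M.part_homog[OF v])
  also have "\<dots> = (\<Sum>j | piece M j \<noteq> {0}. if j = i then part (piece N) (i + k) (h v) else 0)"
    using z by (intro sum.cong) auto
  also have "\<dots> = part (piece N) (i + k) (h v)"
    using M.fin_supp v z by (cases "piece M i = {0}") auto
  finally show ?thesis .
qed

lemma hcomp_lin:
  assumes M: "graded_module T M" and N: "graded_module T N" and h: "h \<in> homs UNIV M N"
  shows "lin_on (scl M) (car M) (scl N) (car N) (hcomp k M N h)"
proof -
  interpret M: graded_space "scl M" "car M" "piece M" by (rule graded_module_space[OF M])
  interpret N: graded_space "scl N" "car N" "piece N" by (rule graded_module_space[OF N])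
  interpret vector_space "scl N" by (rule N.vs)
  note h' = homsD[OF h]
  have pM: "part (piece M) i v \<in> car M" if "v \<in> car M" for i v using M.part_in[OF that] M.C(2) by blast
  have "lin_on (scl M) (car M) (scl N) (car N) (part (piece N) (i + k) \<circ> h \<circ> part (piece M) i)" for i
  proof -
    have "lin_on (scl M) (car M) (scl N) (car N) (\<lambda>v. h (part (piece M) i v))"
      using pM by (intro lin_on_comp[OF M.part_lin h'(1)]) blast
    then have "lin_on (scl M) (car M) (scl N) (piece N (i + k)) (\<lambda>v. part (piece N) (i + k) (h (part (piece M) i v)))"
      using pM h'(4) by (intro lin_on_comp[OF _ N.part_lin]) auto
    then show ?thesis using N.C(2) by (auto simp: lin_on_def)
  qed
  note l = lin_onD[OF this, unfolded comp_def]
  show ?thesis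
    unfolding lin_on_def
  proof (intro conjI ballI allI)
    fix x assume x: "x \<in> car M"
    show "hcomp k M N h x \<in> car N"
      using x l(1) by (auto simp: hcomp_def intro: subspaceD(6)[OF N.vs N.sub])
    show "hcomp k M N h (scl M c x) = scl N c (hcomp k M N h x)" for c
      using x l(3)[OF x] subspaceD(3)[OF M.vs M.sub x] by (simp add: hcomp_def scale_sum_right)
    show "hcomp k M N h (x + y) = hcomp k M N h x + hcomp k M N h y" if y: "y \<in> car M" for y
      using x y l(2)[OF x y] subspaceD(2)[OF M.vs M.sub x y] by (simp add: hcomp_def sum.distrib)
  qed
qed

lemma span_lin_eq:
  assumes "module.span (*s) X = UNIV" "lin_on (*s) UNIV s W f" "lin_on (*s) UNIV s W g"
    "\<And>x. x \<in> X \<Longrightarrow> f x = g x" "vector_space s"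
  shows "f x = g x"
proof -
  interpret vector_space s by (rule assms(5))
  have "x \<in> vec.span X" using assms(1) by simp
  then show ?thesis
  proof (induction rule: vec.span_induct_alt)
    case base
    show ?case using lin_onD(3)[OF assms(2), of 0 0] lin_onD(3)[OF assms(3), of 0 0] by simp
  next
    case (step c x y)
    then show ?case using lin_onD(2,3)[OF assms(2)] lin_onD(2,3)[OF assms(3)] assms(4) by simp
  qed
qed

text \<open>Equivariance of the component is checked for homogeneous elements of D on homogeneous
  vectors, where both sides are the part of one vector in one degree. The hypothesis on the span,
  later \<open>Dgr_span\<close>, extends this to all of D.\<close>

lemma hcomp_ghoms:
  fixes T :: "('k::field, 'g::finite, 'r::finite, 'd::finite) double"
  assumes D: "module.span (*s) (\<Union>n. Dgr T n) = UNIV"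
    and M: "graded_module T M" and N: "graded_module T N" and h: "h \<in> homs UNIV M N"
  shows "hcomp k M N h \<in> ghoms (shift k M) N"
proof -
  interpret M: graded_space "scl M" "car M" "piece M" by (rule graded_module_space[OF M])
  interpret N: graded_space "scl N" "car N" "piece N" by (rule graded_module_space[OF N])
  note M' = fd_moduleD[OF graded_module_fd[OF M]] and N' = fd_moduleD[OF graded_module_fd[OF N]]
  note l = hcomp_lin[OF M N h, of k] and h' = homsD[OF h]
  have "hcomp k M N h (act M x v) = act N x (hcomp k M N h v)" if v: "v \<in> car M" for x v
  proof (rule M.lin_eqI[OF _ _ _ v])
    show "lin_on (scl M) (car M) (scl N) (car N) (\<lambda>v. hcomp k M N h (act M x v))"
      using M'(8) by (intro lin_on_comp[OF M'(4) l]) auto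
    show "lin_on (scl M) (car M) (scl N) (car N) (\<lambda>v. act N x (hcomp k M N h v))"
      using lin_onD(1)[OF l] by (intro lin_on_comp[OF l N'(4)]) auto
    fix i u assume u: "u \<in> piece M i"
    then have uM: "u \<in> car M" using M.C(2) by blast
    show "hcomp k M N h (act M x u) = act N x (hcomp k M N h u)"
    proof (rule span_lin_eq[OF D])
      show "lin_on (*s) UNIV (scl N) (car N) (\<lambda>x. hcomp k M N h (act M x u))"
        using M'(8) uM by (intro lin_on_comp[OF M'(5) l]) auto
      show "lin_on (*s) UNIV (scl N) (car N) (\<lambda>x. act N x (hcomp k M N h u))"
        using N'(5) lin_onD(1)[OF l uM] by blast
      fix x assume "x \<in> (\<Union>n. Dgr T n)"
      then obtain n where x: "x \<in> Dgr T n" by blast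
      have "hcomp k M N h (act M x u) = part (piece N) (n + (i + k)) (act N x (h u))"
        using hcomp_homog[OF M N h graded_module_act[OF M x u]] h'(2)[of x u] uM by (simp add: add.assoc)
      also have "\<dots> = act N x (hcomp k M N h u)"
        using graded_module_act_part[OF N x h'(4)[OF uM]] hcomp_homog[OF M N h u] by simp
      finally show "hcomp k M N h (act M x u) = act N x (hcomp k M N h u)" .
    qed (rule N.vs)
  qed
  then have "hcomp k M N h \<in> homs UNIV M N" using l by (intro homsI) (auto simp: hcomp_def)
  moreover have "hcomp k M N h v \<in> piece N i" if "v \<in> piece M (i - k)" for i v
    using hcomp_homog[OF M N h that, of k] N.part_in[OF h'(4)] M.C(2) that by auto
  ultimately show ?thesis by (auto simp: ghoms_def)
qed

text \<open>This serves to pass from the absence of graded homomorphisms, in all shifts, to the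
  absence of any homomorphism.\<close>

lemma hcomp_eq_0:
  assumes M: "graded_module T M" and N: "graded_module T N" and h: "h \<in> homs UNIV M N"
    and z: "\<And>k. hcomp k M N h = 0"
  shows "h = 0"
proof -
  interpret M: graded_space "scl M" "car M" "piece M" by (rule graded_module_space[OF M])
  interpret N: graded_space "scl N" "car N" "piece N" by (rule graded_module_space[OF N])
  interpret vector_space "scl N" by (rule N.vs)
  note h' = homsD[OF h]
  have 0: "h v = 0" if v: "v \<in> piece M i" for i v
  proof (rule N.parts_eq_0)
    show "part (piece N) j (h v) = 0" for j
      using hcomp_homog[OF M N h v, of "j - i"] z by (simp add: fun_eq_iff)
  qed (use v M.C(2) h'(4) in blast)
  have "lin_on (scl M) (car M) (scl N) (car N) (\<lambda>_. 0)"
    using subspaceD(1)[OF N.vs N.sub] by (auto simp: lin_on_def)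
  then have "h v = (\<lambda>_. 0) v" if "v \<in> car M" for v
    by (rule M.lin_eqI[OF h'(1) _ _ that]) (rule 0)
  then show ?thesis using h'(3) by (auto simp: fun_eq_iff)
qed

lemma fscale_comp_lin_on:
  assumes F: "\<And>h. h \<in> F \<Longrightarrow> (\<lambda>v. g (h v)) \<in> F'" "\<And>h v. h \<in> F \<Longrightarrow> h v \<in> S"
    and g: "lin_on s1 S s2 T g"
  shows "lin_on (fscale s1) F (fscale s2) F' (\<lambda>h v. g (h v))"
  using F lin_onD[OF g] by (auto simp: lin_on_def fun_eq_iff)

text \<open>The spaces \<open>F' F F''\<close> are either all homomorphisms or the graded ones of a fixed degree.\<close>

lemma hom_dim_exact:
  assumes P: "fd_module D A P" and N': "fd_module D A N'" and N: "fd_module D A N" and N'': "fd_module D A N''"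
    and f: "f \<in> homs A N' N" "inj_on f (car N')" and g: "g \<in> homs A N N''"
    and ex: "f ` car N' = {v \<in> car N. g v = 0}"
    and sub': "module.subspace (fscale (scl N')) F'" "F' \<subseteq> homs A P N'"
    and sub: "module.subspace (fscale (scl N)) F" "F \<subseteq> homs A P N"
    and sub'': "F'' \<subseteq> homs A P N''"
    and cl: "\<And>h. h \<in> F' \<Longrightarrow> (\<lambda>v. f (h v)) \<in> F" "\<And>h. h \<in> F \<Longrightarrow> (\<lambda>v. g (h v)) \<in> F''"
      "\<And>h. h \<in> homs A P N' \<Longrightarrow> (\<lambda>v. f (h v)) \<in> F \<Longrightarrow> h \<in> F'"
    and lift: "\<And>h. h \<in> F'' \<Longrightarrow> \<exists>h'\<in>F. \<forall>v\<in>car P. g (h' v) = h v"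
  shows "hom_dim N F = hom_dim N' F' + hom_dim N'' F''"
proof -
  note nN' = fd_moduleD[OF N'] and nN = fd_moduleD[OF N] and nN'' = fd_moduleD[OF N'']
  have g0: "g 0 = 0" by (rule homs_zero[OF N g])
  have val: "h v \<in> car N'" if "h \<in> F'" for h v
    using that sub'(2) homsD(3,4)[of h A P N'] subspaceD(1)[OF nN'(2,3)] by (cases "v \<in> car P") auto
  have val2: "h v \<in> car N" if "h \<in> F" for h v
    using that sub(2) homsD(3,4)[of h A P N] subspaceD(1)[OF nN(2,3)] by (cases "v \<in> car P") auto
  have surj: "(\<lambda>h v. g (h v)) ` F = F''"
  proof (intro subset_antisym subsetI)
    fix h assume h: "h \<in> F''"
    then obtain h' where h': "h' \<in> F" "\<forall>v\<in>car P. g (h' v) = h v" using lift by blast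
    have "g (h' v) = h v" for v
    proof (cases "v \<in> car P")
      case False
      have "h' v = 0" "h v = 0" using homsD(3)[of h' A P N v] homsD(3)[of h A P N'' v] sub(2) sub'' h h'(1)
          False by blast+
      then show ?thesis using g0 by simp
    qed (use h' in blast)
    then show "h \<in> (\<lambda>h v. g (h v)) ` F" using h'(1) by (intro image_eqI[of _ _ h']) auto
  qed (use cl(2) in blast)
  show ?thesis
    unfolding hom_dim_def
  proof (rule dim_exact)
    show "fd_space (fscale (scl N')) F'" by (rule fd_space_subspace[OF homs_fd[OF P N'] sub'])
    show "fd_space (fscale (scl N)) F" by (rule fd_space_subspace[OF homs_fd[OF P N] sub])
    show "vector_space (fscale (scl N'') :: _ \<Rightarrow> ('c \<Rightarrow> _) \<Rightarrow> _)" by (rule vector_space_fscale[OF nN''(2)])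
    show "lin_on (fscale (scl N')) F' (fscale (scl N)) F (\<lambda>h v. f (h v))"
      by (rule fscale_comp_lin_on[OF _ _ homsD(1)[OF f(1)]]) (use cl(1) val in blast)+
    show "lin_on (fscale (scl N)) F (fscale (scl N'')) F'' (\<lambda>h v. g (h v))"
      by (rule fscale_comp_lin_on[OF _ _ homsD(1)[OF g]]) (use cl(2) val2 in blast)+
    show "inj_on (\<lambda>h v. f (h v)) F'"
      using inj_onD[OF f(2)] val by (auto simp: inj_on_def fun_eq_iff)
    show "(\<lambda>h v. g (h v)) ` F = F''" by (rule surj)
    show "{h \<in> F. (\<lambda>v. g (h v)) = 0} = (\<lambda>h v. f (h v)) ` F'"
    proof (intro subset_antisym subsetI)
      fix h assume h: "h \<in> {h \<in> F. (\<lambda>v. g (h v)) = 0}"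
      then have "h ` car P \<subseteq> f ` car N'" using val2 ex by (auto simp: fun_eq_iff)
      then obtain h' where h': "h' \<in> homs A P N'" "\<And>v. f (h' v) = h v"
        using homs_lift_inj[OF P N' f, of h] h sub(2) by blast
      then have eq: "(\<lambda>v. f (h' v)) = h" by auto
      then have "h' \<in> F'" using cl(3)[OF h'(1)] h by simp
      then show "h \<in> (\<lambda>h v. f (h v)) ` F'" using eq by blast
    next
      fix h assume "h \<in> (\<lambda>h v. f (h v)) ` F'"
      then obtain h' where h': "h' \<in> F'" "h = (\<lambda>v. f (h' v))" by blast
      have "g (f (h' v)) = 0" for v using ex val[OF h'(1), of v] by blast
      then show "h \<in> {h \<in> F. (\<lambda>v. g (h v)) = 0}" using cl(1)[OF h'(1)] unfolding h'(2) by (simp add: fun_eq_iff)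
    qed
  qed
qed

lemma homs_injI:
  assumes "fd_module D A Z" "k \<in> homs A Z Z'" "{v \<in> car Z. k v = 0} = {0}"
  shows "inj_on k (car Z)"
proof (rule inj_onI)
  note Z = fd_moduleD[OF assms(1)]
  fix x y assume xy: "x \<in> car Z" "y \<in> car Z" "k x = k y"
  then have "x - y \<in> {v \<in> car Z. k v = 0}"
    using lin_on_diff[OF Z(2,3) homsD(1)[OF assms(2)] xy(1,2)] subspaceD(4)[OF Z(2,3) xy(1,2)] by simp
  then show "x = y" using assms(3) by simp
qed

text \<open>\<open>projective_module\<close> tests lifting only against modules carried by
  \<open>nat => 'k\<close>. Both \<open>X\<close> and \<open>Y\<close> are replaced by isomorphic
  copies in that type, and the lift is carried back.\<close>

lemma projective_lift:
  assumes P: "projective_module D P" and X: "fd_module D UNIV X" and Y: "fd_module D UNIV Y"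
    and g: "g \<in> homs UNIV X Y" "g ` car X = car Y" and f: "f \<in> homs UNIV P Y"
  shows "\<exists>h\<in>homs UNIV P X. \<forall>v\<in>car P. g (h v) = f v"
proof -
  obtain X' :: "('a, 'b) urep" and a where X': "fd_module D UNIV X'" "a \<in> homs UNIV X X'" "a ` car X = car X'"
    "{v \<in> car X. a v = 0} = {0}"
    using exists_quotient[OF subalgebra_UNIV X submodule_zero[OF X]] by blast
  obtain Y' :: "('a, 'b) urep" and b where Y': "fd_module D UNIV Y'" "b \<in> homs UNIV Y Y'" "b ` car Y = car Y'"
    "{v \<in> car Y. b v = 0} = {0}"
    using exists_quotient[OF subalgebra_UNIV Y submodule_zero[OF Y]] by blast
  have "bij_betw a (car X) (car X')" using homs_injI[OF X X'(2,4)] X'(3) by (simp add: bij_betw_def)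
  then obtain a' where a': "a' \<in> homs UNIV X' X" "\<And>v. v \<in> car X \<Longrightarrow> a' (a v) = v" "\<And>w. w \<in> car X' \<Longrightarrow> a (a' w) = w"
    "bij_betw a' (car X') (car X)"
    using homs_inverse[OF X X'(1,2)] by metis
  define g' where "g' = (\<lambda>v. b (g (a' v)))"
  have g': "g' \<in> homs UNIV X' Y'"
    unfolding g'_def by (rule homs_comp[OF Y homs_comp[OF X a'(1) g(1)] Y'(2)])
  have "g' ` car X' = b ` (g ` (a' ` car X'))" by (simp add: g'_def image_image)
  also have "\<dots> = car Y'" using a'(4) g(2) Y'(3) by (simp add: bij_betw_def)
  finally have surj: "g' ` car X' = car Y'" .
  have f': "(\<lambda>v. b (f v)) \<in> homs UNIV P Y'" by (rule homs_comp[OF Y f Y'(2)])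
  obtain h where h: "h \<in> homs UNIV P X'" "\<And>v. v \<in> car P \<Longrightarrow> g' (h v) = b (f v)"
    using P[unfolded projective_module_def, THEN conjunct2, rule_format, OF X'(1) Y'(1) g' surj f'] by blast
  have "g (a' (h v)) = f v" if v: "v \<in> car P" for v
    using h(2)[OF v] inj_onD[OF homs_injI[OF Y Y'(2,4)], of "g (a' (h v))" "f v"]
      homsD(4)[OF g(1) homsD(4)[OF a'(1) homsD(4)[OF h(1) v]]] homsD(4)[OF f v] by (simp add: g'_def)
  then show ?thesis by (intro bexI[OF _ homs_comp[OF X'(1) h(1) a'(1)]] ballI)
qed

section \<open>Hopf algebras in coordinates\<close>

abbreviation vlin :: "('k::field ^ 'a \<Rightarrow> 'k ^ 'b) \<Rightarrow> bool"
  where "vlin \<equiv> Vector_Spaces.linear (*s) (*s)"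

lemma vlinI:
  fixes f :: "'k::field ^ 'a \<Rightarrow> 'k ^ 'b"
  assumes "\<And>x y. f (x + y) = f x + f y" "\<And>c x. f (c *s x) = c *s f x"
  shows "vlin f"
  using assms by (simp add: Vector_Spaces.linear_iff vec.vector_space_axioms)

lemma vlinD:
  assumes "vlin f"
  shows "f (x + y) = f x + f y" "f (c *s x) = c *s f x" "f 0 = 0" "f (sum h I) = (\<Sum>i\<in>I. f (h i))"
proof -
  interpret Vector_Spaces.linear "(*s)" "(*s)" f by fact
  show "f (x + y) = f x + f y" "f (c *s x) = c *s f x" "f 0 = 0" "f (sum h I) = (\<Sum>i\<in>I. f (h i))"
    by (simp_all add: add scale zero sum)
qed

lemma vector_expand: "x = (\<Sum>i\<in>UNIV. x $ i *s axis i 1)" for x :: "'k::field ^ 'a::finite"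
  by (simp add: vec_eq_iff axis_def if_distrib cong: if_cong)

lemma axis_pair: "axis (a, b) (1::'k::field) = tens (axis a 1) (axis b 1)"
  by (auto simp: vec_eq_iff tens_def axis_def)

lemma tens_add: "tens (x + x') y = tens x y + tens x' y" "tens x (y + y') = tens x y + tens x y'"
  by (simp_all add: vec_eq_iff tens_def algebra_simps)

lemma tens_scale: "tens (c *s x) y = c *s tens x y" "tens x (c *s y) = c *s tens x y"
  by (simp_all add: vec_eq_iff tens_def algebra_simps)

lemma vlin_tens: "vlin (\<lambda>x. tens x y)" "vlin (\<lambda>y. tens x y)"
  by (auto intro!: vlinI simp: tens_add tens_scale)

lemma tens_0 [simp]: "tens 0 y = 0" "tens x 0 = 0"
  by (simp_all add: vec_eq_iff tens_def)

lemma vlin_lift2: "vlin (lift2 m)"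
  by (rule vlinI) (simp_all add: lift2_def sum.distrib vec.scale_left_distrib vec.scale_sum_right)

lemma lift2_tens:
  assumes "\<And>y. vlin (\<lambda>x. m x y)" "\<And>x. vlin (m x)"
  shows "lift2 m (tens x y) = m x y"
proof -
  have "m x y = m (\<Sum>i\<in>UNIV. x $ i *s axis i 1) (\<Sum>j\<in>UNIV. y $ j *s axis j 1)"
    by (simp only: vector_expand[symmetric])
  also have "\<dots> = (\<Sum>i\<in>UNIV. \<Sum>j\<in>UNIV. (x $ i * y $ j) *s m (axis i 1) (axis j 1))"
    by (simp add: vlinD[OF assms(1)] vlinD[OF assms(2)] vec.scale_sum_right) (subst sum.swap, simp add: mult.commute)
  also have "\<dots> = lift2 m (tens x y)"
    unfolding lift2_def UNIV_Times_UNIV[symmetric] sum.cartesian_product' by (simp add: tens_def case_prod_beta)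
  finally show ?thesis ..
qed

lemma vlin_comp: "vlin f \<Longrightarrow> vlin g \<Longrightarrow> vlin (\<lambda>x. g (f x))"
  by (rule vlinI) (simp_all add: vlinD)

lemma linear_lift2: "vlin L \<Longrightarrow> L (lift2 m t) = lift2 (\<lambda>a b. L (m a b)) t"
  unfolding lift2_def by (simp add: vlinD)

lemma lift2_tmap:
  assumes "\<And>y. vlin (\<lambda>x. m x y)" "\<And>x. vlin (m x)"
  shows "lift2 m (tmap f g t) = lift2 (\<lambda>a b. m (f a) (g b)) t"
  unfolding tmap_def linear_lift2[OF vlin_lift2] lift2_tens[OF assms] ..

lemma vlin_eq_tens:
  assumes "vlin f" "vlin g" "\<And>x y. f (tens x y) = g (tens x y)"
  shows "f t = g t"
proof -
  have "f t = (\<Sum>p\<in>UNIV. t $ p *s f (axis p 1))"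
    by (subst vector_expand[of t], simp add: vlinD[OF assms(1)])
  also have "\<dots> = (\<Sum>p\<in>UNIV. t $ p *s g (axis p 1))"
    by (intro sum.cong refl) (metis axis_pair assms(3) surj_pair)
  also have "\<dots> = g t"
    by (subst (2) vector_expand[of t], simp add: vlinD[OF assms(2)])
  finally show ?thesis .
qed

lemma assoc_algebraD:
  assumes "assoc_algebra A"
  shows "vlin (\<lambda>y. mul A x y)" "vlin (\<lambda>x. mul A x y)" "mul A (mul A x y) z = mul A x (mul A y z)"
    "mul A (one A) x = x" "mul A x (one A) = x"
  using assms by (auto simp: assoc_algebra_def)

text \<open>Both maps are convolution inverses of the identity. The convolution product of
  \<open>S\<close>, the identity and \<open>S'\<close>, bracketed in two ways, gives
  \<open>S\<close> and \<open>S'\<close>. Uniqueness is what gives the description in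
  \<open>antipode\<close> a value.\<close>

lemma antipode_unique:
  assumes A: "assoc_algebra A" "coalgebra A" and S: "is_antipode A S" "is_antipode A S'"
  shows "S = S'"
proof
  fix x
  note a = assoc_algebraD[OF A(1)]
  have S': "vlin S" "vlin S'"
    "\<And>x. lift2 (\<lambda>a b. mul A (S a) b) (cop A x) = cou A x *s one A"
    "\<And>x. lift2 (\<lambda>a b. mul A a (S' b)) (cop A x) = cou A x *s one A"
    using S by (auto simp: is_antipode_def)
  have co: "lift2 (\<lambda>a b. cou A a *s b) (cop A x) = x" "lift2 (\<lambda>a b. cou A b *s a) (cop A x) = x"
    "reassoc (tmap (cop A) id (cop A x)) = tmap id (cop A) (cop A x)"
    using A(2) by (auto simp: coalgebra_def)
  \<comment> \<open>\<Phi> brackets the threefold product to the right and \<Psi> to the left;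
    \<open>reassoc\<close> and associativity of the product identify them.\<close>
  define \<Phi> where "\<Phi> = lift2 (\<lambda>a t. mul A (S a) (lift2 (\<lambda>c d. mul A c (S' d)) t))"
  define \<Psi> where "\<Psi> = lift2 (\<lambda>t d. mul A (lift2 (\<lambda>a c. mul A (S a) c) t) (S' d))"
  have bil: "\<And>y. vlin (\<lambda>a. mul A (S a) y)" "\<And>x. vlin (\<lambda>d. mul A x (S' d))"
    using vlin_comp[OF S'(1) a(2)] vlin_comp[OF S'(2) a(1)] by auto
  have \<Phi>t: "\<Phi> (tens u t) = mul A (S u) (lift2 (\<lambda>c d. mul A c (S' d)) t)" for u t
    unfolding \<Phi>_def by (intro lift2_tens bil vlin_comp[OF vlin_lift2 a(1)])
  have \<Psi>t: "\<Psi> (tens t d) = mul A (lift2 (\<lambda>a c. mul A (S a) c) t) (S' d)" for t d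
    unfolding \<Psi>_def by (intro lift2_tens bil vlin_comp[OF vlin_lift2 a(2)])
  have r: "vlin reassoc" by (rule vlinI) (simp_all add: reassoc_def vec_eq_iff)
  have rt: "reassoc (tens (tens p q) d) = tens p (tens q d)" for p q and d :: "'a ^ 'b"
    by (simp add: reassoc_def tens_def vec_eq_iff mult.assoc)
  have \<Psi>\<Phi>: "\<Psi> s = \<Phi> (reassoc s)" for s
  proof (rule vlin_eq_tens[of \<Psi> "\<lambda>s. \<Phi> (reassoc s)"])
    show "vlin \<Psi>" "vlin (\<lambda>s. \<Phi> (reassoc s))"
      unfolding \<Psi>_def \<Phi>_def by (rule vlin_lift2, rule vlin_comp[OF r vlin_lift2])
    fix t d
    show "\<Psi> (tens t d) = \<Phi> (reassoc (tens t d))"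
    proof (rule vlin_eq_tens[of "\<lambda>t. \<Psi> (tens t d)" "\<lambda>t. \<Phi> (reassoc (tens t d))"])
      show "vlin (\<lambda>t. \<Psi> (tens t d))" "vlin (\<lambda>t. \<Phi> (reassoc (tens t d)))"
        unfolding \<Psi>_def \<Phi>_def
        by (rule vlin_comp[OF vlin_tens(1) vlin_lift2], rule vlin_comp[OF vlin_comp[OF vlin_tens(1) r] vlin_lift2])
      fix p q
      have "\<Psi> (tens (tens p q) d) = mul A (mul A (S p) q) (S' d)"
        unfolding \<Psi>t by (subst lift2_tens) (auto intro: bil a)
      moreover have "\<Phi> (tens p (tens q d)) = mul A (S p) (mul A q (S' d))"
        unfolding \<Phi>t by (subst lift2_tens) (auto intro: bil a)
      ultimately show "\<Psi> (tens (tens p q) d) = \<Phi> (reassoc (tens (tens p q) d))"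
        by (simp add: rt a(3))
    qed
  qed
  have "\<Phi> (tmap id (cop A) (cop A x)) = lift2 (\<lambda>u b. mul A (S u) (lift2 (\<lambda>c d. mul A c (S' d)) (cop A b))) (cop A x)"
    unfolding \<Phi>_def by (subst lift2_tmap) (auto intro: bil vlin_comp[OF vlin_lift2 a(1)])
  also have "\<dots> = lift2 (\<lambda>u b. S (cou A b *s u)) (cop A x)"
    by (simp add: S' vlinD[OF a(1)] a vlinD[OF S'(1)])
  also have "\<dots> = S x"
    unfolding linear_lift2[OF S'(1), of "\<lambda>u b. cou A b *s u", symmetric] co(2) ..
  finally have 1: "\<Phi> (tmap id (cop A) (cop A x)) = S x" .
  have "\<Psi> (tmap (cop A) id (cop A x)) = lift2 (\<lambda>u b. mul A (lift2 (\<lambda>c d. mul A (S c) d) (cop A u)) (S' b)) (cop A x)"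
    unfolding \<Psi>_def by (subst lift2_tmap) (auto intro: bil vlin_comp[OF vlin_lift2 a(2)])
  also have "\<dots> = lift2 (\<lambda>u b. S' (cou A u *s b)) (cop A x)"
    by (simp add: S' vlinD[OF a(2)] a vlinD[OF S'(2)])
  also have "\<dots> = S' x"
    unfolding linear_lift2[OF S'(2), of "\<lambda>u b. cou A u *s b", symmetric] co(1) ..
  finally show "S x = S' x" using 1 \<Psi>\<Phi> co(3) by simp
qed

lemma is_antipode_antipode: "hopf_algebra A \<Longrightarrow> is_antipode A (antipode A)"
  unfolding antipode_def hopf_algebra_def bialgebra_def using antipode_unique by (metis theI)

lemma pairing_linear:
  "pairing f (x + y) = pairing f x + pairing f y" "pairing f (c *s x) = c * pairing f x"
  "pairing (f + g) x = pairing f x + pairing g x" "pairing (c *s f) x = c * pairing f x" "pairing f 0 = 0"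
      "pairing 0 x = 0"
  by (simp_all add: pairing_def algebra_simps sum.distrib sum_distrib_left)

lemma pairing_sum: "pairing f (sum h I) = (\<Sum>i\<in>I. pairing f (h i))"
  by (induction I rule: infinite_finite_induct) (auto simp: pairing_linear)

lemma pairing_axis: "pairing f (axis i 1) = f $ i"
  by (simp add: pairing_def axis_def if_distrib cong: if_cong)

lemma vec_eq_pairing:
  assumes "\<And>x g. pairing f (tens x (axis g 1)) = pairing f' (tens x (axis g 1))"
  shows "f = f'"
proof (subst vec_eq_iff, intro allI)
  fix i :: "'b \<times> 'c"
  show "f $ i = f' $ i"
    using assms[of "axis (fst i) 1" "snd i"] by (simp add: axis_pair[symmetric] pairing_axis)
qed

text \<open>The value of the functional \<open>g\<close> tensor \<open>f\<close>. The order of the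
  arguments anticipates \<open>dual_op\<close>, whose product evaluates its second factor on the
  first tensor leg.\<close>

definition pair2 :: "'k::field ^ 'b \<Rightarrow> 'k ^ 'b \<Rightarrow> 'k ^ ('b::finite \<times> 'b) \<Rightarrow> 'k"
  where "pair2 g f t = (\<Sum>p\<in>UNIV. t $ p * g $ fst p * f $ snd p)"

lemma pair2_linear:
  "pair2 g f (s + t) = pair2 g f s + pair2 g f t" "pair2 g f (c *s t) = c * pair2 g f t" "pair2 g f 0 = 0"
  by (simp_all add: pair2_def algebra_simps sum.distrib sum_distrib_left)

lemma pair2_sum: "pair2 g f (sum h I) = (\<Sum>i\<in>I. pair2 g f (h i))"
  by (induction I rule: infinite_finite_induct) (auto simp: pair2_linear)

lemma pair2_lift2: "pair2 g f (lift2 m t) = (\<Sum>p\<in>UNIV. t $ p * pair2 g f (m (axis (fst p) 1) (axis (snd p) 1)))"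
  by (simp add: lift2_def pair2_sum pair2_linear)

lemma pair2_tens: "pair2 g f (tens x y) = pairing g x * pairing f y"
  unfolding pair2_def pairing_def sum_product UNIV_Times_UNIV[symmetric] sum.cartesian_product'
  by (simp add: tens_def case_prod_beta mult_ac)

lemma pairing_dual_mul:
  assumes "vlin (cop A)"
  shows "pairing (mul (dual_op A) f g) z = pair2 g f (cop A z)"
proof -
  have "pairing (mul (dual_op A) f g) z = (\<Sum>i\<in>UNIV. z $ i * pair2 g f (cop A (axis i 1)))"
    by (simp add: pairing_def dual_op_def pair2_def mult.commute)
  also have "\<dots> = pair2 g f (cop A (\<Sum>i\<in>UNIV. z $ i *s axis i 1))"
    by (simp only: vlinD[OF assms] pair2_sum pair2_linear)
  also have "\<dots> = pair2 g f (cop A z)" by (simp only: vector_expand[symmetric])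
  finally show ?thesis .
qed

lemma sum_single: "(\<And>i. i \<noteq> a \<Longrightarrow> f i = 0) \<Longrightarrow> sum f UNIV = f a" for a :: "'a::finite"
  using sum.mono_neutral_right[of UNIV "{a}" f] by simp

abbreviation smash :: "'k::field ^ 'r \<Rightarrow> 'g \<Rightarrow> 'k ^ ('r::finite \<times> 'g::finite)"
  where "smash x g \<equiv> tens x (axis g 1)"

lemma slice_smash: "slice (smash x g) h = (if h = g then x else 0)"
  by (simp add: slice_def tens_def axis_def vec_eq_iff)

lemma smash_slices: "u = (\<Sum>g\<in>UNIV. smash (slice u g) g)"
proof -
  have "(\<Sum>g\<in>UNIV. u $ (a, g) * axis g 1 $ h) = u $ (a, h)" for a h
    by (simp add: axis_def if_distrib cong: if_cong)
  then show ?thesis by (simp add: vec_eq_iff slice_def tens_def)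
qed

section \<open>The double of the group inside the double of the bosonization\<close>

locale dbl =
  fixes V :: "('k::{alg_closed_field, field_char_0}, 'g::finite, 'v::ab_group_add) yd"
    and T :: "('k, 'g, 'r::finite, 'd::finite) double"
  assumes dbl: "double_of V T"
begin

abbreviation "G \<equiv> grp T"
abbreviation "H \<equiv> bos T"
abbreviation "B \<equiv> nic T"
abbreviation "Y \<equiv> nyd T"
abbreviation "D \<equiv> alg T"

lemma G: "group G" "carrier G = UNIV"
  using dbl by (auto simp: double_of_def)

interpretation group G by (rule G)

lemma Ginv [simp]: "inv\<^bsub>G\<^esub> g \<otimes>\<^bsub>G\<^esub> g = \<one>\<^bsub>G\<^esub>" "g \<otimes>\<^bsub>G\<^esub> inv\<^bsub>G\<^esub> g = \<one>\<^bsub>G\<^esub>"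
  and Gone [simp]: "\<one>\<^bsub>G\<^esub> \<otimes>\<^bsub>G\<^esub> g = g" "g \<otimes>\<^bsub>G\<^esub> \<one>\<^bsub>G\<^esub> = g"
  and Gassoc: "g \<otimes>\<^bsub>G\<^esub> h \<otimes>\<^bsub>G\<^esub> k = g \<otimes>\<^bsub>G\<^esub> (h \<otimes>\<^bsub>G\<^esub> k)"
  and Ginv_one [simp]: "inv\<^bsub>G\<^esub> (inv\<^bsub>G\<^esub> g) = g"
  using G(2) by (simp_all add: m_assoc)

lemma G_conj_eq: "s = g \<otimes>\<^bsub>G\<^esub> k \<otimes>\<^bsub>G\<^esub> inv\<^bsub>G\<^esub> g \<longleftrightarrow> k = inv\<^bsub>G\<^esub> g \<otimes>\<^bsub>G\<^esub> s \<otimes>\<^bsub>G\<^esub> g"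
proof
  assume "s = g \<otimes>\<^bsub>G\<^esub> k \<otimes>\<^bsub>G\<^esub> inv\<^bsub>G\<^esub> g"
  then have "inv\<^bsub>G\<^esub> g \<otimes>\<^bsub>G\<^esub> s \<otimes>\<^bsub>G\<^esub> g = (inv\<^bsub>G\<^esub> g \<otimes>\<^bsub>G\<^esub> g) \<otimes>\<^bsub>G\<^esub> k \<otimes>\<^bsub>G\<^esub> (inv\<^bsub>G\<^esub> g \<otimes>\<^bsub>G\<^esub> g)"
    by (simp only: Gassoc)
  then show "k = inv\<^bsub>G\<^esub> g \<otimes>\<^bsub>G\<^esub> s \<otimes>\<^bsub>G\<^esub> g" by simp
next
  assume "k = inv\<^bsub>G\<^esub> g \<otimes>\<^bsub>G\<^esub> s \<otimes>\<^bsub>G\<^esub> g"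
  then have "g \<otimes>\<^bsub>G\<^esub> k \<otimes>\<^bsub>G\<^esub> inv\<^bsub>G\<^esub> g = (g \<otimes>\<^bsub>G\<^esub> inv\<^bsub>G\<^esub> g) \<otimes>\<^bsub>G\<^esub> s \<otimes>\<^bsub>G\<^esub> (g \<otimes>\<^bsub>G\<^esub> inv\<^bsub>G\<^esub> g)"
    by (simp only: Gassoc)
  then show "s = g \<otimes>\<^bsub>G\<^esub> k \<otimes>\<^bsub>G\<^esub> inv\<^bsub>G\<^esub> g" by simp
qed

lemma braided: "braided_hopf_algebra G B Y" and braided_gr: "braided_grading B Y (ngr T)"
  and ngr_0: "ngr T 0 = range (\<lambda>c. c *s one B)"
  using dbl by (auto simp: double_of_def nichols_algebra_def)

lemma B_alg: "assoc_algebra B" "coalgebra B" "yd_module G Y" "yscl Y = (*s)" "ycar Y = UNIV"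
  and gact_one: "gact Y g (one B) = one B" and one_gcomp: "one B \<in> gcomp Y \<one>\<^bsub>G\<^esub>"
  and cou_gact: "cou B (gact Y g x) = cou B x"
  and cou_gcomp: "x \<in> gcomp Y g \<Longrightarrow> g \<noteq> \<one>\<^bsub>G\<^esub> \<Longrightarrow> cou B x = 0"
  and cop_one: "cop B (one B) = tens (one B) (one B)"
  and cou_mul: "cou B (mul B x y) = cou B x * cou B y" and cou_one: "cou B (one B) = 1"
  using braided unfolding braided_hopf_algebra_def by auto

lemmas Ba = assoc_algebraD[OF B_alg(1)]

lemma cou_linear: "cou B (x + y) = cou B x + cou B y" "cou B (c *s x) = c * cou B x" "cou B 0 = 0"
proof -
  interpret Vector_Spaces.linear "(*s)" "(*)" "cou B" using B_alg(2) by (simp add: coalgebra_def)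
  show "cou B (x + y) = cou B x + cou B y" "cou B (c *s x) = c * cou B x" "cou B 0 = 0"
    by (simp_all add: add scale zero)
qed

lemma cou_sum: "cou B (sum f I) = (\<Sum>i\<in>I. cou B (f i))"
  by (induction I rule: infinite_finite_induct) (auto simp: cou_linear)

lemma counit: "lift2 (\<lambda>a b. cou B b *s a) (cop B x) = x"
  using B_alg(2) by (simp add: coalgebra_def)

lemma vlin_gact: "vlin (gact Y g)"
  using B_alg(3,4,5) by (intro vlinI) (auto simp: yd_module_def lin_on_def)

lemma fd_UNIV: "fd_space (*s) (UNIV :: ('k ^ 'a::finite) set)"
  unfolding fd_space_def using vec.vector_space_axioms vec.span_Basis vec.finite_Basis vec.subspace_UNIV by blast

lemma Y_gs: "graded_space (*s) UNIV (gcomp Y)"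
  using B_alg(3-5) fd_UNIV by (auto simp: graded_space_def yd_module_def)

lemma ngr_gs: "graded_space (*s) UNIV (ngr T)"
  using braided_gr fd_UNIV by (auto simp: graded_space_def braided_grading_def)

interpretation Y: graded_space "(*s)" UNIV "gcomp Y" by (rule Y_gs)
interpretation R: graded_space "(*s)" UNIV "ngr T" by (rule ngr_gs)

lemma vlin_part: "vlin (part (gcomp Y) k)"
  using lin_onD[OF Y.part_lin] by (intro vlinI) auto

text \<open>The counit is a morphism to the trivial Yetter-Drinfeld module, hence kills every
  component but that of the neutral element.\<close>

lemma cou_part: "cou B (part (gcomp Y) k x) = (if k = \<one>\<^bsub>G\<^esub> then cou B x else 0)"
proof -
  have 0: "cou B (part (gcomp Y) k x) = 0" if "k \<noteq> \<one>\<^bsub>G\<^esub>" for k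
    using cou_gcomp[OF Y.part_in[of x k] that] by simp
  have "cou B x = (\<Sum>k\<in>UNIV. cou B (part (gcomp Y) k x))"
    by (subst Y.sum_parts[of x UNIV]) (auto simp: cou_sum)
  also have "\<dots> = cou B (part (gcomp Y) \<one>\<^bsub>G\<^esub> x)"
    by (subst sum.remove[of UNIV "\<one>\<^bsub>G\<^esub>"]) (auto simp: 0)
  finally show ?thesis using 0 by auto
qed

lemma cou_ngr: "x \<in> ngr T m \<Longrightarrow> m \<noteq> 0 \<Longrightarrow> cou B x = 0"
  using braided_gr by (simp add: braided_grading_def)

lemma H_mul: "mul H (smash x g) (smash y h) = smash (mul B x (gact Y g y)) (g \<otimes>\<^bsub>G\<^esub> h)"
proof -
  have "mul H (smash x g) (smash y h) = (\<Sum>g'\<in>UNIV. \<Sum>h'\<in>UNIV.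
      smash (mul B (if g' = g then x else 0) (gact Y g' (if h' = h then y else 0))) (g' \<otimes>\<^bsub>G\<^esub> h'))"
    by (simp add: bosonization_def slice_smash)
  also have "\<dots> = (\<Sum>h'\<in>UNIV. smash (mul B (if g = g then x else 0) (gact Y g (if h' = h then y else 0))) (g \<otimes>\<^bsub>G\<^esub> h'))"
    by (rule sum_single) (simp add: vlinD[OF Ba(2)])
  also have "\<dots> = smash (mul B (if g = g then x else 0) (gact Y g (if h = h then y else 0))) (g \<otimes>\<^bsub>G\<^esub> h)"
    by (rule sum_single) (simp add: vlinD[OF Ba(1)] vlinD[OF vlin_gact])
  finally show ?thesis by simp
qed

lemma H_one: "one H = smash (one B) \<one>\<^bsub>G\<^esub>"
  by (simp add: bosonization_def)

lemma H_cou: "cou H (smash x g) = cou B x"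
  using sum_single[of g "\<lambda>h. cou B (slice (smash x g) h)"]
  by (simp add: bosonization_def slice_smash cou_linear)

lemma H_cop: "cop H (smash x g) = lift2 (\<lambda>a b. \<Sum>k\<in>UNIV.
    tens (smash a (k \<otimes>\<^bsub>G\<^esub> g)) (smash (part (gcomp Y) k b) g)) (cop B x)"
proof -
  have c: "vlin (cop B)" using B_alg(2) by (simp add: coalgebra_def)
  show ?thesis
    using sum_single[of g "\<lambda>g'. lift2 (\<lambda>a b. \<Sum>k\<in>UNIV.
      tens (smash a (k \<otimes>\<^bsub>G\<^esub> g')) (smash (part (gcomp Y) k b) g')) (cop B (slice (smash x g) g'))"]
    by (simp add: bosonization_def slice_smash vlinD[OF c] vlinD(3)[OF vlin_lift2])
qed

lemma double: "hopf_algebra H" "hopf_algebra D" "bialgebra_hom H D (emb T)" "bialgebra_hom (dual_op H) D (demb T)"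
  "bij (lift2 (\<lambda>h f. mul D (emb T h) (demb T f)))"
  "mul D (demb T f) (emb T h) =
      lift2 (\<lambda>a r. lift2 (\<lambda>b c. mul D (emb T b)
          (demb T (\<chi> y. pairing f (mul H a (mul H (axis y 1) (antipode H c))))))
        (cop H r)) (cop H h)"
  using dbl by (auto simp: double_of_def drinfeld_double_def)

lemma HD_alg: "assoc_algebra H" "coalgebra H" "assoc_algebra D"
  using double(1,2) by (auto simp: hopf_algebra_def bialgebra_def)

lemmas Ha = assoc_algebraD[OF HD_alg(1)]
lemmas Da = assoc_algebraD[OF HD_alg(3)]

lemma emb: "vlin (emb T)" "emb T (mul H x y) = mul D (emb T x) (emb T y)" "emb T (one H) = one D"
  and demb: "vlin (demb T)" "demb T (mul (dual_op H) f f') = mul D (demb T f) (demb T f')"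
      "demb T (one (dual_op H)) = one D"
  using double(3,4) by (auto simp: bialgebra_hom_def)

definition gam :: "'g \<Rightarrow> 'k ^ ('r \<times> 'g)" where "gam g = smash (one B) g"

text \<open>For linear \<open>y\<close> this is the functional taking \<open>x # g\<close> to
  \<open>y x * w g\<close>, in coordinates of the dual basis. With the counit for \<open>y\<close>
  it is the function \<open>w\<close> on G, pulled back along the projection of the bosonization to
  the group algebra; with \<open>w\<close> constantly one it is invariant under right multiplication
  by G.\<close>

definition fn :: "('k ^ 'r \<Rightarrow> 'k) \<Rightarrow> ('g \<Rightarrow> 'k) \<Rightarrow> 'k ^ ('r \<times> 'g)"
  where "fn y w = (\<chi> p. y (axis (fst p) 1) * w (snd p))"

lemma pairing_fn:
  assumes "\<And>x x'. y (x + x') = y x + y x'" "\<And>c x. y (c *s x) = c * y x"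
  shows "pairing (fn y w) (smash x g) = y x * w g"
proof -
  have ys: "y (sum f I) = (\<Sum>i\<in>I. y (f i))" for f and I :: "'r set"
    using assms(1) assms(2)[of 0 0] by (induction I rule: infinite_finite_induct) auto
  have "pairing (fn y w) (smash x g) = (\<Sum>a\<in>UNIV. \<Sum>h\<in>UNIV. y (axis a 1) * w h * (x $ a * axis g 1 $ h))"
    unfolding pairing_def UNIV_Times_UNIV[symmetric] sum.cartesian_product'
    by (simp add: fn_def tens_def case_prod_beta)
  also have "\<dots> = (\<Sum>a\<in>UNIV. y (axis a 1) * w g * (x $ a * axis g 1 $ g))"
    by (intro sum.cong refl sum_single) (simp add: axis_def)
  also have "\<dots> = (\<Sum>a\<in>UNIV. y (axis a 1) * w g * x $ a)" by simp
  also have "\<dots> = y (\<Sum>a\<in>UNIV. x $ a *s axis a 1) * w g"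
    by (simp add: ys assms(2) sum_distrib_left sum_distrib_right mult_ac)
  finally show ?thesis by (simp only: vector_expand[symmetric])
qed

abbreviation "ef w \<equiv> fn (cou B) w"

lemma pairing_ef: "pairing (ef w) (smash x g) = cou B x * w g"
  by (rule pairing_fn) (auto simp: cou_linear)

text \<open>In the coproduct of \<open>x # g\<close> the counit on the second leg leaves only the
  term with trivial coaction, so \<open>u\<close> and \<open>w\<close> are evaluated at the same
  group element.\<close>

lemma fn_mul:
  assumes y: "\<And>x x'. y (x + x') = y x + y x'" "\<And>c x. y (c *s x) = c * y x"
  shows "mul (dual_op H) (ef u) (fn y w) = fn y (\<lambda>g. w g * u g)"
proof (rule vec_eq_pairing)
  fix x g
  have c: "vlin (cop H)" using HD_alg(2) by (simp add: coalgebra_def)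
  have ys: "y (sum f I) = (\<Sum>i\<in>I. y (f i))" for f and I :: "('r \<times> 'r) set"
    using y(1) y(2)[of 0 0] by (induction I rule: infinite_finite_induct) auto
  have *: "pair2 (fn y w) (ef u) (\<Sum>k\<in>UNIV. tens (smash a (k \<otimes>\<^bsub>G\<^esub> g)) (smash (part (gcomp Y) k b) g))
      = y (cou B b *s a) * (w g * u g)" for a b
  proof -
    have "pair2 (fn y w) (ef u) (\<Sum>k\<in>UNIV. tens (smash a (k \<otimes>\<^bsub>G\<^esub> g)) (smash (part (gcomp Y) k b) g))
      = (\<Sum>k\<in>UNIV. y a * w (k \<otimes>\<^bsub>G\<^esub> g) * (cou B (part (gcomp Y) k b) * u g))"
      by (simp add: pair2_sum pair2_tens pairing_fn[OF y] pairing_ef)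
    also have "\<dots> = y a * w (\<one>\<^bsub>G\<^esub> \<otimes>\<^bsub>G\<^esub> g) * (cou B (part (gcomp Y) \<one>\<^bsub>G\<^esub> b) * u g)"
      by (rule sum_single) (simp add: cou_part)
    also have "\<dots> = y (cou B b *s a) * (w g * u g)" by (simp add: cou_part y(2))
    finally show ?thesis .
  qed
  have "pairing (mul (dual_op H) (ef u) (fn y w)) (smash x g)
      = y (lift2 (\<lambda>a b. cou B b *s a) (cop B x)) * (w g * u g)"
    unfolding pairing_dual_mul[OF c] H_cop pair2_lift2 *
    by (simp add: lift2_def ys y(2) sum_distrib_left sum_distrib_right mult_ac)
  also have "\<dots> = pairing (fn y (\<lambda>g. w g * u g)) (smash x g)"
    by (simp add: counit pairing_fn[OF y])
  finally show "pairing (mul (dual_op H) (ef u) (fn y w)) (smash x g) = pairing (fn y (\<lambda>g. w g * u g)) (smash x g)" .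
qed

lemma dual_one: "one (dual_op H) = ef (\<lambda>_. 1)"
proof (rule vec_eq_pairing)
  fix x g
  have c: "Vector_Spaces.linear (*s) (*) (cou H)" using HD_alg(2) by (simp add: coalgebra_def)
  interpret c: Vector_Spaces.linear "(*s)" "(*)" "cou H" by (rule c)
  have "pairing (one (dual_op H)) z = cou H z" for z
  proof -
    have "cou H z = cou H (\<Sum>i\<in>UNIV. z $ i *s axis i 1)" by (simp only: vector_expand[symmetric])
    also have "\<dots> = pairing (one (dual_op H)) z" unfolding c.sum c.scale
        by (simp add: pairing_def dual_op_def mult.commute)
    finally show ?thesis ..
  qed
  then show "pairing (one (dual_op H)) (smash x g) = pairing (ef (\<lambda>_. 1)) (smash x g)"
    by (simp add: H_cou pairing_ef)
qed

text \<open>The double of the group is spanned by the products \<open>gm g\<close> times \<open>ed s\<close>, where \<open>ed s\<close> is the image of the delta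
  function at \<open>s\<close>.\<close>

definition gm :: "'g \<Rightarrow> 'k ^ 'd" where "gm g = emb T (gam g)"

definition ed :: "'g \<Rightarrow> 'k ^ 'd" where "ed s = demb T (ef (\<lambda>g. if g = s then 1 else 0))"

lemma gam_mul: "mul H (gam g) (gam h) = gam (g \<otimes>\<^bsub>G\<^esub> h)"
  by (simp add: gam_def H_mul gact_one Ba)

lemma gm_mul: "mul D (gm g) (gm h) = gm (g \<otimes>\<^bsub>G\<^esub> h)" and gm_one: "gm \<one>\<^bsub>G\<^esub> = one D"
  by (simp_all add: gm_def emb(2)[symmetric] gam_mul emb(3)[symmetric] H_one gam_def[symmetric])

lemma ef_sum: "ef w = (\<Sum>s\<in>UNIV. w s *s ef (\<lambda>g. if g = s then 1 else 0))"
  by (simp add: vec_eq_iff fn_def if_distrib cong: if_cong)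

lemma demb_ef: "demb T (ef w) = (\<Sum>s\<in>UNIV. w s *s ed s)"
  by (subst ef_sum) (simp add: vlinD[OF demb(1)] ed_def)

lemma ed_mul: "mul D (ed s) (ed t) = (if s = t then ed s else 0)"
proof -
  have "mul D (ed s) (ed t) = demb T (ef (\<lambda>g. (if g = t then 1 else 0) * (if g = s then 1 else 0)))"
    unfolding ed_def demb(2)[symmetric] by (subst fn_mul) (auto simp: cou_linear)
  also have "\<dots> = (\<Sum>r\<in>UNIV. if r = t then if s = t then ed s else 0 else 0)"
    unfolding demb_ef by (intro sum.cong) auto
  finally show ?thesis by simp
qed

lemma ed_sum: "(\<Sum>s\<in>UNIV. ed s) = one D"
  using demb_ef[of "\<lambda>_. 1"] by (simp add: demb(3)[symmetric] dual_one)

lemma cop_gam: "cop H (gam g) = tens (gam g) (gam g)"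
proof -
  have p: "part (gcomp Y) k (one B) = (if k = \<one>\<^bsub>G\<^esub> then one B else 0)" for k
    using Y.part_homog[OF one_gcomp] by simp
  have "cop H (gam g) = (\<Sum>k\<in>UNIV. tens (smash (one B) (k \<otimes>\<^bsub>G\<^esub> g)) (smash (part (gcomp Y) k (one B)) g))"
    unfolding gam_def H_cop cop_one
    by (rule lift2_tens) (auto intro!: vlinI simp: tens_add tens_scale vlinD[OF vlin_part] sum.distrib
        vec.scale_sum_right)
  also have "\<dots> = tens (smash (one B) (\<one>\<^bsub>G\<^esub> \<otimes>\<^bsub>G\<^esub> g)) (smash (part (gcomp Y) \<one>\<^bsub>G\<^esub> (one B)) g)"
    by (rule sum_single) (simp add: p)
  finally show ?thesis by (simp add: p gam_def)
qed

text \<open>On a grouplike element the antipode axiom exhibits a left inverse, which must be the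
  inverse group element.\<close>

lemma antipode_gam: "antipode H (gam g) = gam (inv\<^bsub>G\<^esub> g)"
proof -
  let ?S = "antipode H"
  have S: "vlin ?S" "lift2 (\<lambda>a b. mul H (?S a) b) (cop H (gam g)) = cou H (gam g) *s one H"
    using is_antipode_antipode[OF double(1)] by (auto simp: is_antipode_def)
  have "mul H (?S (gam g)) (gam g) = one H"
    using S(2) unfolding cop_gam
    by (subst (asm) lift2_tens) (auto intro: Ha vlin_comp[OF S(1) Ha(2)] simp: gam_def H_cou cou_one)
  then have "mul H (mul H (?S (gam g)) (gam g)) (gam (inv\<^bsub>G\<^esub> g)) = gam (inv\<^bsub>G\<^esub> g)" by (simp add: Ha)
  then show ?thesis unfolding Ha(3) gam_mul by (simp add: gam_def[of "\<one>\<^bsub>G\<^esub>"] H_one[symmetric] Ha)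
qed

text \<open>For a group element the commutation rule of the double becomes conjugation: the delta
  function at \<open>s\<close> turns into its composite with conjugation by \<open>g\<close>, and
  this is again a delta function because the counit is invariant under the action of G.\<close>

lemma ed_gm: "mul D (ed s) (gm g) = mul D (gm g) (ed (inv\<^bsub>G\<^esub> g \<otimes>\<^bsub>G\<^esub> s \<otimes>\<^bsub>G\<^esub> g))"
proof -
  let ?f = "ef (\<lambda>k. if k = s then 1 else 0)"
  let ?F = "\<lambda>a c. demb T (\<chi> y. pairing ?f (mul H a (mul H (axis y 1) (antipode H c))))"
  have S: "vlin (antipode H)" using is_antipode_antipode[OF double(1)] by (auto simp: is_antipode_def)
  have F: "vlin (\<lambda>a. ?F a c)" "vlin (\<lambda>c. ?F a c)" for a c
    by (rule vlin_comp[OF _ demb(1)], rule vlinI,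
        simp_all add: vec_eq_iff vlinD[OF Ha(1)] vlinD[OF Ha(2)] vlinD[OF S] pairing_linear)+
  have inner: "lift2 (\<lambda>b c. mul D (emb T b) (?F a c)) (tens b c) = mul D (emb T b) (?F a c)" for a b c
    by (rule lift2_tens) (rule vlin_comp[OF emb(1) Da(2)], rule vlin_comp[OF F(2) Da(1)])
  have "mul D (ed s) (gm g) = lift2 (\<lambda>a r. lift2 (\<lambda>b c. mul D (emb T b) (?F a c)) (cop H r)) (cop H (gam g))"
    unfolding ed_def gm_def double(6) ..
  also have "\<dots> = lift2 (\<lambda>a r. lift2 (\<lambda>b c. mul D (emb T b) (?F a c)) (cop H r)) (tens (gam g) (gam g))"
    by (simp only: cop_gam)
  also have "\<dots> = lift2 (\<lambda>b c. mul D (emb T b) (?F (gam g) c)) (cop H (gam g))"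
  proof (rule lift2_tens)
    have c: "vlin (cop H)" using HD_alg(2) by (simp add: coalgebra_def)
    show "vlin (\<lambda>r. lift2 (\<lambda>b c. mul D (emb T b) (?F a c)) (cop H r))" for a
      by (rule vlin_comp[OF c vlin_lift2])
    show "vlin (\<lambda>a. lift2 (\<lambda>b c. mul D (emb T b) (?F a c)) (cop H r))" for r
      by (rule vlinI) (simp_all add: lift2_def vlinD[OF F(1)] vlinD[OF Da(1)] sum.distrib vec.scale_sum_right
          vec.scale_right_distrib vec.scale_scale mult.commute)
  qed
  also have "\<dots> = mul D (gm g) (?F (gam g) (gam g))" unfolding cop_gam inner gm_def ..
  also have "(\<chi> y. pairing ?f (mul H (gam g) (mul H (axis y 1) (antipode H (gam g))))) =
      ef (\<lambda>k. if k = inv\<^bsub>G\<^esub> g \<otimes>\<^bsub>G\<^esub> s \<otimes>\<^bsub>G\<^esub> g then 1 else 0)" (is "?l = ?r")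
  proof (subst vec_eq_iff, intro allI)
    fix p :: "'r \<times> 'g"
    obtain a k where p: "p = (a, k)" by (cases p)
    have "mul H (gam g) (mul H (axis p 1) (antipode H (gam g))) = smash (gact Y g (axis a 1))
        (g \<otimes>\<^bsub>G\<^esub> k \<otimes>\<^bsub>G\<^esub> inv\<^bsub>G\<^esub> g)"
      unfolding antipode_gam unfolding p axis_pair gam_def by (simp add: H_mul gact_one Ba Gassoc)
    then have "?l $ p = cou B (axis a 1) * (if g \<otimes>\<^bsub>G\<^esub> k \<otimes>\<^bsub>G\<^esub> inv\<^bsub>G\<^esub> g = s then 1 else 0)"
      by (simp add: pairing_ef cou_gact)
    also have "(g \<otimes>\<^bsub>G\<^esub> k \<otimes>\<^bsub>G\<^esub> inv\<^bsub>G\<^esub> g = s) = (k = inv\<^bsub>G\<^esub> g \<otimes>\<^bsub>G\<^esub> s \<otimes>\<^bsub>G\<^esub> g)"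
      by (subst eq_commute) (rule G_conj_eq)
    also have "cou B (axis a 1) * (if k = inv\<^bsub>G\<^esub> g \<otimes>\<^bsub>G\<^esub> s \<otimes>\<^bsub>G\<^esub> g then 1 else 0) = ?r $ p"
      unfolding p fn_def by (simp only: vec_lambda_beta fst_conv snd_conv)
    finally show "?l $ p = ?r $ p" .
  qed
  finally show ?thesis by (simp add: ed_def)
qed

end

lemma lin_on_sum2:
  assumes "vector_space s1" "module.subspace s1 S" "lin_on s1 S s2 T f" "\<And>i j. g i j \<in> S"
  shows "f (\<Sum>i\<in>I. \<Sum>j\<in>J. g i j) = (\<Sum>i\<in>I. \<Sum>j\<in>J. f (g i j))"
proof -
  have "(\<Sum>j\<in>J. g i j) \<in> S" for i using assms(4) by (intro subspaceD(6)[OF assms(1,2)])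
  then have "f (\<Sum>i\<in>I. \<Sum>j\<in>J. g i j) = (\<Sum>i\<in>I. f (\<Sum>j\<in>J. g i j))"
    by (rule lin_on_sum[OF assms(1-3)])
  also have "\<dots> = (\<Sum>i\<in>I. \<Sum>j\<in>J. f (g i j))"
    by (intro sum.cong refl lin_on_sum[OF assms(1-3)] assms(4))
  finally show ?thesis .
qed

context dbl begin

interpretation group G by (rule G)
interpretation Y: graded_space "(*s)" UNIV "gcomp Y" by (rule Y_gs)
interpretation R: graded_space "(*s)" UNIV "ngr T" by (rule ngr_gs)

section \<open>The subalgebra \<open>DG\<close> and the homogeneous elements of D\<close>

lemma function_algebra_eq: "function_algebra T = demb T ` range ef"
proof -
  have "(\<forall>x g. pairing f (smash x g) = cou B x * pairing f (smash (one B) g)) \<longleftrightarrow> f \<in> range ef" for f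
  proof
    assume a: "\<forall>x g. pairing f (smash x g) = cou B x * pairing f (smash (one B) g)"
    have "f = ef (\<lambda>g. pairing f (smash (one B) g))"
    proof (rule vec_eq_pairing)
      fix x g
      show "pairing f (smash x g) = pairing (ef (\<lambda>g. pairing f (smash (one B) g))) (smash x g)"
        unfolding pairing_ef using a by blast
    qed
    then show "f \<in> range ef" by blast
  qed (auto simp: pairing_ef cou_one)
  then show ?thesis unfolding function_algebra_def by simp
qed

lemma tens_one_expand: "tens (one B) a = (\<Sum>g\<in>UNIV. a $ g *s gam g)"
  by (subst vector_expand[of a]) (simp add: vlinD[OF vlin_tens(2)] gam_def)

lemma gm_group_algebra: "gm g \<in> group_algebra T"
  by (auto simp: group_algebra_def gm_def gam_def)

lemma ed_function_algebra: "ed s \<in> function_algebra T"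
  by (auto simp: function_algebra_eq ed_def)

lemma DG_eq: "DG T = vec.span {mul D (gm g) (ed s) | g s. True}" (is "_ = vec.span ?X")
proof (rule subset_antisym)
  show "vec.span ?X \<subseteq> DG T"
    unfolding DG_def using gm_group_algebra ed_function_algebra by (intro vec.span_mono) blast
  show "DG T \<subseteq> vec.span ?X"
    unfolding DG_def
  proof (rule vec.span_minimal)
    show "{mul D x y |x y. x \<in> group_algebra T \<and> y \<in> function_algebra T} \<subseteq> vec.span ?X"
    proof clarify
      fix x y assume "x \<in> group_algebra T" "y \<in> function_algebra T"
      then obtain a u where xy: "x = emb T (tens (one B) a)" "y = demb T (ef u)"
        unfolding group_algebra_def function_algebra_eq by blast
      have "mul D x y = (\<Sum>g\<in>UNIV. \<Sum>s\<in>UNIV. (a $ g * u s) *s mul D (gm g) (ed s))"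
        unfolding xy tens_one_expand demb_ef
        by (simp add: vlinD[OF emb(1)] vlinD[OF Da(1)] vlinD[OF Da(2)] gm_def[symmetric] vec.scale_sum_right)
          (subst sum.swap, simp add: mult.commute)
      also have "\<dots> \<in> vec.span ?X" by (intro vec.span_sum vec.span_scale vec.span_base) blast
      finally show "mul D x y \<in> vec.span ?X" .
    qed
  qed simp
qed

lemma DG_base: "mul D (gm g) (ed s) \<in> DG T"
  unfolding DG_eq by (rule vec.span_base) blast

lemma DG_subspace: "vec.subspace (DG T)"
  unfolding DG_def by simp

lemma gm_DG: "gm g \<in> DG T"
proof -
  have "gm g = (\<Sum>s\<in>UNIV. mul D (gm g) (ed s))"
    by (simp add: vlinD[OF Da(1), symmetric] ed_sum Da)
  also have "\<dots> \<in> DG T" by (intro vec.subspace_sum[OF DG_subspace] DG_base)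
  finally show ?thesis .
qed

lemma ed_DG: "ed s \<in> DG T"
  using DG_base[of "\<one>\<^bsub>G\<^esub>" s] by (simp add: gm_one Da)

text \<open>\<open>ed_gm\<close> moves \<open>ed s\<close> past \<open>gm h\<close>; afterwards the
  group elements multiply, and the two idempotents either agree or annihilate each other.\<close>

lemma DG_mul_base: "mul D (mul D (gm g) (ed s)) (mul D (gm h) (ed t)) \<in> DG T"
proof -
  have "mul D (mul D (gm g) (ed s)) (mul D (gm h) (ed t)) = mul D (gm g) (mul D (mul D (ed s) (gm h)) (ed t))"
    by (simp add: Da)
  also have "\<dots> = mul D (mul D (gm g) (gm h)) (mul D (ed (inv\<^bsub>G\<^esub> h \<otimes>\<^bsub>G\<^esub> s \<otimes>\<^bsub>G\<^esub> h)) (ed t))"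
    unfolding ed_gm by (simp add: Da)
  also have "\<dots> \<in> DG T"
    unfolding gm_mul ed_mul using DG_base vec.subspace_0[OF DG_subspace] by (auto simp: vlinD[OF Da(1)])
  finally show ?thesis .
qed

lemma DG_subalgebra: "subalgebra D (DG T)"
  unfolding subalgebra_def
proof (intro conjI ballI)
  show "one D \<in> DG T" using gm_DG[of "\<one>\<^bsub>G\<^esub>"] by (simp add: gm_one)
  have 1: "mul D (mul D (gm g) (ed s)) y \<in> DG T" if "y \<in> DG T" for g s y
    using that unfolding DG_eq
  proof (induction rule: vec.span_induct_alt)
    case (step c x y)
    then show ?case using DG_mul_base unfolding DG_eq
      by (auto simp: vlinD[OF Da(1)] intro!: vec.span_add vec.span_scale)
  qed (simp add: vlinD[OF Da(1)] vec.span_zero)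
  show "mul D x y \<in> DG T" if "x \<in> DG T" "y \<in> DG T" for x y
    using that(1) unfolding DG_eq
  proof (induction rule: vec.span_induct_alt)
    case (step c x z)
    then show ?case using 1[OF that(2)] unfolding DG_eq
      by (auto simp: vlinD[OF Da(2)] intro!: vec.span_add vec.span_scale)
  qed (simp add: vlinD[OF Da(2)] vec.span_zero)
qed (rule DG_subspace)

lemma one_DG: "one D \<in> DG T"
  using subalgebraD(1)[OF DG_subalgebra] .

lemma nich_part_0: "nich_part T 0 = range (\<lambda>c. c *s one D)"
proof -
  have "emb T (smash (one B) \<one>\<^bsub>G\<^esub>) = one D" using emb(3) by (simp only: H_one)
  then have "emb T (smash (c *s one B) \<one>\<^bsub>G\<^esub>) = c *s one D" for c
    by (simp add: tens_scale vlinD[OF emb(1)])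
  moreover have "{smash x \<one>\<^bsub>G\<^esub> | x. x \<in> range (\<lambda>c. c *s one B)} = range (\<lambda>c. smash (c *s one B) \<one>\<^bsub>G\<^esub>)"
    by blast
  ultimately show ?thesis unfolding nich_part_def ngr_0 by (simp add: image_image)
qed

lemma smash_gam: "smash x g = mul H (smash x \<one>\<^bsub>G\<^esub>) (gam g)" "mul H (smash x h) (gam g) = smash x (h \<otimes>\<^bsub>G\<^esub> g)"
  by (simp_all add: gam_def H_mul gact_one Ba)

text \<open>A functional that is constant in the group variable is invariant under right
  multiplication by G, and its degree is that of \<open>y\<close>.\<close>

lemma fn_dnich:
  assumes y: "\<And>x x'. y (x + x') = y x + y x'" "\<And>c x. y (c *s x) = c * y x"
    and z: "\<And>m x. m \<noteq> j \<Longrightarrow> x \<in> ngr T m \<Longrightarrow> y x = 0"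
  shows "demb T (fn y (\<lambda>_. 1)) \<in> dnich_part T j"
proof -
  have "pairing (fn y (\<lambda>_. 1)) (mul H u (gam g)) = pairing (fn y (\<lambda>_. 1)) u" for u g
  proof -
    have "pairing (fn y (\<lambda>_. 1)) (mul H u (gam g)) = (\<Sum>h\<in>UNIV. y (slice u h))"
      by (subst smash_slices[of u]) (simp add: vlinD[OF Ha(2)] smash_gam(2) pairing_sum pairing_fn[OF y])
    also have "\<dots> = pairing (fn y (\<lambda>_. 1)) u"
      by (subst (2) smash_slices[of u]) (simp add: pairing_sum pairing_fn[OF y])
    finally show ?thesis .
  qed
  then show ?thesis unfolding dnich_part_def using z by (auto simp: pairing_fn[OF y] gam_def[symmetric])
qed

lemma one_dnich_0: "one D \<in> dnich_part T 0"
  using fn_dnich[of "cou B" 0] cou_ngr by (auto simp: cou_linear dual_one[symmetric] demb(3))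

text \<open>The dual side is connected as well: right invariance and support in degree zero leave a
  functional that is determined by its value on \<open>1 # 1\<close>, hence a multiple of the
  counit.\<close>

lemma dnich_part_0:
  assumes "z \<in> dnich_part T 0"
  obtains c where "z = c *s one D"
proof -
  obtain f where f: "z = demb T f" "\<And>u g. pairing f (mul H u (gam g)) = pairing f u"
    "\<And>m x g. m \<noteq> 0 \<Longrightarrow> x \<in> ngr T m \<Longrightarrow> pairing f (smash x g) = 0"
    using assms by (auto simp: dnich_part_def gam_def)
  let ?c = "pairing f (gam \<one>\<^bsub>G\<^esub>)"
  have hom: "pairing f (smash x g) = ?c * cou B x" if x: "x \<in> ngr T m" for m x g
  proof (cases "m = 0")
    case True
    then obtain c where c: "x = c *s one B" using x ngr_0 by auto
    have "pairing f (smash x g) = c * pairing f (mul H (gam \<one>\<^bsub>G\<^esub>) (gam g))"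
      unfolding c gam_mul by (simp add: tens_scale pairing_linear gam_def)
    then show ?thesis using f(2) by (simp add: c cou_linear cou_one)
  next
    case False
    then show ?thesis using f(3)[OF False x] cou_ngr[OF x False] by simp
  qed
  have "f = ?c *s ef (\<lambda>_. 1)"
  proof (rule vec_eq_pairing)
    fix x g
    let ?I = "{i. ngr T i \<noteq> {0}}"
    have "pairing f (smash x g) = (\<Sum>i\<in>?I. pairing f (smash (part (ngr T) i x) g))"
      by (subst R.sum_parts[OF UNIV_I R.fin_supp subset_refl, of x]) (simp add: vlinD[OF vlin_tens(1)] pairing_sum)
    also have "\<dots> = (\<Sum>i\<in>?I. ?c * cou B (part (ngr T) i x))"
      by (intro sum.cong refl hom[OF R.part_in]) simp
    also have "\<dots> = ?c * cou B x"
      by (subst (2) R.sum_parts[OF UNIV_I R.fin_supp subset_refl, of x]) (simp add: cou_sum sum_distrib_left)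
    finally show "pairing f (smash x g) = pairing (?c *s ef (\<lambda>_. 1)) (smash x g)"
      by (simp add: pairing_linear pairing_ef)
  qed
  then have "z = demb T (?c *s ef (\<lambda>_. 1))" unfolding f(1) by (rule arg_cong)
  also have "\<dots> = ?c *s one D" by (simp only: vlinD[OF demb(1)] dual_one[symmetric] demb(3))
  finally show ?thesis by (rule that)
qed

lemma DgrI: "x \<in> nich_part T i \<Longrightarrow> d \<in> DG T \<Longrightarrow> y \<in> dnich_part T j \<Longrightarrow> mul D (mul D x d) y \<in> Dgr T (int j - int i)"
  unfolding Dgr_def by (rule vec.span_base) blast

lemma one_nich_0: "one D \<in> nich_part T 0"
  unfolding nich_part_0 by (metis rangeI vec.scale_one)

lemma DG_Dgr: "d \<in> DG T \<Longrightarrow> d \<in> Dgr T 0"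
  using DgrI[OF one_nich_0 _ one_dnich_0, of d] by (simp add: Da)

lemma dnich_Dgr: "y \<in> dnich_part T j \<Longrightarrow> y \<in> Dgr T (int j)"
  using DgrI[OF one_nich_0 one_DG, of y j] by (simp add: Da)

lemma nich_Dgr: "x \<in> nich_part T i \<Longrightarrow> x \<in> Dgr T (- int i)"
  using DgrI[OF _ one_DG one_dnich_0, of x i] by (simp add: Da)

text \<open>The coordinate functional at \<open>a\<close> is the sum of its composites with the
  projections to the degrees \<open>j\<close>.\<close>

lemma axis_expand: "axis (a, g) (1::'k) = (\<Sum>j | ngr T j \<noteq> {0}. fn (\<lambda>x. part (ngr T) j x $ a) (\<lambda>h. if h
    = g then 1 else 0))"
proof -
  have p: "(\<Sum>j | ngr T j \<noteq> {0}. part (ngr T) j x $ a) = x $ a" for x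
    using arg_cong[OF R.sum_parts[OF UNIV_I R.fin_supp subset_refl, of x], of "\<lambda>x. x $ a"] by simp
  show ?thesis
    by (simp add: vec_eq_iff fn_def sum_distrib_right[symmetric] p) (simp add: axis_def)
qed

text \<open>Surjectivity of the multiplication map of the double reduces this to products of basis
  vectors. Each factor is split by degree, and the group element and the delta function are gathered
  in the middle, where they form an element of \<open>DG\<close>.\<close>

lemma Dgr_span: "vec.span (\<Union>n. Dgr T n) = UNIV"
proof -
  let ?S = "vec.span (\<Union>n. Dgr T n)" and ?I = "{j. ngr T j \<noteq> {0}}"
  let ?y = "\<lambda>a j. \<lambda>x. part (ngr T) j x $ a" and ?d = "\<lambda>g h. if h = g then 1 else (0::'k)"
  have y: "?y a j (x + x') = ?y a j x + ?y a j x'" "?y a j (c *s x) = c * ?y a j x" for a j c x x'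
    using lin_onD(2,3)[OF R.part_lin] by auto
  have base: "mul D (emb T (smash (part (ngr T) i x) g)) (demb T (fn (?y a j) (?d h))) \<in> ?S" for i x g a j h
  proof -
    have e: "emb T (smash (part (ngr T) i x) g) = mul D (emb T (smash (part (ngr T) i x) \<one>\<^bsub>G\<^esub>)) (gm g)"
      by (subst smash_gam(1)) (simp add: emb(2) gm_def)
    \<comment> \<open>A functional of this form is a delta function on G times a right invariant
      functional of degree \<open>j\<close>.\<close>
    have "mul (dual_op H) (ef (?d h)) (fn (?y a j) (\<lambda>_. 1)) = fn (?y a j) (?d h)"
      using fn_mul[of "?y a j", OF y] by simp
    then have d: "demb T (fn (?y a j) (?d h)) = mul D (ed h) (demb T (fn (?y a j) (\<lambda>_. 1)))"
      by (metis demb(2) ed_def)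
    have "mul D (emb T (smash (part (ngr T) i x) g)) (demb T (fn (?y a j) (?d h)))
      = mul D (mul D (emb T (smash (part (ngr T) i x) \<one>\<^bsub>G\<^esub>)) (mul D (gm g) (ed h))) (demb T (fn (?y a j) (\<lambda>_. 1)))"
      unfolding e d by (simp add: Da)
    also have "\<dots> \<in> Dgr T (int j - int i)"
    proof (rule DgrI[OF _ DG_base])
      show "emb T (smash (part (ngr T) i x) \<one>\<^bsub>G\<^esub>) \<in> nich_part T i"
        unfolding nich_part_def using R.part_in by blast
      show "demb T (fn (?y a j) (\<lambda>_. 1)) \<in> dnich_part T j"
        by (rule fn_dnich[of "?y a j", OF y]) (use R.part_homog in auto)
    qed
    finally show ?thesis by (intro vec.span_base) blast
  qed
  have "mul D (emb T (axis p 1)) (demb T (axis q 1)) \<in> ?S" for p q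
  proof -
    obtain a g b h where pq: "p = (a, g)" "q = (b, h)" by (cases p, cases q)
    have "axis p 1 = (\<Sum>i\<in>?I. smash (part (ngr T) i (axis a 1)) g)"
      unfolding pq axis_pair by (subst R.sum_parts[OF UNIV_I R.fin_supp subset_refl, of "axis a 1"])
          (simp add: vlinD[OF vlin_tens(1)])
    moreover have "axis q 1 = (\<Sum>j\<in>?I. fn (?y b j) (?d h))" unfolding pq by (rule axis_expand)
    ultimately have "mul D (emb T (axis p 1)) (demb T (axis q 1)) =
      (\<Sum>j\<in>?I. \<Sum>i\<in>?I. mul D (emb T (smash (part (ngr T) i (axis a 1)) g)) (demb T (fn (?y b j) (?d h))))"
      by (simp only: vlinD[OF emb(1)] vlinD[OF demb(1)] vlinD[OF Da(1)] vlinD[OF Da(2)])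
    also have "\<dots> \<in> ?S" by (intro vec.span_sum base)
    finally show ?thesis .
  qed
  then have *: "lift2 (\<lambda>h f. mul D (emb T h) (demb T f)) t \<in> ?S" for t
    unfolding lift2_def by (intro vec.span_sum vec.span_scale)
  have "x \<in> ?S" for x
  proof -
    obtain t where "x = lift2 (\<lambda>h f. mul D (emb T h) (demb T f)) t"
      using bij_is_surj[OF double(5)] by (rule surjE)
    then show ?thesis using * by (simp only:)
  qed
  then show ?thesis by blast
qed

text \<open>\<open>DG\<close> is spanned by the products of \<open>gm g\<close> and
  \<open>ed s\<close>, so equivariance under these two families suffices.\<close>

lemma DG_homsI:
  assumes M: "fd_module D (DG T) M" and N: "fd_module D (DG T) N"
    and h: "lin_on (scl M) (car M) (scl N) (car N) h" "\<And>v. v \<notin> car M \<Longrightarrow> h v = 0"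
    and eq: "\<And>g v. v \<in> car M \<Longrightarrow> h (act M (gm g) v) = act N (gm g) (h v)"
      "\<And>s v. v \<in> car M \<Longrightarrow> h (act M (ed s) v) = act N (ed s) (h v)"
  shows "h \<in> homs (DG T) M N"
proof (rule homsI[OF h(1) _ h(2)])
  note M' = fd_moduleD[OF M] and N' = fd_moduleD[OF N] and A = subalgebraD[OF DG_subalgebra]
  fix x v assume "x \<in> DG T" and v: "v \<in> car M"
  from this(1)[unfolded DG_eq] have "x \<in> DG T \<and> h (act M x v) = act N x (h v)"
  proof (induction rule: vec.span_induct_alt)
    case base
    have "(0::'k^'d) \<in> DG T" using vec.subspace_0[OF DG_subspace] .
    moreover have "act M 0 v = 0" "act N 0 (h v) = 0"
      using lin_on_zero[OF vec.vector_space_axioms DG_subspace M'(5)[OF v]]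
        lin_on_zero[OF vec.vector_space_axioms DG_subspace N'(5)[OF lin_onD(1)[OF h(1) v]]] by auto
    moreover have "h 0 = 0" using lin_on_zero[OF M'(2,3) h(1)] .
    ultimately show ?case by simp
  next
    case (step c x y)
    then obtain g s where x: "x = mul D (gm g) (ed s)" by blast
    have xD: "x \<in> DG T" unfolding x by (rule DG_base)
    have "act M x v = act M (gm g) (act M (ed s) v)" unfolding x using M'(7)[OF gm_DG ed_DG v] .
    moreover have "act N x (h v) = act N (gm g) (act N (ed s) (h v))"
      unfolding x using N'(7)[OF gm_DG ed_DG lin_onD(1)[OF h(1) v]] .
    ultimately have hx: "h (act M x v) = act N x (h v)"
      using eq(1)[OF M'(8)[OF ed_DG v]] eq(2)[OF v] by simp
    have m: "act M (c *s x + y) v = scl M c (act M x v) + act M y v"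
      using lin_onD(2,3)[OF M'(5)[OF v]] A(4)[OF xD] xD step.IH by simp
    have n: "act N (c *s x + y) (h v) = scl N c (act N x (h v)) + act N y (h v)"
      using lin_onD(2,3)[OF N'(5)[OF lin_onD(1)[OF h(1) v]]] A(4)[OF xD] xD step.IH by simp
    have "act M x v \<in> car M" "act M y v \<in> car M" using M'(8)[OF _ v] xD step.IH by auto
    then have "h (act M (c *s x + y) v) = act N (c *s x + y) (h v)"
      unfolding m n using lin_onD(2,3)[OF h(1)] subspaceD(3)[OF M'(2,3)] hx step.IH by simp
    then show ?case using A(3)[OF A(4)[OF xD]] step.IH by blast
  qed
  then show "h (act M x v) = act N x (h v)" ..
qed

section \<open>Semisimplicity of the double of the group\<close>

text \<open>Maschke's theorem for the double of the group: average a linear lift over the elements \<open>g e\<^sub>s\<close>.\<close>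

lemma DG_lift:
  assumes M: "fd_module D (DG T) M" and N: "fd_module D (DG T) N" and N'': "fd_module D (DG T) N''"
    and g: "g \<in> homs (DG T) N N''" "g ` car N = car N''" and f: "f \<in> homs (DG T) M N''"
  shows "\<exists>h\<in>homs (DG T) M N. \<forall>v\<in>car M. g (h v) = f v"
proof -
  note M' = fd_moduleD[OF M] and N' = fd_moduleD[OF N] and N2 = fd_moduleD[OF N'']
  note f' = homsD[OF f] and g' = homsD[OF g(1)]
  interpret sN: vector_space "scl N" by (rule N'(2))
  obtain \<sigma> where \<sigma>: "lin_on (scl N'') (car N'') (scl N) (car N) \<sigma>" "\<And>y. y \<in> car N'' \<Longrightarrow> g (\<sigma> y) = y"
    using lin_on_section[OF N'(1) N2(2) g'(1) g(2)] by blast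
  define h0 where "h0 v = \<sigma> (f v)" for v
  have h0: "lin_on (scl M) (car M) (scl N) (car N) h0" "\<And>v. v \<in> car M \<Longrightarrow> g (h0 v) = f v"
    unfolding h0_def using lin_on_comp[OF f'(1) \<sigma>(1)] f'(4) \<sigma>(2) by auto
  \<comment> \<open>The order of G is invertible in characteristic zero.\<close>
  define w :: 'k where "w = inverse (of_nat (card (UNIV :: 'g set)))"
  \<comment> \<open>Summing over \<open>s\<close> the cuts by \<open>ed s\<close> on both sides
    makes the linear lift \<open>h0\<close> compatible with the idempotents; summing the conjugates
    over \<open>k\<close> makes it compatible with G.\<close>
  define q where "q k s v = act N (gm k) (act N (ed s) (h0 (act M (ed s) (act M (gm (inv\<^bsub>G\<^esub> k)) v))))" for k s v
  define h where "h v = (if v \<in> car M then scl N w (\<Sum>k\<in>UNIV. \<Sum>s\<in>UNIV. q k s v) else 0)" for v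
  have lM: "lin_on (scl M) (car M) (scl M) (car M) (act M x)"
      and lN: "lin_on (scl N) (car N) (scl N) (car N) (act N x)"
    if "x \<in> DG T" for x using M'(4) N'(4) that by auto
  have q: "lin_on (scl M) (car M) (scl N) (car N) (q k s)" for k s
  proof -
    have "lin_on (scl M) (car M) (scl M) (car M) (\<lambda>v. act M (ed s) (act M (gm (inv\<^bsub>G\<^esub> k)) v))"
      using M'(8) gm_DG by (intro lin_on_comp[OF lM lM]) (auto intro: ed_DG)
    then have "lin_on (scl M) (car M) (scl N) (car N) (\<lambda>v. h0 (act M (ed s) (act M (gm (inv\<^bsub>G\<^esub> k)) v)))"
      using M'(8) gm_DG ed_DG by (intro lin_on_comp[OF _ h0(1)]) auto
    then have "lin_on (scl M) (car M) (scl N) (car N) (\<lambda>v. act N (ed s) (h0 (act M (ed s) (act M (gm (inv\<^bsub>G\<^esub> k))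
        v))))"
      using lin_onD(1)[OF h0(1)] M'(8) gm_DG ed_DG by (intro lin_on_comp[OF _ lN]) auto
    then show ?thesis
      unfolding q_def[abs_def] using lin_onD(1)[OF h0(1)] M'(8) N'(8) gm_DG ed_DG by (intro lin_on_comp[OF _ lN]) auto
  qed
  note q' = lin_onD[OF q]
  have qs: "(\<Sum>k\<in>UNIV. \<Sum>s\<in>UNIV. q k s v) \<in> car N" if "v \<in> car M" for v
    using q'(1)[OF that] by (intro subspaceD(6)[OF N'(2,3)])
  have "h \<in> homs (DG T) M N"
  proof (rule DG_homsI[OF M N])
    show "lin_on (scl M) (car M) (scl N) (car N) h"
      unfolding lin_on_def h_def
      using q' qs subspaceD(2,3)[OF M'(2,3)] subspaceD(3)[OF N'(2,3)]
      by (auto simp: sum.distrib sN.scale_right_distrib sN.scale_sum_right[symmetric] mult.commute)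
    show "h v = 0" if "v \<notin> car M" for v using that by (simp add: h_def)
    fix v assume v: "v \<in> car M"
    show "h (act M (gm c) v) = act N (gm c) (h v)" for c
    proof -
      \<comment> \<open>Multiplication by \<open>c\<close> permutes the summands, as in the usual
        averaging.\<close>
      have qc: "q (c \<otimes>\<^bsub>G\<^esub> k) s (act M (gm c) v) = act N (gm c) (q k s v)" for k s
      proof -
        have "act M (gm (inv\<^bsub>G\<^esub> (c \<otimes>\<^bsub>G\<^esub> k))) (act M (gm c) v) = act M (gm (inv\<^bsub>G\<^esub> k)) v"
        proof -
          have "inv\<^bsub>G\<^esub> (c \<otimes>\<^bsub>G\<^esub> k) \<otimes>\<^bsub>G\<^esub> c = inv\<^bsub>G\<^esub> k"
            using G(2) by (simp add: inv_mult_group Gassoc)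
          then show ?thesis using M'(7)[OF gm_DG gm_DG v, symmetric] by (simp add: gm_mul)
        qed
        moreover have "act N (gm (c \<otimes>\<^bsub>G\<^esub> k)) u = act N (gm c) (act N (gm k) u)" if "u \<in> car N" for u
          using N'(7)[OF gm_DG gm_DG that] by (simp add: gm_mul)
        ultimately show ?thesis
          unfolding q_def using N'(8) M'(8) gm_DG ed_DG lin_onD(1)[OF h0(1)] v by simp
      qed
      have inj: "inj (\<lambda>k. c \<otimes>\<^bsub>G\<^esub> k)" using G(2) by (auto intro!: injI)
      then have bij: "bij (\<lambda>k. c \<otimes>\<^bsub>G\<^esub> k)" by (simp add: finite_UNIV_inj_surj bij_def)
      have "(\<Sum>k\<in>UNIV. \<Sum>s\<in>UNIV. q k s (act M (gm c) v)) = (\<Sum>k\<in>UNIV. \<Sum>s\<in>UNIV. q (c \<otimes>\<^bsub>G\<^esub> k) s (act M (gm c) v))"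
        by (rule sum.reindex_bij_betw[OF bij, symmetric])
      also have "\<dots> = (\<Sum>k\<in>UNIV. \<Sum>s\<in>UNIV. act N (gm c) (q k s v))" by (simp add: qc)
      also have "\<dots> = act N (gm c) (\<Sum>k\<in>UNIV. \<Sum>s\<in>UNIV. q k s v)"
        by (rule lin_on_sum2[OF N'(2,3) lN[OF gm_DG] q'(1)[OF v], symmetric])
      finally show ?thesis
        unfolding h_def using v M'(8)[OF gm_DG v] lin_onD(3)[OF lN[OF gm_DG] qs[OF v]] by simp
    qed
    show "h (act M (ed t) v) = act N (ed t) (h v)" for t
    proof -
      let ?t = "\<lambda>k. inv\<^bsub>G\<^esub> k \<otimes>\<^bsub>G\<^esub> t \<otimes>\<^bsub>G\<^esub> k"
      have c0: "act M 0 u = 0" if "u \<in> car M" for u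
        using lin_on_zero[OF vec.vector_space_axioms DG_subspace M'(5)[OF that]] .
      have c1: "act N 0 u = 0" if "u \<in> car N" for u
        using lin_on_zero[OF vec.vector_space_axioms DG_subspace N'(5)[OF that]] .
      have n0: "act N x 0 = 0" if "x \<in> DG T" for x using lin_on_zero[OF N'(2,3) lN[OF that]] .
      have h00: "h0 0 = 0" using lin_on_zero[OF M'(2,3) h0(1)] .
      have eM: "act M (ed s) (act M (ed s') u) = (if s = s' then act M (ed s) u else 0)" if "u \<in> car M" for s s' u
        using M'(7)[OF ed_DG ed_DG that, symmetric] c0[OF that] by (simp add: ed_mul)
      have eN: "act N (ed s) (act N (ed s') u) = (if s = s' then act N (ed s) u else 0)" if "u \<in> car N" for s s' u
        using N'(7)[OF ed_DG ed_DG that, symmetric] c1[OF that] by (simp add: ed_mul)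
      \<comment> \<open>Passing \<open>ed t\<close> through the group element conjugates it to
        \<open>ed (?t k)\<close>. Applied before or after \<open>q k s\<close>, it therefore selects
        the same summand, that with \<open>s = ?t k\<close>.\<close>
      have qt: "q k s (act M (ed t) v) = (if s = ?t k then q k s v else 0)"
        "act N (ed t) (q k s v) = (if s = ?t k then q k s v else 0)" for k s
      proof -
        have "ed (?t k) = ed (inv\<^bsub>G\<^esub> k \<otimes>\<^bsub>G\<^esub> t \<otimes>\<^bsub>G\<^esub> k)" ..
        have cm: "mul D (gm (inv\<^bsub>G\<^esub> k)) (ed t) = mul D (ed (?t k)) (gm (inv\<^bsub>G\<^esub> k))"
        proof -
          have "inv\<^bsub>G\<^esub> (inv\<^bsub>G\<^esub> k) \<otimes>\<^bsub>G\<^esub> ?t k \<otimes>\<^bsub>G\<^esub> inv\<^bsub>G\<^esub> k = t"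
            using G_conj_eq[of t k "?t k"] by simp
          then show ?thesis using ed_gm[of "?t k" "inv\<^bsub>G\<^esub> k"] by simp
        qed
        have "act M (gm (inv\<^bsub>G\<^esub> k)) (act M (ed t) v) = act M (ed (?t k)) (act M (gm (inv\<^bsub>G\<^esub> k)) v)"
          using M'(7)[OF gm_DG ed_DG v, symmetric] M'(7)[OF ed_DG gm_DG v, symmetric] cm by simp
        then show "q k s (act M (ed t) v) = (if s = ?t k then q k s v else 0)"
          unfolding q_def using eM[OF M'(8)[OF gm_DG v]] by (simp add: h00 n0 gm_DG ed_DG)
        let ?u = "act N (ed s) (h0 (act M (ed s) (act M (gm (inv\<^bsub>G\<^esub> k)) v)))"
        have hc: "h0 (act M (ed s) (act M (gm (inv\<^bsub>G\<^esub> k)) v)) \<in> car N"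
          using lin_onD(1)[OF h0(1)] M'(8) gm_DG ed_DG v by simp
        have u: "?u \<in> car N" using N'(8)[OF ed_DG hc] .
        have "act N (ed t) (q k s v) = act N (mul D (ed t) (gm k)) ?u"
          unfolding q_def using N'(7)[OF ed_DG gm_DG u] by simp
        also have "\<dots> = act N (gm k) (act N (ed (?t k)) ?u)"
          unfolding ed_gm using N'(7)[OF gm_DG ed_DG u] by simp
        finally show "act N (ed t) (q k s v) = (if s = ?t k then q k s v else 0)"
          using eN[OF hc, of "?t k" s] by (auto simp: q_def n0 gm_DG)
      qed
      have "act N (ed t) (\<Sum>k\<in>UNIV. \<Sum>s\<in>UNIV. q k s v) = (\<Sum>k\<in>UNIV. \<Sum>s\<in>UNIV. act N (ed t) (q k s v))"
        by (rule lin_on_sum2[OF N'(2,3) lN[OF ed_DG] q'(1)[OF v]])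
      then have "(\<Sum>k\<in>UNIV. \<Sum>s\<in>UNIV. q k s (act M (ed t) v)) = act N (ed t) (\<Sum>k\<in>UNIV. \<Sum>s\<in>UNIV. q k s v)"
        by (simp only: qt)
      then show ?thesis
        unfolding h_def using v M'(8)[OF ed_DG v] lin_onD(3)[OF lN[OF ed_DG] qs[OF v]] by simp
    qed
  qed
  moreover have "g (h v) = f v" if v: "v \<in> car M" for v
  proof -
    have gq: "g (q k s v) = f (act M (gm k) (act M (ed s) (act M (gm (inv\<^bsub>G\<^esub> k)) v)))" for k s
    proof -
      let ?u = "act M (gm (inv\<^bsub>G\<^esub> k)) v"
      have u: "?u \<in> car M" "act M (ed s) ?u \<in> car M" using M'(8) gm_DG ed_DG v by auto
      have "g (q k s v) = act N'' (gm k) (act N'' (ed s) (f (act M (ed s) ?u)))"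
        unfolding q_def using g'(2) h0(2)[OF u(2)] lin_onD(1)[OF h0(1) u(2)] N'(8) gm_DG ed_DG by simp
      also have "\<dots> = f (act M (gm k) (act M (ed s) (act M (ed s) ?u)))"
        using f'(2) u M'(8) gm_DG ed_DG by simp
      also have "act M (ed s) (act M (ed s) ?u) = act M (ed s) ?u"
        using M'(7)[OF ed_DG ed_DG u(1), of s s] by (simp add: ed_mul)
      finally show ?thesis .
    qed
    \<comment> \<open>For each \<open>k\<close> the sum over \<open>s\<close> is the identity, since
      the idempotents add up to one; the sum over G then contributes the factor that
      \<open>w\<close> cancels.\<close>
    have "(\<Sum>s\<in>UNIV. act M (gm k) (act M (ed s) (act M (gm (inv\<^bsub>G\<^esub> k)) v))) = v" for k
    proof -
      let ?u = "act M (gm (inv\<^bsub>G\<^esub> k)) v"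
      have u: "?u \<in> car M" using M'(8) gm_DG v by auto
      have "(\<Sum>s\<in>UNIV. act M (ed s) ?u) = act M (one D) ?u"
        unfolding ed_sum[symmetric] using ed_DG by (subst lin_on_sum[OF vec.vector_space_axioms DG_subspace
            M'(5)[OF u]]) auto
      then have "(\<Sum>s\<in>UNIV. act M (ed s) ?u) = ?u" using M'(6)[OF u] by simp
      moreover have "act M (gm k) (\<Sum>s\<in>UNIV. act M (ed s) ?u) = (\<Sum>s\<in>UNIV. act M (gm k) (act M (ed s) ?u))"
        using M'(8)[OF ed_DG u] by (intro lin_on_sum[OF M'(2,3) lM[OF gm_DG]])
      moreover have "act M (gm k) ?u = v"
        using M'(7)[OF gm_DG gm_DG v, of k "inv\<^bsub>G\<^esub> k"] M'(6)[OF v] by (simp add: gm_mul gm_one)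
      ultimately show ?thesis by simp
    qed
    moreover have "f (\<Sum>s\<in>UNIV. act M (gm k) (act M (ed s) (act M (gm (inv\<^bsub>G\<^esub> k)) v))) = (\<Sum>s\<in>UNIV. g (q k s v))" for k
      unfolding gq using M'(8) gm_DG ed_DG v by (intro lin_on_sum[OF M'(2,3) f'(1)]) auto
    ultimately have s1: "(\<Sum>s\<in>UNIV. g (q k s v)) = f v" for k by metis
    have "g (\<Sum>k\<in>UNIV. \<Sum>s\<in>UNIV. q k s v) = (\<Sum>k\<in>UNIV. \<Sum>s\<in>UNIV. g (q k s v))"
      by (rule lin_on_sum2[OF N'(2,3) g'(1) q'(1)[OF v]])
    also have "\<dots> = scl N'' (of_nat (card (UNIV :: 'g set))) (f v)"
    proof -
      interpret s2: vector_space "scl N''" by (rule N2(2))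
      have "(\<Sum>k\<in>K. f v) = scl N'' (of_nat (card K)) (f v)" if "finite K" for K :: "'g set"
        using that by induction (auto simp: s2.scale_left_distrib)
      then show ?thesis by (simp add: s1)
    qed
    finally show ?thesis
      unfolding h_def using v lin_onD(3)[OF g'(1) qs[OF v]] vector_space.vector_space_assms(3)[OF N2(2)]
        vector_space.vector_space_assms(4)[OF N2(2)] by (simp add: w_def)
  qed
  ultimately show ?thesis by blast
qed

end

section \<open>Simple modules and Schur's lemma\<close>

lemma hom_dim_eq_0: "F = {0} \<Longrightarrow> vector_space (scl N) \<Longrightarrow> hom_dim N F = 0"
  unfolding hom_dim_def using vs_dim_0[OF vector_space_fscale] by simp

lemma simple_moduleD:
  assumes "simple_module D A S"
  shows "fd_module D A S" "car S \<noteq> {0}" "\<And>U. submodule A S U \<Longrightarrow> U = {0} \<or> U = car S"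
  using assms by (auto simp: simple_module_def)

lemma homs_ne_0: "f \<in> homs A M N \<Longrightarrow> f \<noteq> 0 \<Longrightarrow> \<exists>v\<in>car M. f v \<noteq> 0"
  using homsD(3) by (fastforce simp: fun_eq_iff)

lemma simple_hom_inj:
  assumes S: "simple_module D A S" and N: "fd_module D A N" and f: "f \<in> homs A S N" "f \<noteq> 0"
  shows "{v \<in> car S. f v = 0} = {0}" "inj_on f (car S)"
proof -
  note S' = simple_moduleD[OF S]
  have "{v \<in> car S. f v = 0} \<noteq> car S" using homs_ne_0[OF f] by auto
  then show *: "{v \<in> car S. f v = 0} = {0}"
    using S'(3)[OF hom_kernel_submodule[OF S'(1) N f(1)]] by blast
  show "inj_on f (car S)" by (rule homs_injI[OF S'(1) f(1) *])
qed

lemma simple_hom_onto: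
  assumes S: "simple_module D A S" and M: "fd_module D A M" and f: "f \<in> homs A M S" "f \<noteq> 0"
  shows "f ` car M = car S"
proof -
  note S' = simple_moduleD[OF S]
  have "f ` car M \<noteq> {0}" using homs_ne_0[OF f] by auto
  then show ?thesis using S'(3)[OF hom_image_submodule[OF M S'(1) f(1) submodule_car[OF M]]] by blast
qed

text \<open>\<open>F\<close> is a subspace of \<open>homs\<close>, not necessarily all of it, in
  order to cover graded homomorphisms of a fixed degree as well.\<close>

lemma hom_dim_schur:
  fixes N :: "('k::alg_closed_field, 'd::finite, 'n::ab_group_add, 'z) rep_scheme"
  assumes M: "fd_module D A M" and N: "fd_module D A N" "car N \<noteq> {0}"
    and F: "module.subspace (fscale (scl N)) F" "F \<subseteq> homs A M N"
    and sch: "\<And>h. h \<in> F \<Longrightarrow> h \<noteq> 0 \<Longrightarrow> h ` car M = car N \<and> {v \<in> car M. h v = 0} = K"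
    and ne: "F \<noteq> {0}"
  shows "hom_dim N F = 1"
proof -
  note vf = vector_space_fscale[OF fd_moduleD(2)[OF N(1)]]
  obtain h where h: "h \<in> F" "h \<noteq> 0" using ne subspaceD(1)[OF vf F(1)] by blast
  show ?thesis
    unfolding hom_dim_def
  proof (rule dim_eq_1[OF vf F(1) h])
    fix h' assume "h' \<in> F"
    then show "\<exists>c. h' = (\<lambda>v. scl N c (h v))"
      using F(2) homsD(1)
      by (intro schur_proportional[OF fd_moduleD(2,3)[OF M] fd_moduleD(1)[OF N(1)] N(2) F(1) _ sch h]) blast+
  qed
qed

lemma hom_dim_simple:
  fixes S' :: "('k::alg_closed_field, 'd::finite, 'n::ab_group_add, 'z) rep_scheme"
  assumes S: "simple_module D A S" and S': "simple_module D A S'"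
  shows "hom_dim S' (homs A S S') = (if iso_modules A S S' then 1 else 0)"
proof -
  note s = simple_moduleD[OF S] and s' = simple_moduleD[OF S']
  note sub = homs_subspace[OF s(1) s'(1)] and vf = vector_space_fscale[OF fd_moduleD(2)[OF s'(1)]]
  show ?thesis
  proof (cases "homs A S S' = {0}")
    case True
    have "\<not> iso_modules A S S'"
    proof
      assume "iso_modules A S S'"
      then have "bij_betw (0 :: 'a \<Rightarrow> 'n) (car S) (car S')" using True by (auto simp: iso_modules_def)
      then have "car S' \<subseteq> {0}" by (auto simp: bij_betw_def)
      then show False using s'(2) subspaceD(1)[OF fd_moduleD(2,3)[OF s'(1)]] by auto
    qed
    then show ?thesis using True hom_dim_eq_0 fd_moduleD(2)[OF s'(1)] by auto
  next
    case False
    then obtain h where h: "h \<in> homs A S S'" "h \<noteq> 0" using subspaceD(1)[OF vf sub] by blast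
    have "iso_modules A S S'"
      unfolding iso_modules_def bij_betw_def
      using h simple_hom_inj(2)[OF S s'(1) h] simple_hom_onto[OF S' s(1) h] by blast
    moreover have "hom_dim S' (homs A S S') = 1"
      by (rule hom_dim_schur[OF s(1) s'(1,2) sub subset_refl _ False, of "{0}"])
        (use simple_hom_inj(1)[OF S s'(1)] simple_hom_onto[OF S' s(1)] in blast)
    ultimately show ?thesis by simp
  qed
qed

lemma submodule_car_update: "submodule A (M\<lparr>car := U\<rparr>) W \<longleftrightarrow> submodule A M W \<and> W \<subseteq> U" if "U \<subseteq> car M"
  using that by (auto simp: submodule_def)

text \<open>A nonzero member of least dimension is minimal. The predicate \<open>Pr\<close> allows
  the same argument for graded submodules.\<close>

lemma exists_minimal_submodule:
  assumes "Pr (car M)" "fd_module D A M" "car M \<noteq> {0}"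
  obtains U where "submodule A M U" "Pr U" "U \<noteq> {0}"
    "\<And>W. submodule A M W \<Longrightarrow> Pr W \<Longrightarrow> W \<subseteq> U \<Longrightarrow> W = {0} \<or> W = U"
proof -
  note M = fd_moduleD[OF assms(2)]
  let ?ok = "\<lambda>U. submodule A M U \<and> Pr U \<and> U \<noteq> {0}"
  have "?ok (car M)" using assms submodule_car by blast
  then obtain U where U: "?ok U" "\<And>W. ?ok W \<Longrightarrow> vector_space.dim (scl M) U \<le> vector_space.dim (scl M) W"
    using ex_has_least_nat[of ?ok "car M" "vector_space.dim (scl M)"] by blast
  have "W = U" if W: "submodule A M W" "Pr W" "W \<subseteq> U" "W \<noteq> {0}" for W
  proof (rule ccontr)
    assume "W \<noteq> U"
    then have "vector_space.dim (scl M) W < vector_space.dim (scl M) U"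
      using W U(1) fd_space_dim_less[OF fd_space_subspace[OF M(1)]] submoduleD(1,2) by blast
    then show False using U(2)[of W] W by auto
  qed
  then show ?thesis using that[of U] U(1) by blast
qed

lemma exists_simple_submodule:
  assumes "fd_module D A M" "car M \<noteq> {0}"
  obtains U where "submodule A M U" "simple_module D A (M\<lparr>car := U\<rparr>)"
proof -
  obtain U where U: "submodule A M U" "U \<noteq> {0}" "\<And>W. submodule A M W \<Longrightarrow> W \<subseteq> U \<Longrightarrow> W = {0} \<or> W = U"
    using exists_minimal_submodule[of "submodule A M", OF submodule_car[OF assms(1)] assms] by metis
  have "simple_module D A (M\<lparr>car := U\<rparr>)"
    unfolding simple_module_def submodule_car_update[OF submoduleD(2)[OF U(1)]]
    using U submodule_fd_module[OF assms(1) U(1)] by auto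
  then show ?thesis using that U(1) by blast
qed

lemma simple_module_iso:
  assumes M: "simple_module D A M" and N: "fd_module D A N" and f: "f \<in> homs A M N" "bij_betw f (car M) (car N)"
  shows "simple_module D A N"
proof -
  note M' = simple_moduleD[OF M]
  obtain g where g: "g \<in> homs A N M" "\<And>v. v \<in> car M \<Longrightarrow> g (f v) = v" "\<And>w. w \<in> car N \<Longrightarrow> f (g w) = w"
    using homs_inverse[OF M'(1) N f] by metis
  have "W = {0} \<or> W = car N" if W: "submodule A N W" for W
  proof -
    have W': "W \<subseteq> car N" using submoduleD(2)[OF W] .
    have fg: "f ` g ` W = W" using g(3) W' by (force simp: image_image)
    have "g ` W = {0} \<or> g ` W = car M" using M'(3)[OF hom_image_submodule[OF N M'(1) g(1) W]] .
    then show ?thesis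
    proof
      assume "g ` W = {0}"
      then show ?thesis using fg homs_zero[OF M'(1) f(1)] by simp
    next
      assume "g ` W = car M"
      then show ?thesis using fg f(2) by (simp add: bij_betw_def)
    qed
  qed
  moreover have "car N \<noteq> {0}"
  proof
    assume "car N = {0}"
    then have "f v = f 0" if "v \<in> car M" for v using homsD(4)[OF f(1) that] homs_zero[OF M'(1) f(1)] by simp
    then have "v = 0" if "v \<in> car M" for v
      using that inj_onD[OF bij_betw_imp_inj_on[OF f(2)], of v 0] subspaceD(1)[OF fd_moduleD(2,3)[OF M'(1)]] by blast
    then have "car M = {0}" using subspaceD(1)[OF fd_moduleD(2,3)[OF M'(1)]] by (intro subset_antisym subsetI) auto
    then show False using M'(2) by simp
  qed
  ultimately show ?thesis using N unfolding simple_module_def by blast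
qed

lemma exists_urep_iso:
  fixes M :: "('k::field, 'd::finite, 'm::ab_group_add, 'z) rep_scheme"
  assumes "subalgebra D A" "fd_module D A M"
  obtains Q :: "('k, 'd) urep" and \<pi> where "fd_module D A Q" "\<pi> \<in> homs A M Q" "bij_betw \<pi> (car M) (car Q)"
proof -
  obtain Q :: "('k, 'd) urep" and \<pi> where Q: "fd_module D A Q" "\<pi> \<in> homs A M Q" "\<pi> ` car M = car Q"
    "{v \<in> car M. \<pi> v = 0} = {0}"
    using exists_quotient[OF assms submodule_zero[OF assms(2)]] by blast
  then show ?thesis using that homs_injI[OF assms(2) Q(2,4)] by (simp add: bij_betw_def)
qed

lemma ghoms_onto_piece:
  assumes M: "graded_module T M" and N: "graded_module T N" and f: "f \<in> ghoms M N" "f ` car M = car N"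
  shows "f ` piece M i = piece N i"
proof (intro subset_antisym subsetI)
  interpret M: graded_space "scl M" "car M" "piece M" by (rule graded_module_space[OF M])
  interpret N: graded_space "scl N" "car N" "piece N" by (rule graded_module_space[OF N])
  fix w assume w: "w \<in> piece N i"
  then have "w \<in> f ` car M" using f(2) N.C(2) by blast
  then obtain u where u: "u \<in> car M" "w = f u" by blast
  have "w = part (piece N) i w" using N.part_homog[OF w, of i] by simp
  also have "\<dots> = f (part (piece M) i u)" unfolding u(2) by (rule ghoms_part[OF M N f(1) u(1)])
  finally show "w \<in> f ` piece M i" using M.part_in[OF u(1)] by blast
qed (use ghomsD(2)[OF f(1)] in blast)

lemma ghoms_factor:
  assumes M: "graded_module T M" and N: "graded_module T N" and K: "graded_module T K"
    and g: "g \<in> ghoms M N" "g ` car M = car N" and f: "f \<in> ghoms M K"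
    and ker: "\<And>v. v \<in> car M \<Longrightarrow> g v = 0 \<Longrightarrow> f v = 0"
  obtains h where "h \<in> ghoms N K" "\<And>v. h (g v) = f v"
proof -
  obtain h where h: "h \<in> homs UNIV N K" "\<And>v. h (g v) = f v"
    using homs_factor[OF graded_module_fd[OF M] ghomsD(1)[OF g(1)] g(2) ghomsD(1)[OF f] ker
        graded_module_fd[OF N]] by blast
  have "h w \<in> piece K i" if "w \<in> piece N i" for w i
  proof -
    have "w \<in> g ` piece M i" using that ghoms_onto_piece[OF M N g, of i] by simp
    then show ?thesis using h(2) ghomsD(2)[OF f] by auto
  qed
  then have "h \<in> ghoms N K" using h(1) by (auto simp: ghoms_def)
  then show ?thesis using h(2) by (rule that)
qed

lemma ghoms_subspace:
  assumes M: "graded_module T M" and N: "graded_module T N"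
  shows "module.subspace (fscale (scl N)) (ghoms M N)"
proof -
  note sub = homs_subspace[OF graded_module_fd[OF M] graded_module_fd[OF N]]
  have vs: "vector_space (scl N)" using fd_moduleD(2)[OF graded_module_fd[OF N]] .
  note s = subspaceD[OF vector_space_fscale[OF vs] sub] and p = subspaceD[OF vs graded_module_piece(1)[OF N]]
  show ?thesis
    by (rule vs_subspaceI[OF vector_space_fscale[OF vs]])
      (use s(1-3) p(1-3) in \<open>auto simp: ghoms_def image_subset_iff\<close>)
qed

lemma (in graded_space) inter_0: "x \<in> C i \<Longrightarrow> x \<in> C j \<Longrightarrow> i \<noteq> j \<Longrightarrow> x = 0"
  using part_homog[of x i i] part_homog[of x j i] by auto

lemma gen_subalgebra_base: "X \<subseteq> gen_subalgebra D X"
  by (auto simp: gen_subalgebra_def)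

lemma gen_subalgebra_subalgebra: "subalgebra D (gen_subalgebra D X)"
  unfolding subalgebra_def gen_subalgebra_def
  by (auto intro!: vec.subspace_Inter)

lemma gen_subalgebra_least: "subalgebra D U \<Longrightarrow> X \<subseteq> U \<Longrightarrow> gen_subalgebra D X \<subseteq> U"
  unfolding gen_subalgebra_def subalgebra_def by blast

context dbl begin

lemma fd_DG: "fd_module D UNIV N \<Longrightarrow> fd_module D (DG T) N"
  by (rule fd_module_mono) auto

lemma piece_submodule:
  assumes N: "graded_module T N"
  shows "submodule (DG T) N (piece N i)"
  unfolding submodule_def
  using graded_module_piece[OF N] graded_module_act[OF N DG_Dgr, of _ _ i] by auto

lemma piece_fd: "graded_module T N \<Longrightarrow> fd_module D (DG T) (N\<lparr>car := piece N i\<rparr>)"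
  by (rule submodule_fd_module[OF fd_DG[OF graded_module_fd] piece_submodule])

end

lemma sum_fun_apply: "sum f I j = (\<Sum>i\<in>I. f i j)"
  by (induction I rule: infinite_finite_induct) auto

section \<open>Verma modules and their heads\<close>

text \<open>The clauses of \<open>verma_module\<close> with their witnesses \<open>l'\<close> and
  \<open>q\<close>. Nonvanishing of \<open>M\<close> is an assumption here; \<open>verma_loc\<close>
  supplies it by way of the projective cover.\<close>

locale verma = dbl V T
  for V :: "('k::{alg_closed_field, field_char_0}, 'g::finite, 'v::ab_group_add) yd"
    and T :: "('k, 'g, 'r::finite, 'd::finite) double" +
  fixes l l' :: "('k, 'd) urep" and M :: "('k, 'd) ugrep" and q :: "('d \<Rightarrow> nat \<Rightarrow> 'k) \<Rightarrow> nat \<Rightarrow> 'k"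
  assumes l: "simple_module D (DG T) l" and M: "graded_module T M" and ne: "car M \<noteq> {0}"
    and infl: "inflation T l l'"
    and q_lin: "lin_on (tscl l) (tspace l) (scl M) (car M) q" and q_onto: "q ` tspace l = car M"
    and q_ker: "{t \<in> tspace l. q t = 0} = module.span (tscl l)
        {pure l (mul D x b) v - pure l x (act l' b v) | x b v. b \<in> Dge0 T \<and> v \<in> car l}"
    and q_act: "\<And>x y v. v \<in> car l \<Longrightarrow> act M y (q (pure l x v)) = q (pure l (mul D y x) v)"
    and q_piece: "\<And>n. piece M n = q ` module.span (tscl l) {pure l x v | x v. x \<in> Dgr T n \<and> v \<in> car l}"
begin

lemma l_fd: "fd_module D (DG T) l" using l by (simp add: simple_module_def)

lemmas lD = fd_moduleD[OF l_fd]
lemmas M_fd = graded_module_fd[OF M]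
lemmas MD = fd_moduleD[OF M_fd]

interpretation ls: vector_space "scl l" by (rule lD(2))
interpretation Ms: vector_space "scl M" by (rule MD(2))
interpretation Mg: graded_space "scl M" "car M" "piece M" by (rule graded_module_space[OF M])

lemma tscl_vs: "vector_space (tscl l)"
  using vector_space_fscale[OF lD(2)] by (simp add: tscl_def[abs_def])

lemma tspace_sub: "module.subspace (tscl l) (tspace l)"
  by (rule vs_subspaceI[OF tscl_vs]) (use subspaceD[OF lD(2,3)] in \<open>auto simp: tspace_def tscl_def\<close>)

interpretation ts: vector_space "tscl l" by (rule tscl_vs)

lemma pure_tspace: "v \<in> car l \<Longrightarrow> pure l x v \<in> tspace l"
  using subspaceD(3)[OF lD(2,3)] by (simp add: pure_def tspace_def)

text \<open>\<open>Q x v\<close> is the class of \<open>x \<otimes> v\<close> in the Verma module.\<close>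

definition Q where "Q x v = q (pure l x v)"

lemma Q_car: "v \<in> car l \<Longrightarrow> Q x v \<in> car M"
  unfolding Q_def using lin_onD(1)[OF q_lin pure_tspace] .

lemma Q_lin: "v \<in> car l \<Longrightarrow> lin_on (*s) UNIV (scl M) (car M) (\<lambda>x. Q x v)"
proof -
  assume v: "v \<in> car l"
  have "pure l (x + y) v = pure l x v + pure l y v" "pure l (c *s x) v = tscl l c (pure l x v)" for x y c
    by (auto simp: pure_def tscl_def fun_eq_iff ls.scale_left_distrib)
  then show ?thesis unfolding lin_on_def using lin_onD[OF q_lin] pure_tspace[OF v] by (simp add: Q_def)
qed

lemma Q_lin2: "lin_on (scl l) (car l) (scl M) (car M) (Q x)"
proof -
  have "pure l x (v + w) = pure l x v + pure l x w" "pure l x (scl l c v) = tscl l c (pure l x v)" for v w c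
    by (auto simp: pure_def tscl_def fun_eq_iff ls.scale_right_distrib mult.commute)
  then show ?thesis unfolding lin_on_def using lin_onD[OF q_lin] pure_tspace by (simp add: Q_def)
qed

lemma Q_act: "v \<in> car l \<Longrightarrow> act M y (Q x v) = Q (mul D y x) v"
  unfolding Q_def by (rule q_act)

lemma pure_expand: "t = (\<Sum>i\<in>UNIV. pure l (axis i 1) (t i))"
proof
  fix j
  have "(\<Sum>i\<in>UNIV. pure l (axis i 1) (t i)) j = (\<Sum>i\<in>UNIV. pure l (axis i 1) (t i) j)"
    by (rule sum_fun_apply)
  also have "\<dots> = pure l (axis j 1) (t j) j" by (rule sum_single) (simp add: pure_def axis_def)
  finally show "t j = (\<Sum>i\<in>UNIV. pure l (axis i 1) (t i)) j" by (simp add: pure_def)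
qed

lemma q_expand: "t \<in> tspace l \<Longrightarrow> q t = (\<Sum>i\<in>UNIV. Q (axis i 1) (t i))"
proof -
  assume t: "t \<in> tspace l"
  have "q (\<Sum>i\<in>UNIV. pure l (axis i 1) (t i)) = (\<Sum>i\<in>UNIV. q (pure l (axis i 1) (t i)))"
    using t pure_tspace by (intro lin_on_sum[OF tscl_vs tspace_sub q_lin]) (auto simp: tspace_def)
  then show ?thesis unfolding pure_expand[of t, symmetric] by (simp add: Q_def)
qed

lemma inflD: "fd_module D (Dge0 T) l'" "scl l' = scl l" "car l' = car l"
  "\<And>x v. x \<in> DG T \<Longrightarrow> v \<in> car l \<Longrightarrow> act l' x v = act l x v"
  using infl by (auto simp: inflation_def)

lemmas l'D = fd_moduleD[OF inflD(1), unfolded inflD(2,3)]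

lemma Dge0_alg: "subalgebra D (Dge0 T)" and DG_Dge0: "DG T \<subseteq> Dge0 T" and dnich_Dge0: "dnich_part T j \<subseteq> Dge0 T"
  unfolding Dge0_def
  using gen_subalgebra_base[of "DG T \<union> (\<Union>j. dnich_part T j)" D] gen_subalgebra_subalgebra by blast+

lemma Q_bal: "b \<in> Dge0 T \<Longrightarrow> v \<in> car l \<Longrightarrow> Q (mul D x b) v = Q x (act l' b v)"
proof -
  assume b: "b \<in> Dge0 T" "v \<in> car l"
  have w: "act l' b v \<in> car l" using l'D(8)[OF b] .
  have "pure l (mul D x b) v - pure l x (act l' b v) \<in> {t \<in> tspace l. q t = 0}"
    unfolding q_ker using b by (intro ts.span_base) blast
  then show ?thesis unfolding Q_def
    using lin_on_diff[OF tscl_vs tspace_sub q_lin pure_tspace[OF b(2)] pure_tspace[OF w], of "mul D x b" x] by simp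
qed

lemma piece_subI:
  assumes W: "module.subspace (scl M) W" and gen: "\<And>x v. x \<in> Dgr T n \<Longrightarrow> v \<in> car l \<Longrightarrow> Q x v \<in> W"
  shows "piece M n \<subseteq> W"
proof -
  have "module.subspace (tscl l) {t \<in> tspace l. q t \<in> W}"
    using subspaceD[OF tscl_vs tspace_sub] subspaceD[OF MD(2) W] lin_on_zero[OF tscl_vs tspace_sub q_lin]
        lin_onD[OF q_lin]
    by (intro vs_subspaceI[OF tscl_vs]) auto
  then have "module.span (tscl l) {pure l x v | x v. x \<in> Dgr T n \<and> v \<in> car l} \<subseteq> {t \<in> tspace l. q t \<in> W}"
    using gen pure_tspace by (intro ts.span_minimal) (auto simp: Q_def)
  then show ?thesis unfolding q_piece by blast
qed

lemma Q_piece: "x \<in> Dgr T n \<Longrightarrow> v \<in> car l \<Longrightarrow> Q x v \<in> piece M n"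
  unfolding q_piece Q_def by (intro imageI ts.span_base) blast

lemma Q1_piece: "v \<in> car l \<Longrightarrow> Q (one D) v \<in> piece M 0"
  using Q_piece[OF DG_Dgr[OF one_DG]] .

lemma Q_eq_act: "v \<in> car l \<Longrightarrow> Q x v = act M x (Q (one D) v)"
  using Q_act[of v x "one D"] by (simp add: Da)

text \<open>\<open>inflation\<close> prescribes a zero action only in degree one. In any positive
  degree \<open>j\<close> the vector lies in the piece of degree \<open>j\<close>, but by the
  balancing relation also in that of degree zero, so it vanishes.\<close>

lemma dnich_kill:
  assumes "y \<in> dnich_part T j" "j \<noteq> 0" "v \<in> car l"
  shows "act M y (Q (one D) v) = 0"
proof (rule Mg.inter_0)
  show "act M y (Q (one D) v) \<in> piece M (int j + 0)"
    by (rule graded_module_act[OF M dnich_Dgr[OF assms(1)] Q1_piece[OF assms(3)]])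
  have yD: "y \<in> Dge0 T" using dnich_Dge0 assms(1) by blast
  have "act M y (Q (one D) v) = Q (mul D (one D) y) v" using Q_act[OF assms(3), of y "one D"] by (simp add: Da)
  also have "\<dots> = Q (one D) (act l' y v)" by (rule Q_bal[OF yD assms(3)])
  finally show "act M y (Q (one D) v) \<in> piece M 0" using Q1_piece l'D(8)[OF yD assms(3)] by simp
qed (use assms in simp)

lemma Q1_DG: "d \<in> DG T \<Longrightarrow> v \<in> car l \<Longrightarrow> act M d (Q (one D) v) = Q (one D) (act l d v)"
  using Q_bal[of d v "one D"] Q_eq_act[of v d] DG_Dge0 inflD(4)[of d v] by (auto simp: Da)

text \<open>Elements of degree \<open>n\<close> are sums of products \<open>a d y\<close>. A factor
  \<open>y\<close> of positive degree kills the class of \<open>1 \<otimes> v\<close>, one of degree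
  zero is a scalar, and \<open>d\<close> only changes \<open>v\<close>; what remains is
  \<open>a\<close>, of degree \<open>n = - i\<close>.\<close>

lemma piece_genI:
  assumes W: "module.subspace (scl M) W"
    and gen: "\<And>a v i. a \<in> nich_part T i \<Longrightarrow> n = - int i \<Longrightarrow> v \<in> car l \<Longrightarrow> act M a (Q (one D) v) \<in> W"
  shows "piece M n \<subseteq> W"
proof (rule piece_subI[OF W])
  fix x v assume x: "x \<in> Dgr T n" and v: "v \<in> car l"
  note w = subspaceD[OF MD(2) W] and ql = lin_onD[OF Q_lin[OF v]]
  have "vec.subspace {x. Q x v \<in> W}"
    using w ql lin_on_zero[OF vec.vector_space_axioms vec.subspace_UNIV Q_lin[OF v]]
    by (intro vs_subspaceI[OF vec.vector_space_axioms]) auto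
  moreover have "{mul D (mul D x d) y | x d y i j. x \<in> nich_part T i \<and> d \<in> DG T \<and> y \<in> dnich_part T j \<and> n
      = int j - int i}
      \<subseteq> {x. Q x v \<in> W}"
  proof clarify
    fix a d y i j assume a: "a \<in> nich_part T i" "d \<in> DG T" "y \<in> dnich_part T j" "n = int j - int i"
    have "Q (mul D (mul D a d) y) v = act M a (act M d (act M y (Q (one D) v)))"
      unfolding Q_eq_act[OF v, of "mul D (mul D a d) y"] using MD(7,8) Q_car[OF v] by simp
    also have "\<dots> \<in> W"
    proof (cases "j = 0")
      case True
      then obtain c where c: "y = c *s one D" using a(3) dnich_part_0 by metis
      have "act M y (Q (one D) v) = Q y v" by (rule Q_eq_act[OF v, symmetric])
      also have "\<dots> = scl M c (Q (one D) v)" unfolding c using ql(3) by simp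
      finally have "act M a (act M d (act M y (Q (one D) v))) = scl M c (act M a (act M d (Q (one D) v)))"
        using lin_onD(3)[OF MD(4)] MD(8) Q_car[OF v] by simp
      also have "act M a (act M d (Q (one D) v)) = act M a (Q (one D) (act l d v))"
        using Q1_DG[OF a(2) v] by simp
      finally show ?thesis using w(3) gen[OF a(1)] a(4) True lD(8)[OF a(2) v] by simp
    next
      case False
      have "act M x 0 = 0" for x using lin_on_zero[OF MD(2,3,4)] by simp
      then show ?thesis using dnich_kill[OF a(3) False v] w(1) by simp
    qed
    finally show "Q (mul D (mul D a d) y) v \<in> W" .
  qed
  ultimately have "Dgr T n \<subseteq> {x. Q x v \<in> W}" unfolding Dgr_def by (intro vec.span_minimal)
  then show "Q x v \<in> W" using x by blast
qed

lemma piece_pos: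
  assumes "n > 0"
  shows "piece M n = {0}"
proof (rule subset_antisym)
  show "piece M n \<subseteq> {0}"
    by (rule piece_genI[OF fd_spaceD(3)[OF fd_space_singleton[OF MD(2)]]]) (use assms in simp)
qed (use subspaceD(1)[OF MD(2) Mg.C(1)] in simp)

lemma piece_0: "piece M 0 = Q (one D) ` car l"
proof (rule subset_antisym)
  have W: "module.subspace (scl M) (Q (one D) ` car l)"
    by (rule lin_on_image_subspace[OF lD(2,3) MD(2) Q_lin2 lD(3) subset_refl])
  show "piece M 0 \<subseteq> Q (one D) ` car l"
  proof (rule piece_genI[OF W])
    fix a v i assume a: "a \<in> nich_part T i" "0 = - int i" "v \<in> car l"
    then obtain c where c: "a = c *s one D" using nich_part_0 by auto
    have "act M a (Q (one D) v) = scl M c (Q (one D) v)"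
      using Q_eq_act[OF a(3), of a] lin_onD(3)[OF Q_lin[OF a(3)]] by (simp add: c)
    then show "act M a (Q (one D) v) \<in> Q (one D) ` car l" using subspaceD(3)[OF MD(2) W] a(3) by auto
  qed
qed (use Q1_piece in blast)

lemma piece_neg: "piece M (- int n) \<subseteq> module.span (scl M) {act M a w | a w. a \<in> nich_part T n \<and> w \<in> piece M 0}"
proof (rule piece_genI[OF Ms.subspace_span])
  fix a v i assume "a \<in> nich_part T i" "- int n = - int i" "v \<in> car l"
  then show "act M a (Q (one D) v) \<in> module.span (scl M) {act M a w | a w. a \<in> nich_part T n \<and> w \<in> piece M 0}"
    using Q1_piece by (intro Ms.span_base) auto
qed

definition J where "J v = (if v \<in> car l then Q (one D) v else 0)"

lemma J_hom: "J \<in> homs (DG T) l (M\<lparr>car := piece M 0\<rparr>)"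
proof (rule homsI)
  show "lin_on (scl l) (car l) (scl (M\<lparr>car := piece M 0\<rparr>)) (car (M\<lparr>car := piece M 0\<rparr>)) J"
    unfolding lin_on_def
  proof (intro conjI ballI allI)
    fix v assume "v \<in> car l"
    then have v: "v \<in> car l" "scl l c v \<in> car l" for c using subspaceD(3)[OF lD(2,3)] by auto
    show "J v \<in> car (M\<lparr>car := piece M 0\<rparr>)" using v(1) Q1_piece[OF v(1)] by (simp add: J_def)
    show "J (scl l c v) = scl (M\<lparr>car := piece M 0\<rparr>) c (J v)" for c
      using v lin_onD(3)[OF Q_lin2 v(1)] by (simp add: J_def)
    fix w assume w: "w \<in> car l"
    then have "v + w \<in> car l" using v(1) subspaceD(2)[OF lD(2,3)] by blast
    then show "J (v + w) = J v + J w" using v(1) w lin_onD(2)[OF Q_lin2 v(1) w] by (simp add: J_def)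
  qed
  show "J (act l x v) = act (M\<lparr>car := piece M 0\<rparr>) x (J v)" if "x \<in> DG T" "v \<in> car l" for x v
    using that Q1_DG lD(8) by (simp add: J_def)
qed (simp add: J_def)

text \<open>\<open>J\<close> is nonzero because its image generates the nonzero module
  \<open>M\<close>, and then injective because \<open>l\<close> is simple.\<close>

lemma J_bij: "bij_betw J (car l) (car (M\<lparr>car := piece M 0\<rparr>))"
proof -
  have im: "J ` car l = piece M 0" unfolding piece_0 by (auto simp: J_def)
  have "J \<noteq> 0"
  proof
    assume "J = 0"
    then have z: "Q (one D) v = 0" if "v \<in> car l" for v
    proof -
      have "J v = 0" unfolding \<open>J = 0\<close> by simp
      then show ?thesis using that by (simp add: J_def)
    qed
    have "q t = 0" if t: "t \<in> tspace l" for t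
      unfolding q_expand[OF t]
    proof (rule sum.neutral, rule ballI)
      fix i
      have "t i \<in> car l" using t by (simp add: tspace_def)
      then show "Q (axis i 1) (t i) = 0"
        using Q_eq_act[of "t i" "axis i 1"] z lin_on_zero[OF MD(2,3,4)] by simp
    qed
    then have "car M \<subseteq> {0}" using q_onto by auto
    then show False using ne subspaceD(1)[OF MD(2,3)] by auto
  qed
  then show ?thesis using simple_hom_inj(2)[OF l piece_fd[OF M] J_hom] im by (simp add: bij_betw_def)
qed

text \<open>The candidate taking \<open>x \<otimes> v\<close> to \<open>x\<close> applied to
  \<open>\<phi> v\<close> respects the balancing relations once \<phi> is a map of
  \<open>Dge0\<close> modules. As \<phi> lands in the top piece of \<open>N\<close>, elements of
  positive degree kill its image, just as they kill \<open>l'\<close>.\<close>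

lemma universal:
  assumes N: "graded_module T N" and \<phi>: "\<phi> \<in> homs (DG T) l (N\<lparr>car := piece N i\<rparr>)"
    and top: "\<And>n. n > i \<Longrightarrow> piece N n = {0}"
  obtains \<Phi> where "\<Phi> \<in> ghoms (shift i M) N" "\<And>v. v \<in> car l \<Longrightarrow> \<Phi> (J v) = \<phi> v"
proof -
  note ND = fd_moduleD[OF graded_module_fd[OF N]]
  interpret Ns: vector_space "scl N" by (rule ND(2))
  interpret Ng: graded_space "scl N" "car N" "piece N" by (rule graded_module_space[OF N])
  have \<phi>': "lin_on (scl l) (car l) (scl N) (piece N i) \<phi>" "\<And>x v. x \<in> DG T \<Longrightarrow> v \<in> car l \<Longrightarrow> \<phi> (act l x v) = act N x (\<phi> v)"
    using homsD[OF \<phi>] by auto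
  have \<phi>N: "\<phi> v \<in> car N" if "v \<in> car l" for v using lin_onD(1)[OF \<phi>'(1) that] Ng.C(2) by blast
  have aN: "lin_on (scl N) (car N) (scl N) (car N) (act N x)" for x using ND(4) by simp
  have \<phi>0: "\<phi> 0 = 0" using lin_on_zero[OF lD(2,3) \<phi>'(1)] .
  \<comment> \<open>Since \<open>J\<close> is injective, the vanishing in \<open>dnich_kill\<close>
    carries over from \<open>M\<close> to \<open>l'\<close>.\<close>
  have J0: "act l' y v = 0" if y: "y \<in> dnich_part T j" "j \<noteq> 0" and v: "v \<in> car l" for y j v
  proof -
    have yD: "y \<in> Dge0 T" using dnich_Dge0 y(1) by blast
    have "Q (one D) (act l' y v) = 0"
      using dnich_kill[OF y v] Q_eq_act[OF v, of y] Q_bal[OF yD v, of "one D"] by (simp add: Da)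
    then have "J (act l' y v) = J 0" using l'D(8)[OF yD v] subspaceD(1)[OF lD(2,3)]
        lin_on_zero[OF lD(2,3) Q_lin2] by (simp add: J_def)
    then show ?thesis using inj_onD[OF bij_betw_imp_inj_on[OF J_bij]] l'D(8)[OF yD v] subspaceD(1)[OF lD(2,3)]
        by blast
  qed
  \<comment> \<open>The elements of \<open>Dge0 T\<close> that \<phi> intertwines form a subalgebra,
    so only generators have to be examined.\<close>
  let ?U = "{b \<in> Dge0 T. \<forall>v\<in>car l. \<phi> (act l' b v) = act N b (\<phi> v)}"
  note ge = subalgebraD[OF Dge0_alg]
  have "Dge0 T \<subseteq> ?U"
  proof -
    have aNl: "act N (b + b') w = act N b w + act N b' w" "act N (c *s b) w = scl N c (act N b w)"
        if "w \<in> car N" for b b' w c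
      using lin_onD(2,3)[OF ND(5)[OF that]] by auto
    have "subalgebra D ?U"
      unfolding subalgebra_def
    proof (intro conjI ballI)
      have "0 \<in> Dge0 T" using Dge0_alg by (simp add: subalgebra_def vec.subspace_0)
      moreover have "act l' 0 v = 0" if "v \<in> car l" for v
        using lin_on_zero[OF vec.vector_space_axioms _ l'D(5)[OF that]] Dge0_alg by (simp add: subalgebra_def)
      moreover have "act N 0 (\<phi> v) = 0" if "v \<in> car l" for v
        using lin_on_zero[OF vec.vector_space_axioms vec.subspace_UNIV ND(5)[OF \<phi>N[OF that]]] .
      ultimately show "vec.subspace ?U"
        using ge lin_onD[OF l'D(5)] lin_onD[OF \<phi>'(1)] aNl \<phi>N \<phi>0
        by (intro vs_subspaceI[OF vec.vector_space_axioms]) auto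
      show "one D \<in> ?U" using ge(1) l'D(6) ND(6) \<phi>N by auto
      show "mul D x y \<in> ?U" if "x \<in> ?U" "y \<in> ?U" for x y
        using that ge(2) l'D(7,8) ND(7) \<phi>N by auto
    qed
    moreover have "y \<in> ?U" if y: "y \<in> dnich_part T j" for y j
    proof (cases "j = 0")
      case True
      then obtain c where "y = c *s one D" using y dnich_part_0 by metis
      then have "y \<in> DG T" using subalgebraD(4)[OF DG_subalgebra one_DG] by simp
      then show ?thesis using DG_Dge0 \<phi>'(2) inflD(4) by auto
    next
      case False
      have "act N y (\<phi> v) = 0" if "v \<in> car l" for v
        using graded_module_act[OF N dnich_Dgr[OF y] lin_onD(1)[OF \<phi>'(1) that]] top[of "int j + i"] False by auto
      then show ?thesis using J0[OF y False] \<phi>0 dnich_Dge0 y by auto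
    qed
    moreover have "DG T \<subseteq> ?U" using DG_Dge0 \<phi>'(2) inflD(4) by auto
    ultimately show ?thesis unfolding Dge0_def by (intro gen_subalgebra_least) auto
  qed
  then have bal: "\<phi> (act l' b v) = act N b (\<phi> v)" if "b \<in> Dge0 T" "v \<in> car l" for b v using that by blast
  \<comment> \<open>The map taking \<open>x \<otimes> v\<close> to \<open>x\<close> applied to
    \<open>\<phi> v\<close>, written for the families of coordinates that represent tensors.\<close>
  define F where "F t = (\<Sum>i\<in>UNIV. act N (axis i 1) (\<phi> (t i)))" for t
  have F_lin: "lin_on (tscl l) (tspace l) (scl N) (car N) F"
    unfolding lin_on_def F_def
  proof (intro conjI ballI allI)
    fix t assume t: "t \<in> tspace l"
    then have ti: "t i \<in> car l" for i by (simp add: tspace_def)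
    show "(\<Sum>i\<in>UNIV. act N (axis i 1) (\<phi> (t i))) \<in> car N"
      using ND(8) \<phi>N ti by (intro subspaceD(6)[OF ND(2,3)]) auto
    show "(\<Sum>i\<in>UNIV. act N (axis i 1) (\<phi> (tscl l c t i))) = scl N c (\<Sum>i\<in>UNIV. act N (axis i 1) (\<phi> (t i)))" for c
      by (simp add: tscl_def lin_onD(3)[OF \<phi>'(1) ti] lin_onD(3)[OF aN \<phi>N[OF ti]] Ns.scale_sum_right)
    fix t' assume "t' \<in> tspace l"
    then have ti': "t' i \<in> car l" for i by (simp add: tspace_def)
    show "(\<Sum>i\<in>UNIV. act N (axis i 1) (\<phi> ((t + t') i))) =
      (\<Sum>i\<in>UNIV. act N (axis i 1) (\<phi> (t i))) + (\<Sum>i\<in>UNIV. act N (axis i 1) (\<phi> (t' i)))"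
      by (simp add: lin_onD(2)[OF \<phi>'(1) ti ti'] lin_onD(2)[OF aN \<phi>N[OF ti] \<phi>N[OF ti']] sum.distrib)
  qed
  have F_pure: "F (pure l x v) = act N x (\<phi> v)" if v: "v \<in> car l" for x v
  proof -
    have "F (pure l x v) = (\<Sum>i\<in>UNIV. act N (x $ i *s axis i 1) (\<phi> v))"
      unfolding F_def pure_def
      using lin_onD(3)[OF \<phi>'(1) v] lin_onD(3)[OF aN \<phi>N[OF v]] lin_onD(3)[OF ND(5)[OF \<phi>N[OF v]]] by simp
    also have "\<dots> = act N (\<Sum>i\<in>UNIV. x $ i *s axis i 1) (\<phi> v)"
      by (rule lin_on_sum[OF vec.vector_space_axioms vec.subspace_UNIV ND(5)[OF \<phi>N[OF v]], symmetric]) simp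
    finally show ?thesis by (simp only: vector_expand[symmetric])
  qed
  have F_ker: "F t = 0" if "t \<in> tspace l" "q t = 0" for t
  proof -
    have "module.subspace (tscl l) {t \<in> tspace l. F t = 0}"
      by (rule lin_on_kernel_subspace[OF tscl_vs tspace_sub ND(2) F_lin])
    moreover have "pure l (mul D x b) v - pure l x (act l' b v) \<in> {t \<in> tspace l. F t = 0}"
      if b: "b \<in> Dge0 T" "v \<in> car l" for x b v
    proof -
      have w: "act l' b v \<in> car l" using l'D(8)[OF b] .
      have "F (pure l (mul D x b) v - pure l x (act l' b v)) = act N (mul D x b) (\<phi> v) - act N x (\<phi> (act l' b v))"
        using lin_on_diff[OF tscl_vs tspace_sub F_lin pure_tspace[OF b(2)] pure_tspace[OF w]] F_pure[OF b(2)]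
            F_pure[OF w] by simp
      also have "\<dots> = 0" using bal[OF b] ND(7)[OF UNIV_I UNIV_I \<phi>N[OF b(2)]] by simp
      finally show ?thesis using subspaceD(4)[OF tscl_vs tspace_sub pure_tspace[OF b(2)] pure_tspace[OF w]] by simp
    qed
    ultimately have "module.span (tscl l) {pure l (mul D x b) v - pure l x (act l' b v) | x b v. b \<in> Dge0 T
        \<and> v \<in> car l}
      \<subseteq> {t \<in> tspace l. F t = 0}" by (intro ts.span_minimal) auto
    then show ?thesis using that q_ker by blast
  qed
  obtain \<Phi> where \<Phi>: "lin_on (scl M) (car M) (scl N) (car N) \<Phi>" "\<And>t. t \<in> tspace l \<Longrightarrow> \<Phi> (q t) = F t"
    "\<And>w. w \<notin> car M \<Longrightarrow> \<Phi> w = 0"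
    using lin_on_factor[OF tscl_vs tspace_sub q_lin q_onto F_lin F_ker] by blast
  have \<Phi>Q: "\<Phi> (Q x v) = act N x (\<phi> v)" if "v \<in> car l" for x v
    unfolding Q_def using \<Phi>(2)[OF pure_tspace[OF that]] F_pure[OF that] by simp
  have "\<Phi> (act M y w) = act N y (\<Phi> w)" if w: "w \<in> car M" for y w
  proof -
    obtain t where t: "t \<in> tspace l" "w = q t" using w q_onto by blast
    have ti: "t i \<in> car l" for i using t(1) by (simp add: tspace_def)
    have aM: "lin_on (scl M) (car M) (scl M) (car M) (act M y)" using MD(4) by simp
    have "act M y w = (\<Sum>i\<in>UNIV. Q (mul D y (axis i 1)) (t i))"
      unfolding t(2) q_expand[OF t(1)] using lin_on_sum[OF MD(2,3) aM, of UNIV "\<lambda>i. Q (axis i 1) (t i)"]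
          Q_car[OF ti] Q_act[OF ti] by simp
    then have "\<Phi> (act M y w) = (\<Sum>i\<in>UNIV. \<Phi> (Q (mul D y (axis i 1)) (t i)))"
      using lin_on_sum[OF MD(2,3) \<Phi>(1), of UNIV "\<lambda>i. Q (mul D y (axis i 1)) (t i)"] Q_car[OF ti] by simp
    also have "\<dots> = (\<Sum>i\<in>UNIV. act N y (act N (axis i 1) (\<phi> (t i))))"
      using \<Phi>Q[OF ti] ND(7) \<phi>N[OF ti] by simp
    also have "\<dots> = act N y (F t)"
      unfolding F_def using ND(8) \<phi>N[OF ti] by (intro lin_on_sum[OF ND(2,3) aN, symmetric]) auto
    finally show ?thesis using \<Phi>(2)[OF t(1)] t(2) by simp
  qed
  then have \<Phi>h: "\<Phi> \<in> homs UNIV M N" using \<Phi> by (intro homsI)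
  \<comment> \<open>An element of degree \<open>n\<close> takes \<open>\<phi> v\<close>, which has
    degree \<open>i\<close>, to degree \<open>n + i\<close>; whence the shift by
    \<open>i\<close>.\<close>
  have "piece M n \<subseteq> {w \<in> car M. \<Phi> w \<in> piece N (n + i)}" for n
  proof (rule piece_subI)
    show "module.subspace (scl M) {w \<in> car M. \<Phi> w \<in> piece N (n + i)}"
      using subspaceD[OF MD(2,3)] lin_onD[OF \<Phi>(1)] lin_on_zero[OF MD(2,3) \<Phi>(1)] subspaceD[OF ND(2) Ng.C(1)]
      by (intro vs_subspaceI[OF MD(2)]) auto
    show "Q x v \<in> {w \<in> car M. \<Phi> w \<in> piece N (n + i)}" if "x \<in> Dgr T n" "v \<in> car l" for x v
      using Q_car[OF that(2)] \<Phi>Q[OF that(2)] graded_module_act[OF N that(1) lin_onD(1)[OF \<phi>'(1) that(2)]] by auto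
  qed
  then have "\<Phi> w \<in> piece N n" if "w \<in> piece M (n - i)" for w n using that by force
  then have "\<Phi> \<in> ghoms (shift i M) N" using \<Phi>h by (auto simp: ghoms_def)
  moreover have "\<Phi> (J v) = \<phi> v" if "v \<in> car l" for v
    using \<Phi>Q[OF that, of "one D"] ND(6)[OF \<phi>N[OF that]] that by (simp add: J_def)
  ultimately show ?thesis using that by blast
qed

end

lemma fun_ne_0I: "f x \<noteq> 0 \<Longrightarrow> f \<noteq> 0"
  by auto

lemma submoduleI:
  assumes "module.subspace (scl M) U" "U \<subseteq> car M" "\<And>x u. x \<in> A \<Longrightarrow> u \<in> U \<Longrightarrow> act M x u \<in> U"
  shows "submodule A M U"
  using assms by (simp add: submodule_def)

section \<open>The greatest proper submodule of a Verma module and the simple head\<close>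

context verma begin

interpretation Ms: vector_space "scl M" by (rule MD(2))
interpretation Mg: graded_space "scl M" "car M" "piece M" by (rule graded_module_space[OF M])

lemma M0_simple: "simple_module D (DG T) (M\<lparr>car := piece M 0\<rparr>)"
  by (rule simple_module_iso[OF l piece_fd[OF M] J_hom J_bij])

lemma part_0_lin: "lin_on (scl M) (car M) (scl M) (piece M i) (part (piece M) i)"
  by (rule Mg.part_lin)

text \<open>The sum of the pieces of degree less than \<open>n\<close>. Submodules of
  \<open>M\<close> need not be graded, so their elements are compared with homogeneous ones modulo
  this filtration.\<close>

definition below :: "int \<Rightarrow> (nat \<Rightarrow> 'k) set" where "below n = {v \<in> car M. \<forall>i\<ge>n. part (piece M) i v = 0}"

lemma below_subspace: "module.subspace (scl M) (below n)"
  unfolding below_def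
  using subspaceD[OF MD(2,3)] lin_onD[OF Mg.part_lin] lin_on_zero[OF MD(2,3) Mg.part_lin]
  by (intro vs_subspaceI[OF MD(2)]) auto

lemma below_act:
  assumes "a \<in> nich_part T n" "v \<in> below m"
  shows "act M a v \<in> below (m - int n)"
  unfolding below_def
proof (intro CollectI conjI allI impI)
  have v: "v \<in> car M" "\<And>i. i \<ge> m \<Longrightarrow> part (piece M) i v = 0" using assms(2) by (auto simp: below_def)
  show "act M a v \<in> car M" using MD(8) v(1) by simp
  fix i assume "m - int n \<le> i"
  then have "part (piece M) (i + int n) v = 0" using v(2) by simp
  then show "part (piece M) i (act M a v) = 0"
    using graded_module_act_part[OF M nich_Dgr[OF assms(1)] v(1), of "i + int n"] lin_on_zero[OF MD(2,3,4)] by simp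
qed

text \<open>The piece of degree \<open>-n\<close> is \<open>B\<^sup>n(V)\<close> times the piece of degree zero, so each of its elements agrees with
  an element of \<open>W\<close> up to lower degrees, and \<open>M\<close> is bounded below.\<close>

lemma nakayama:
  assumes W: "submodule UNIV M W" and top: "\<And>u. u \<in> piece M 0 \<Longrightarrow> \<exists>w\<in>W. w - u \<in> below 0"
  shows "W = car M"
proof -
  note W' = submoduleD[OF W] and w = subspaceD[OF MD(2) submoduleD(1)[OF W]] and m = subspaceD[OF MD(2,3)]
  note b = subspaceD[OF MD(2) below_subspace]
  \<comment> \<open>By \<open>piece_neg\<close> it suffices to treat an element of the Nichols
    algebra of degree \<open>n\<close> applied to a vector of degree zero; applying it to the
    element of \<open>W\<close> provided by \<open>top\<close> lowers the error by
    \<open>n\<close>.\<close>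
  have lift: "\<exists>w\<in>W. w - u \<in> below (- int n)" if u: "u \<in> piece M (- int n)" for u n
  proof -
    let ?U = "{u \<in> car M. \<exists>w\<in>W. w - u \<in> below (- int n)}"
    have "module.subspace (scl M) ?U"
    proof (rule vs_subspaceI[OF MD(2)])
      show "0 \<in> ?U" using m(1) w(1) b(1) by force
      show "x + y \<in> ?U" if xy: "x \<in> ?U" "y \<in> ?U" for x y
      proof -
        obtain a c where ac: "a \<in> W" "a - x \<in> below (- int n)" "c \<in> W" "c - y \<in> below (- int n)" using xy by blast
        have e: "(a + c) - (x + y) = (a - x) + (c - y)" by simp
        have "(a + c) - (x + y) \<in> below (- int n)" unfolding e by (rule b(2)[OF ac(2,4)])
        then show ?thesis using xy m(2) w(2)[OF ac(1,3)] by blast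
      qed
      show "scl M c x \<in> ?U" if x: "x \<in> ?U" for c x
      proof -
        obtain a where a: "a \<in> W" "a - x \<in> below (- int n)" using x by blast
        have e: "scl M c a - scl M c x = scl M c (a - x)" by (simp add: Ms.scale_right_diff_distrib)
        have "scl M c a - scl M c x \<in> below (- int n)" unfolding e by (rule b(3)[OF a(2)])
        then show ?thesis using x m(3) w(3)[OF a(1)] by blast
      qed
    qed
    moreover have "act M a s \<in> ?U" if a: "a \<in> nich_part T n" "s \<in> piece M 0" for a s
    proof -
      obtain x where x: "x \<in> W" "x - s \<in> below 0" using top a(2) by blast
      have s: "s \<in> car M" using a(2) Mg.C(2) by blast
      have "act M a (x - s) = act M a x - act M a s"
        using lin_on_diff[OF MD(2,3) MD(4)] x(1) W'(2) s by blast
      then have "act M a x - act M a s \<in> below (- int n)" using below_act[OF a(1) x(2)] by simp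
      then show ?thesis using W'(3)[OF UNIV_I x(1)] MD(8) s by blast
    qed
    ultimately have "module.span (scl M) {act M a w | a w. a \<in> nich_part T n \<and> w \<in> piece M 0} \<subseteq> ?U"
      by (intro Ms.span_minimal) auto
    then show ?thesis using piece_neg[of n] u by blast
  qed
  obtain K :: nat where K: "\<And>i. i < - int K \<Longrightarrow> piece M i = {0}"
  proof -
    define X where "X = (\<lambda>i. nat (- i)) ` {i. piece M i \<noteq> {0}}"
    have X: "finite X" unfolding X_def using Mg.fin_supp by simp
    have "piece M i = {0}" if "i < - int (Max (insert 0 X))" for i
    proof (rule ccontr)
      assume "piece M i \<noteq> {0}"
      then have "nat (- i) \<le> Max (insert 0 X)" using X by (intro Max_ge) (auto simp: X_def)
      then show False using that by linarith
    qed
    then show thesis using that by blast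
  qed
  \<comment> \<open>The part of \<open>v\<close> in degree \<open>- n\<close> is approximated by
    some \<open>x\<close> in \<open>W\<close>, and the remainder \<open>v - x\<close> has only lower
    degrees.\<close>
  have step: "below (1 - int n) \<subseteq> W" if "below (- int n) \<subseteq> W" for n
  proof
    fix v assume v: "v \<in> below (1 - int n)"
    then have vc: "v \<in> car M" and vp: "\<And>i. i \<ge> 1 - int n \<Longrightarrow> part (piece M) i v = 0" by (auto simp: below_def)
    let ?u = "part (piece M) (- int n) v"
    have u: "?u \<in> piece M (- int n)" using Mg.part_in[OF vc] .
    then have uc: "?u \<in> car M" using Mg.C(2) by blast
    obtain x where x: "x \<in> W" "x - ?u \<in> below (- int n)" using lift[OF u] by blast
    have "v - ?u \<in> below (- int n)"
      unfolding below_def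
    proof (intro CollectI conjI allI impI)
      show "v - ?u \<in> car M" using m(4)[OF vc uc] .
      fix i assume i: "- int n \<le> i"
      have "part (piece M) i (v - ?u) = part (piece M) i v - part (piece M) i ?u"
        by (rule lin_on_diff[OF MD(2,3) Mg.part_lin vc uc])
      then show "part (piece M) i (v - ?u) = 0" using Mg.part_homog[OF u, of i] vp[of i] i
          by (cases "i = - int n") auto
    qed
    then have "(v - ?u) - (x - ?u) \<in> W" using b(4) x(2) that by blast
    then have "v - x \<in> W" by simp
    then show "v \<in> W" using w(2)[of "v - x" x] x(1) by simp
  qed
  have base: "below (- int K) \<subseteq> W"
  proof
    fix v assume "v \<in> below (- int K)"
    then have v: "v \<in> car M" "\<And>i. i \<ge> - int K \<Longrightarrow> part (piece M) i v = 0" by (auto simp: below_def)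
    have "v = 0"
    proof (rule Mg.parts_eq_0[OF v(1)])
      show "part (piece M) i v = 0" for i
        using v(2)[of i] K[of i] Mg.part_in[OF v(1), of i] by (cases "i < - int K") auto
    qed
    then show "v \<in> W" using w(1) by simp
  qed
  \<comment> \<open>Descending induction from \<open>n = K\<close>, where
    \<open>below (- int K)\<close> is zero; at \<open>n = 0\<close> the set \<open>below 1\<close>
    is all of \<open>M\<close>, as there are no positive degrees.\<close>
  have "below (1 - int n) \<subseteq> W" if "n \<le> K" for n
    using that
  proof (induction "K - n" arbitrary: n)
    case 0
    then show ?case using step[of n] base by simp
  next
    case (Suc k)
    then have "below (1 - int (Suc n)) \<subseteq> W" by (intro Suc.hyps) auto
    then show ?case using step[of n] by simp
  qed
  from this[of 0] have "below 1 \<subseteq> W" by simp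
  moreover have "car M \<subseteq> below 1"
    using Mg.part_in piece_pos by (force simp: below_def)
  ultimately show ?thesis using W'(2) by blast
qed

text \<open>\<open>W\<close> need not be graded, but its projection to degree zero is a
  \<open>DG\<close> submodule of a simple module. Were it everything, \<open>nakayama\<close> would
  make \<open>W\<close> all of \<open>M\<close>.\<close>

lemma proper_submodule:
  assumes W: "submodule UNIV M W" "W \<noteq> car M" and w: "w \<in> W"
  shows "part (piece M) 0 w = 0"
proof -
  note W' = submoduleD[OF W(1)]
  let ?N = "M\<lparr>car := piece M 0\<rparr>"
  have "submodule (DG T) ?N (part (piece M) 0 ` W)"
    unfolding submodule_def
  proof (intro conjI ballI)
    show "module.subspace (scl ?N) (part (piece M) 0 ` W)"
      using lin_on_image_subspace[OF MD(2,3) MD(2) part_0_lin W'(1,2)] by simp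
    show "part (piece M) 0 ` W \<subseteq> car ?N" using Mg.part_in W'(2) by auto
    fix x u assume x: "x \<in> DG T" and u: "u \<in> part (piece M) 0 ` W"
    then obtain y where y: "y \<in> W" "u = part (piece M) 0 y" by blast
    have "act M x u = part (piece M) 0 (act M x y)"
      using graded_module_act_part[OF M DG_Dgr[OF x], of y 0] y W'(2) by auto
    then show "act ?N x u \<in> part (piece M) 0 ` W" using W'(3)[OF UNIV_I y(1)] by simp
  qed
  from simple_moduleD(3)[OF M0_simple this]
  have "part (piece M) 0 ` W = {0} \<or> part (piece M) 0 ` W = piece M 0" by simp
  moreover have "part (piece M) 0 ` W \<noteq> piece M 0"
  proof
    assume eq: "part (piece M) 0 ` W = piece M 0"
    have "W = car M"
    proof (rule nakayama[OF W(1)])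
      fix u assume u: "u \<in> piece M 0"
      then have "u \<in> part (piece M) 0 ` W" using eq by simp
      then obtain y where y: "y \<in> W" "u = part (piece M) 0 y" by blast
      have yc: "y \<in> car M" and uc: "u \<in> car M" using y(1) W'(2) u Mg.C(2) by blast+
      have "part (piece M) i (y - u) = 0" if "0 \<le> i" for i
      proof (cases "i = 0")
        case True
        then show ?thesis using lin_on_diff[OF MD(2,3) Mg.part_lin[of 0] yc uc] Mg.part_homog[OF u, of 0] y(2) by simp
      next
        case False
        then have "piece M i = {0}" using that piece_pos by simp
        then show ?thesis using Mg.part_in[OF subspaceD(4)[OF MD(2,3) yc uc], of i] by simp
      qed
      then have "y - u \<in> below 0" using subspaceD(4)[OF MD(2,3) yc uc] by (simp add: below_def)
      then show "\<exists>w\<in>W. w - u \<in> below 0" using y(1) by blast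
    qed
    then show False using W(2) by simp
  qed
  ultimately show ?thesis using w by blast
qed

lemma sum_submodule:
  assumes "submodule UNIV M W1" "submodule UNIV M W2"
  shows "submodule UNIV M {x + y | x y. x \<in> W1 \<and> y \<in> W2}"
proof -
  note w1 = submoduleD[OF assms(1)] and w2 = submoduleD[OF assms(2)]
  have "act M a (x + y) = act M a x + act M a y" if "x \<in> W1" "y \<in> W2" for a x y
    using lin_onD(2)[OF MD(4)] w1(2) w2(2) that by blast
  then show ?thesis
    unfolding submodule_def using Ms.subspace_sums[OF w1(1) w2(1)] w1(2,3) w2(2,3) subspaceD(2)[OF MD(2,3)] by blast
qed

lemma M0_ne: "\<exists>u. u \<in> piece M 0 \<and> u \<noteq> 0"
  using simple_moduleD(2)[OF M0_simple] subspaceD(1)[OF MD(2) Mg.C(1)] by auto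

text \<open>All proper submodules have zero projection to degree zero, so the sum of two of them is
  still proper. Their union is therefore a submodule, and it is the only maximal one.\<close>

lemma radical_facts: "submodule UNIV M (radical M)" "radical M \<noteq> car M"
  "\<And>W. submodule UNIV M W \<Longrightarrow> W \<noteq> car M \<Longrightarrow> W \<subseteq> radical M"
  "\<And>w. w \<in> radical M \<Longrightarrow> part (piece M) 0 w = 0"
proof -
  let ?R = "{w. \<exists>W. submodule UNIV M W \<and> W \<noteq> car M \<and> w \<in> W}"
  obtain u where u: "u \<in> piece M 0" "u \<noteq> 0" using M0_ne by blast
  have u0: "part (piece M) 0 u = u" using Mg.part_homog[OF u(1), of 0] by simp
  have uc: "u \<in> car M" using u(1) Mg.C(2) by blast
  have proper: "W \<noteq> car M" if "\<And>w. w \<in> W \<Longrightarrow> part (piece M) 0 w = 0" for W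
    using that u0 u(2) uc by metis
  have p0: "part (piece M) 0 w = 0" if "w \<in> ?R" for w using that proper_submodule by blast
  have sub: "submodule UNIV M ?R"
  proof (rule submoduleI)
    have "{0} \<noteq> car M" using u(2) uc by blast
    then have z: "0 \<in> ?R" using submodule_zero[OF M_fd] by blast
    show "module.subspace (scl M) ?R"
    proof (rule vs_subspaceI[OF MD(2) z])
      fix x y assume "x \<in> ?R" "y \<in> ?R"
      then obtain W1 W2 where W: "submodule UNIV M W1" "W1 \<noteq> car M" "x \<in> W1" "submodule UNIV M W2" "W2 \<noteq> car M"
          "y \<in> W2"
        by blast
      have "{x + y | x y. x \<in> W1 \<and> y \<in> W2} \<noteq> car M"
      proof (rule proper)
        fix w assume "w \<in> {x + y | x y. x \<in> W1 \<and> y \<in> W2}"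
        then obtain a b where "a \<in> W1" "b \<in> W2" "w = a + b" by blast
        then show "part (piece M) 0 w = 0"
          using lin_onD(2)[OF part_0_lin] proper_submodule[OF W(1,2)] proper_submodule[OF W(4,5)]
            submoduleD(2)[OF W(1)] submoduleD(2)[OF W(4)] by (auto simp: subset_iff)
      qed
      then show "x + y \<in> ?R" using sum_submodule[OF W(1,4)] W(3,6) by blast
    next
      fix c x assume "x \<in> ?R"
      then obtain W where W: "submodule UNIV M W" "W \<noteq> car M" "x \<in> W" by blast
      then have "scl M c x \<in> W" using subspaceD(3)[OF MD(2) submoduleD(1)[OF W(1)]] by blast
      then show "scl M c x \<in> ?R" using W by blast
    qed
    show "?R \<subseteq> car M"
    proof
      fix v assume "v \<in> ?R"
      then obtain W where W: "submodule UNIV M W" "v \<in> W" by blast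
      then show "v \<in> car M" using submoduleD(2)[OF W(1)] by blast
    qed
    fix x v assume "v \<in> ?R"
    then obtain W where W: "submodule UNIV M W" "W \<noteq> car M" "v \<in> W" by blast
    have "act M x v \<in> W" by (rule submoduleD(3)[OF W(1) UNIV_I W(3)])
    then show "act M x v \<in> ?R" using W by blast
  qed
  have Rp: "?R \<noteq> car M" by (rule proper) (rule p0)
  have all: "W \<subseteq> ?R" if "submodule UNIV M W" "W \<noteq> car M" for W using that by blast
  \<comment> \<open>\<open>?R\<close> is itself maximal, and every maximal submodule is contained in
    it and so equal to it.\<close>
  have "radical M = ?R"
  proof (intro subset_antisym)
    have "?R \<in> {U. submodule UNIV M U \<and> U \<noteq> car M \<and>
      (\<forall>W. submodule UNIV M W \<longrightarrow> U \<subseteq> W \<longrightarrow> W = U \<or> W = car M)}"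
    proof (intro CollectI conjI allI impI sub Rp)
      fix W assume W: "submodule UNIV M W" "?R \<subseteq> W"
      show "W = ?R \<or> W = car M"
      proof (cases "W = car M")
        case False
        then have "W \<subseteq> ?R" by (rule all[OF W(1)])
        then have "W = ?R" using W(2) by (rule subset_antisym)
        then show ?thesis ..
      qed (rule disjI2)
    qed
    then show "radical M \<subseteq> ?R" unfolding radical_def by (intro le_infI2 Inter_lower)
    show "?R \<subseteq> radical M"
      unfolding radical_def
    proof (intro Int_greatest submoduleD(2)[OF sub] Inter_greatest)
      fix X assume "X \<in> {U. submodule UNIV M U \<and> U \<noteq> car M \<and>
        (\<forall>W. submodule UNIV M W \<longrightarrow> U \<subseteq> W \<longrightarrow> W = U \<or> W = car M)}"
      then have X: "submodule UNIV M X" "X \<noteq> car M" "\<And>W. submodule UNIV M W \<Longrightarrow> X \<subseteq> W \<Longrightarrow> W = X \<or> W = car M" by auto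
      show "?R \<subseteq> X"
      proof (rule disjE[OF X(3)[OF sub all[OF X(1,2)]]])
        assume "?R = car M"
        with Rp show "?R \<subseteq> X" by (rule notE)
      qed (rule equalityD1)
    qed
  qed
  note R = this
  show "submodule UNIV M (radical M)" unfolding R by (rule sub)
  show "radical M \<noteq> car M" unfolding R by (rule Rp)
  show "W \<subseteq> radical M" if "submodule UNIV M W" "W \<noteq> car M" for W unfolding R by (rule all[OF that])
  show "part (piece M) 0 w = 0" if "w \<in> radical M" for w using that unfolding R by (rule p0)
qed

context
  fixes L :: "('k, 'd) ugrep" and \<pi>
  assumes L: "graded_module T L" and \<pi>: "\<pi> \<in> ghoms M L" "\<pi> ` car M = car L" "{v \<in> car M. \<pi> v = 0} = radical M"
begin

text \<open>The preimage in \<open>M\<close> of a proper submodule is proper, hence contained in the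
  radical, which \<pi> kills.\<close>

lemma L_simple: "simple_module D UNIV L"
proof -
  note \<pi>' = homsD[OF ghomsD(1)[OF \<pi>(1)]] and LD = fd_moduleD[OF graded_module_fd[OF L]]
  have "W = {0} \<or> W = car L" if W: "submodule UNIV L W" for W
  proof -
    note W' = submoduleD[OF W] and w = subspaceD[OF LD(2) submoduleD(1)[OF W]]
    let ?V = "{v \<in> car M. \<pi> v \<in> W}"
    have V: "submodule UNIV M ?V"
    proof (rule submoduleI)
      show "module.subspace (scl M) ?V"
        using subspaceD[OF MD(2,3)] lin_onD[OF \<pi>'(1)] w lin_on_zero[OF MD(2,3) \<pi>'(1)]
        by (intro vs_subspaceI[OF MD(2)]) auto
      show "act M x v \<in> ?V" if "v \<in> ?V" for x v
      proof -
        have v: "v \<in> car M" "\<pi> v \<in> W" using that by auto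
        have "\<pi> (act M x v) \<in> W" unfolding \<pi>'(2)[OF UNIV_I v(1)] by (rule W'(3)[OF UNIV_I v(2)])
        then show ?thesis using MD(8)[OF UNIV_I v(1)] by simp
      qed
    qed auto
    have img: "W = \<pi> ` ?V"
    proof (intro subset_antisym subsetI)
      fix w assume w: "w \<in> W"
      then have "w \<in> \<pi> ` car M" using W'(2) unfolding \<pi>(2) by (rule rev_subsetD)
      then show "w \<in> \<pi> ` ?V" using w by auto
    qed auto
    show ?thesis
    proof (cases "?V = car M")
      case True
      then show ?thesis using img \<pi>(2) by simp
    next
      case False
      then have "?V \<subseteq> radical M" by (rule radical_facts(3)[OF V])
      then have "\<pi> v = 0" if "v \<in> ?V" for v using that unfolding \<pi>(3)[symmetric] by blast
      then have "W \<subseteq> {0}" by (subst img) (simp add: image_subset_iff)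
      then show ?thesis using w(1) by (intro disjI1 subset_antisym) simp_all
    qed
  qed
  moreover have "car L \<noteq> {0}"
  proof
    assume "car L = {0}"
    then have "{v \<in> car M. \<pi> v = 0} = car M" using \<pi>'(4) by auto
    then show False using \<pi>(3) radical_facts(2) by simp
  qed
  ultimately show ?thesis using graded_module_fd[OF L] by (simp add: simple_module_def)
qed

lemma L_pos: "n > 0 \<Longrightarrow> piece L n = {0}"
  using ghoms_onto_piece[OF M L \<pi>(1,2), of n] piece_pos[of n] homs_zero[OF M_fd ghomsD(1)[OF \<pi>(1)]] by simp

text \<open>The radical meets degree zero trivially, so the copy of \<open>l\<close> in
  \<open>M\<close> survives in the head.\<close>

lemma L_0: "\<exists>f\<in>homs (DG T) l (L\<lparr>car := piece L 0\<rparr>). bij_betw f (car l) (piece L 0)"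
proof -
  note \<pi>' = homsD[OF ghomsD(1)[OF \<pi>(1)]] and p = ghoms_onto_piece[OF M L \<pi>(1,2), of 0]
  let ?p = "\<lambda>v. if v \<in> piece M 0 then \<pi> v else 0"
  have h: "?p \<in> homs (DG T) (M\<lparr>car := piece M 0\<rparr>) (L\<lparr>car := piece L 0\<rparr>)"
    using p by (intro homs_restrict[OF fd_DG[OF M_fd] ghomsD(1)[OF \<pi>(1)] _ piece_submodule[OF M]]) auto
  have "?p v \<noteq> 0" if "v \<in> piece M 0" "v \<noteq> 0" for v
  proof
    assume "?p v = 0"
    then have "v \<in> radical M" using \<pi>(3) that(1) Mg.C(2) by auto
    then show False using radical_facts(4)[of v] Mg.part_homog[OF that(1), of 0] that(2) by simp
  qed
  moreover obtain u where "u \<in> piece M 0" "u \<noteq> 0" using M0_ne by blast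
  ultimately have "?p u \<noteq> 0" by blast
  then have "?p \<noteq> 0" by (rule fun_ne_0I[of ?p u])
  from simple_hom_inj(2)[OF M0_simple piece_fd[OF L] h this] have "bij_betw ?p (piece M 0) (piece L 0)"
    using p by (auto simp: bij_betw_def)
  from bij_betw_trans[OF _ this, of J "car l"] have "bij_betw (\<lambda>v. ?p (J v)) (car l) (piece L 0)"
    using J_bij by (simp add: comp_def)
  moreover have "(\<lambda>v. ?p (J v)) \<in> homs (DG T) l (L\<lparr>car := piece L 0\<rparr>)"
    by (rule homs_comp[OF piece_fd[OF M] J_hom h])
  ultimately show ?thesis by blast
qed

text \<open>The induced map \<Phi> from \<open>M\<close> is onto, and its kernel lies in the
  radical. The image of the radical is a graded submodule; it is not all of \<open>N\<close>, since
  \<open>M\<close> would then be the radical plus the kernel. So it is zero and \<Phi> descends to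
  \<open>L\<close>, where simplicity of \<open>L\<close> makes it injective.\<close>

lemma L_complete:
  assumes N: "graded_module T N" and min: "\<And>U. gsub N U \<Longrightarrow> U = {0} \<or> U = car N"
    and top: "\<And>n. n > i \<Longrightarrow> piece N n = {0}"
    and \<phi>: "\<phi> \<in> homs (DG T) l (N\<lparr>car := piece N i\<rparr>)" "\<phi> \<noteq> 0"
  shows "\<exists>f\<in>ghoms (shift i L) N. bij_betw f (car L) (car N)"
proof -
  obtain \<Phi> where \<Phi>: "\<Phi> \<in> ghoms (shift i M) N" "\<And>v. v \<in> car l \<Longrightarrow> \<Phi> (J v) = \<phi> v"
    using universal[OF N \<phi>(1) top] by metis
  note sM = graded_module_shift[OF M, of i] and sL = graded_module_shift[OF L, of i]
  have \<pi>s: "\<pi> \<in> ghoms (shift i M) (shift i L)" using \<pi>(1) by (simp only: ghoms_shift)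
  obtain v where v: "v \<in> car l" "\<phi> v \<noteq> 0" using homs_ne_0[OF \<phi>] by blast
  have Jv: "J v \<in> car M" using homsD(4)[OF J_hom v(1)] Mg.C(2) by auto
  have h\<Phi>: "\<Phi> \<in> homs UNIV M N" using ghomsD(1)[OF \<Phi>(1)] by simp
  have "\<Phi> ` car M \<noteq> {0}" using Jv \<Phi>(2)[OF v(1)] v(2) by (metis imageI singletonD)
  then have onto: "\<Phi> ` car M = car N"
    using min[OF gsub_image[OF sM N \<Phi>(1) gsub_car[OF sM]]] by simp
  have sub: "submodule UNIV M {v \<in> car M. \<Phi> v = 0}"
    by (rule hom_kernel_submodule[OF M_fd graded_module_fd[OF N] h\<Phi>])
  have "J v \<notin> {v \<in> car M. \<Phi> v = 0}" using \<Phi>(2)[OF v(1)] v(2) by simp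
  then have "{v \<in> car M. \<Phi> v = 0} \<noteq> car M" using Jv by metis
  then have kr: "{v \<in> car M. \<Phi> v = 0} \<subseteq> radical M" by (rule radical_facts(3)[OF sub])
  have "gsub (shift i M) (radical M)"
    using gsub_kernel[OF sM sL \<pi>s] \<pi>(3) by simp
  then have "\<Phi> ` radical M = {0} \<or> \<Phi> ` radical M = car N" by (intro min gsub_image[OF sM N \<Phi>(1)])
  moreover have "\<Phi> ` radical M \<noteq> car N"
  proof
    assume eq: "\<Phi> ` radical M = car N"
    have "car M \<subseteq> radical M"
    proof
      fix x assume x: "x \<in> car M"
      then have "\<Phi> x \<in> \<Phi> ` radical M" using eq onto by blast
      then obtain y where y: "y \<in> radical M" "\<Phi> x = \<Phi> y" by blast
      have yc: "y \<in> car M" using y(1) submoduleD(2)[OF radical_facts(1)] by blast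
      have "x - y \<in> {v \<in> car M. \<Phi> v = 0}"
        using lin_on_diff[OF MD(2,3) homsD(1)[OF h\<Phi>] x yc] y(2) subspaceD(4)[OF MD(2,3) x yc] by simp
      then have "x - y \<in> radical M" using kr by blast
      then show "x \<in> radical M" using subspaceD(2)[OF MD(2) submoduleD(1)[OF radical_facts(1)] _ y(1), of
          "x - y"] by simp
    qed
    then show False using radical_facts(2) submoduleD(2)[OF radical_facts(1)] by blast
  qed
  ultimately have r0: "\<Phi> ` radical M = {0}" by blast
  have ker: "\<Phi> x = 0" if "x \<in> car (shift i M)" "\<pi> x = 0" for x using that r0 \<pi>(3) by auto
  obtain f where f: "f \<in> ghoms (shift i L) N" "\<And>v. f (\<pi> v) = \<Phi> v"
    by (rule ghoms_factor[OF sM sL N \<pi>s _ \<Phi>(1) ker]) (use \<pi>(2) in auto)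
  have fh: "f \<in> homs UNIV L N" using ghomsD(1)[OF f(1)] by simp
  have "f \<noteq> 0" using f(2)[of "J v"] \<Phi>(2)[OF v(1)] v(2) by auto
  then have "inj_on f (car L)" by (rule simple_hom_inj(2)[OF L_simple graded_module_fd[OF N] fh])
  moreover have "f ` car L = car N" using onto f(2) \<pi>(2) by (metis image_image image_cong)
  ultimately show ?thesis using f(1) by (auto simp: bij_betw_def)
qed

end

end

section \<open>Projective covers and characters\<close>

text \<open>In contrast to \<open>short_exact\<close> the maps are named and the modules may live in
  different types, which allows a module to be compared with its copy in
  \<open>ugrep\<close>.\<close>

definition gexact :: "('m \<Rightarrow> 'n) \<Rightarrow> ('n \<Rightarrow> 'p) \<Rightarrow> ('k::field, 'd::finite, 'm::ab_group_add, 'x) grep_scheme \<Rightarrow>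
    ('k, 'd, 'n::ab_group_add, 'y) grep_scheme \<Rightarrow> ('k, 'd, 'p::ab_group_add, 'z) grep_scheme \<Rightarrow> bool"
  where "gexact f g N' N N'' \<longleftrightarrow> f \<in> ghoms N' N \<and> g \<in> ghoms N N'' \<and>
    inj_on f (car N') \<and> f ` car N' = {v \<in> car N. g v = 0} \<and> g ` car N = car N''"

lemma gexactD:
  assumes "gexact f g N' N N''"
  shows "f \<in> ghoms N' N" "g \<in> ghoms N N''" "inj_on f (car N')" "f ` car N' = {v \<in> car N. g v = 0}" "g ` car N
      = car N''"
  using assms by (auto simp: gexact_def)

lemma homs_codomain:
  assumes "f \<in> homs A M N" "N' = N\<lparr>car := W\<rparr>" "\<And>v. v \<in> car M \<Longrightarrow> f v \<in> W"
  shows "f \<in> homs A M N'"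
  using assms by (auto simp: homs_def lin_on_def)

lemma ghoms_zero: "graded_module T N' \<Longrightarrow> graded_module T N \<Longrightarrow> 0 \<in> ghoms N' N"
  using subspaceD(1)[OF vector_space_fscale[OF fd_moduleD(2)[OF graded_module_fd]] ghoms_subspace] by blast

lemma ghoms_inj_piece:
  assumes M: "graded_module T M" and N: "graded_module T N" and f: "f \<in> ghoms M N" "inj_on f (car M)"
    and u: "u \<in> car M" "f u \<in> piece N i"
  shows "u \<in> piece M i"
proof -
  interpret M: graded_space "scl M" "car M" "piece M" by (rule graded_module_space[OF M])
  interpret N: graded_space "scl N" "car N" "piece N" by (rule graded_module_space[OF N])
  have "f (part (piece M) i u) = f u"
    using ghoms_part[OF M N f(1) u(1), of i] N.part_homog[OF u(2), of i] by simp
  then have "part (piece M) i u = u"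
    using inj_onD[OF f(2)] u(1) M.part_in[OF u(1)] M.C(2) by blast
  then show ?thesis using M.part_in[OF u(1), of i] by simp
qed

lemma gexact_piece:
  assumes "graded_module T N'" "graded_module T N" "graded_module T N''" and ex: "gexact f g N' N N''"
  shows "f ` piece N' i = {v \<in> piece N i. g v = 0}"
proof (intro subset_antisym subsetI)
  note e = gexactD[OF ex]
  fix v assume "v \<in> f ` piece N' i"
  then obtain u where u: "u \<in> piece N' i" "v = f u" by blast
  then have "v \<in> f ` car N'" using graded_module_piece(2)[OF assms(1)] by blast
  then show "v \<in> {v \<in> piece N i. g v = 0}" using e(4) ghomsD(2)[OF e(1) u(1)] u(2) by auto
next
  note e = gexactD[OF ex]
  fix v assume v: "v \<in> {v \<in> piece N i. g v = 0}"
  then have "v \<in> f ` car N'" using e(4) graded_module_piece(2)[OF assms(2)] by auto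
  then obtain u where u: "u \<in> car N'" "v = f u" by blast
  have "u \<in> piece N' i" using ghoms_inj_piece[OF assms(1,2) e(1,3) u(1)] u(2) v by simp
  then show "v \<in> f ` piece N' i" using u(2) by blast
qed

section \<open>Coefficients of Laurent polynomials\<close>

lemma laurent_lookup:
  assumes "finite {i. a i \<noteq> 0}"
  shows "Poly_Mapping.lookup (laurent_poly a) i = a i"
proof -
  have "Poly_Mapping.lookup (laurent_poly a) i = (\<Sum>j | a j \<noteq> 0. Poly_Mapping.lookup (Poly_Mapping.single j (a j)) i)"
    unfolding laurent_poly_def by (rule lookup_sum)
  also have "\<dots> = (\<Sum>j | a j \<noteq> 0. if i = j then a i else 0)"
    by (intro sum.cong) (auto simp: lookup_single when_def)
  also have "\<dots> = a i" using assms by simp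
  finally show ?thesis .
qed

lemma laurent_add:
  assumes "finite {i. a i \<noteq> 0}" "finite {i. b i \<noteq> 0}" "\<And>i. c i = a i + b i"
  shows "laurent_poly c = laurent_poly a + laurent_poly b"
proof (rule poly_mapping_eqI)
  have "finite {i. c i \<noteq> 0}"
    by (rule finite_subset[OF _ finite_UnI[OF assms(1,2)]]) (auto simp: assms(3))
  then show "Poly_Mapping.lookup (laurent_poly c) k = Poly_Mapping.lookup (laurent_poly a + laurent_poly b) k" for k
    using assms by (simp add: laurent_lookup lookup_add)
qed

text \<open>The terms of degree \<open>n\<close> and \<open>m\<close> are split off the two factors;
  every other product of terms has degree less than \<open>n + m\<close>.\<close>

lemma lookup_mult_top:
  fixes q r :: laurent
  assumes "\<And>i. i > n \<Longrightarrow> Poly_Mapping.lookup q i = 0" "\<And>i. i > m \<Longrightarrow> Poly_Mapping.lookup r i = 0"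
  shows "Poly_Mapping.lookup (q * r) (n + m) = Poly_Mapping.lookup q n * Poly_Mapping.lookup r m"
proof -
  define q' where "q' = q - Poly_Mapping.single n (Poly_Mapping.lookup q n)"
  define r' where "r' = r - Poly_Mapping.single m (Poly_Mapping.lookup r m)"
  have q': "a < n" if "a \<in> Poly_Mapping.keys q'" for a
    using that assms(1)[of a] by (cases a n rule: linorder_cases) (auto simp: q'_def in_keys_iff lookup_minus
        lookup_single)
  have r': "a < m" if "a \<in> Poly_Mapping.keys r'" for a
    using that assms(2)[of a] by (cases a m rule: linorder_cases) (auto simp: r'_def in_keys_iff lookup_minus
        lookup_single)
  have r: "a \<le> m" if "a \<in> Poly_Mapping.keys r" for a
    using that assms(2)[of a] by (cases a m rule: linorder_cases) (auto simp: in_keys_iff)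
  let ?s = "Poly_Mapping.single n (Poly_Mapping.lookup q n)"
  have "q * r = ?s * Poly_Mapping.single m (Poly_Mapping.lookup r m) + ?s * r' + q' * r"
    by (simp add: q'_def r'_def algebra_simps)
  moreover have "Poly_Mapping.lookup (q' * r) (n + m) = 0"
  proof (rule ccontr)
    assume "\<not> ?thesis"
    then have "n + m \<in> Poly_Mapping.keys (q' * r)" by (simp add: in_keys_iff)
    then obtain a b where "n + m = a + b" "a \<in> Poly_Mapping.keys q'" "b \<in> Poly_Mapping.keys r"
      using keys_mult[of q' r] by blast
    then show False using q' r by force
  qed
  moreover have "Poly_Mapping.lookup (?s * r') (n + m) = 0"
  proof (rule ccontr)
    assume "\<not> ?thesis"
    then have "n + m \<in> Poly_Mapping.keys (?s * r')" by (simp add: in_keys_iff)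
    then obtain a b where "n + m = a + b" "a \<in> Poly_Mapping.keys ?s" "b \<in> Poly_Mapping.keys r'"
      using keys_mult[of ?s r'] by blast
    then show False using r' by (force split: if_splits)
  qed
  ultimately show ?thesis by (simp add: lookup_add mult_single)
qed

section \<open>Simple graded modules and maps out of projective covers\<close>

locale setup_data = dbl V T
  for V :: "('k::{alg_closed_field, field_char_0}, 'g::finite, 'v::ab_group_add) yd"
    and T :: "('k, 'g, 'r::finite, 'd::finite) double" +
  fixes \<Lambda> :: "('k, 'd) urep set" and M L P :: "('k, 'd) urep \<Rightarrow> ('k, 'd) ugrep"
  assumes wts: "weights T \<Lambda>"
    and ver: "\<And>l. l \<in> \<Lambda> \<Longrightarrow> verma_module T l (M l)"
    and hd: "\<And>l. l \<in> \<Lambda> \<Longrightarrow> graded_head T (M l) (L l)"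
    and cov: "\<And>l. l \<in> \<Lambda> \<Longrightarrow> graded_projective_cover T l (L l) (P l)"
begin

lemma lam_simple: "l \<in> \<Lambda> \<Longrightarrow> simple_module D (DG T) l"
  using wts by (simp add: weights_def)

lemma lam_unique:
  assumes "l \<in> \<Lambda>" "m \<in> \<Lambda>" "iso_modules (DG T) l m"
  shows "l = m"
proof -
  have "\<exists>!k. k \<in> \<Lambda> \<and> iso_modules (DG T) l k" using wts lam_simple[OF assms(1)] by (simp add: weights_def)
  moreover have "iso_modules (DG T) l l" by (rule iso_modules_refl[OF simple_moduleD(1)[OF lam_simple[OF assms(1)]]])
  ultimately show ?thesis using assms by blast
qed

text \<open>\<open>weights\<close> concerns modules carried by \<open>nat => 'k\<close> and
  isomorphisms onto members of \<Lambda>; here a simple module in any type is reached, by an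
  isomorphism in the opposite direction.\<close>

lemma exists_weight:
  fixes S :: "('k, 'd, 'm::ab_group_add, 'z) rep_scheme"
  assumes S: "simple_module D (DG T) S"
  obtains l k where "l \<in> \<Lambda>" "k \<in> homs (DG T) l S" "bij_betw k (car l) (car S)"
proof -
  note S' = simple_moduleD(1)[OF S]
  obtain Q :: "('k, 'd) urep" and \<pi> where Q: "fd_module D (DG T) Q" "\<pi> \<in> homs (DG T) S Q" "bij_betw \<pi> (car S) (car Q)"
    using exists_urep_iso[OF DG_subalgebra S'] by blast
  have "simple_module D (DG T) Q" by (rule simple_module_iso[OF S Q])
  then obtain l where l: "l \<in> \<Lambda>" "iso_modules (DG T) Q l" using wts unfolding weights_def by blast
  have lf: "fd_module D (DG T) l" using simple_moduleD(1)[OF lam_simple[OF l(1)]] .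
  obtain g where "g \<in> homs (DG T) Q S" "bij_betw g (car Q) (car S)"
    using homs_inverse[OF S' Q] by metis
  then have "iso_modules (DG T) Q S" unfolding iso_modules_def by blast
  then have "iso_modules (DG T) l S"
    by (rule iso_modules_trans[OF Q(1) iso_modules_sym[OF Q(1) lf l(2)]])
  then show ?thesis using that l(1) unfolding iso_modules_def by blast
qed

lemma P_graded: "l \<in> \<Lambda> \<Longrightarrow> graded_module T (P l)" and P_proj: "l \<in> \<Lambda> \<Longrightarrow> projective_module D (P l)"
  using cov by (auto simp: graded_projective_cover_def)

lemma L_graded: "l \<in> \<Lambda> \<Longrightarrow> graded_module T (L l)" and M_graded: "l \<in> \<Lambda> \<Longrightarrow> graded_module T (M l)"
  using hd ver by (auto simp: graded_head_def verma_module_def)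

lemma P_ne: "l \<in> \<Lambda> \<Longrightarrow> car (P l) \<noteq> {0}"
proof
  assume l: "l \<in> \<Lambda>" and z: "car (P l) = {0}"
  have "\<exists>U. U \<subseteq> piece (P l) 0 \<and> submodule (DG T) (P l) U \<and> iso_modules (DG T) l ((P l)\<lparr>car := U\<rparr>) \<and>
      (\<forall>W. submodule UNIV (P l) W \<longrightarrow> U \<subseteq> W \<longrightarrow> W = car (P l))"
    using cov[OF l] unfolding graded_projective_cover_def by (elim conjE)
  then obtain U where U: "U \<subseteq> piece (P l) 0" "iso_modules (DG T) l ((P l)\<lparr>car := U\<rparr>)"
    by (elim exE conjE) (rule that)
  then obtain f where f: "bij_betw f (car l) U" by (auto simp: iso_modules_def)
  have U0: "U \<subseteq> {0}" using U(1) graded_module_piece(2)[OF P_graded[OF l], of 0] z by auto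
  note lf = simple_moduleD(1,2)[OF lam_simple[OF l]]
  have 0: "0 \<in> car l" using subspaceD(1)[OF fd_moduleD(2,3)[OF lf(1)]] .
  then obtain v where v: "v \<in> car l" "v \<noteq> 0" using lf(2) by auto
  have "f v \<in> {0}" "f 0 \<in> {0}" using bij_betwE[OF f] v(1) 0 subsetD[OF U0] by blast+
  then have "f v = f 0" by simp
  then show False using inj_onD[OF bij_betw_imp_inj_on[OF f] _ v(1) 0] v(2) by blast
qed

lemma cover_map:
  assumes "l \<in> \<Lambda>"
  obtains f where "f \<in> ghoms (P l) (L l)" "f ` car (P l) = car (L l)"
    "\<forall>U. submodule UNIV (P l) U \<longrightarrow> f ` U = car (L l) \<longrightarrow> U = car (P l)"
proof -
  have "\<exists>f\<in>ghoms (P l) (L l). f ` car (P l) = car (L l) \<and>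
      (\<forall>U. submodule UNIV (P l) U \<longrightarrow> f ` U = car (L l) \<longrightarrow> U = car (P l))"
    using cov[OF assms] unfolding graded_projective_cover_def by (elim conjE)
  then show ?thesis using that by blast
qed

text \<open>If \<open>L l\<close> were zero, the zero submodule would be mapped onto it, and since
  the covering is essential \<open>P l\<close> would be zero, although it contains a copy of
  \<open>l\<close>.\<close>

lemma L_ne: "l \<in> \<Lambda> \<Longrightarrow> car (L l) \<noteq> {0}"
proof
  assume l: "l \<in> \<Lambda>" and z: "car (L l) = {0}"
  note Pf = graded_module_fd[OF P_graded[OF l]]
  obtain f where f0: "f \<in> ghoms (P l) (L l)" "f ` car (P l) = car (L l)"
    "\<forall>U. submodule UNIV (P l) U \<longrightarrow> f ` U = car (L l) \<longrightarrow> U = car (P l)"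
    by (rule cover_map[OF l])
  note f = f0(1,2) f0(3)[rule_format]
  have "f ` {0} = car (L l)" using z homs_zero[OF Pf ghomsD(1)[OF f(1)]] by simp
  then have "{0} = car (P l)" by (rule f(3)[OF submodule_zero[OF Pf]])
  then show False using P_ne[OF l] by simp
qed

lemma head_map:
  assumes "l \<in> \<Lambda>"
  obtains \<pi> where "\<pi> \<in> ghoms (M l) (L l)" "\<pi> ` car (M l) = car (L l)" "{v \<in> car (M l). \<pi> v = 0} = radical (M l)"
  using hd[OF assms] unfolding graded_head_def by blast

lemma verma_loc:
  assumes l: "l \<in> \<Lambda>"
  obtains l' q where "verma V T l l' (M l) q"
proof -
  obtain \<pi> where \<pi>: "\<pi> \<in> ghoms (M l) (L l)" "\<pi> ` car (M l) = car (L l)" by (rule head_map[OF l])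
  \<comment> \<open>The Verma module is nonzero because it maps onto the nonzero
    \<open>L l\<close>.\<close>
  have "car (M l) \<noteq> {0}"
    using \<pi>(2) L_ne[OF l] homs_zero[OF graded_module_fd[OF M_graded[OF l]] ghomsD(1)[OF \<pi>(1)]] by auto
  moreover obtain l' q where "inflation T l l'"
      "lin_on (tscl l) (tspace l) (scl (M l)) (car (M l)) q" "q ` tspace l = car (M l)"
      "{t \<in> tspace l. q t = 0} = module.span (tscl l)
        {pure l (mul D x b) v - pure l x (act l' b v) | x b v. b \<in> Dge0 T \<and> v \<in> car l}"
      "\<forall>x y. \<forall>v\<in>car l. act (M l) y (q (pure l x v)) = q (pure l (mul D y x) v)"
      "\<forall>n. piece (M l) n = q ` module.span (tscl l) {pure l x v | x v. x \<in> Dgr T n \<and> v \<in> car l}"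
    using ver[OF l] unfolding verma_module_def by blast
  ultimately have "verma V T l l' (M l) q"
    by (intro verma.intro dbl_axioms verma_axioms.intro lam_simple[OF l] M_graded[OF l]) auto
  then show ?thesis by (rule that)
qed

lemma L_simple: "l \<in> \<Lambda> \<Longrightarrow> simple_module D UNIV (L l)"
  and L_pos: "l \<in> \<Lambda> \<Longrightarrow> n > 0 \<Longrightarrow> piece (L l) n = {0}"
  and L_0: "l \<in> \<Lambda> \<Longrightarrow> \<exists>f\<in>homs (DG T) l ((L l)\<lparr>car := piece (L l) 0\<rparr>). bij_betw f (car l) (piece (L l) 0)"
proof -
  assume l: "l \<in> \<Lambda>"
  obtain l' q where v: "verma V T l l' (M l) q" by (rule verma_loc[OF l])
  obtain \<pi> where \<pi>: "\<pi> \<in> ghoms (M l) (L l)" "\<pi> ` car (M l) = car (L l)" "{v \<in> car (M l). \<pi> v = 0} = radical (M l)"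
    by (rule head_map[OF l])
  show "simple_module D UNIV (L l)" by (rule verma.L_simple[OF v L_graded[OF l] \<pi>])
  show "n > 0 \<Longrightarrow> piece (L l) n = {0}" by (rule verma.L_pos[OF v L_graded[OF l] \<pi>])
  show "\<exists>f\<in>homs (DG T) l ((L l)\<lparr>car := piece (L l) 0\<rparr>). bij_betw f (car l) (piece (L l) 0)"
    by (rule verma.L_0[OF v L_graded[OF l] \<pi>])
qed

text \<open>The inclusion of \<open>S\<close> in \<open>N\<close> is a graded homomorphism, so parts
  taken in \<open>gsubmod N S\<close> agree with those taken in \<open>N\<close>.\<close>

lemma gsub_gsubmod:
  assumes N: "graded_module T N" and S: "gsub N S" and U: "gsub (gsubmod N S) U"
  shows "gsub N U" "U \<subseteq> S"
proof -
  have SS: "submodule UNIV N S" using S by (simp add: gsub_def)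
  have U': "submodule UNIV (gsubmod N S) U" using U by (simp add: gsub_def)
  then show US: "U \<subseteq> S" by (simp add: submodule_def)
  have "submodule UNIV N U" using U' submoduleD(2)[OF SS] by (auto simp: submodule_def)
  moreover have "part (piece N) i u \<in> U" if u: "u \<in> U" for u i
  proof -
    let ?f = "\<lambda>v. if v \<in> S then v else 0"
    have f: "?f \<in> ghoms (gsubmod N S) N"
      using subspaceD[OF fd_moduleD(2)[OF graded_module_fd[OF N]] submoduleD(1)[OF SS]] submoduleD(2,3)[OF SS]
      by (auto simp: ghoms_def homs_def lin_on_def)
    have p: "part (piece (gsubmod N S)) i u \<in> U" using U u by (simp add: gsub_def)
    have "part (piece N) i (?f u) = ?f (part (piece (gsubmod N S)) i u)"
      using US u by (intro ghoms_part[OF graded_module_gsubmod[OF N S] N f]) auto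
    then show ?thesis using p US u by (auto simp: subset_iff split: if_splits)
  qed
  ultimately show "gsub N U" by (simp add: gsub_def)
qed

text \<open>\<open>S\<close> is chosen minimal among graded submodules only; that it has no other
  submodules either becomes clear when \<open>L_complete\<close> identifies it with a shift of some
  \<open>L l\<close>.\<close>

lemma exists_simple_gsub:
  fixes N :: "('k, 'd) ugrep"
  assumes N: "graded_module T N" "car N \<noteq> {0}"
  obtains S l i f where "gsub N S" "S \<noteq> {0}" "l \<in> \<Lambda>" "f \<in> ghoms (shift i (L l)) (gsubmod N S)"
      "bij_betw f (car (L l)) S"
proof -
  obtain S where S': "submodule UNIV N S" "gsub N S" "S \<noteq> {0}"
      "\<And>W. submodule UNIV N W \<Longrightarrow> gsub N W \<Longrightarrow> W \<subseteq> S \<Longrightarrow> W = {0} \<or> W = S"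
    using exists_minimal_submodule[of "gsub N", OF gsub_car[OF N(1)] graded_module_fd[OF N(1)] N(2)] by metis
  have S: "gsub N S" "S \<noteq> {0}" "\<And>W. gsub N W \<Longrightarrow> W \<subseteq> S \<Longrightarrow> W = {0} \<or> W = S"
    using S' by (auto simp: gsub_def)
  let ?N = "gsubmod N S"
  have gN: "graded_module T ?N" by (rule graded_module_gsubmod[OF N(1) S(1)])
  have min: "U = {0} \<or> U = car ?N" if "gsub ?N U" for U
    using S(3)[OF gsub_gsubmod[OF N(1) S(1) that]] by simp
  interpret G: graded_space "scl ?N" "car ?N" "piece ?N" by (rule graded_module_space[OF gN])
  let ?I = "{i. piece ?N i \<noteq> {0}}"
  have "?I \<noteq> {}"
  proof
    assume "?I = {}"
    then have "v = 0" if "v \<in> car ?N" for v using G.sum_parts[OF that finite.emptyI] by simp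
    then show False using S(2) subspaceD(1)[OF G.vs G.sub] by auto
  qed
  then have i: "Max ?I \<in> ?I" using Max_in[OF G.fin_supp] by blast
  define i where "i = Max ?I"
  have top: "piece ?N n = {0}" if "n > i" for n
  proof (rule ccontr)
    assume "piece ?N n \<noteq> {0}"
    then have "n \<le> i" unfolding i_def using Max_ge[OF G.fin_supp, of n] by blast
    then show False using that by simp
  qed
  have pf: "fd_module D (DG T) (?N\<lparr>car := piece ?N i\<rparr>)" by (rule piece_fd[OF gN])
  have "car (?N\<lparr>car := piece ?N i\<rparr>) \<noteq> {0}" using i unfolding i_def by simp
  from exists_simple_submodule[OF pf this]
  obtain U where U: "submodule (DG T) (?N\<lparr>car := piece ?N i\<rparr>) U"
      "simple_module D (DG T) (?N\<lparr>car := piece ?N i\<rparr>\<lparr>car := U\<rparr>)" by metis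
  obtain l k where l: "l \<in> \<Lambda>" "k \<in> homs (DG T) l (?N\<lparr>car := piece ?N i\<rparr>\<lparr>car := U\<rparr>)" "bij_betw k (car l) U"
    using exists_weight[OF U(2)] by auto
  have Ui: "U \<subseteq> piece ?N i" using submoduleD(2)[OF U(1)] by simp
  have "k v \<in> piece ?N i" if "v \<in> car l" for v using homsD(4)[OF l(2) that] Ui by auto
  then have k: "k \<in> homs (DG T) l (?N\<lparr>car := piece ?N i\<rparr>)"
    by (intro homs_codomain[OF l(2)]) auto
  have "k \<noteq> 0"
  proof
    assume "k = 0"
    then have "U \<subseteq> {0}" using l(3) by (auto simp: bij_betw_def)
    then show False using simple_moduleD(2)[OF U(2)] subspaceD(1)[OF fd_moduleD(2,3)[OF simple_moduleD(1)[OF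
        U(2)]]] by auto
  qed
  obtain l' q where v: "verma V T l l' (M l) q" by (rule verma_loc[OF l(1)])
  obtain \<pi> where \<pi>: "\<pi> \<in> ghoms (M l) (L l)" "\<pi> ` car (M l) = car (L l)" "{v \<in> car (M l). \<pi> v = 0} = radical (M l)"
    by (rule head_map[OF l(1)])
  obtain f where "f \<in> ghoms (shift i (L l)) ?N" "bij_betw f (car (L l)) (car ?N)"
    using verma.L_complete[OF v L_graded[OF l(1)] \<pi> gN min top k \<open>k \<noteq> 0\<close>] by blast
  then show ?thesis using that[OF S(1,2) l(1)] by simp
qed

text \<open>The case \<open>exact\<close> is used both for extensions and to pass along
  isomorphisms, since an isomorphism is an exact sequence with zero third term. An identity between
  additive quantities thereby reduces to zero modules and the shifts of the
  \<open>L l\<close>.\<close>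

lemma graded_module_induct [consumes 1, case_names zero simple exact]:
  fixes N :: "('k, 'd) ugrep"
  assumes N: "graded_module T N"
    and zero: "\<And>N. graded_module T N \<Longrightarrow> car N = {0} \<Longrightarrow> R N"
    and simple: "\<And>l i. l \<in> \<Lambda> \<Longrightarrow> R (shift i (L l))"
    and ext: "\<And>f g N' N N''. graded_module T N' \<Longrightarrow> graded_module T N \<Longrightarrow> graded_module T N'' \<Longrightarrow>
      gexact f g N' N N'' \<Longrightarrow> R N' \<Longrightarrow> R N'' \<Longrightarrow> R N"
  shows "R N"
  using N
proof (induction "vector_space.dim (scl N) (car N)" arbitrary: N rule: less_induct)
  case less
  note N = less.prems and ND = fd_moduleD[OF graded_module_fd[OF less.prems]]
  show ?case
  proof (cases "car N = {0}")
    case False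
    obtain S l i f where S: "gsub N S" "S \<noteq> {0}" "l \<in> \<Lambda>" "f \<in> ghoms (shift i (L l)) (gsubmod N S)"
        "bij_betw f (car (L l)) S"
      by (rule exists_simple_gsub[OF N False])
    have SS: "submodule UNIV N S" using S(1) by (simp add: gsub_def)
    let ?S = "gsubmod N S" and ?Z = "gsubmod N {0}"
    have gS: "graded_module T ?S" and gZ: "graded_module T ?Z"
      using graded_module_gsubmod[OF N] S(1) gsub_zero[OF N] by auto
    \<comment> \<open>The isomorphism of the shifted \<open>L l\<close> with \<open>S\<close>, read
      as an exact sequence ending in the zero module.\<close>
    have "gexact f 0 (shift i (L l)) ?S ?Z"
      unfolding gexact_def using S(4,5) ghoms_zero[OF gS gZ] subspaceD(1)[OF ND(2) submoduleD(1)[OF SS]]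
          by (auto simp: bij_betw_def)
    then have RS: "R ?S"
      by (rule ext[OF graded_module_shift[OF L_graded[OF S(3)]] gS gZ _ simple[OF S(3)] zero[OF gZ]]) simp
    obtain Q :: "('k, 'd) ugrep" and \<pi> where Q: "graded_module T Q" "\<pi> \<in> ghoms N Q" "\<pi> ` car N = car Q"
        "{v \<in> car N. \<pi> v = 0} = S"
      by (rule exists_graded_quotient[OF N S(1)])
    have "vector_space.dim (scl N) (car N) = vector_space.dim (scl N) S + vector_space.dim (scl Q) (car Q)"
      using rank_nullity(2)[OF ND(1) fd_moduleD(2)[OF graded_module_fd[OF Q(1)]] homsD(1)[OF ghomsD(1)[OF
          Q(2)]]] Q(3,4) by simp
    moreover have "vector_space.dim (scl N) S \<noteq> 0"
      using fd_space_dim_eq_0[OF fd_space_subspace[OF ND(1) submoduleD(1,2)[OF SS]]] S(2) by simp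
    ultimately have RQ: "R Q" by (intro less.hyps Q(1)) simp
    have f: "(\<lambda>v. if v \<in> S then v else 0) \<in> ghoms ?S N"
      using subspaceD[OF ND(2) submoduleD(1)[OF SS]] submoduleD(2,3)[OF SS]
      by (auto simp: ghoms_def homs_def lin_on_def)
    have "gexact (\<lambda>v. if v \<in> S then v else 0) \<pi> ?S N Q"
      unfolding gexact_def using f Q(2,3,4) by (auto simp: inj_on_def)
    then show ?thesis by (rule ext[OF gS N Q(1) _ RS RQ])
  qed (rule zero[OF N])
qed

text \<open>The kernel of the covering contains every proper submodule: one not inside it would be
  mapped onto \<open>L l\<close> and so be everything. Hence the kernel of \<open>h\<close> lies in
  that of \<open>f\<close>, and simplicity of \<open>Q\<close> gives equality.\<close>

lemma cover_hom:
  fixes Q :: "('k, 'd, 'm::ab_group_add, 'z) rep_scheme"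
  assumes l: "l \<in> \<Lambda>" and f: "f \<in> ghoms (P l) (L l)" "f ` car (P l) = car (L l)"
    "\<And>U. submodule UNIV (P l) U \<Longrightarrow> f ` U = car (L l) \<Longrightarrow> U = car (P l)"
    and Q: "simple_module D UNIV Q" and h: "h \<in> homs UNIV (P l) Q" "h \<noteq> 0"
  shows "h ` car (P l) = car Q" "{v \<in> car (P l). h v = 0} = {v \<in> car (P l). f v = 0}"
proof -
  note Pf = graded_module_fd[OF P_graded[OF l]] and Lf = graded_module_fd[OF L_graded[OF l]] and Qf
      = simple_moduleD(1)[OF Q]
  note PD = fd_moduleD[OF Pf] and fh = ghomsD(1)[OF f(1)]
  show "h ` car (P l) = car Q" by (rule simple_hom_onto[OF Q Pf h])
  let ?K = "{v \<in> car (P l). f v = 0}" and ?H = "{v \<in> car (P l). h v = 0}"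
  have K: "submodule UNIV (P l) ?K" by (rule hom_kernel_submodule[OF Pf Lf fh])
  have H: "submodule UNIV (P l) ?H" by (rule hom_kernel_submodule[OF Pf Qf h(1)])
  have Hne: "?H \<noteq> car (P l)" using homs_ne_0[OF h] by auto
  have "f ` ?H = {0} \<or> f ` ?H = car (L l)"
    by (rule simple_moduleD(3)[OF L_simple[OF l] hom_image_submodule[OF Pf Lf fh H]])
  then have "f ` ?H = {0}" using f(3)[OF H] Hne by blast
  then have HK: "?H \<subseteq> ?K" by auto
  have "h ` ?K = {0} \<or> h ` ?K = car Q"
    by (rule simple_moduleD(3)[OF Q hom_image_submodule[OF Pf Qf h(1) K]])
  moreover have "h ` ?K \<noteq> car Q"
  proof
    assume eq: "h ` ?K = car Q"
    have "car (P l) \<subseteq> ?K"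
    proof
      fix v assume v: "v \<in> car (P l)"
      then have "h v \<in> h ` ?K" using eq homsD(4)[OF h(1) v] by simp
      then obtain k where k: "k \<in> ?K" "h v = h k" by blast
      then have kP: "k \<in> car (P l)" by simp
      have "v - k \<in> ?H" using lin_on_diff[OF PD(2,3) homsD(1)[OF h(1)] v kP] k(2) subspaceD(4)[OF PD(2,3) v kP]
          by simp
      then have "v - k \<in> ?K" using HK by blast
      then show "v \<in> ?K" using subspaceD(2)[OF PD(2) submoduleD(1)[OF K] _ k(1), of "v - k"] by simp
    qed
    then have "f ` car (P l) \<subseteq> {0}" by auto
    then show False using f(2) L_ne[OF l] subspaceD(1)[OF fd_moduleD(2,3)[OF Lf]] by auto
  qed
  ultimately have "h ` ?K = {0}" by blast
  then have "?K \<subseteq> ?H" by auto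
  then show "?H = ?K" using HK by blast
qed

text \<open>By \<open>cover_hom\<close> all nonzero maps from \<open>P l\<close> to \<open>Q\<close>
  have the kernel of the covering, which is the situation of \<open>hom_dim_schur\<close>.\<close>

lemma cover_hom_dim:
  fixes Q :: "('k, 'd, 'm::ab_group_add, 'z) rep_scheme"
  assumes l: "l \<in> \<Lambda>" and Q: "simple_module D UNIV Q"
    and F: "module.subspace (fscale (scl Q)) F" "F \<subseteq> homs UNIV (P l) Q"
  shows "hom_dim Q F = (if F = {0} then 0 else 1)"
proof -
  note Pf = graded_module_fd[OF P_graded[OF l]] and Qf = simple_moduleD(1,2)[OF Q]
  obtain f where f0: "f \<in> ghoms (P l) (L l)" "f ` car (P l) = car (L l)"
    "\<forall>U. submodule UNIV (P l) U \<longrightarrow> f ` U = car (L l) \<longrightarrow> U = car (P l)"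
    by (rule cover_map[OF l])
  note f = f0(1,2) f0(3)[rule_format]
  show ?thesis
  proof (cases "F = {0}")
    case True
    then show ?thesis using hom_dim_eq_0[OF True fd_moduleD(2)[OF Qf(1)]] by simp
  next
    case False
    have "hom_dim Q F = 1"
    proof (rule hom_dim_schur[OF Pf Qf F _ False])
      fix h assume h: "h \<in> F" "h \<noteq> 0"
      then have hh: "h \<in> homs UNIV (P l) Q" using F(2) by blast
      show "h ` car (P l) = car Q \<and> {v \<in> car (P l). h v = 0} = {v \<in> car (P l). f v = 0}"
        by (intro conjI cover_hom[OF l f Q hh h(2)])
    qed
    then show ?thesis using False by simp
  qed
qed

text \<open>A nonzero map factors through the covering and induces an isomorphism of
  \<open>L l\<close> shifted by \<open>i\<close> with \<open>L m\<close> shifted by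
  \<open>j\<close>. Their nonzero top pieces are in degrees \<open>i\<close> and \<open>j\<close>,
  so the degrees agree, and the top pieces recover the weights.\<close>

lemma cover_ghoms:
  assumes l: "l \<in> \<Lambda>" "m \<in> \<Lambda>"
  shows "ghoms (shift i (P l)) (shift j (L m)) \<noteq> {0} \<longleftrightarrow> l = m \<and> i = j"
proof -
  obtain f where f0: "f \<in> ghoms (P l) (L l)" "f ` car (P l) = car (L l)"
    "\<forall>U. submodule UNIV (P l) U \<longrightarrow> f ` U = car (L l) \<longrightarrow> U = car (P l)"
    by (rule cover_map[OF l(1)])
  note f = f0(1,2) f0(3)[rule_format]
  note gP = P_graded[OF l(1)] and gL = L_graded[OF l(1)] and gL' = L_graded[OF l(2)]
  note sP = graded_module_shift[OF gP, of i] and sL = graded_module_shift[OF gL, of i] and sL'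
      = graded_module_shift[OF gL', of j]
  have zero: "0 \<in> ghoms (shift i (P l)) (shift j (L m))" by (rule ghoms_zero[OF sP sL'])
  show ?thesis
  proof
    assume "l = m \<and> i = j"
    then have e: "m = l" "j = i" by auto
    have "f \<noteq> 0"
    proof
      assume "f = 0"
      then have "car (L l) \<subseteq> {0}" using f(2) by auto
      then show False using L_ne[OF l(1)] subspaceD(1)[OF fd_moduleD(2,3)[OF graded_module_fd[OF gL]]] by auto
    qed
    moreover have "f \<in> ghoms (shift i (P l)) (shift j (L m))" unfolding e ghoms_shift by (rule f(1))
    ultimately show "ghoms (shift i (P l)) (shift j (L m)) \<noteq> {0}" by blast
  next
    assume "ghoms (shift i (P l)) (shift j (L m)) \<noteq> {0}"
    then obtain h where h: "h \<in> ghoms (shift i (P l)) (shift j (L m))" "h \<noteq> 0" using zero by blast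
    have hh: "h \<in> homs UNIV (P l) (L m)" using ghomsD(1)[OF h(1)] by simp
    note ch = cover_hom[OF l(1) f L_simple[OF l(2)] hh h(2)]
    have fs: "f \<in> ghoms (shift i (P l)) (shift i (L l))" using f(1) by (simp only: ghoms_shift)
    have ker: "h v = 0" if "v \<in> car (shift i (P l))" "f v = 0" for v using ch(2) that by auto
    obtain k where k: "k \<in> ghoms (shift i (L l)) (shift j (L m))" "\<And>v. k (f v) = h v"
      by (rule ghoms_factor[OF sP sL sL' fs _ h(1) ker]) (use f(2) in auto)
    have kh: "k \<in> homs UNIV (L l) (L m)" using ghomsD(1)[OF k(1)] by simp
    obtain v where "h v \<noteq> 0" using homs_ne_0[OF hh h(2)] by blast
    then have k0: "k \<noteq> 0" using k(2)[of v] by auto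
    have inj: "inj_on k (car (L l))" by (rule simple_hom_inj(2)[OF L_simple[OF l(1)] graded_module_fd[OF gL'] kh k0])
    have onto: "k ` car (L l) = car (L m)" by (rule simple_hom_onto[OF L_simple[OF l(2)] graded_module_fd[OF gL]
        kh k0])
    have kp: "k ` piece (L l) (n - i) = piece (L m) (n - j)" for n
      using ghoms_onto_piece[OF sL sL' k(1), of n] onto by simp
    have ne0: "piece (L x) 0 \<noteq> {0}" if x: "x \<in> \<Lambda>" for x
    proof
      assume z: "piece (L x) 0 = {0}"
      obtain b where b: "b \<in> homs (DG T) x ((L x)\<lparr>car := piece (L x) 0\<rparr>)" "bij_betw b (car x) (piece (L x) 0)"
        using L_0[OF x] by blast
      note xf = simple_moduleD(1,2)[OF lam_simple[OF x]]
      have "v = 0" if "v \<in> car x" for v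
        using inj_onD[OF bij_betw_imp_inj_on[OF b(2)], of v 0] that z b(2) homs_zero[OF xf(1) b(1)]
          subspaceD(1)[OF fd_moduleD(2,3)[OF xf(1)]] by (auto simp: bij_betw_def)
      then show False using xf(2) subspaceD(1)[OF fd_moduleD(2,3)[OF xf(1)]] by auto
    qed
    have k00: "k 0 = 0" using homs_zero[OF graded_module_fd[OF gL] kh] .
    \<comment> \<open>Otherwise the top piece of \<open>L l\<close> would be mapped into a piece of
      \<open>L m\<close> of positive degree, which is zero.\<close>
    have "i \<le> j"
    proof (rule ccontr)
      assume "\<not> i \<le> j"
      then have "piece (L m) (i - j) = {0}" using L_pos[OF l(2)] by simp
      then have "k ` piece (L l) 0 = {0}" using kp[of i] by simp
      then have "piece (L l) 0 \<subseteq> {0}"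
        using inj_onD[OF inj, of _ 0] k00 graded_module_piece[OF gL] subspaceD(1)[OF fd_moduleD(2,3)[OF
            graded_module_fd[OF gL]]] by fastforce
      then show False using ne0[OF l(1)] subspaceD(1)[OF fd_moduleD(2)[OF graded_module_fd[OF gL]]
          graded_module_piece(1)[OF gL, of 0]] by blast
    qed
    moreover have "j \<le> i"
    proof (rule ccontr)
      assume "\<not> j \<le> i"
      then have "piece (L l) (j - i) = {0}" using L_pos[OF l(1)] by simp
      then have "piece (L m) 0 = {0}" using kp[of j] k00 by simp
      then show False using ne0[OF l(2)] by simp
    qed
    ultimately have ij: "i = j" by simp
    let ?k = "\<lambda>v. if v \<in> piece (L l) 0 then k v else 0"
    have kp0: "k ` piece (L l) 0 = piece (L m) 0" using kp[of i] ij by simp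
    have "?k \<in> homs (DG T) ((L l)\<lparr>car := piece (L l) 0\<rparr>) ((L m)\<lparr>car := piece (L m) 0\<rparr>)"
      using kp0 by (intro homs_restrict[OF fd_DG[OF graded_module_fd[OF gL]] kh _ piece_submodule[OF gL]]) auto
    moreover have "bij_betw ?k (piece (L l) 0) (piece (L m) 0)"
      using kp0 inj graded_module_piece(2)[OF gL, of 0] by (auto simp: bij_betw_def inj_on_def subset_iff)
    ultimately have "iso_modules (DG T) ((L l)\<lparr>car := piece (L l) 0\<rparr>) ((L m)\<lparr>car := piece (L m) 0\<rparr>)"
      by (auto simp: iso_modules_def)
    moreover have iso: "iso_modules (DG T) x ((L x)\<lparr>car := piece (L x) 0\<rparr>)" if "x \<in> \<Lambda>" for x
      using L_0[OF that] by (auto simp: iso_modules_def)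
    note pl = piece_fd[OF gL, of 0] and pm = piece_fd[OF gL', of 0] and mf = simple_moduleD(1)[OF lam_simple[OF l(2)]]
    ultimately have "iso_modules (DG T) l m"
      using iso_modules_trans[OF pl iso[OF l(1)]] iso_modules_trans[OF pm _ iso_modules_sym[OF mf pm iso[OF
          l(2)]]] by blast
    then show "l = m \<and> i = j" using lam_unique[OF l] ij by simp
  qed
qed

end

lemma laurent_shift: "laurent_poly (\<lambda>i. a (i - j)) = Poly_Mapping.single j 1 * laurent_poly a"
proof -
  have "bij_betw (\<lambda>k. k + j) {k. a k \<noteq> 0} {i. a (i - j) \<noteq> 0}"
    by (rule bij_betwI[of _ _ _ "\<lambda>i. i - j"]) auto
  from sum.reindex_bij_betw[OF this, of "\<lambda>i. Poly_Mapping.single i (a (i - j))", symmetric]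
  have "laurent_poly (\<lambda>i. a (i - j)) = (\<Sum>k | a k \<noteq> 0. Poly_Mapping.single (k + j) (a k))"
    by (simp add: laurent_poly_def)
  also have "\<dots> = Poly_Mapping.single j 1 * laurent_poly a"
    by (simp add: laurent_poly_def sum_distrib_left mult_single add.commute)
  finally show ?thesis .
qed

lemma eval1_superset:
  assumes "finite I" "Poly_Mapping.keys p \<subseteq> I"
  shows "eval1 p = (\<Sum>i\<in>I. Poly_Mapping.lookup p i)"
  unfolding eval1_def using assms by (intro sum.mono_neutral_left) (auto simp: in_keys_iff)

lemma eval1_add: "eval1 (p + q) = eval1 p + eval1 q"
proof -
  let ?I = "Poly_Mapping.keys p \<union> Poly_Mapping.keys q"
  have "Poly_Mapping.keys (p + q) \<subseteq> ?I" by (rule Poly_Mapping.keys_add)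
  then show ?thesis
    using eval1_superset[of ?I p] eval1_superset[of ?I q] eval1_superset[of ?I "p + q"]
    by (simp add: lookup_add sum.distrib)
qed

lemma eval1_single: "eval1 (Poly_Mapping.single j c) = c"
  using eval1_superset[of "{j}" "Poly_Mapping.single j c"] by simp

lemma eval1_0: "eval1 0 = 0"
  by (simp add: eval1_def)

lemma laurent_poly_0: "laurent_poly (\<lambda>_. 0) = 0"
  by (simp add: laurent_poly_def)

lemma laurent_poly_delta: "laurent_poly (\<lambda>i. if i = j then 1 else 0) = Poly_Mapping.single j 1"
proof -
  have "{i. (if i = j then 1 else 0 :: int) \<noteq> 0} = {j}" by auto
  then show ?thesis by (simp add: laurent_poly_def)
qed

lemma lscale_simps: "lscale p (c + c') = lscale p c + lscale p c'" "lscale (p + p') c = lscale p c + lscale p' c"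
  "lscale (p * p') c = lscale p (lscale p' c)" "lscale 1 c = c" "lscale 0 c = 0" "lscale p 0 = 0"
  by (simp_all add: lscale_def fun_eq_iff algebra_simps)

context setup_data begin

section \<open>Finiteness of the set of weights\<close>

lemma regular_fd: "fd_module D (DG T) (\<lparr>scl = (*s), car = DG T, act = mul D\<rparr> :: ('k, 'd, 'k ^ 'd) rep)"
proof -
  have "fd_space (*s) (DG T)" by (rule fd_space_subspace[OF fd_UNIV DG_subspace]) simp
  then show ?thesis
    unfolding fd_module_def fd_space_def lin_on_def
    using subalgebraD(2)[OF DG_subalgebra] by (auto simp: vlinD[OF Da(1)] vlinD[OF Da(2)] Da)
qed

text \<open>Induction on the dimension along a simple submodule \<open>U\<close>: a nonzero map to
  \<open>N\<close> either stays nonzero in the quotient or is an isomorphism onto \<open>U\<close>,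
  and the latter happens for at most one weight.\<close>

lemma finite_weights_into:
  fixes N :: "('k, 'd) urep"
  assumes "fd_module D (DG T) N"
  shows "finite {l \<in> \<Lambda>. homs (DG T) l N \<noteq> {0}}"
  using assms
proof (induction "vector_space.dim (scl N) (car N)" arbitrary: N rule: less_induct)
  case less
  note N = less.prems and ND = fd_moduleD[OF less.prems]
  have zero: "0 \<in> homs (DG T) l K" if "fd_module D (DG T) l" "fd_module D (DG T) K" for l K :: "('k, 'd) urep"
    using subspaceD(1)[OF vector_space_fscale[OF fd_moduleD(2)[OF that(2)]] homs_subspace[OF that]] .
  show ?case
  proof (cases "car N = {0}")
    case True
    have "homs (DG T) l N = {0}" if l: "l \<in> \<Lambda>" for l
    proof (rule ccontr)
      assume "homs (DG T) l N \<noteq> {0}"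
      then obtain h where h: "h \<in> homs (DG T) l N" "h \<noteq> 0"
        using zero[OF simple_moduleD(1)[OF lam_simple[OF l]] N] by blast
      then show False using homs_ne_0[OF h] homsD(4)[OF h(1)] True by auto
    qed
    then have "{l \<in> \<Lambda>. homs (DG T) l N \<noteq> {0}} = {}" by blast
    then show ?thesis by (simp only: finite.emptyI)
  next
    case False
    obtain U where U: "submodule (DG T) N U" "simple_module D (DG T) (N\<lparr>car := U\<rparr>)"
      by (rule exists_simple_submodule[OF N False])
    obtain Q :: "('k, 'd) urep" and \<pi> where Q: "fd_module D (DG T) Q" "\<pi> \<in> homs (DG T) N Q" "\<pi> ` car N = car Q"
      "{v \<in> car N. \<pi> v = 0} = U"
      by (rule exists_quotient[OF DG_subalgebra N U(1)])
    have "vector_space.dim (scl N) (car N) = vector_space.dim (scl N) U + vector_space.dim (scl Q) (car Q)"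
      using rank_nullity(2)[OF ND(1) fd_moduleD(2)[OF Q(1)] homsD(1)[OF Q(2)]] Q(3,4) by simp
    moreover have "vector_space.dim (scl N) U \<noteq> 0"
      using fd_space_dim_eq_0[OF fd_space_subspace[OF ND(1) submoduleD(1,2)[OF U(1)]]]
          simple_moduleD(2)[OF U(2)] by simp
    ultimately have finQ: "finite {l \<in> \<Lambda>. homs (DG T) l Q \<noteq> {0}}" by (intro less.hyps Q(1)) simp
    let ?E = "{l \<in> \<Lambda>. iso_modules (DG T) l (N\<lparr>car := U\<rparr>)}"
    have "l = m" if "l \<in> ?E" "m \<in> ?E" for l m
      using that lam_unique[of l m] simple_moduleD(1)[OF lam_simple] simple_moduleD(1)[OF U(2)]
        iso_modules_trans[OF simple_moduleD(1)[OF U(2)]] iso_modules_sym by (metis (no_types, lifting) mem_Collect_eq)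
    then have "?E = {} \<or> (\<exists>l. ?E = {l})" by blast
    then have finE: "finite ?E"
    proof
      assume "?E = {}"
      then show ?thesis by (rule ssubst) simp
    next
      assume "\<exists>l. ?E = {l}"
      then obtain l where "?E = {l}" ..
      then show ?thesis by (rule ssubst) simp
    qed
    have "{l \<in> \<Lambda>. homs (DG T) l N \<noteq> {0}} \<subseteq> {l \<in> \<Lambda>. homs (DG T) l Q \<noteq> {0}} \<union> ?E"
    proof (intro subsetI)
      fix l assume "l \<in> {l \<in> \<Lambda>. homs (DG T) l N \<noteq> {0}}"
      then have l: "l \<in> \<Lambda>" "homs (DG T) l N \<noteq> {0}" by auto
      note ls = lam_simple[OF l(1)] and lf = simple_moduleD(1)[OF lam_simple[OF l(1)]]
      obtain h where h: "h \<in> homs (DG T) l N" "h \<noteq> 0" using l(2) zero[OF lf N] by blast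
      have c: "(\<lambda>v. \<pi> (h v)) \<in> homs (DG T) l Q" by (rule homs_comp[OF N h(1) Q(2)])
      show "l \<in> {l \<in> \<Lambda>. homs (DG T) l Q \<noteq> {0}} \<union> ?E"
      proof (cases "(\<lambda>v. \<pi> (h v)) = 0")
        case True
        then have "\<pi> (h v) = 0" for v by (simp add: fun_eq_iff)
        then have hU: "h v \<in> U" if "v \<in> car l" for v using homsD(4)[OF h(1) that] Q(4) by blast
        have hh: "h \<in> homs (DG T) l (N\<lparr>car := U\<rparr>)" by (rule homs_codomain[OF h(1) refl hU])
        have "bij_betw h (car l) (car (N\<lparr>car := U\<rparr>))"
          unfolding bij_betw_def using simple_hom_inj(2)[OF ls N h] simple_hom_onto[OF U(2) lf hh h(2)] by blast
        then show ?thesis using hh l(1) by (auto simp: iso_modules_def)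
      next
        case False
        then have "homs (DG T) l Q \<noteq> {0}" using c by blast
        then show ?thesis using l(1) by blast
      qed
    qed
    then show ?thesis using finite_subset finite_UnI[OF finQ finE] by blast
  qed
qed

text \<open>Acting on a nonzero vector maps the regular module onto \<open>l\<close>, and
  \<open>DG_lift\<close> splits this map, so each \<open>l\<close> embeds in the regular module.
  Finiteness is what gives the sums over \<Lambda> their intended meaning.\<close>

lemma finite_weights: "finite \<Lambda>"
proof -
  let ?X = "\<lparr>scl = (*s), car = DG T, act = mul D\<rparr> :: ('k, 'd, 'k ^ 'd) rep"
  obtain Q :: "('k, 'd) urep" and \<pi> where Q: "fd_module D (DG T) Q" "\<pi> \<in> homs (DG T) ?X Q"
      "bij_betw \<pi> (car ?X) (car Q)"
    by (rule exists_urep_iso[OF DG_subalgebra regular_fd])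
  have "homs (DG T) l Q \<noteq> {0}" if l: "l \<in> \<Lambda>" for l
  proof -
    note ls = lam_simple[OF l] and lf = simple_moduleD(1)[OF lam_simple[OF l]]
    note lD = fd_moduleD[OF lf]
    obtain v where v: "v \<in> car l" "v \<noteq> 0"
      using simple_moduleD(2)[OF ls] subspaceD(1)[OF lD(2,3)] by auto
    define g where "g x = (if x \<in> DG T then act l x v else 0)" for x
    have g: "g \<in> homs (DG T) ?X l"
      using lin_onD[OF lD(5)[OF v(1)]] lD(7)[OF _ _ v(1)] subalgebraD[OF DG_subalgebra]
      by (intro homsI) (auto simp: g_def lin_on_def)
    have "g (one D) = v" using one_DG lD(6)[OF v(1)] by (simp add: g_def)
    then have g0: "g \<noteq> 0" using v(2) by (metis zero_fun_apply)
    obtain h where h: "h \<in> homs (DG T) l ?X" "\<And>u. u \<in> car l \<Longrightarrow> g (h u) = (if u \<in> car l then u else 0)"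
      using DG_lift[OF lf regular_fd lf g simple_hom_onto[OF ls regular_fd g g0] homs_id[OF lf]] by blast
    have hv: "h v \<in> car ?X" "h v \<noteq> 0"
      using homsD(4)[OF h(1) v(1)] h(2)[OF v(1)] v homs_zero[OF regular_fd g] by auto
    have "\<pi> (h v) \<noteq> \<pi> 0"
      using inj_onD[OF bij_betw_imp_inj_on[OF Q(3)] _ hv(1)] hv(2)
          subspaceD(1)[OF fd_moduleD(2,3)[OF regular_fd]] by blast
    then have "(\<lambda>u. \<pi> (h u)) \<noteq> 0" using homs_zero[OF regular_fd Q(2)] by (metis zero_fun_apply)
    then show ?thesis using homs_comp[OF regular_fd h(1) Q(2)] by blast
  qed
  then have "\<Lambda> \<subseteq> {l \<in> \<Lambda>. homs (DG T) l Q \<noteq> {0}}" by blast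
  then show ?thesis using finite_weights_into[OF Q(1)] finite_subset by blast
qed

section \<open>Graded characters and their independence\<close>

lemma ch_zero:
  assumes N: "graded_module T N" and z: "piece N i = {0}"
  shows "ch T \<Lambda> (N\<lparr>car := piece N i\<rparr>) l = 0"
proof (cases "l \<in> \<Lambda>")
  case True
  note lf = simple_moduleD(1)[OF lam_simple[OF True]] and pf = piece_fd[OF N, of i]
  have "h = 0" if h: "h \<in> homs (DG T) l (N\<lparr>car := piece N i\<rparr>)" for h
    using homs_ne_0[OF h] homsD(4)[OF h] z by auto
  moreover have "0 \<in> homs (DG T) l (N\<lparr>car := piece N i\<rparr>)"
    using subspaceD(1)[OF vector_space_fscale[OF fd_moduleD(2)[OF pf]] homs_subspace[OF lf pf]] .
  ultimately have "homs (DG T) l (N\<lparr>car := piece N i\<rparr>) = {0}" by blast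
  from hom_dim_eq_0[OF this fd_moduleD(2)[OF pf]] show ?thesis using True by (simp add: ch_def)
qed (simp add: ch_def)

lemma ch_fin: "graded_module T N \<Longrightarrow> finite {i. ch T \<Lambda> (N\<lparr>car := piece N i\<rparr>) l \<noteq> 0}"
  using ch_zero[of N] by (intro finite_subset[OF _ graded_space.fin_supp[OF graded_module_space[of T N]]]) auto

lemma lookup_gch: "graded_module T N \<Longrightarrow> Poly_Mapping.lookup (gch T \<Lambda> N l) i = ch T \<Lambda> (N\<lparr>car := piece N i\<rparr>) l"
  unfolding gch_def by (rule laurent_lookup[OF ch_fin])

text \<open>In each degree the sequence is an exact sequence of \<open>DG\<close> modules, and by
  \<open>DG_lift\<close> every map from \<open>l\<close> to the third term lifts.\<close>

lemma ch_exact: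
  assumes N': "graded_module T N'" and N: "graded_module T N" and N'': "graded_module T N''"
      and ex: "gexact f g N' N N''"
  shows "ch T \<Lambda> (N\<lparr>car := piece N i\<rparr>) l = ch T \<Lambda> (N'\<lparr>car := piece N' i\<rparr>) l + ch T \<Lambda> (N''\<lparr>car := piece N'' i\<rparr>) l"
proof (cases "l \<in> \<Lambda>")
  case True
  note lf = simple_moduleD(1)[OF lam_simple[OF True]]
  note pf' = piece_fd[OF N', of i] and pf = piece_fd[OF N, of i] and pf'' = piece_fd[OF N'', of i]
  note e = gexactD[OF ex] and gp = ghoms_onto_piece[OF N N'' gexactD(2,5)[OF ex], of i]
  note fp = gexact_piece[OF N' N N'' ex, of i]
  let ?f = "\<lambda>v. if v \<in> piece N' i then f v else 0" and ?g = "\<lambda>v. if v \<in> piece N i then g v else 0"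
  have f: "?f \<in> homs (DG T) (N'\<lparr>car := piece N' i\<rparr>) (N\<lparr>car := piece N i\<rparr>)"
    using fp by (intro homs_restrict[OF fd_DG[OF graded_module_fd[OF N']] ghomsD(1)[OF e(1)] _
        piece_submodule[OF N']]) auto
  have g: "?g \<in> homs (DG T) (N\<lparr>car := piece N i\<rparr>) (N''\<lparr>car := piece N'' i\<rparr>)"
    using gp by (intro homs_restrict[OF fd_DG[OF graded_module_fd[OF N]] ghomsD(1)[OF e(2)] _
        piece_submodule[OF N]]) auto
  have inj: "inj_on ?f (car (N'\<lparr>car := piece N' i\<rparr>))"
    using inj_onD[OF e(3)] graded_module_piece(2)[OF N', of i] by (intro inj_onI) (auto simp: subset_iff)
  have ker: "?f ` car (N'\<lparr>car := piece N' i\<rparr>) = {v \<in> car (N\<lparr>car := piece N i\<rparr>). ?g v = 0}"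
    using fp by auto
  have onto: "?g ` car (N\<lparr>car := piece N i\<rparr>) = car (N''\<lparr>car := piece N'' i\<rparr>)" using gp by simp
  have "hom_dim (N\<lparr>car := piece N i\<rparr>) (homs (DG T) l (N\<lparr>car := piece N i\<rparr>))
    = hom_dim (N'\<lparr>car := piece N' i\<rparr>) (homs (DG T) l (N'\<lparr>car := piece N' i\<rparr>))
    + hom_dim (N''\<lparr>car := piece N'' i\<rparr>) (homs (DG T) l (N''\<lparr>car := piece N'' i\<rparr>))"
    by (rule hom_dim_exact[OF lf pf' pf pf'' f inj g ker homs_subspace[OF lf pf'] subset_refl
          homs_subspace[OF lf pf] subset_refl subset_refl homs_comp[OF pf' _ f] homs_comp[OF pf _ g] _
          DG_lift[OF lf pf pf'' g onto]])
  then show ?thesis using True by (simp add: ch_def)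
qed (simp add: ch_def)

lemma gch_exact:
  assumes "graded_module T N'" "graded_module T N" "graded_module T N''" "gexact f g N' N N''"
  shows "gch T \<Lambda> N = gch T \<Lambda> N' + gch T \<Lambda> N''"
proof
  fix l
  show "gch T \<Lambda> N l = (gch T \<Lambda> N' + gch T \<Lambda> N'') l"
    unfolding gch_def plus_fun_apply by (intro laurent_add ch_fin ch_exact[OF assms] assms)
qed

lemma gch_shift: "gch T \<Lambda> (shift j N) = lscale (Poly_Mapping.single j 1) (gch T \<Lambda> N)"
proof
  fix l
  have "ch T \<Lambda> ((shift j N)\<lparr>car := piece (shift j N) i\<rparr>) l = ch T \<Lambda> (N\<lparr>car := piece N (i - j)\<rparr>) l" for i
    by (simp add: ch_def hom_dim_def homs_def)
  then show "gch T \<Lambda> (shift j N) l = lscale (Poly_Mapping.single j 1) (gch T \<Lambda> N) l"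
    unfolding gch_def lscale_def
    by (simp only: laurent_shift[of "\<lambda>i. ch T \<Lambda> (N\<lparr>car := piece N i\<rparr>) l" j])
qed

lemma gch_L:
  assumes l: "l \<in> \<Lambda>" "m \<in> \<Lambda>"
  shows "Poly_Mapping.lookup (gch T \<Lambda> (L m) l) 0 = (if l = m then 1 else 0)"
    "i > 0 \<Longrightarrow> Poly_Mapping.lookup (gch T \<Lambda> (L m) l) i = 0"
proof -
  note gL = L_graded[OF l(2)] and ls = lam_simple[OF l(1)] and ms = lam_simple[OF l(2)]
  show "i > 0 \<Longrightarrow> Poly_Mapping.lookup (gch T \<Lambda> (L m) l) i = 0"
    unfolding lookup_gch[OF gL] using ch_zero[OF gL L_pos[OF l(2)]] .
  let ?L = "(L m)\<lparr>car := piece (L m) 0\<rparr>"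
  note pf = piece_fd[OF gL, of 0]
  have iso: "iso_modules (DG T) m ?L" using L_0[OF l(2)] by (auto simp: iso_modules_def)
  have "simple_module D (DG T) ?L" using L_0[OF l(2)] simple_module_iso[OF ms pf] by auto
  from hom_dim_simple[OF ls this]
  have "hom_dim ?L (homs (DG T) l ?L) = (if iso_modules (DG T) l ?L then 1 else 0)" .
  moreover have "iso_modules (DG T) l ?L \<longleftrightarrow> l = m"
    using iso lam_unique[OF l] iso_modules_trans[OF pf _ iso_modules_sym[OF simple_moduleD(1)[OF ms] pf iso]] by blast
  ultimately show "Poly_Mapping.lookup (gch T \<Lambda> (L m) l) 0 = (if l = m then 1 else 0)"
    unfolding lookup_gch[OF gL] using l(1) by (simp add: ch_def)
qed

text \<open>The top degree of the character of \<open>L(m)\<close> is zero, where the coefficient is \<open>m\<close>; so the highest degree of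
  the \<open>p m\<close> cannot cancel.\<close>

lemma gch_independent:
  assumes z: "(\<Sum>m\<in>\<Lambda>. lscale (p m) (gch T \<Lambda> (L m))) = 0" and l: "l \<in> \<Lambda>"
  shows "p l = 0"
proof (rule ccontr)
  assume pl: "p l \<noteq> 0"
  let ?K = "\<Union>m\<in>\<Lambda>. Poly_Mapping.keys (p m)"
  have fin: "finite ?K" using finite_weights by auto
  have "?K \<noteq> {}" using pl l by auto
  then have "Max ?K \<in> ?K" by (rule Max_in[OF fin])
  then obtain k where k: "k \<in> \<Lambda>" "Max ?K \<in> Poly_Mapping.keys (p k)" by blast
  \<comment> \<open>The highest degree occurring in any of the \<open>p m\<close>, attained by
    \<open>p k\<close>. The coefficient to be compared is that of \<open>k\<close> in this
    degree.\<close>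
  define n where "n = Max ?K"
  have top: "Poly_Mapping.lookup (p m) i = 0" if "m \<in> \<Lambda>" "i > n" for m i
  proof (rule ccontr)
    assume "Poly_Mapping.lookup (p m) i \<noteq> 0"
    then have "i \<in> ?K" using that(1) by (auto simp: in_keys_iff)
    then show False using Max_ge[OF fin] that(2) unfolding n_def by force
  qed
  have "0 = Poly_Mapping.lookup ((\<Sum>m\<in>\<Lambda>. lscale (p m) (gch T \<Lambda> (L m))) k) (n + 0)" using z by simp
  also have "\<dots> = (\<Sum>m\<in>\<Lambda>. Poly_Mapping.lookup (p m * gch T \<Lambda> (L m) k) (n + 0))"
    by (simp add: sum_fun_apply lookup_sum lscale_def)
  also have "\<dots> = (\<Sum>m\<in>\<Lambda>. Poly_Mapping.lookup (p m) n * (if k = m then 1 else 0))"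
    by (intro sum.cong refl) (use k(1) in \<open>simp only: lookup_mult_top[OF top gch_L(2)] gch_L(1)\<close>)
  also have "\<dots> = Poly_Mapping.lookup (p k) n"
    using finite_weights k(1) by (simp add: if_distrib cong: if_cong)
  finally show False using k(2) by (simp add: n_def in_keys_iff)
qed

end

context setup_data begin

section \<open>Multiplicities\<close>

text \<open>A nonzero graded map out of \<open>P l\<close> shifted by \<open>i\<close> requires
  degrees \<open>a\<close> of \<open>P l\<close> and \<open>b\<close> of \<open>N\<close> with
  \<open>i = b - a\<close>, of which there are finitely many.\<close>

lemma mult_fin:
  assumes N: "graded_module T N" and l: "l \<in> \<Lambda>"
  shows "finite {i. int (hom_dim N (ghoms (shift i (P l)) N)) \<noteq> 0}"
proof -
  note gP = P_graded[OF l]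
  interpret p: graded_space "scl (P l)" "car (P l)" "piece (P l)" by (rule graded_module_space[OF gP])
  interpret n: graded_space "scl N" "car N" "piece N" by (rule graded_module_space[OF N])
  let ?I = "(\<lambda>(a, b). b - a) ` ({a. piece (P l) a \<noteq> {0}} \<times> {b. piece N b \<noteq> {0}})"
  have "hom_dim N (ghoms (shift i (P l)) N) = 0" if i: "i \<notin> ?I" for i
  proof -
    have "f = 0" if f: "f \<in> ghoms (shift i (P l)) N" for f
    proof -
      have fh: "f \<in> homs UNIV (P l) N" using ghomsD(1)[OF f] by simp
      note f' = homsD[OF fh]
      have 0: "f v = 0" if v: "v \<in> piece (P l) a" for a v
      proof (cases "v = 0")
        case False
        then have "piece (P l) a \<noteq> {0}" using v by blast
        then have "piece N (a + i) = {0}" using i by force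
        moreover have "f v \<in> piece N (a + i)" using ghomsD(2)[OF f, of v "a + i"] v by simp
        ultimately show ?thesis by simp
      qed (use homs_zero[OF graded_module_fd[OF gP] fh] in simp)
      interpret vs: vector_space "scl N" by (rule n.vs)
      have "f v = (\<lambda>_. 0) v" if "v \<in> car (P l)" for v
      proof (rule p.lin_eqI[OF f'(1) _ _ that])
        show "lin_on (scl (P l)) (car (P l)) (scl N) (car N) (\<lambda>_. 0)"
          using subspaceD(1)[OF n.vs n.sub] by (simp add: lin_on_def)
      qed (rule 0)
      then show "f = 0" using f'(3) by (intro ext) (metis zero_fun_apply)
    qed
    then have "ghoms (shift i (P l)) N = {0}" using ghoms_zero[OF graded_module_shift[OF gP] N] by blast
    then show ?thesis by (rule hom_dim_eq_0[OF _ n.vs])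
  qed
  then have "{i. int (hom_dim N (ghoms (shift i (P l)) N)) \<noteq> 0} \<subseteq> ?I"
      by (metis (mono_tags, lifting) mem_Collect_eq of_nat_0 subsetI)
  then show ?thesis using finite_subset p.fin_supp n.fin_supp by blast
qed

text \<open>Projectivity provides an ungraded lift; its homogeneous component of degree zero is a
  lift as well, because \<open>g\<close> and the map to be lifted preserve degrees.\<close>

lemma ghom_dim_exact:
  assumes N': "graded_module T N'" and N: "graded_module T N" and N'': "graded_module T N''"
      and ex: "gexact f g N' N N''"
    and l: "l \<in> \<Lambda>"
  shows "hom_dim N (ghoms (shift i (P l)) N) = hom_dim N' (ghoms (shift i (P l)) N') + hom_dim N''
      (ghoms (shift i (P l)) N'')"
proof -
  let ?P = "shift i (P l)"
  note gP = graded_module_shift[OF P_graded[OF l], of i]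
  note e = gexactD[OF ex] and F = graded_module_fd
  interpret p: graded_space "scl ?P" "car ?P" "piece ?P" by (rule graded_module_space[OF gP])
  interpret n: graded_space "scl N''" "car N''" "piece N''" by (rule graded_module_space[OF N''])
  have hs: "homs UNIV ?P Y = homs UNIV (P l) Y" for Y :: "('k, 'd) urep"
    by (simp add: homs_def)
  have pr: "projective_module D ?P"
    unfolding projective_module_def hs shift_simps
    by (rule conjI[OF graded_module_fd[OF gP] P_proj[OF l, unfolded projective_module_def, THEN conjunct2]])
  show ?thesis
  proof (rule hom_dim_exact[OF F[OF gP] F[OF N'] F[OF N] F[OF N''] ghomsD(1)[OF e(1)] e(3) ghomsD(1)[OF e(2)] e(4)
        ghoms_subspace[OF gP N'] _ ghoms_subspace[OF gP N]])
    show "ghoms ?P N' \<subseteq> homs UNIV ?P N'" "ghoms ?P N \<subseteq> homs UNIV ?P N" "ghoms ?P N'' \<subseteq> homs UNIV ?P N''"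
      by (auto simp only: ghoms_def)
    show "(\<lambda>v. f (h v)) \<in> ghoms ?P N" if "h \<in> ghoms ?P N'" for h by (rule ghoms_comp[OF F[OF N'] that e(1)])
    show "(\<lambda>v. g (h v)) \<in> ghoms ?P N''" if "h \<in> ghoms ?P N" for h by (rule ghoms_comp[OF F[OF N] that e(2)])
    show "h \<in> ghoms ?P N'" if h: "h \<in> homs UNIV ?P N'" "(\<lambda>v. f (h v)) \<in> ghoms ?P N" for h
    proof -
      have "h v \<in> piece N' n" if v: "v \<in> piece ?P n" for v n
        using ghoms_inj_piece[OF N' N e(1,3) homsD(4)[OF h(1)] ghomsD(2)[OF h(2) v]] p.C(2) v by blast
      then show ?thesis using h(1) by (auto simp only: ghoms_def image_subset_iff mem_Collect_eq)
    qed
    show "\<exists>h'\<in>ghoms ?P N. \<forall>v\<in>car ?P. g (h' v) = h v" if h: "h \<in> ghoms ?P N''" for h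
    proof -
      obtain k where k: "k \<in> homs UNIV ?P N" "\<And>v. v \<in> car ?P \<Longrightarrow> g (k v) = h v"
        using projective_lift[OF pr F[OF N] F[OF N''] ghomsD(1)[OF e(2)] e(5) ghomsD(1)[OF h]] by metis
      let ?k = "hcomp 0 ?P N k"
      have gk: "?k \<in> ghoms ?P N" using hcomp_ghoms[OF Dgr_span gP N k(1), of 0] by simp
      have kl: "lin_on (scl ?P) (car ?P) (scl N'') (car N'') (\<lambda>v. g (?k v))"
        using homsD(1)[OF homs_comp[OF F[OF N] ghomsD(1)[OF gk] ghomsD(1)[OF e(2)]]] .
      have "g (?k v) = h v" if "v \<in> car ?P" for v
      proof (rule p.lin_eqI[OF kl homsD(1)[OF ghomsD(1)[OF h]] _ that])
        fix j u assume u: "u \<in> piece ?P j"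
        then have uc: "u \<in> car ?P" using p.C(2) by blast
        have "g (?k u) = g (part (piece N) j (k u))" using hcomp_homog[OF gP N k(1) u, of 0] by simp
        also have "\<dots> = part (piece N'') j (g (k u))"
          by (rule ghoms_part[OF N N'' e(2) homsD(4)[OF k(1) uc], symmetric])
        also have "\<dots> = h u" using k(2)[OF uc] n.part_homog[OF ghomsD(2)[OF h u], of j] by simp
        finally show "g (?k u) = h u" .
      qed
      then show ?thesis using gk by blast
    qed
  qed
qed

lemma mult_poly_exact:
  assumes "graded_module T N'" "graded_module T N" "graded_module T N''" "gexact f g N' N N''" "l \<in> \<Lambda>"
  shows "mult_poly (P l) N = mult_poly (P l) N' + mult_poly (P l) N''"
  unfolding mult_poly_def by (intro laurent_add mult_fin assms) (simp add: ghom_dim_exact[OF assms])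

lemma mult_poly_L:
  assumes "l \<in> \<Lambda>" "m \<in> \<Lambda>"
  shows "mult_poly (P l) (shift j (L m)) = (if l = m then Poly_Mapping.single j 1 else 0)"
proof -
  have "int (hom_dim (shift j (L m)) (ghoms (shift i (P l)) (shift j (L m))))
      = (if i = j then if l = m then 1 else 0 else 0)" for i
  proof -
    note gL = graded_module_shift[OF L_graded[OF assms(2)], of j] and gP
        = graded_module_shift[OF P_graded[OF assms(1)], of i]
    have "hom_dim (L m) (ghoms (shift i (P l)) (shift j (L m))) = (if ghoms (shift i (P l)) (shift j (L m))
        = {0} then 0 else 1)"
    proof (rule cover_hom_dim[OF assms(1) L_simple[OF assms(2)]])
      show "module.subspace (\<lambda>c f v. scl (L m) c (f v)) (ghoms (shift i (P l)) (shift j (L m)))"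
        using ghoms_subspace[OF gP gL] by simp
      show "ghoms (shift i (P l)) (shift j (L m)) \<subseteq> homs UNIV (P l) (L m)" using ghomsD(1) by fastforce
    qed
    then show ?thesis using cover_ghoms[OF assms, of i j] by (auto simp: hom_dim_def)
  qed
  then have "mult_poly (P l) (shift j (L m)) = laurent_poly (\<lambda>i. if i = j then if l = m then 1 else 0 else 0)"
    unfolding mult_poly_def by simp
  then show ?thesis by (simp add: laurent_poly_delta laurent_poly_0)
qed

lemma gexact_zero:
  assumes "graded_module T Z" "car Z = {0}"
  shows "gexact 0 0 Z Z Z"
  unfolding gexact_def using assms ghoms_zero[OF assms(1,1)] by auto

text \<open>The sequence with all three terms \<open>Z\<close> is exact, so any additive quantity
  equals its own double.\<close>

lemma zero_module:
  assumes "graded_module T Z" "car Z = {0}"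
  shows "gch T \<Lambda> Z = 0" "l \<in> \<Lambda> \<Longrightarrow> mult_poly (P l) Z = 0"
  using gch_exact[OF assms(1,1,1) gexact_zero[OF assms]] mult_poly_exact[OF assms(1,1,1) gexact_zero[OF assms]]
      by auto

text \<open>\<open>graded_module_induct\<close> concerns modules in \<open>ugrep\<close>. An exact
  sequence with zero first term transfers the values of additive quantities from a module in any
  type to such a copy.\<close>

lemma exists_ugrep_exact:
  fixes N :: "('k, 'd, 'n::ab_group_add, 'z) grep_scheme"
  assumes N: "graded_module T N"
  obtains Q :: "('k, 'd) ugrep" and \<pi> where "graded_module T Q" "gexact 0 \<pi> (gsubmod N {0}) N Q"
proof -
  obtain Q :: "('k, 'd) ugrep" and \<pi> where Q: "graded_module T Q" "\<pi> \<in> ghoms N Q" "\<pi> ` car N = car Q"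
      "{v \<in> car N. \<pi> v = 0} = {0}"
    by (rule exists_graded_quotient[OF N gsub_zero[OF N]])
  have "gexact 0 \<pi> (gsubmod N {0}) N Q"
    unfolding gexact_def using Q ghoms_zero[OF graded_module_gsubmod[OF N gsub_zero[OF N]] N] by auto
  then show ?thesis using that Q(1) by blast
qed

lemma lscale_single_sum:
  assumes "m \<in> \<Lambda>"
  shows "(\<Sum>l\<in>\<Lambda>. lscale (if l = m then p else 0) (c l)) = lscale p (c m)"
proof -
  have "(\<Sum>l\<in>\<Lambda>. lscale (if l = m then p else 0) (c l)) = (\<Sum>l\<in>\<Lambda>. if l = m then lscale p (c m) else 0)"
    by (intro sum.cong refl) (simp add: lscale_simps)
  then show ?thesis using assms finite_weights by simp
qed

lemma gch_mult_poly_ugrep: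
  fixes N :: "('k, 'd) ugrep"
  assumes "graded_module T N"
  shows "gch T \<Lambda> N = (\<Sum>l\<in>\<Lambda>. lscale (mult_poly (P l) N) (gch T \<Lambda> (L l)))"
  using assms
proof (induction rule: graded_module_induct)
  case (zero N)
  then show ?case by (simp add: zero_module lscale_simps)
next
  case (simple m i)
  have "(\<Sum>l\<in>\<Lambda>. lscale (mult_poly (P l) (shift i (L m))) (gch T \<Lambda> (L l)))
    = (\<Sum>l\<in>\<Lambda>. lscale (if l = m then Poly_Mapping.single i 1 else 0) (gch T \<Lambda> (L l)))"
    by (intro sum.cong refl) (simp add: mult_poly_L simple)
  also have "\<dots> = gch T \<Lambda> (shift i (L m))" by (simp only: lscale_single_sum[OF simple] gch_shift)
  finally show ?case ..
next
  case (exact f g N' N N'')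
  have "(\<Sum>l\<in>\<Lambda>. lscale (mult_poly (P l) N) (gch T \<Lambda> (L l)))
    = (\<Sum>l\<in>\<Lambda>. lscale (mult_poly (P l) N') (gch T \<Lambda> (L l)) + lscale (mult_poly (P l) N'') (gch T \<Lambda> (L l)))"
    by (intro sum.cong refl) (simp add: mult_poly_exact[OF exact(1-4)] lscale_simps)
  then show ?case using gch_exact[OF exact(1-4)] exact(5,6) by (simp add: sum.distrib)
qed

lemma gch_mult_poly:
  fixes N :: "('k, 'd, 'n::ab_group_add) grep"
  assumes N: "graded_module T N"
  shows "gch T \<Lambda> N = (\<Sum>l\<in>\<Lambda>. lscale (mult_poly (P l) N) (gch T \<Lambda> (L l)))"
proof -
  obtain Q :: "('k, 'd) ugrep" and \<pi> where Q: "graded_module T Q" "gexact 0 \<pi> (gsubmod N {0}) N Q"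
    by (rule exists_ugrep_exact[OF N])
  have gZ: "graded_module T (gsubmod N {0})" by (rule graded_module_gsubmod[OF N gsub_zero[OF N]])
  have "gch T \<Lambda> N = gch T \<Lambda> Q" using gch_exact[OF gZ N Q] zero_module(1)[OF gZ] by simp
  moreover have "mult_poly (P l) N = mult_poly (P l) Q" if "l \<in> \<Lambda>" for l
    using mult_poly_exact[OF gZ N Q that] zero_module(2)[OF gZ _ that] by simp
  ultimately show ?thesis using gch_mult_poly_ugrep[OF Q(1)] by simp
qed

lemma mult_poly_unique:
  fixes N :: "('k, 'd, 'n::ab_group_add) grep"
  assumes N: "graded_module T N" and p: "gch T \<Lambda> N = (\<Sum>l\<in>\<Lambda>. lscale (p l) (gch T \<Lambda> (L l)))" and l: "l \<in> \<Lambda>"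
  shows "p l = mult_poly (P l) N"
proof -
  have "(\<Sum>l\<in>\<Lambda>. lscale (p l - mult_poly (P l) N) (gch T \<Lambda> (L l)))
    = (\<Sum>l\<in>\<Lambda>. lscale (p l) (gch T \<Lambda> (L l)) - lscale (mult_poly (P l) N) (gch T \<Lambda> (L l)))"
    by (simp add: lscale_def fun_eq_iff algebra_simps sum_fun_apply)
  also have "\<dots> = 0" unfolding sum_subtractf using p gch_mult_poly[OF N] by simp
  finally show ?thesis using gch_independent[of "\<lambda>l. p l - mult_poly (P l) N", OF _ l] by simp
qed

lemma P_hom_dim_exact:
  fixes N' :: "('k, 'd, 'm1::ab_group_add, 'y1) rep_scheme" and N :: "('k, 'd, 'm2::ab_group_add, 'y2) rep_scheme"
    and N'' :: "('k, 'd, 'm3::ab_group_add, 'y3) rep_scheme"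
  assumes N': "fd_module D UNIV N'" and N: "fd_module D UNIV N" and N'': "fd_module D UNIV N''" and l: "l \<in> \<Lambda>"
    and f: "f \<in> homs UNIV N' N" "inj_on f (car N')" and g: "g \<in> homs UNIV N N''" "g ` car N = car N''"
    and ker: "f ` car N' = {v \<in> car N. g v = 0}"
  shows "hom_dim N (homs UNIV (P l) N) = hom_dim N' (homs UNIV (P l) N') + hom_dim N'' (homs UNIV (P l) N'')"
proof -
  note Pf = graded_module_fd[OF P_graded[OF l]]
  show ?thesis
    by (rule hom_dim_exact[OF Pf N' N N'' f g(1) ker homs_subspace[OF Pf N'] subset_refl
          homs_subspace[OF Pf N] subset_refl subset_refl homs_comp[OF N' _ f(1)] homs_comp[OF N _ g(1)] _
          projective_lift[OF P_proj[OF l] N N'' g]])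
qed

text \<open>If the weights differ, every homogeneous component of a homomorphism is a graded map
  from a shift of \<open>P l\<close> to \<open>L m\<close>, hence zero by
  \<open>cover_ghoms\<close>.\<close>

lemma P_hom_L:
  assumes "l \<in> \<Lambda>" "m \<in> \<Lambda>"
  shows "hom_dim (L m) (homs UNIV (P l) (L m)) = (if l = m then 1 else 0)"
proof -
  note gP = P_graded[OF assms(1)] and gL = L_graded[OF assms(2)]
  have "homs UNIV (P l) (L m) = {0} \<longleftrightarrow> l \<noteq> m"
  proof
    assume z: "homs UNIV (P l) (L m) = {0}"
    have "ghoms (P l) (L m) \<subseteq> homs UNIV (P l) (L m)" by (auto simp: ghoms_def)
    then have "ghoms (P l) (L m) = {0}" using z ghoms_zero[OF gP gL] by blast
    then show "l \<noteq> m" using cover_ghoms[OF assms, of 0 0] by simp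
  next
    assume lm: "l \<noteq> m"
    have "h = 0" if h: "h \<in> homs UNIV (P l) (L m)" for h
    proof (rule hcomp_eq_0[OF gP gL h])
      fix k
      have "hcomp k (P l) (L m) h \<in> ghoms (shift k (P l)) (shift 0 (L m))"
        using hcomp_ghoms[OF Dgr_span gP gL h] by simp
      then show "hcomp k (P l) (L m) h = 0" using cover_ghoms[OF assms, of k 0] lm by blast
    qed
    moreover have "0 \<in> homs UNIV (P l) (L m)" using ghoms_zero[OF gP gL] by (simp add: ghoms_def)
    ultimately show "homs UNIV (P l) (L m) = {0}" by blast
  qed
  then show ?thesis
    using cover_hom_dim[OF assms(1) L_simple[OF assms(2)] homs_subspace[OF graded_module_fd[OF gP]
        graded_module_fd[OF gL]] subset_refl]
    by simp
qed

lemma P_hom_exact_g: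
  assumes "graded_module T N'" "graded_module T N" "graded_module T N''" "gexact f g N' N N''" "l \<in> \<Lambda>"
  shows "hom_dim N (homs UNIV (P l) N) = hom_dim N' (homs UNIV (P l) N') + hom_dim N'' (homs UNIV (P l) N'')"
  using gexactD[OF assms(4)]
  by (intro P_hom_dim_exact[OF graded_module_fd[OF assms(1)] graded_module_fd[OF assms(2)] graded_module_fd[OF
      assms(3)] assms(5)])
    (auto dest: ghomsD(1))

lemma zero_hom_dim:
  assumes "graded_module T Z" "car Z = {0}" "l \<in> \<Lambda>"
  shows "hom_dim Z (homs UNIV (P l) Z) = 0"
  using P_hom_exact_g[OF assms(1,1,1) gexact_zero[OF assms(1,2)] assms(3)] by simp

text \<open>Both sides are additive on exact sequences, which leaves the shifts of the
  \<open>L m\<close>, where each side is one if \<open>l = m\<close> and zero otherwise.\<close>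

lemma eval1_mult_poly_ugrep:
  fixes N :: "('k, 'd) ugrep"
  assumes "graded_module T N" "l \<in> \<Lambda>"
  shows "eval1 (mult_poly (P l) N) = int (hom_dim N (homs UNIV (P l) N))"
  using assms(1)
proof (induction rule: graded_module_induct)
  case (zero N)
  then show ?case using assms(2) by (simp add: zero_module zero_hom_dim eval1_0)
next
  case (simple m i)
  have "hom_dim (shift i (L m)) (homs UNIV (P l) (shift i (L m))) = (if l = m then 1 else 0)"
    using P_hom_L[OF assms(2) simple] by (simp add: hom_dim_def)
  then show ?case by (simp add: mult_poly_L[OF assms(2) simple] eval1_single eval1_0)
next
  case (exact f g N' N N'')
  then show ?case
    using mult_poly_exact[OF exact(1-4) assms(2)] P_hom_exact_g[OF exact(1-4) assms(2)] by (simp add: eval1_add)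
qed

lemma eval1_mult_poly:
  fixes N :: "('k, 'd, 'n::ab_group_add) grep"
  assumes N: "graded_module T N" and l: "l \<in> \<Lambda>"
  shows "eval1 (mult_poly (P l) N) = int (hom_dim N (homs UNIV (P l) N))"
proof -
  obtain Q :: "('k, 'd) ugrep" and \<pi> where Q: "graded_module T Q" "gexact 0 \<pi> (gsubmod N {0}) N Q"
    by (rule exists_ugrep_exact[OF N])
  have gZ: "graded_module T (gsubmod N {0})" by (rule graded_module_gsubmod[OF N gsub_zero[OF N]])
  have "mult_poly (P l) N = mult_poly (P l) Q"
    using mult_poly_exact[OF gZ N Q l] zero_module(2)[OF gZ _ l] by simp
  moreover have "hom_dim N (homs UNIV (P l) N) = hom_dim Q (homs UNIV (P l) Q)"
    using P_hom_exact_g[OF gZ N Q l] zero_hom_dim[OF gZ _ l] by simp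
  ultimately show ?thesis using eval1_mult_poly_ugrep[OF Q(1) l] by simp
qed

section \<open>Multiplicities in ungraded composition series\<close>

text \<open>The factor \<open>Q\<close>, a copy of \<open>U' / U\<close>, is simple, so the maps
  from \<open>P l\<close> to it form a space of dimension at most one, which is nonzero exactly if
  \<open>Q\<close> is isomorphic to \<open>L l\<close>. Exactness of Hom out of \<open>P l\<close>
  adds this to the contribution of \<open>U\<close>.\<close>

lemma composition_step:
  fixes N :: "('k, 'd, 'n::ab_group_add, 'z) rep_scheme"
  assumes N: "fd_module D UNIV N" and l: "l \<in> \<Lambda>" and U: "submodule UNIV N U" and U': "submodule UNIV N U'"
      and "U \<subset> U'"
    and max: "\<And>W. submodule UNIV N W \<Longrightarrow> U \<subseteq> W \<Longrightarrow> W \<subseteq> U' \<Longrightarrow> W = U \<or> W = U'"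
  shows "hom_dim N (homs UNIV (P l) (N\<lparr>car := U'\<rparr>)) =
    hom_dim N (homs UNIV (P l) (N\<lparr>car := U\<rparr>)) + (if subquotient_iso N U U' (L l) then 1 else 0)"
proof -
  let ?N = "N\<lparr>car := U'\<rparr>" and ?U = "N\<lparr>car := U\<rparr>"
  note Nf = submodule_fd_module[OF N U'] and Uf = submodule_fd_module[OF N U] and ND = fd_moduleD[OF N]
  note gP = P_graded[OF l] and gL = L_graded[OF l]
  note Pf = graded_module_fd[OF gP] and Lf = graded_module_fd[OF gL]
  have UU: "U \<subseteq> U'" using assms(5) by blast
  have sN: "submodule UNIV ?N U" using U UU by (auto simp: submodule_def)
  obtain Q :: "('k, 'd) urep" and \<pi> where Q0: "fd_module D UNIV Q" "\<pi> \<in> homs UNIV ?N Q"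
      "\<pi> ` car ?N = car Q" "{v \<in> car ?N. \<pi> v = 0} = U"
    by (rule exists_quotient[OF subalgebra_UNIV Nf sN])
  have cN: "car ?N = U'" by simp
  note Q = Q0[unfolded cN]
  note \<pi>' = homsD[OF Q(2), simplified] and QD = fd_moduleD[OF Q(1)]
  have Qs: "simple_module D UNIV Q"
    unfolding simple_module_def
  proof (intro conjI allI impI Q(1))
    show "car Q \<noteq> {0}"
    proof
      assume "car Q = {0}"
      then have "{v \<in> U'. \<pi> v = 0} = U'" using Q(3) by auto
      then show False using Q(4) assms(5) by simp
    qed
    fix W assume W: "submodule UNIV Q W"
    note W' = submoduleD[OF W] and w = subspaceD[OF QD(2) submoduleD(1)[OF W]]
    let ?V = "{v \<in> U'. \<pi> v \<in> W}"
    have "submodule UNIV N ?V"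
    proof (rule submoduleI)
      note u = subspaceD[OF ND(2) submoduleD(1)[OF U']]
      show "module.subspace (scl N) ?V"
        using u w \<pi>'(1) lin_on_zero[OF ND(2) submoduleD(1)[OF U'] \<pi>'(1)]
        by (intro vs_subspaceI[OF ND(2)]) (auto simp: lin_on_def)
      show "?V \<subseteq> car N" using submoduleD(2)[OF U'] by blast
      fix x v assume v: "v \<in> ?V"
      then have "act N x v \<in> U'" using submoduleD(3)[OF U'] by blast
      moreover have "\<pi> (act N x v) = act Q x (\<pi> v)" using \<pi>'(2) v by blast
      moreover have "act Q x (\<pi> v) \<in> W" using W'(3) v by blast
      ultimately show "act N x v \<in> ?V" by simp
    qed
    moreover have "U \<subseteq> ?V"
    proof
      fix v assume v: "v \<in> U"
      then have "v \<in> {v \<in> U'. \<pi> v = 0}" unfolding Q(4) .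
      then show "v \<in> ?V" using w(1) by simp
    qed
    ultimately have V: "?V = U \<or> ?V = U'" by (intro max) auto
    have img: "W = \<pi> ` ?V"
    proof (intro subset_antisym subsetI)
      fix y assume y: "y \<in> W"
      then have "y \<in> \<pi> ` U'" using W'(2) unfolding Q(3) by blast
      then show "y \<in> \<pi> ` ?V" using y by auto
    qed auto
    show "W = {0} \<or> W = car Q"
    proof (cases "?V = U'")
      case True
      then have "W = \<pi> ` U'" by (subst img) simp
      then show ?thesis using Q(3) by simp
    next
      case False
      then have "?V = U" using V by simp
      then have VU: "?V = {v \<in> U'. \<pi> v = 0}" using Q(4) by simp
      have "y = 0" if "y \<in> W" for y
      proof -
        have "y \<in> \<pi> ` ?V" by (rule subsetD[OF equalityD1[OF img] that])
        then obtain v where v: "v \<in> ?V" "y = \<pi> v" by (rule imageE)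
        then have "v \<in> {v \<in> U'. \<pi> v = 0}" using VU by blast
        then show ?thesis using v(2) by simp
      qed
      then have "W = {0}" using w(1) by blast
      then show ?thesis ..
    qed
  qed
  have incl: "(\<lambda>v. if v \<in> U then v else 0) \<in> homs UNIV ?U ?N"
    using subspaceD[OF ND(2) submoduleD(1)[OF U]] submoduleD(3)[OF U] UU
    by (intro homsI) (auto simp: lin_on_def)
  have inj: "inj_on (\<lambda>v. if v \<in> U then v else 0) (car ?U)" by (auto simp: inj_on_def)
  have onto: "\<pi> ` car ?N = car Q" using Q(3) by simp
  have ker: "(\<lambda>v. if v \<in> U then v else 0) ` car ?U = {v \<in> car ?N. \<pi> v = 0}" using Q(4) by auto
  have "hom_dim ?N (homs UNIV (P l) ?N) = hom_dim ?U (homs UNIV (P l) ?U) + hom_dim Q (homs UNIV (P l) Q)"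
    by (rule P_hom_dim_exact[OF Uf Nf Q(1) l incl inj Q(2) onto ker])
  moreover have "hom_dim Q (homs UNIV (P l) Q) = (if homs UNIV (P l) Q = {0} then 0 else 1)"
    by (rule cover_hom_dim[OF l Qs homs_subspace[OF Pf Q(1)] subset_refl])
  \<comment> \<open>A nonzero map to \<open>Q\<close> factors through the covering and identifies
    \<open>L l\<close> with \<open>Q\<close>. Conversely, a map of \<open>U'\<close> onto
    \<open>L l\<close> with kernel \<open>U\<close> allows the covering to be lifted to
    \<open>U'\<close>, and the lift is not contained in \<open>U\<close>.\<close>
  moreover have "homs UNIV (P l) Q \<noteq> {0} \<longleftrightarrow> subquotient_iso N U U' (L l)"
  proof -
    obtain f where f0: "f \<in> ghoms (P l) (L l)" "f ` car (P l) = car (L l)"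
      "\<forall>U. submodule UNIV (P l) U \<longrightarrow> f ` U = car (L l) \<longrightarrow> U = car (P l)"
      by (rule cover_map[OF l])
    note f = f0(1,2) f0(3)[rule_format] and fh = ghomsD(1)[OF f0(1)]
    have z: "0 \<in> homs UNIV (P l) Q" using subspaceD(1)[OF vector_space_fscale[OF QD(2)] homs_subspace[OF Pf Q(1)]] .
    show ?thesis
    proof
      assume "homs UNIV (P l) Q \<noteq> {0}"
      then obtain h where h: "h \<in> homs UNIV (P l) Q" "h \<noteq> 0" using z by blast
      note ch = cover_hom[OF l f Qs h]
      have kh: "h v = 0" if "v \<in> car (P l)" "f v = 0" for v using ch(2) that by blast
      obtain k where k: "k \<in> homs UNIV (L l) Q" "\<And>v. k (f v) = h v"
        using homs_factor[OF Pf fh f(2) h(1) kh Lf] by metis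
      obtain v where "h v \<noteq> 0" using homs_ne_0[OF h] by blast
      then have k0: "k \<noteq> 0" using fun_ne_0I[of k "f v"] k(2) by simp
      have kb: "bij_betw k (car (L l)) (car Q)"
        unfolding bij_betw_def using simple_hom_inj(2)[OF L_simple[OF l] Q(1) k(1) k0]
            simple_hom_onto[OF Qs Lf k(1) k0] by blast
      obtain j where j: "j \<in> homs UNIV Q (L l)" "bij_betw j (car Q) (car (L l))"
        using homs_inverse[OF Lf Q(1) k(1) kb] by metis
      have jh: "(\<lambda>v. j (\<pi> v)) \<in> homs UNIV ?N (L l)" by (rule homs_comp[OF Q(1,2) j(1)])
      have "(\<lambda>v. j (\<pi> v)) ` U' = car (L l)"
        using Q(3) j(2) by (metis bij_betw_imp_surj_on image_image)
      moreover have "j (\<pi> v) = 0 \<longleftrightarrow> \<pi> v = 0" if "v \<in> U'" for v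
      proof -
        have pv: "\<pi> v \<in> car Q" using that Q(3) by blast
        show ?thesis
          using inj_onD[OF bij_betw_imp_inj_on[OF j(2)], of "\<pi> v" 0] pv subspaceD(1)[OF QD(2,3)]
              homs_zero[OF Q(1) j(1)] by auto
      qed
      then have "{v \<in> U'. j (\<pi> v) = 0} = U" using Q(4) by blast
      ultimately show "subquotient_iso N U U' (L l)" unfolding subquotient_iso_def using jh by blast
    next
      assume "subquotient_iso N U U' (L l)"
      then obtain s where s: "s \<in> homs UNIV ?N (L l)" "s ` U' = car (L l)" "{v \<in> U'. s v = 0} = U"
        unfolding subquotient_iso_def by blast
      have so: "s ` car ?N = car (L l)" using s(2) by simp
      obtain h where h: "h \<in> homs UNIV (P l) ?N" "\<And>v. v \<in> car (P l) \<Longrightarrow> s (h v) = f v"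
        using projective_lift[OF P_proj[OF l] Nf Lf s(1) so fh] by blast
      have "car (L l) \<noteq> {0}" "0 \<in> car (L l)" using L_ne[OF l] subspaceD(1)[OF fd_moduleD(2,3)[OF Lf]] by auto
      then obtain p where p: "p \<in> car (P l)" "f p \<noteq> 0" using f(2) by force
      have hp: "h p \<in> U'" using homsD(4)[OF h(1) p(1)] by simp
      have "s (h p) \<noteq> 0" using h(2)[OF p(1)] p(2) by simp
      then have "h p \<notin> U" using s(3) by blast
      then have "\<pi> (h p) \<noteq> 0" using Q(4) hp by blast
      then have "(\<lambda>v. \<pi> (h v)) \<noteq> 0" by (rule fun_ne_0I[of "\<lambda>v. \<pi> (h v)" p])
      moreover have "(\<lambda>v. \<pi> (h v)) \<in> homs UNIV (P l) Q" by (rule homs_comp[OF Nf h(1) Q(2)])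
      ultimately show "homs UNIV (P l) Q \<noteq> {0}" by blast
    qed
  qed
  \<comment> \<open>\<open>hom_dim\<close> sees only the scalar multiplication of its first
    argument, which is unaffected by updates of \<open>car\<close>.\<close>
  ultimately show ?thesis by (auto simp: hom_dim_def)
qed

text \<open>\<open>multiplicity_in\<close> is a description ranging over all composition series; the
  existence of one is what makes it determine a number.\<close>

lemma exists_composition_series:
  fixes N :: "('k, 'd, 'n::ab_group_add, 'z) rep_scheme"
  assumes N: "fd_module D UNIV N"
  shows "\<exists>us. composition_series N us"
proof -
  note ND = fd_moduleD[OF N]
  have "\<exists>us. us \<noteq> [] \<and> hd us = {0} \<and> last us = U \<and> (\<forall>V\<in>set us. submodule UNIV N V) \<and>
    (\<forall>i. Suc i < length us \<longrightarrow> us ! i \<subset> us ! Suc i \<and>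
      (\<forall>W. submodule UNIV N W \<longrightarrow> us ! i \<subseteq> W \<longrightarrow> W \<subseteq> us ! Suc i \<longrightarrow> W = us ! i \<or> W = us ! Suc i))"
    if "submodule UNIV N U" for U
    using that
  proof (induction "vector_space.dim (scl N) U" arbitrary: U rule: less_induct)
    case less
    note U = submoduleD[OF less.prems]
    have fdU: "fd_space (scl N) U" by (rule fd_space_subspace[OF ND(1) U(1,2)])
    have 0: "0 \<in> U" using subspaceD(1)[OF ND(2) U(1)] .
    show ?case
    proof (cases "U = {0}")
      case True
      then show ?thesis using less.prems by (intro exI[of _ "[{0}]"]) simp
    next
      case False
      let ?ok = "\<lambda>V. submodule UNIV N V \<and> V \<subset> U"
      have ok0: "?ok {0}" using submodule_zero[OF N] 0 False by blast
      have bound: "\<forall>V. ?ok V \<longrightarrow> vector_space.dim (scl N) V < vector_space.dim (scl N) U + 1"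
        using fd_space_dim_less[OF fdU] submoduleD(1) by fastforce
      \<comment> \<open>A proper submodule of greatest dimension is maximal, so \<open>U\<close> can
        be appended to its series.\<close>
      obtain V where V: "?ok V" "\<forall>W. ?ok W \<longrightarrow> vector_space.dim (scl N) W \<le> vector_space.dim (scl N) V"
        using ex_has_greatest_nat[of ?ok, OF ok0 bound] by (elim exE) (rule that, erule conjunct1, erule conjunct2)
      have max: "W = V \<or> W = U" if W: "submodule UNIV N W" "V \<subseteq> W" "W \<subseteq> U" for W
      proof (rule ccontr)
        assume n: "\<not> (W = V \<or> W = U)"
        have "vector_space.dim (scl N) V < vector_space.dim (scl N) W"
          using n W(2) V(1) by (intro fd_space_dim_less[OF fd_space_subspace[OF ND(1) submoduleD(1,2)[OF W(1)]]
              submoduleD(1)]) auto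
        moreover have "?ok W" using n W by blast
        ultimately show False using V(2) by fastforce
      qed
      have "vector_space.dim (scl N) V < vector_space.dim (scl N) U"
        using V(1) fd_space_dim_less[OF fdU] submoduleD(1) by blast
      then obtain us where us: "us \<noteq> []" "hd us = {0}" "last us = V" "\<forall>V\<in>set us. submodule UNIV N V"
        "\<forall>i. Suc i < length us \<longrightarrow> us ! i \<subset> us ! Suc i \<and>
        (\<forall>W. submodule UNIV N W \<longrightarrow> us ! i \<subseteq> W \<longrightarrow> W \<subseteq> us ! Suc i \<longrightarrow> W = us ! i \<or> W = us ! Suc i)"
        using less.hyps[of V] V(1) by blast
      let ?vs = "us @ [U]"
      have "?vs ! i \<subset> ?vs ! Suc i \<and>
        (\<forall>W. submodule UNIV N W \<longrightarrow> ?vs ! i \<subseteq> W \<longrightarrow> W \<subseteq> ?vs ! Suc i \<longrightarrow> W = ?vs ! i \<or> W = ?vs ! Suc i)"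
        if i: "Suc i < length ?vs" for i
      proof (cases "Suc i < length us")
        case True
        then show ?thesis using us(5) by (simp add: nth_append)
      next
        case False
        then have "i = length us - 1" using i us(1) by (cases us) auto
        then have "?vs ! i = V" "?vs ! Suc i = U" using us(1,3) by (auto simp: nth_append last_conv_nth)
        then show ?thesis using V(1) max by simp
      qed
      then show ?thesis using us less.prems by (intro exI[of _ ?vs]) auto
    qed
  qed
  from this[OF submodule_car[OF N]] show ?thesis unfolding composition_series_def by blast
qed

text \<open>The dimension of Hom from \<open>P l\<close> into the members of the series grows by one
  exactly at the factors isomorphic to \<open>L l\<close>. In particular the count does not depend
  on the series.\<close>

lemma composition_series_count:
  fixes N :: "('k, 'd, 'n::ab_group_add, 'z) rep_scheme"
  assumes N: "fd_module D UNIV N" and l: "l \<in> \<Lambda>" and us: "composition_series N us"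
  shows "card {i. Suc i < length us \<and> subquotient_iso N (us ! i) (us ! Suc i) (L l)} = hom_dim N (homs UNIV (P l) N)"
proof -
  note Pf = graded_module_fd[OF P_graded[OF l]]
  have us': "us \<noteq> []" "hd us = {0}" "last us = car N" "\<And>i. i < length us \<Longrightarrow> submodule UNIV N (us ! i)"
    "\<And>i. Suc i < length us \<Longrightarrow> us ! i \<subset> us ! Suc i"
    "\<And>i W. Suc i < length us \<Longrightarrow> submodule UNIV N W \<Longrightarrow> us ! i \<subseteq> W \<Longrightarrow> W \<subseteq> us ! Suc i \<Longrightarrow> W = us ! i \<or> W = us ! Suc i"
    using us unfolding composition_series_def by auto
  let ?d = "\<lambda>k. hom_dim N (homs UNIV (P l) (N\<lparr>car := us ! k\<rparr>))"
  let ?S = "\<lambda>i. subquotient_iso N (us ! i) (us ! Suc i) (L l)"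
  have "?d k = card {i. i < k \<and> ?S i}" if "k < length us" for k
    using that
  proof (induction k)
    case 0
    have e: "us ! 0 = {0}" using us'(1,2) by (simp add: hd_conv_nth)
    have Zf: "fd_module D UNIV (N\<lparr>car := {0}\<rparr>)" by (rule submodule_fd_module[OF N submodule_zero[OF N]])
    have "h = 0" if h: "h \<in> homs UNIV (P l) (N\<lparr>car := {0}\<rparr>)" for h
      using homs_ne_0[OF h] homsD(4)[OF h] by auto
    moreover have "0 \<in> homs UNIV (P l) (N\<lparr>car := {0}\<rparr>)"
      using subspaceD(1)[OF vector_space_fscale[OF fd_moduleD(2)[OF Zf]] homs_subspace[OF Pf Zf]] .
    ultimately have "homs UNIV (P l) (N\<lparr>car := {0}\<rparr>) = {0}" by blast
    then show ?case unfolding e using hom_dim_eq_0[OF _ fd_moduleD(2)[OF N]] by simp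
  next
    case (Suc k)
    have "?d (Suc k) = ?d k + (if ?S k then 1 else 0)"
      using Suc.prems by (intro composition_step[OF N l us'(4,4,5,6)]) auto
    also have "\<dots> = card {i. i < k \<and> ?S i} + (if ?S k then 1 else 0)" using Suc by simp
    also have "\<dots> = card {i. i < Suc k \<and> ?S i}"
    proof -
      have "{i. i < Suc k \<and> ?S i} = (if ?S k then insert k {i. i < k \<and> ?S i} else {i. i < k \<and> ?S i})"
        by (auto simp: less_Suc_eq)
      then show ?thesis by simp
    qed
    finally show ?case .
  qed
  from this[of "length us - 1"] have "?d (length us - 1) = card {i. i < length us - 1 \<and> ?S i}" using us'(1) by simp
  moreover have "us ! (length us - 1) = car N" using us'(1,3) by (simp add: last_conv_nth)
  moreover have "{i. i < length us - 1 \<and> ?S i} = {i. Suc i < length us \<and> ?S i}" by auto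
  ultimately show ?thesis by simp
qed

lemma multiplicity_in_eq:
  fixes N :: "('k, 'd, 'n::ab_group_add) grep"
  assumes N: "graded_module T N" and l: "l \<in> \<Lambda>"
  shows "int (multiplicity_in N (L l)) = eval1 (mult_poly (P l) N)"
proof -
  note Nf = graded_module_fd[OF N]
  obtain us where us: "composition_series N us" using exists_composition_series[OF Nf] by blast
  have "multiplicity_in N (L l) = hom_dim N (homs UNIV (P l) N)"
    unfolding multiplicity_in_def
  proof (rule the_equality)
    show "\<forall>us. composition_series N us \<longrightarrow>
      hom_dim N (homs UNIV (P l) N) = card {i. Suc i < length us \<and> subquotient_iso N (us ! i) (us ! Suc i) (L l)}"
      using composition_series_count[OF Nf l] by simp
    fix m assume "\<forall>us. composition_series N us \<longrightarrow>
      m = card {i. Suc i < length us \<and> subquotient_iso N (us ! i) (us ! Suc i) (L l)}"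
    then show "m = hom_dim N (homs UNIV (P l) N)" using us composition_series_count[OF Nf l us] by simp
  qed
  then show ?thesis using eval1_mult_poly[OF N l] by simp
qed

end

section \<open>The Grothendieck group\<close>

lemma of_int_single: "of_int a * Poly_Mapping.single l (1::int) = Poly_Mapping.single (l::int) a"
proof -
  have "of_int a = Poly_Mapping.single (0::int) (a::int)" using single_of_int[of a, where ?'b = int and ?'a
      = int] by simp
  then show ?thesis by (simp add: mult_single)
qed

lemma poly_mapping_sum_singles: "(\<Sum>l\<in>Poly_Mapping.keys p. Poly_Mapping.single l (Poly_Mapping.lookup p l)) = p"
proof (rule poly_mapping_eqI)
  fix k
  have "(\<Sum>l\<in>Poly_Mapping.keys p. Poly_Mapping.lookup (Poly_Mapping.single l (Poly_Mapping.lookup p l)) k)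
    = (\<Sum>l\<in>Poly_Mapping.keys p. if k = l then Poly_Mapping.lookup p k else 0)"
    by (intro sum.cong refl) (auto simp: lookup_single when_def)
  then show "Poly_Mapping.lookup (\<Sum>l\<in>Poly_Mapping.keys p. Poly_Mapping.single l (Poly_Mapping.lookup p l)) k
      = Poly_Mapping.lookup p k"
    by (simp add: lookup_sum in_keys_iff)
qed

lemma module_lscale: "module (lscale :: laurent \<Rightarrow> ('i \<Rightarrow> laurent) \<Rightarrow> _)"
  by unfold_locales (simp_all add: lscale_def fun_eq_iff algebra_simps)

lemma keys_sum_subset: "(\<And>i. i \<in> I \<Longrightarrow> Poly_Mapping.keys (f i) \<subseteq> S) \<Longrightarrow> Poly_Mapping.keys (sum f I) \<subseteq> S"
proof (induction I rule: infinite_finite_induct)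
  case (insert i I)
  then show ?case using Poly_Mapping.keys_add[of "f i" "sum f I"] by auto
qed auto

section \<open>The action of Laurent polynomials on the free group\<close>

definition laurent_act_mono :: "int \<Rightarrow> int \<Rightarrow> (('k, 'd::finite) ugrep \<Rightarrow>\<^sub>0 int) \<Rightarrow> (('k, 'd) ugrep \<Rightarrow>\<^sub>0 int)"
  where "laurent_act_mono l a c = (\<Sum>N\<in>Poly_Mapping.keys c. Poly_Mapping.single (shift l N) (a *
      Poly_Mapping.lookup c N))"

text \<open>Supports may shrink when elements are added, so sums over keys are compared over a
  common finite superset.\<close>

lemma laurent_act_mono_superset:
  assumes "finite I" "Poly_Mapping.keys c \<subseteq> I"
  shows "laurent_act_mono l a c = (\<Sum>N\<in>I. Poly_Mapping.single (shift l N) (a * Poly_Mapping.lookup c N))"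
  unfolding laurent_act_mono_def using assms by (intro sum.mono_neutral_left) (auto simp: in_keys_iff)

lemma laurent_act_mono_add: "laurent_act_mono l a (c + c') = laurent_act_mono l a c + laurent_act_mono l a c'"
proof -
  let ?I = "Poly_Mapping.keys c \<union> Poly_Mapping.keys c'"
  have k: "Poly_Mapping.keys (c + c') \<subseteq> ?I" by (rule Poly_Mapping.keys_add)
  show ?thesis
    using laurent_act_mono_superset[OF _ k, of l a] laurent_act_mono_superset[of ?I c l a]
        laurent_act_mono_superset[of ?I c' l a]
    by (simp add: lookup_add distrib_left single_add sum.distrib)
qed

lemma laurent_act_mono_single: "laurent_act_mono l a (Poly_Mapping.single N b) = Poly_Mapping.single (shift l N)
    (a * b)"
  using laurent_act_mono_superset[of "{N}" "Poly_Mapping.single N b" l a] by simp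

lemma laurent_act_mono_0: "laurent_act_mono l a 0 = 0" "laurent_act_mono l 0 c = 0"
  by (simp_all add: laurent_act_mono_def)

lemma laurent_act_mono_minus: "laurent_act_mono l a (- c) = - laurent_act_mono l a c"
  using laurent_act_mono_add[of l a c "- c"] by (simp add: laurent_act_mono_0 eq_neg_iff_add_eq_0 add.commute)

lemma laurent_act_free_mono: "laurent_act_free p c
    = (\<Sum>l\<in>Poly_Mapping.keys p. laurent_act_mono l (Poly_Mapping.lookup p l) c)"
  by (simp add: laurent_act_free_def laurent_act_mono_def)

lemma laurent_act_free_superset:
  assumes "finite I" "Poly_Mapping.keys p \<subseteq> I"
  shows "laurent_act_free p c = (\<Sum>l\<in>I. laurent_act_mono l (Poly_Mapping.lookup p l) c)"
  unfolding laurent_act_free_mono using assms by (intro sum.mono_neutral_left)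
      (auto simp: in_keys_iff laurent_act_mono_0)

lemma laurent_act_free_add: "laurent_act_free p (c + c') = laurent_act_free p c + laurent_act_free p c'"
  by (simp add: laurent_act_free_mono laurent_act_mono_add sum.distrib)

lemma laurent_act_mono_add_left: "laurent_act_mono l (a + b) c = laurent_act_mono l a c + laurent_act_mono l b c"
  by (simp add: laurent_act_mono_def distrib_right single_add sum.distrib)

lemma laurent_act_free_add_left: "laurent_act_free (p + q) c = laurent_act_free p c + laurent_act_free q c"
proof -
  let ?I = "Poly_Mapping.keys p \<union> Poly_Mapping.keys q"
  have k: "Poly_Mapping.keys (p + q) \<subseteq> ?I" by (rule Poly_Mapping.keys_add)
  show ?thesis
    using laurent_act_free_superset[OF _ k, of c] laurent_act_free_superset[of ?I p c]
        laurent_act_free_superset[of ?I q c]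
    by (simp add: lookup_add laurent_act_mono_add_left sum.distrib)
qed

lemma laurent_act_free_single: "laurent_act_free (Poly_Mapping.single i 1) (Poly_Mapping.single N b)
    = Poly_Mapping.single (shift i N) b"
  using laurent_act_free_superset[of "{i}" "Poly_Mapping.single i 1" "Poly_Mapping.single N b"]
  by (simp add: laurent_act_mono_single)

lemma laurent_act_free_0: "laurent_act_free 0 c = 0"
  by (simp add: laurent_act_free_def)

lemma short_exact_iff: "short_exact N' N N'' \<longleftrightarrow> (\<exists>f g. gexact f g N' N N'')"
  unfolding short_exact_def gexact_def by blast

lemma short_exact_shift: "short_exact N' N N'' \<Longrightarrow> short_exact (shift l N') (shift l N) (shift l N'')"
  unfolding short_exact_iff gexact_def ghoms_shift by simp

context setup_data begin

section \<open>The subgroup of exact relations and its cosets\<close>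

abbreviation "FG \<equiv> free_gmodules T"
abbreviation "ER \<equiv> exact_relations T"
abbreviation "rel N' N N'' \<equiv> Poly_Mapping.single N 1 - Poly_Mapping.single N' 1 - Poly_Mapping.single N'' (1::int)"
abbreviation "is_rel N' N N'' \<equiv> N' \<in> gmodules T \<and> N \<in> gmodules T \<and> N'' \<in> gmodules T \<and> short_exact N' N N''"

lemma ER_0: "0 \<in> ER"
  using generate.one[of FG] by (simp add: exact_relations_def)

lemma ER_add: "a \<in> ER \<Longrightarrow> b \<in> ER \<Longrightarrow> a + b \<in> ER"
  using generate.eng[of a FG _ b] by (simp add: exact_relations_def)

lemma ER_rel: "is_rel N' N N'' \<Longrightarrow> rel N' N N'' \<in> ER"
  unfolding exact_relations_def by (rule generate.incl) blast

lemma rel_keys: "is_rel N' N N'' \<Longrightarrow> Poly_Mapping.keys (rel N' N N'') \<subseteq> gmodules T"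
  using keys_diff[of "Poly_Mapping.single N 1 - Poly_Mapping.single N' 1" "Poly_Mapping.single N'' (1::int)"]
    keys_diff[of "Poly_Mapping.single N 1" "Poly_Mapping.single N' (1::int)"] by auto

text \<open>\<open>generate\<close> closes under the group operation and under inverses of
  generators, whence the separate case of a negated relation; that all negatives belong to the
  subgroup is derived in \<open>ER_minus\<close>.\<close>

lemma ER_induct [consumes 1, case_names zero rel minus add]:
  assumes "c \<in> ER" and "R 0"
    and rel: "\<And>N' N N''. is_rel N' N N'' \<Longrightarrow> R (rel N' N N'')"
    and minus: "\<And>N' N N''. is_rel N' N N'' \<Longrightarrow> R (rel N' N N'') \<Longrightarrow> R (- rel N' N N'')"
    and add: "\<And>a b. a \<in> ER \<Longrightarrow> b \<in> ER \<Longrightarrow> R a \<Longrightarrow> R b \<Longrightarrow> R (a + b)"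
  shows "R c"
  using assms(1)[unfolded exact_relations_def]
proof (induction rule: generate.induct)
  case one
  then show ?case using assms(2) by simp
next
  case (incl h)
  then show ?case using rel by blast
next
  case (inv h)
  then obtain N' N N'' where h: "h = rel N' N N''" "is_rel N' N N''" by blast
  then show ?case using minus[OF h(2) rel[OF h(2)]] rel_keys[OF h(2)] by simp
next
  case (eng a b)
  then show ?case using add[of a b] by (simp add: exact_relations_def)
qed

lemma ER_minus: "c \<in> ER \<Longrightarrow> - c \<in> ER"
proof (induction rule: ER_induct)
  case zero
  then show ?case using ER_0 by simp
next
  case (rel N' N N'')
  have "inv\<^bsub>FG\<^esub> (rel N' N N'') \<in> ER"
    unfolding exact_relations_def using rel by (intro generate.inv) blast
  then show ?case using inv_free_Abelian_group[OF rel_keys[OF rel]] by simp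
next
  case (minus N' N N'')
  then show ?case using ER_rel by (simp only: minus_minus)
next
  case (add a b)
  then show ?case using ER_add[of "- a" "- b"] by (simp only: minus_add_distrib)
qed

lemma ER_diff: "a \<in> ER \<Longrightarrow> b \<in> ER \<Longrightarrow> a - b \<in> ER"
  using ER_add[OF _ ER_minus] by fastforce

lemma ER_sum: "(\<And>i. i \<in> I \<Longrightarrow> f i \<in> ER) \<Longrightarrow> sum f I \<in> ER"
  by (induction I rule: infinite_finite_induct) (auto simp: ER_0 ER_add)

definition cs :: "(('k, 'd) ugrep \<Rightarrow>\<^sub>0 int) \<Rightarrow> (('k, 'd) ugrep \<Rightarrow>\<^sub>0 int) set" where "cs x = ER #>\<^bsub>FG\<^esub> x"

lemma cs_eq: "cs x = {r + x | r. r \<in> ER}"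
  by (auto simp: cs_def r_coset_def)

lemma cs_cong: "x - y \<in> ER \<Longrightarrow> cs x = cs y"
proof -
  assume xy: "x - y \<in> ER"
  have "r + x \<in> cs y" if "r \<in> ER" for r
  proof -
    have "r + x = (r + (x - y)) + y" by simp
    then show ?thesis unfolding cs_eq using ER_add[OF that xy] by blast
  qed
  moreover have "r + y \<in> cs x" if "r \<in> ER" for r
  proof -
    have "r + y = (r - (x - y)) + x" by simp
    then show ?thesis unfolding cs_eq using ER_diff[OF that xy] by blast
  qed
  ultimately show ?thesis unfolding cs_eq[of x] cs_eq[of y] by blast
qed

lemma cs_self: "x \<in> cs x"
proof -
  have "x = 0 + x" by simp
  then show ?thesis unfolding cs_eq using ER_0 by blast
qed

lemma cs_mult: "cs x \<otimes>\<^bsub>grothendieck T\<^esub> cs y = cs (x + y)"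
proof -
  have "set_mult FG (cs x) (cs y) = {a + b | a b. a \<in> cs x \<and> b \<in> cs y}"
    by (auto simp: set_mult_def)
  also have "\<dots> = cs (x + y)"
  proof (intro subset_antisym subsetI)
    fix z assume "z \<in> {a + b | a b. a \<in> cs x \<and> b \<in> cs y}"
    then obtain r s where rs: "r \<in> ER" "s \<in> ER" "z = (r + x) + (s + y)" unfolding cs_eq by blast
    then have "z = (r + s) + (x + y)" by simp
    then show "z \<in> cs (x + y)" unfolding cs_eq using ER_add[OF rs(1,2)] by blast
  next
    fix z assume "z \<in> cs (x + y)"
    then obtain r where r: "r \<in> ER" "z = r + (x + y)" unfolding cs_eq by blast
    then have "z = (r + x) + y" by simp
    moreover have "r + x \<in> cs x" unfolding cs_eq using r(1) by blast
    ultimately show "z \<in> {a + b | a b. a \<in> cs x \<and> b \<in> cs y}" using cs_self by blast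
  qed
  finally show ?thesis by (simp add: grothendieck_def)
qed

lemma grothendieck_carrier: "carrier (grothendieck T) = {cs x | x. Poly_Mapping.keys x \<subseteq> gmodules T}"
  by (auto simp: grothendieck_def FactGroup_def RCOSETS_def cs_def)

lemma gclass_eq: "gclass T N = cs (Poly_Mapping.single N 1)"
  by (simp add: gclass_def cs_def)

section \<open>The character and the Laurent action on classes\<close>

lemma gch_free_superset:
  assumes "finite I" "Poly_Mapping.keys c \<subseteq> I"
  shows "gch_free T \<Lambda> c l = (\<Sum>N\<in>I. of_int (Poly_Mapping.lookup c N) * gch T \<Lambda> N l)"
  unfolding gch_free_def using assms by (intro sum.mono_neutral_left) (auto simp: in_keys_iff)

lemma gch_free_add: "gch_free T \<Lambda> (c + c') = gch_free T \<Lambda> c + gch_free T \<Lambda> c'"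
proof
  fix l
  let ?I = "Poly_Mapping.keys c \<union> Poly_Mapping.keys c'"
  have k: "Poly_Mapping.keys (c + c') \<subseteq> ?I" by (rule Poly_Mapping.keys_add)
  show "gch_free T \<Lambda> (c + c') l = (gch_free T \<Lambda> c + gch_free T \<Lambda> c') l"
    using gch_free_superset[OF _ k, of l] gch_free_superset[of ?I c l] gch_free_superset[of ?I c' l]
    by (simp add: lookup_add distrib_right sum.distrib)
qed

lemma gch_free_0: "gch_free T \<Lambda> 0 = 0"
  by (simp add: gch_free_def fun_eq_iff)

lemma gch_free_minus: "gch_free T \<Lambda> (- c) = - gch_free T \<Lambda> c"
proof -
  have "gch_free T \<Lambda> (- c) + gch_free T \<Lambda> c = 0"
    unfolding gch_free_add[symmetric] by (simp add: gch_free_0)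
  then show ?thesis by (simp only: eq_neg_iff_add_eq_0)
qed

lemma gch_free_sum: "gch_free T \<Lambda> (sum f I) = (\<Sum>i\<in>I. gch_free T \<Lambda> (f i))"
  by (induction I rule: infinite_finite_induct) (simp_all add: gch_free_0 gch_free_add)

lemma gch_free_single: "gch_free T \<Lambda> (Poly_Mapping.single N a) = (\<lambda>l. of_int a * gch T \<Lambda> N l)"
  using gch_free_superset[of "{N}" "Poly_Mapping.single N a"] by (simp add: fun_eq_iff)

lemma gch_free_single_1: "gch_free T \<Lambda> (Poly_Mapping.single N 1) = gch T \<Lambda> N"
  by (simp add: gch_free_single)

lemma gch_free_diff: "gch_free T \<Lambda> (c - c') = gch_free T \<Lambda> c - gch_free T \<Lambda> c'"
  using gch_free_add[of c "- c'"] by (simp add: gch_free_minus)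

lemma gch_free_ER: "c \<in> ER \<Longrightarrow> gch_free T \<Lambda> c = 0"
proof (induction rule: ER_induct)
  case (rel N' N N'')
  then obtain f g where "gexact f g N' N N''" by (auto simp: short_exact_iff)
  then have "gch T \<Lambda> N = gch T \<Lambda> N' + gch T \<Lambda> N''" using rel by (intro gch_exact) (auto simp: gmodules_def)
  then show ?case by (simp add: gch_free_diff gch_free_single_1)
qed (simp_all add: gch_free_0 gch_free_minus gch_free_add del: minus_diff_eq)

text \<open>All representatives of a class have the same character, since \<open>gch_free\<close>
  vanishes on the relations.\<close>

lemma gch_class_cs: "gch_class T \<Lambda> (cs x) = gch_free T \<Lambda> x"
  unfolding gch_class_def
proof (rule the_equality)
  show "\<forall>c\<in>cs x. gch_free T \<Lambda> c = gch_free T \<Lambda> x"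
    unfolding cs_eq by (auto simp: gch_free_add gch_free_ER)
  show "y = gch_free T \<Lambda> x" if "\<forall>c\<in>cs x. gch_free T \<Lambda> c = y" for y using bspec[OF that cs_self] by simp
qed

lemma gmodules_shift: "N \<in> gmodules T \<Longrightarrow> shift l N \<in> gmodules T"
  by (simp add: gmodules_def graded_module_shift)

lemma single_rel_ER:
  assumes "is_rel N' N N''"
  shows "Poly_Mapping.single N a - Poly_Mapping.single N' a - Poly_Mapping.single N'' a \<in> ER"
proof (induction a rule: int_induct[of _ 0])
  case base
  then show ?case using ER_0 by simp
next
  case (step1 a)
  have "Poly_Mapping.single N (a + 1) - Poly_Mapping.single N' (a + 1) - Poly_Mapping.single N'' (a + 1) =
    (Poly_Mapping.single N a - Poly_Mapping.single N' a - Poly_Mapping.single N'' a) + rel N' N N''"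
    by (simp add: single_add)
  then show ?case using ER_add[OF step1(2) ER_rel[OF assms]] by simp
next
  case (step2 a)
  have "Poly_Mapping.single N (a - 1) - Poly_Mapping.single N' (a - 1) - Poly_Mapping.single N'' (a - 1) =
    (Poly_Mapping.single N a - Poly_Mapping.single N' a - Poly_Mapping.single N'' a) - rel N' N N''"
    by (simp add: single_diff)
  then show ?case using ER_diff[OF step2(2) ER_rel[OF assms]] by simp
qed

text \<open>Shifting turns exact sequences into exact sequences, and an integer multiple of a
  relation stays in the subgroup by \<open>single_rel_ER\<close>.\<close>

lemma laurent_act_mono_ER: "c \<in> ER \<Longrightarrow> laurent_act_mono l a c \<in> ER"
proof (induction rule: ER_induct)
  case (rel N' N N'')
  then have "is_rel (shift l N') (shift l N) (shift l N'')" using gmodules_shift short_exact_shift by blast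
  then have "Poly_Mapping.single (shift l N) a - Poly_Mapping.single (shift l N') a - Poly_Mapping.single
      (shift l N'') a \<in> ER"
    by (rule single_rel_ER)
  moreover have "laurent_act_mono l a (rel N' N N'') =
    Poly_Mapping.single (shift l N) a - Poly_Mapping.single (shift l N') a - Poly_Mapping.single (shift l N'') a"
    by (simp only: diff_conv_add_uminus laurent_act_mono_add laurent_act_mono_minus laurent_act_mono_single
        mult_1_right)
  ultimately show ?case by simp
qed (simp_all add: laurent_act_mono_0 ER_0 laurent_act_mono_minus ER_minus laurent_act_mono_add ER_add del:
    minus_diff_eq)

lemma laurent_act_free_ER: "c \<in> ER \<Longrightarrow> laurent_act_free p c \<in> ER"
  unfolding laurent_act_free_mono by (intro ER_sum laurent_act_mono_ER)

text \<open>The cosets united in \<open>laurent_act\<close> all coincide, because the action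
  preserves the subgroup of relations.\<close>

lemma laurent_act_cs: "laurent_act T p (cs x) = cs (laurent_act_free p x)"
proof -
  have "cs (laurent_act_free p c) = cs (laurent_act_free p x)" if c: "c \<in> cs x" for c
  proof -
    obtain r where r: "r \<in> ER" "c = r + x" using c unfolding cs_eq by blast
    show ?thesis
      by (rule cs_cong) (simp add: r(2) laurent_act_free_add laurent_act_free_ER[OF r(1)])
  qed
  then show ?thesis unfolding laurent_act_def cs_def[symmetric] using cs_self by blast
qed

lemma laurent_act_free_keys:
  assumes "Poly_Mapping.keys c \<subseteq> gmodules T"
  shows "Poly_Mapping.keys (laurent_act_free p c) \<subseteq> gmodules T"
  unfolding laurent_act_free_def using assms gmodules_shift
  by (intro keys_sum_subset) (auto split: if_splits)

lemma gch_free_laurent_act: "gch_free T \<Lambda> (laurent_act_free p c) = lscale p (gch_free T \<Lambda> c)"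
proof
  fix m
  have "gch_free T \<Lambda> (laurent_act_free p c) m = (\<Sum>l\<in>Poly_Mapping.keys p. \<Sum>N\<in>Poly_Mapping.keys c.
      of_int (Poly_Mapping.lookup p l * Poly_Mapping.lookup c N) * (Poly_Mapping.single l 1 * gch T \<Lambda> N m))"
    unfolding laurent_act_free_def by (simp add: gch_free_sum sum_fun_apply gch_free_single gch_shift lscale_def)
  also have "\<dots> = (\<Sum>l\<in>Poly_Mapping.keys p. \<Sum>N\<in>Poly_Mapping.keys c.
      (of_int (Poly_Mapping.lookup p l) * Poly_Mapping.single l 1) * (of_int (Poly_Mapping.lookup c N) * gch T \<Lambda>
          N m))"
    by (intro sum.cong refl) (simp add: algebra_simps)
  also have "\<dots> = (\<Sum>l\<in>Poly_Mapping.keys p. of_int (Poly_Mapping.lookup p l) * Poly_Mapping.single l 1) *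
      (\<Sum>N\<in>Poly_Mapping.keys c. of_int (Poly_Mapping.lookup c N) * gch T \<Lambda> N m)"
    by (simp only: sum_product)
  also have "\<dots> = lscale p (gch_free T \<Lambda> c) m"
    by (simp only: of_int_single poly_mapping_sum_singles lscale_def gch_free_def)
  finally show "gch_free T \<Lambda> (laurent_act_free p c) m = lscale p (gch_free T \<Lambda> c) m" .
qed

section \<open>Reduction of classes to combinations of the simple modules\<close>

definition comb :: "(('k, 'd) urep \<Rightarrow> laurent) \<Rightarrow> (('k, 'd) ugrep \<Rightarrow>\<^sub>0 int)"
  where "comb p = (\<Sum>l\<in>\<Lambda>. laurent_act_free (p l) (Poly_Mapping.single (L l) 1))"

lemma comb_add: "comb (\<lambda>l. p l + q l) = comb p + comb q"
  by (simp add: comb_def laurent_act_free_add_left sum.distrib)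

lemma comb_0: "comb (\<lambda>_. 0) = 0"
  by (simp add: comb_def laurent_act_free_0)

lemma comb_minus: "comb (\<lambda>l. - p l) = - comb p"
  using comb_add[of p "\<lambda>l. - p l"] by (simp add: comb_0 eq_neg_iff_add_eq_0 add.commute)

lemma comb_single:
  assumes "l \<in> \<Lambda>"
  shows "comb (\<lambda>m. if m = l then Poly_Mapping.single i 1 else 0) = Poly_Mapping.single (shift i (L l)) 1"
proof -
  have "comb (\<lambda>m. if m = l then Poly_Mapping.single i 1 else 0) =
    (\<Sum>m\<in>\<Lambda>. if m = l then Poly_Mapping.single (shift i (L l)) 1 else 0)"
    unfolding comb_def by (intro sum.cong refl) (simp add: laurent_act_free_0 laurent_act_free_single)
  then show ?thesis using assms finite_weights by simp
qed

lemma gch_free_comb: "gch_free T \<Lambda> (comb p) = (\<Sum>l\<in>\<Lambda>. lscale (p l) (gch T \<Lambda> (L l)))"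
  by (simp add: comb_def gch_free_sum gch_free_laurent_act gch_free_single_1)

text \<open>The relation of an exact sequence adds the coefficients of its outer terms, so
  \<open>graded_module_induct\<close> applies in the group itself, before characters are
  taken.\<close>

lemma single_comb:
  assumes "graded_module T N"
  shows "\<exists>p. Poly_Mapping.single N 1 - comb p \<in> ER"
  using assms
proof (induction rule: graded_module_induct)
  case (zero N)
  \<comment> \<open>For a zero module the relation of this sequence is minus the generator of
    \<open>N\<close>.\<close>
  have "is_rel N N N" using zero gexact_zero[OF zero] unfolding short_exact_iff gmodules_def by blast
  from ER_minus[OF ER_rel[OF this]] have "Poly_Mapping.single N 1 - comb (\<lambda>_. 0) \<in> ER" by (simp add: comb_0)
  then show ?case by (intro exI)
next
  case (simple l i)
  have "Poly_Mapping.single (shift i (L l)) 1 - comb (\<lambda>m. if m = l then Poly_Mapping.single i 1 else 0) \<in> ER"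
    unfolding comb_single[OF simple] using ER_0 by simp
  then show ?case by (intro exI)
next
  case (exact f g N' N N'')
  then obtain p' p'' where p: "Poly_Mapping.single N' 1 - comb p' \<in> ER" "Poly_Mapping.single N'' 1 - comb p'' \<in>
      ER" by blast
  have "is_rel N' N N''" using exact(1-4) unfolding short_exact_iff gmodules_def by blast
  from ER_add[OF ER_add[OF ER_rel[OF this] p(1)] p(2)]
  have "Poly_Mapping.single N 1 - comb (\<lambda>l. p' l + p'' l) \<in> ER"
    by (simp add: comb_add algebra_simps)
  then show ?case by (intro exI)
qed

lemma exists_comb:
  assumes "Poly_Mapping.keys c \<subseteq> gmodules T"
  shows "\<exists>p. c - comb p \<in> ER"
  using assms
proof (induction c rule: frag_induction)
  case zero
  have "0 - comb (\<lambda>_. 0) \<in> ER" using ER_0 by (simp add: comb_0)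
  then show ?case by (intro exI)
next
  case (one N)
  then show ?case using single_comb[of N] by (simp add: gmodules_def)
next
  case (diff a b)
  then obtain p q where pq: "a - comb p \<in> ER" "b - comb q \<in> ER" by blast
  have "(a - b) - comb (\<lambda>l. p l + - q l) \<in> ER"
    using ER_diff[OF pq] by (simp only: comb_add comb_minus) (simp add: algebra_simps)
  then show ?case by (intro exI)
qed

lemma gch_free_eq_comb:
  assumes "Poly_Mapping.keys c \<subseteq> gmodules T"
  obtains p where "c - comb p \<in> ER" "gch_free T \<Lambda> c = (\<Sum>l\<in>\<Lambda>. lscale (p l) (gch T \<Lambda> (L l)))"
proof -
  obtain p where p: "c - comb p \<in> ER" using exists_comb[OF assms] by blast
  then have "gch_free T \<Lambda> c = gch_free T \<Lambda> (comb p)" using gch_free_ER[OF p] by (simp add: gch_free_diff)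
  then show ?thesis using that[OF p] by (simp only: gch_free_comb)
qed

text \<open>Each class is represented by a combination of the \<open>L l\<close>, and independence
  of their characters forces equal coefficients for two classes with the same character.\<close>

lemma gch_class_inj: "inj_on (gch_class T \<Lambda>) (carrier (grothendieck T))"
proof (rule inj_onI)
  fix X Y assume XY: "X \<in> carrier (grothendieck T)" "Y \<in> carrier (grothendieck T)" "gch_class T \<Lambda> X = gch_class T \<Lambda> Y"
  then obtain x y where xy: "X = cs x" "Y = cs y" "Poly_Mapping.keys x \<subseteq> gmodules T" "Poly_Mapping.keys y
      \<subseteq> gmodules T"
    unfolding grothendieck_carrier by blast
  have eq: "gch_free T \<Lambda> x = gch_free T \<Lambda> y" using XY(3) unfolding xy(1,2) gch_class_cs .
  obtain p where p: "x - comb p \<in> ER" "gch_free T \<Lambda> x = (\<Sum>l\<in>\<Lambda>. lscale (p l) (gch T \<Lambda> (L l)))"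
    by (rule gch_free_eq_comb[OF xy(3)])
  obtain q where q: "y - comb q \<in> ER" "gch_free T \<Lambda> y = (\<Sum>l\<in>\<Lambda>. lscale (q l) (gch T \<Lambda> (L l)))"
    by (rule gch_free_eq_comb[OF xy(4)])
  have "(\<Sum>l\<in>\<Lambda>. lscale (p l - q l) (gch T \<Lambda> (L l))) = (\<Sum>l\<in>\<Lambda>. lscale (p l) (gch T \<Lambda> (L l)) - lscale (q l) (gch T \<Lambda>
      (L l)))"
    by (simp add: lscale_def fun_eq_iff algebra_simps sum_fun_apply)
  also have "\<dots> = 0" unfolding sum_subtractf using p(2) q(2) eq by simp
  finally have z: "(\<Sum>l\<in>\<Lambda>. lscale (p l - q l) (gch T \<Lambda> (L l))) = 0" .
  have "p l = q l" if "l \<in> \<Lambda>" for l using gch_independent[OF z that] by simp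
  then have c: "comb p = comb q" unfolding comb_def by (intro sum.cong refl) simp
  have "x - y = (x - comb p) - (y - comb q)" unfolding c by simp
  then have "x - y \<in> ER" using ER_diff[OF p(1) q(1)] by simp
  then show "X = Y" unfolding xy(1,2) by (rule cs_cong)
qed

lemma gch_L_inj: "inj_on (\<lambda>l. gch T \<Lambda> (L l)) \<Lambda>"
proof (rule inj_onI)
  fix l m assume lm: "l \<in> \<Lambda>" "m \<in> \<Lambda>" "gch T \<Lambda> (L l) = gch T \<Lambda> (L m)"
  have "(1::int) = (if l = m then 1 else 0)"
    using gch_L(1)[OF lm(1,1)] gch_L(1)[OF lm(1,2)] lm(3) by simp
  then show "l = m" by (simp split: if_splits)
qed

lemma gch_L_independent: "\<not> module.dependent lscale ((\<lambda>l. gch T \<Lambda> (L l)) ` \<Lambda>)"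
proof
  let ?c = "\<lambda>l. gch T \<Lambda> (L l)"
  interpret m: module "lscale :: laurent \<Rightarrow> (('k, 'd) urep \<Rightarrow> laurent) \<Rightarrow> _" by (rule module_lscale)
  assume "m.dependent (?c ` \<Lambda>)"
  then obtain t u where t: "finite t" "t \<subseteq> ?c ` \<Lambda>" "(\<Sum>v\<in>t. lscale (u v) v) = 0" "\<exists>v\<in>t. u v \<noteq> 0"
    unfolding m.dependent_explicit by blast
  \<comment> \<open>Coefficients attached to vectors become coefficients attached to weights, along
    the injection in \<open>gch_L_inj\<close>.\<close>
  define p where "p l = (if ?c l \<in> t then u (?c l) else 0)" for l
  have "(\<Sum>l\<in>\<Lambda>. lscale (p l) (?c l)) = (\<Sum>v\<in>?c ` \<Lambda>. lscale (if v \<in> t then u v else 0) v)"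
    by (simp add: sum.reindex[OF gch_L_inj] p_def)
  also have "\<dots> = (\<Sum>v\<in>t. lscale (u v) v)"
    using finite_weights t(2) by (intro sum.mono_neutral_cong_right) (auto simp: lscale_simps)
  finally have z: "(\<Sum>l\<in>\<Lambda>. lscale (p l) (?c l)) = 0" using t(3) by simp
  obtain v where v: "v \<in> t" "u v \<noteq> 0" using t(4) by blast
  then obtain l where l: "l \<in> \<Lambda>" "v = ?c l" using t(2) by blast
  have "p l = 0" by (rule gch_independent[OF z l(1)])
  then show False using v l(2) by (simp add: p_def)
qed

lemma gch_L_span: "module.span lscale ((\<lambda>l. gch T \<Lambda> (L l)) ` \<Lambda>) = gch_class T \<Lambda> ` carrier (grothendieck T)"
proof (intro subset_antisym subsetI)
  let ?c = "\<lambda>l. gch T \<Lambda> (L l)"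
  interpret m: module "lscale :: laurent \<Rightarrow> (('k, 'd) urep \<Rightarrow> laurent) \<Rightarrow> _" by (rule module_lscale)
  \<comment> \<open>The image of the Grothendieck group consists of the characters of formal
    combinations of graded modules.\<close>
  have img: "gch_class T \<Lambda> ` carrier (grothendieck T) = gch_free T \<Lambda> ` {x. Poly_Mapping.keys x \<subseteq> gmodules T}"
    unfolding grothendieck_carrier image_Collect by (auto simp: gch_class_cs) (metis gch_class_cs)
  {
    fix y assume "y \<in> m.span (?c ` \<Lambda>)"
    then have "\<exists>x. Poly_Mapping.keys x \<subseteq> gmodules T \<and> y = gch_free T \<Lambda> x"
    proof (induction rule: m.span_induct_alt)
      case base
      show ?case by (intro exI[of _ 0]) (simp add: gch_free_0)
    next
      case (step p v y)
      then obtain l x where l: "l \<in> \<Lambda>" "v = ?c l" and x: "Poly_Mapping.keys x \<subseteq> gmodules T" "y = gch_free T \<Lambda> x"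
          by blast
      let ?z = "laurent_act_free p (Poly_Mapping.single (L l) 1)"
      have "Poly_Mapping.keys ?z \<subseteq> gmodules T"
        using L_graded[OF l(1)] by (intro laurent_act_free_keys) (simp add: gmodules_def)
      then have "Poly_Mapping.keys (?z + x) \<subseteq> gmodules T" using Poly_Mapping.keys_add[of ?z x] x(1) by blast
      moreover have "lscale p v + y = gch_free T \<Lambda> (?z + x)"
        by (simp add: gch_free_add gch_free_laurent_act gch_free_single_1 l(2) x(2))
      ultimately show ?case by blast
    qed
    then show "y \<in> gch_class T \<Lambda> ` carrier (grothendieck T)" unfolding img by blast
  next
    fix y assume "y \<in> gch_class T \<Lambda> ` carrier (grothendieck T)"
    then obtain x where x: "Poly_Mapping.keys x \<subseteq> gmodules T" "y = gch_free T \<Lambda> x" unfolding img by blast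
    obtain p where "gch_free T \<Lambda> x = (\<Sum>l\<in>\<Lambda>. lscale (p l) (?c l))" by (rule gch_free_eq_comb[OF x(1)])
    moreover have "(\<Sum>l\<in>\<Lambda>. lscale (p l) (?c l)) \<in> m.span (?c ` \<Lambda>)"
      by (intro m.span_sum m.span_scale m.span_base imageI)
    ultimately show "y \<in> m.span (?c ` \<Lambda>)" unfolding x(2) by simp
  }
qed

end

theorem theorem3p3:
  fixes V :: "('k::{alg_closed_field, field_char_0}, 'g::finite, 'v::ab_group_add) yd"
    and T :: "('k, 'g, 'r::finite, 'd::finite) double"
    and \<Lambda> :: "('k, 'd) urep set"
    and M L P :: "('k, 'd) urep \<Rightarrow> ('k, 'd) ugrep"
  assumes "double_of V T"
    and "weights T \<Lambda>"
    and "\<And>l. l \<in> \<Lambda> \<Longrightarrow> verma_module T l (M l)"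
    and "\<And>l. l \<in> \<Lambda> \<Longrightarrow> graded_head T (M l) (L l)"
    and "\<And>l. l \<in> \<Lambda> \<Longrightarrow> graded_projective_cover T l (L l) (P l)"
  shows
    "((\<forall>N\<in>gmodules T. gch_class T \<Lambda> (gclass T N) = gch T \<Lambda> N) \<and>
      (\<forall>X\<in>carrier (grothendieck T). \<forall>Y\<in>carrier (grothendieck T).
         gch_class T \<Lambda> (X \<otimes>\<^bsub>grothendieck T\<^esub> Y) = gch_class T \<Lambda> X + gch_class T \<Lambda> Y) \<and>
      (\<forall>p. \<forall>X\<in>carrier (grothendieck T). laurent_act T p X \<in> carrier (grothendieck T) \<and>
         gch_class T \<Lambda> (laurent_act T p X) = lscale p (gch_class T \<Lambda> X)) \<and>
      inj_on (gch_class T \<Lambda>) (carrier (grothendieck T)))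
     \<and>
     (inj_on (\<lambda>l. gch T \<Lambda> (L l)) \<Lambda> \<and>
      \<not> module.dependent lscale ((\<lambda>l. gch T \<Lambda> (L l)) ` \<Lambda>) \<and>
      module.span lscale ((\<lambda>l. gch T \<Lambda> (L l)) ` \<Lambda>) = gch_class T \<Lambda> ` carrier (grothendieck T))
     \<and>
     (\<forall>N :: ('k, 'd, 'n::ab_group_add) grep. graded_module T N \<longrightarrow>
        gch T \<Lambda> N = (\<Sum>l\<in>\<Lambda>. lscale (mult_poly (P l) N) (gch T \<Lambda> (L l))) \<and>
        (\<forall>p. gch T \<Lambda> N = (\<Sum>l\<in>\<Lambda>. lscale (p l) (gch T \<Lambda> (L l))) \<longrightarrow>
          (\<forall>l\<in>\<Lambda>. p l = mult_poly (P l) N)) \<and>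
        (\<forall>l\<in>\<Lambda>. int (multiplicity_in N (L l)) = eval1 (mult_poly (P l) N)))"
proof -
  interpret setup_data V T \<Lambda> M L P
    by (intro setup_data.intro dbl.intro setup_data_axioms.intro assms)
  show ?thesis
  proof (intro conjI ballI allI impI)
    show "gch_class T \<Lambda> (gclass T N) = gch T \<Lambda> N" for N
      by (simp only: gclass_eq gch_class_cs gch_free_single_1)
    show "gch_class T \<Lambda> (X \<otimes>\<^bsub>grothendieck T\<^esub> Y) = gch_class T \<Lambda> X + gch_class T \<Lambda> Y"
      if XY: "X \<in> carrier (grothendieck T)" "Y \<in> carrier (grothendieck T)" for X Y
    proof -
      obtain x y where "X = cs x" "Y = cs y" using XY unfolding grothendieck_carrier by blast
      then show ?thesis by (simp only: cs_mult gch_class_cs gch_free_add)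
    qed
    fix p X assume "X \<in> carrier (grothendieck T)"
    then obtain x where x: "X = cs x" "Poly_Mapping.keys x \<subseteq> gmodules T" unfolding grothendieck_carrier by blast
    show "laurent_act T p X \<in> carrier (grothendieck T)"
      unfolding x(1) laurent_act_cs grothendieck_carrier using laurent_act_free_keys[OF x(2)] by blast
    show "gch_class T \<Lambda> (laurent_act T p X) = lscale p (gch_class T \<Lambda> X)"
      by (simp only: x(1) laurent_act_cs gch_class_cs gch_free_laurent_act)
  qed (fact gch_class_inj gch_L_inj gch_L_independent gch_L_span
    | (rule gch_mult_poly, assumption) | (rule mult_poly_unique, assumption+) |
        (rule multiplicity_in_eq, assumption+))+
qed

end
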